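(* Let $\Sigma$ be a closed orientable surface of genus at least $2$, let $M$ be $\mathbb{R}$ or $S^1$, let $\rho\in \mathrm{Rep}(\pi_1(\Sigma),\mathrm{Homeo}_+(M))$ and let $U$ be a neighbourhood of $\rho$ in $\mathrm{Rep}(\pi_1(\Sigma),\mathrm{Homeo}_+(M))$. Then there exists $\rho'\in U$ having no global fixed points.
   Context: $\mathrm{Homeo}_+(M)$ is the group of orientation preserving homeomorphisms of $M$, with the compact-open topology (uniform convergence on compact sets). For a countable discrete group $G$, $\mathrm{Rep}(G,\mathrm{Homeo}_+(M))$ is the set of group homomorphisms $G\to\mathrm{Homeo}_+(M)$ with the topology of pointwise convergence: $\rho_n\to\rho$ iff $\rho_n(g)\to\rho(g)$ in the compact-open topology for every $g\in G$. A global fixed point of $\rho$ is a point $x\in M$ with $\rho(g)(x)=x$ for all $g\in G$. *)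

theory Defs
  imports "HOL-Analysis.Analysis" "HOL-Algebra.Bij"
begin

text \<open>
  The closed orientable surface of genus \<open>g \<ge> 1\<close> is the closed unit disc, seen as a polygon with
  \<open>4 * g\<close> sides, with its sides identified in pairs according to the boundary word
  \<open>a\<^sub>1 b\<^sub>1 a\<^sub>1\<inverse> b\<^sub>1\<inverse> \<dots> a\<^sub>g b\<^sub>g a\<^sub>g\<inverse> b\<^sub>g\<inverse>\<close>. The sides are numbered from 0 and parametrised
  counterclockwise by \<open>{0..1}\<close>; paired sides are glued with reversed direction.
\<close>

definition polygon_side :: "nat \<Rightarrow> nat \<Rightarrow> real \<Rightarrow> complex" where
  "polygon_side g k t = cis (2 * pi * (real k + t) / real (4 * g))"

inductive side_pairing :: "nat \<Rightarrow> complex \<Rightarrow> complex \<Rightarrow> bool" for g :: nat where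
  "\<lbrakk>i < g; j < 2; t \<in> {0..1}\<rbrakk> \<Longrightarrow>
     side_pairing g (polygon_side g (4 * i + j) t) (polygon_side g (4 * i + j + 2) (1 - t))"

text \<open>
  A space is homeomorphic to the quotient of the disc by the generated equivalence relation iff it
  is the image of a quotient map whose fibres are the equivalence classes.
\<close>

definition closed_orientable_surface :: "nat \<Rightarrow> 'a::topological_space set \<Rightarrow> bool" where
  "closed_orientable_surface g S \<longleftrightarrow> g \<ge> 1 \<and>
     (\<exists>f. quotient_map (top_of_set (cball (0::complex) 1)) (top_of_set S) f \<and>
          (\<forall>x\<in>cball 0 1. \<forall>y\<in>cball 0 1. f x = f y \<longleftrightarrow> equivclp (side_pairing g) x y))"

definition loops_at :: "'a::topological_space set \<Rightarrow> 'a \<Rightarrow> (real \<Rightarrow> 'a) set" where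
  "loops_at S x0 =
     {p. path p \<and> path_image p \<subseteq> S \<and> pathstart p = x0 \<and> pathfinish p = x0}"

definition loop_class :: "'a::topological_space set \<Rightarrow> 'a \<Rightarrow> (real \<Rightarrow> 'a) \<Rightarrow> (real \<Rightarrow> 'a) set" where
  "loop_class S x0 p = {q \<in> loops_at S x0. homotopic_paths S p q}"

definition fundamental_group :: "'a::topological_space set \<Rightarrow> 'a \<Rightarrow> (real \<Rightarrow> 'a) set monoid" where
  "fundamental_group S x0 =
     \<lparr>carrier = loop_class S x0 ` loops_at S x0,
      mult = \<lambda>A B. \<Union>p\<in>A. \<Union>q\<in>B. loop_class S x0 (p +++ q),
      one = loop_class S x0 (\<lambda>_. x0)\<rparr>"

definition Homeo :: "'m::topological_space set \<Rightarrow> ('m \<Rightarrow> 'm) set" where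
  "Homeo M = {f \<in> Bij M. \<exists>f'. homeomorphism M M f f'}"

definition Homeo_plus_real :: "(real \<Rightarrow> real) monoid" where
  "Homeo_plus_real = (BijGroup UNIV)\<lparr>carrier := {f \<in> Homeo UNIV. strict_mono f}\<rparr>"

abbreviation circle :: "complex set" where
  "circle \<equiv> sphere 0 1"

text \<open>
  A homeomorphism of the circle preserves orientation iff its lifts to the universal cover
  \<open>cis\<close> are increasing.
\<close>

definition Homeo_plus_circle :: "(complex \<Rightarrow> complex) monoid" where
  "Homeo_plus_circle = (BijGroup circle)
     \<lparr>carrier := {f \<in> Homeo circle. \<exists>F :: real \<Rightarrow> real.
        continuous_on UNIV F \<and> strict_mono F \<and> (\<forall>t. f (cis t) = cis (F t))}\<rparr>"

definition compact_open_topology ::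
    "'m::topological_space set \<Rightarrow> ('m \<Rightarrow> 'm) set \<Rightarrow> ('m \<Rightarrow> 'm) topology" where
  "compact_open_topology M H = topology_generated_by
     {{f \<in> H. f ` K \<subseteq> V} | K V. compact K \<and> K \<subseteq> M \<and> openin (top_of_set M) V}"

text \<open>
  \<^const>\<open>hom\<close> leaves functions unconstrained outside the carrier; the points of the product
  topology are extensional, so each homomorphism is represented exactly once.
\<close>

definition Rep ::
    "('g, 'b) monoid_scheme \<Rightarrow> 'm::topological_space set \<Rightarrow> ('m \<Rightarrow> 'm) monoid \<Rightarrow>
     ('g \<Rightarrow> 'm \<Rightarrow> 'm) topology" where
  "Rep G M H = subtopology
     (product_topology (\<lambda>_. compact_open_topology M (carrier H)) (carrier G)) (hom G H)"

definition neighbourhood_in :: "'a topology \<Rightarrow> 'a \<Rightarrow> 'a set \<Rightarrow> bool" where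
  "neighbourhood_in T x U \<longleftrightarrow> U \<subseteq> topspace T \<and> (\<exists>V. openin T V \<and> x \<in> V \<and> V \<subseteq> U)"

definition global_fixed_point ::
    "('g, 'b) monoid_scheme \<Rightarrow> 'm set \<Rightarrow> ('g \<Rightarrow> 'm \<Rightarrow> 'm) \<Rightarrow> 'm \<Rightarrow> bool" where
  "global_fixed_point G M \<rho> x \<longleftrightarrow> x \<in> M \<and> (\<forall>\<gamma>\<in>carrier G. \<rho> \<gamma> x = x)"

end

theory Submission
  imports Defs
begin

text \<open>
  The idea is to describe representations of the surface group by tuples of homeomorphisms satisfying the
  single relation \<open>[a\<^sub>1, b\<^sub>1] \<dots> [a\<^sub>g, b\<^sub>g] = 1\<close>, and to perturb such tuples by hand until no
  common fixed point is left. Only a representation with a global fixed point has to be perturbed. Its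
  generators have lifts to the line with a common fixed point, on which the relation holds exactly, so
  everything takes place among increasing homeomorphisms of the line that commute with the translation by
  \<open>L\<close>, where \<open>L = 0\<close> for the line and \<open>L = 2 * pi\<close> for the circle.

  The dynamical part is \<open>perturb_without_common_fixed_point\<close>. First the closed set of common fixed points
  is made finite modulo \<open>L\<close>: between common fixed points that are close to each other all letters are
  replaced by the identity, except one that moves every point there, which keeps the relation
  (\<open>reduce_to_finitely_many_orbits\<close>). An isolated common fixed point \<open>p\<close> is then removed as follows. A
  handle that moves some point \<open>s\<close> close to \<open>p\<close> can be changed between \<open>s\<close> and \<open>p\<close> so that its
  commutator has any prescribed germ at \<open>p\<close> (\<open>commutator_flexible\<close>). Thus the tuple can be changed so
  that near \<open>p\<close> every single commutator is trivial while every handle moves all points other than \<open>p\<close>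
  (\<open>standardize_both_sides\<close>).
  Now one handle may be conjugated by a small homeomorphism supported near \<open>p\<close> without spoiling the
  relation. This moves its fixed point away from \<open>p\<close>, while a second handle still fixes only \<open>p\<close>: here the
  genus has to be at least two (\<open>remove_common_fixed_orbit\<close>).

  The topological part establishes what is needed about the fundamental group of the glued polygon: it is
  generated by the loops crossing one pair of sides, these satisfy the relation, and every tuple in a group
  that satisfies the relation comes from a homomorphism (\<open>surface_generators\<close>, \<open>surface_relation\<close>,
  \<open>surface_group_hom\<close>). Homomorphisms are constructed as the holonomy of a flat cocycle on the disc
  (\<open>holonomy_hom\<close>), which avoids covering spaces and the theorem of van Kampen. Generation follows from
  local contractibility (\<open>generated_by_jumps\<close>).

  Finally, sequences of homeomorphisms that converge pointwise form a group. A sequence of perturbed tuples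
  converging to the original one defines a homomorphism into this group, so the resulting representations
  converge at every element of the fundamental group. For increasing maps pointwise convergence implies
  convergence in the compact-open topology.
\<close>

section \<open>Increasing homeomorphisms of the line\<close>

abbreviation finv :: "('a \<Rightarrow> 'b) \<Rightarrow> 'b \<Rightarrow> 'a" where "finv f \<equiv> inv_into UNIV f"

definition inc_homeo :: "(real \<Rightarrow> real) \<Rightarrow> bool" where
  "inc_homeo f \<longleftrightarrow> strict_mono f \<and> surj f"

lemma inc_homeo_bij: "inc_homeo f \<Longrightarrow> bij f"
  unfolding inc_homeo_def bij_def by (simp add: strict_mono_imp_inj_on)

lemma inc_homeo_less: "inc_homeo f \<Longrightarrow> f x < f y \<longleftrightarrow> x < y"
  and inc_homeo_le: "inc_homeo f \<Longrightarrow> f x \<le> f y \<longleftrightarrow> x \<le> y"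
  and inc_homeo_eq: "inc_homeo f \<Longrightarrow> f x = f y \<longleftrightarrow> x = y"
  unfolding inc_homeo_def by (auto simp: strict_mono_less strict_mono_less_eq strict_mono_eq)

lemma inc_homeo_inv_right [simp]: "inc_homeo f \<Longrightarrow> f (finv f x) = x"
  and inc_homeo_inv_left [simp]: "inc_homeo f \<Longrightarrow> finv f (f x) = x"
  by (auto simp: inc_homeo_bij bij_is_surj surj_f_inv_f inv_f_f bij_is_inj)

lemma inc_homeo_id [simp]: "inc_homeo id" "inc_homeo (\<lambda>x. x)"
  by (auto simp: inc_homeo_def strict_mono_def surj_def)

lemma inc_homeo_comp [simp]: "inc_homeo f \<Longrightarrow> inc_homeo g \<Longrightarrow> inc_homeo (f \<circ> g)"
  unfolding inc_homeo_def using comp_surj strict_mono_o by blast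

lemma inc_homeo_inv [simp]: assumes "inc_homeo f" shows "inc_homeo (finv f)"
proof -
  have "surj (finv f)" using inc_homeo_bij[OF assms] bij_betw_inv_into bij_is_surj by blast
  moreover have "finv f x < finv f y" if "x < y" for x y
    using inc_homeo_less[OF assms, of "finv f x" "finv f y"] assms that by simp
  ultimately show ?thesis by (auto simp: inc_homeo_def strict_mono_def)
qed

lemma inc_homeo_inv_less: "inc_homeo f \<Longrightarrow> finv f x < y \<longleftrightarrow> x < f y"
  and inc_homeo_less_inv: "inc_homeo f \<Longrightarrow> x < finv f y \<longleftrightarrow> f x < y"
  and inc_homeo_inv_le: "inc_homeo f \<Longrightarrow> finv f x \<le> y \<longleftrightarrow> x \<le> f y"
  and inc_homeo_le_inv: "inc_homeo f \<Longrightarrow> x \<le> finv f y \<longleftrightarrow> f x \<le> y"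
  and inc_homeo_inv_eq: "inc_homeo f \<Longrightarrow> finv f x = y \<longleftrightarrow> x = f y"
  using inc_homeo_less[of f "finv f x" y] inc_homeo_less[of f x "finv f y"]
    inc_homeo_le[of f "finv f x" y] inc_homeo_le[of f x "finv f y"] inc_homeo_eq[of f "finv f x" y]
  by auto

lemma inc_homeo_inv_comp [simp]:
  "inc_homeo f \<Longrightarrow> finv f \<circ> f = id" "inc_homeo f \<Longrightarrow> f \<circ> finv f = id"
  by (auto simp: fun_eq_iff)

lemma inc_homeo_inv_o: "inc_homeo f \<Longrightarrow> inc_homeo g \<Longrightarrow> finv (f \<circ> g) = finv g \<circ> finv f"
  by (simp add: inc_homeo_bij o_inv_distrib)

lemma inc_homeo_inv_inv [simp]: "inc_homeo f \<Longrightarrow> finv (finv f) = f"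
  by (simp add: inc_homeo_bij inv_inv_eq)

lemma inc_homeo_continuous: assumes "inc_homeo f" shows "continuous_on A f"
proof -
  have "continuous_on UNIV f"
  proof (rule continuous_onI_mono)
    show "open (f ` UNIV)" using assms by (simp add: inc_homeo_def)
  qed (use assms inc_homeo_le in auto)
  thus ?thesis using continuous_on_subset by blast
qed

lemma inc_homeo_isCont: "inc_homeo f \<Longrightarrow> isCont f x"
  using inc_homeo_continuous[of f UNIV] by (simp add: continuous_on_eq_continuous_at)

lemma inc_homeo_join:
  assumes "inc_homeo f" "inc_homeo g" "f c = g c"
  shows "inc_homeo (\<lambda>x. if x \<le> c then f x else g x)"
proof -
  let ?h = "\<lambda>x. if x \<le> c then f x else g x"
  have "?h x < ?h y" if "x < y" for x y
  proof (cases "x \<le> c \<and> \<not> y \<le> c")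
    case True
    have "f x \<le> f c" using True inc_homeo_le[OF assms(1), of x c] by simp
    moreover have "g c < g y" using True inc_homeo_less[OF assms(2), of c y] by simp
    ultimately show ?thesis using True assms by simp
  qed (use that assms in \<open>auto simp: inc_homeo_less\<close>)
  moreover have "\<exists>x. ?h x = y" for y
  proof (cases "y \<le> f c")
    case True
    thus ?thesis by (intro exI[of _ "finv f y"]) (use assms in \<open>simp add: inc_homeo_inv_le\<close>)
  next
    case False
    thus ?thesis using assms by (intro exI[of _ "finv g y"]) (simp add: inc_homeo_inv_le)
  qed
  ultimately show ?thesis unfolding inc_homeo_def strict_mono_def surj_def by metis
qed

lemma inc_homeo_affine: "0 < (k::real) \<Longrightarrow> inc_homeo (\<lambda>x. c + k * x)"
  unfolding inc_homeo_def strict_mono_def surj_def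
  by (auto intro!: exI[of _ "(_ - c) / k"])

lemma inc_homeo_max:
  assumes "inc_homeo f" "inc_homeo g" shows "inc_homeo (\<lambda>x. max (f x) (g x))"
proof -
  have "\<exists>x. max (f x) (g x) = y" for y
    by (intro exI[of _ "min (finv f y) (finv g y)"])
      (use assms inc_homeo_le[OF assms(1), of "finv g y" "finv f y"] inc_homeo_le[OF assms(2), of "finv f y" "finv g y"]
        in \<open>auto simp: min_def max_def\<close>)
  thus ?thesis using assms unfolding inc_homeo_def strict_mono_def surj_def
    by (metis max_less_iff_conj less_max_iff_disj max_def)
qed

lemma inc_homeo_min:
  assumes "inc_homeo f" "inc_homeo g" shows "inc_homeo (\<lambda>x. min (f x) (g x))"
proof -
  have "\<exists>x. min (f x) (g x) = y" for y
    by (intro exI[of _ "max (finv f y) (finv g y)"])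
      (use assms inc_homeo_le[OF assms(1), of "finv g y" "finv f y"] inc_homeo_le[OF assms(2), of "finv f y" "finv g y"]
        in \<open>auto simp: min_def max_def\<close>)
  thus ?thesis using assms unfolding inc_homeo_def strict_mono_def surj_def
    by (metis min_less_iff_conj min_less_iff_disj min_def)
qed

text \<open>Between \<open>M\<close>, up to which \<open>f\<close> is kept, and a point \<open>m\<close> close to \<open>p\<close>, from which on \<open>g\<close> is followed, an
affine piece is inserted. It is increasing as soon as \<open>f M < g m\<close>, which holds for \<open>m\<close> near \<open>p\<close>
because both maps fix \<open>p\<close>.\<close>

lemma inc_homeo_change_germ_left:
  assumes f: "inc_homeo f" "f p = p" and g: "inc_homeo g" "g p = p" and "M < p"
  obtains h m where "inc_homeo h" "M < m" "m < p" "\<And>x. x \<le> M \<or> p \<le> x \<Longrightarrow> h x = f x"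
    "\<And>x. m \<le> x \<Longrightarrow> x < p \<Longrightarrow> h x = g x"
proof -
  have fM: "f M < p" using inc_homeo_less[OF f(1), of M p] assms by simp
  define m where "m = (p + max M (finv g (f M))) / 2"
  have mx: "max M (finv g (f M)) < p" using fM assms by (simp add: inc_homeo_inv_less)
  have m: "M < m" "m < p" "finv g (f M) < m" using mx by (auto simp: m_def)
  have gm: "f M < g m" using m(3) g by (simp add: inc_homeo_inv_less)
  define k where "k = (g m - f M) / (m - M)"
  have k: "k > 0" "(f M - k * M) + k * m = g m"
    using gm m by (auto simp: k_def simp flip: right_diff_distrib)
      (simp add: divide_simps, simp add: algebra_simps)
  define l where "l = (\<lambda>x. (f M - k * M) + k * x)"
  have l: "inc_homeo l" unfolding l_def using k(1) by (rule inc_homeo_affine)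
  define h1 where "h1 = (\<lambda>x. if x \<le> M then f x else l x)"
  have h1: "inc_homeo h1" unfolding h1_def by (rule inc_homeo_join[OF f(1) l]) (simp add: l_def)
  define h2 where "h2 = (\<lambda>x. if x \<le> m then h1 x else g x)"
  have h2: "inc_homeo h2" unfolding h2_def
    by (rule inc_homeo_join[OF h1 g(1)]) (use m k in \<open>simp add: h1_def l_def\<close>)
  define h where "h = (\<lambda>x. if x \<le> p then h2 x else f x)"
  have h: "inc_homeo h" unfolding h_def
    by (rule inc_homeo_join[OF h2 f(1)]) (use m g f in \<open>simp add: h2_def\<close>)
  show ?thesis
  proof (rule that[OF h m(1,2)])
    show "h x = f x" if "x \<le> M \<or> p \<le> x" for x
      using that m f g by (auto simp: h_def h2_def h1_def)
    have "h m = g m" using m k by (auto simp: h_def h2_def h1_def l_def)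
    thus "h x = g x" if "m \<le> x" "x < p" for x
      using that m f g by (cases "x = m") (auto simp: h_def h2_def h1_def)
  qed
qed

text \<open>A conjugacy from \<open>F\<close> to \<open>G\<close> is determined by its values on a fundamental domain. Under iteration of
the inverse of \<open>F\<close> every point of the interval from \<open>s\<close> to \<open>p\<close> arrives to the left of \<open>s\<close>, where \<open>e\<close>
already conjugates \<open>F\<close> to \<open>G\<close>; hence the only possible continuation is
\<open>e' x = G\<^sup>n (e (F\<^sup>-\<^sup>n x))\<close>, for any \<open>n\<close> with \<open>F\<^sup>-\<^sup>n x \<le> s\<close>. It reaches all points
below \<open>p\<close> because \<open>G\<close> has no fixed point between \<open>e s\<close> and \<open>p\<close> either.\<close>

lemma extend_conjugacy:
  assumes F: "inc_homeo F" "F p = p" and G: "inc_homeo G" "G p = p" and e: "inc_homeo e" "e p = p"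
    and sp: "s < p"
    and Fpos: "\<And>x. s \<le> x \<Longrightarrow> x < p \<Longrightarrow> x < F x"
    and Gpos: "\<And>y. e s \<le> y \<Longrightarrow> y < p \<Longrightarrow> y < G y"
    and low: "\<And>y. F y \<le> s \<Longrightarrow> e (F y) = G (e y)"
    and high: "\<And>y. p \<le> y \<Longrightarrow> e (F y) = G (e y)"
  shows "\<exists>e'. inc_homeo e' \<and> (\<forall>x. x \<le> s \<or> p \<le> x \<longrightarrow> e' x = e x) \<and> (\<forall>x. e' (F x) = G (e' x))"
proof -
  let ?f = "finv F"
  have f: "inc_homeo ?f" "?f p = p" using F by (auto simp: inc_homeo_inv_eq)
  have fit: "inc_homeo (?f ^^ n)" "inc_homeo (F ^^ n)" "inc_homeo (G ^^ n)" for n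
    using f F G by (induction n) (simp_all del: id_apply)
  have itp: "(?f ^^ n) p = p" "(G ^^ n) p = p" for n using f G by (induction n) auto
  have fs: "?f x \<le> s" if "x \<le> s" for x
  proof -
    have "x \<le> F s" using that Fpos[of s] sp by simp
    thus ?thesis using F by (simp add: inc_homeo_inv_le)
  qed
  have itle: "(?f ^^ (n + k)) x \<le> s" if "(?f ^^ n) x \<le> s" for n k x
    using that by (induction k) (auto intro: fs)
  have step: "(G ^^ Suc n) (e ((?f ^^ Suc n) x)) = (G ^^ n) (e ((?f ^^ n) x))"
    if "(?f ^^ n) x \<le> s" for n x
  proof -
    have "e (F (?f ((?f ^^ n) x))) = G (e (?f ((?f ^^ n) x)))"
      by (rule low) (use F that in simp)
    hence "e ((?f ^^ n) x) = G (e ((?f ^^ Suc n) x))" using F by simp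
    thus ?thesis by (simp only: funpow_Suc_right o_apply)
  qed
  have indep: "(G ^^ (n + k)) (e ((?f ^^ (n + k)) x)) = (G ^^ n) (e ((?f ^^ n) x))"
    if "(?f ^^ n) x \<le> s" for n k x
  proof (induction k)
    case (Suc k)
    show ?case using step[OF itle[OF that, of k]] Suc by simp
  qed simp
  \<comment> \<open>A decreasing orbit that stayed above \<open>c\<close> would converge to a fixed point in the forbidden interval.\<close>
  have conv: "\<exists>n. (H ^^ n) y \<le> c" if H: "inc_homeo H" and y: "y < p"
    and neg: "\<And>x. c \<le> x \<Longrightarrow> x < p \<Longrightarrow> H x < x" for H y c
  proof (rule ccontr)
    assume "\<not> ?thesis"
    hence gt: "c < (H ^^ n) y" for n by (simp add: not_le)
    have lt: "(H ^^ n) y \<le> y" for n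
    proof (induction n)
      case (Suc n)
      have "H ((H ^^ n) y) < (H ^^ n) y" by (rule neg) (use Suc y gt[of n] in auto)
      thus ?case using Suc by simp
    qed simp
    have dec: "decseq (\<lambda>n. (H ^^ n) y)"
    proof (intro decseq_SucI)
      show "(H ^^ Suc n) y \<le> (H ^^ n) y" for n
        using neg[of "(H ^^ n) y"] gt[of n] lt[of n] y by simp
    qed
    then obtain l where l: "(\<lambda>n. (H ^^ n) y) \<longlonglongrightarrow> l" "\<forall>n. l \<le> (H ^^ n) y"
      using decseq_convergent[OF dec, of c] gt less_imp_le by metis
    have "(\<lambda>n. H ((H ^^ n) y)) \<longlonglongrightarrow> H l" using l(1) inc_homeo_isCont[OF H] isCont_tendsto_compose by blast
    moreover have "(\<lambda>n. H ((H ^^ n) y)) \<longlonglongrightarrow> l" using LIMSEQ_Suc[OF l(1)] by simp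
    ultimately have "H l = l" using LIMSEQ_unique by blast
    have "c \<le> l" using LIMSEQ_le_const[OF l(1)] gt less_imp_le by blast
    moreover have "l < p" using l(2) y by (metis funpow_0 order.strict_trans1)
    ultimately show False using neg[of l] \<open>H l = l\<close> by force
  qed
  have fconv: "\<exists>n. (?f ^^ n) x \<le> s" if "x < p" for x
    by (rule conv[OF f(1) that]) (use Fpos F in \<open>simp add: inc_homeo_inv_less\<close>)
  have Gconv: "\<exists>n. (finv G ^^ n) y \<le> e s" if "y < p" for y
    by (rule conv[OF _ that]) (use Gpos G in \<open>simp_all add: inc_homeo_inv_less\<close>)
  define N where "N = (\<lambda>x. LEAST n. (?f ^^ n) x \<le> s)"
  have N: "(?f ^^ N x) x \<le> s" if "x < p" for x
    unfolding N_def using LeastI_ex[OF fconv[OF that]] .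
  define e' where "e' = (\<lambda>x. if p \<le> x then e x else (G ^^ N x) (e ((?f ^^ N x) x)))"
  have e'_val: "e' x = (G ^^ n) (e ((?f ^^ n) x))" if "x < p" "(?f ^^ n) x \<le> s" for x n
  proof -
    have "N x \<le> n" unfolding N_def using that(2) by (rule Least_le)
    then obtain k where "n = N x + k" using le_Suc_ex by blast
    thus ?thesis using indep[OF N[OF that(1)], of k] that(1) by (simp add: e'_def)
  qed
  have lessp: "e' x < p" if "x < p" for x
  proof -
    have "(?f ^^ N x) x < p" using N[OF that] sp by simp
    hence "e ((?f ^^ N x) x) < p" using inc_homeo_less[OF e(1), of _ p] e(2) by metis
    hence "(G ^^ N x) (e ((?f ^^ N x) x)) < p"
      using inc_homeo_less[OF fit(3), of "N x" _ p] itp(2) by metis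
    thus ?thesis using that by (simp add: e'_def)
  qed
  have high': "e' x = e x \<and> p \<le> e' x" if "p \<le> x" for x
    using that inc_homeo_le[OF e(1), of p x] e(2) by (simp add: e'_def)
  have mono: "e' x < e' y" if "x < y" for x y
  proof (cases "y < p")
    case True
    let ?n = "N x + N y"
    have "e' x = (G ^^ ?n) (e ((?f ^^ ?n) x))"
      by (rule e'_val) (use True that itle[OF N, of x "N y"] in auto)
    moreover have "e' y = (G ^^ ?n) (e ((?f ^^ ?n) y))"
      by (rule e'_val) (use True that itle[OF N, of y "N x"] in \<open>auto simp: add.commute\<close>)
    ultimately show ?thesis using fit that e by (simp add: inc_homeo_less)
  next
    case False
    show ?thesis
    proof (cases "x < p")
      case True
      thus ?thesis using lessp[OF True] high'[of y] False by simp
    next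
      case False
      thus ?thesis using high'[of x] high'[of y] that inc_homeo_less[OF e(1), of x y] by simp
    qed
  qed
  have surj: "\<exists>x. e' x = y" for y
  proof (cases "y < p")
    case True
    then obtain n where n: "(finv G ^^ n) y \<le> e s" using Gconv by blast
    define u where "u = finv e ((finv G ^^ n) y)"
    have u: "u \<le> s" unfolding u_def using n e by (simp add: inc_homeo_inv_le)
    have itinv: "(H ^^ k) ((finv H ^^ k) z) = z" if "inc_homeo H" for H k z
    proof (induction k arbitrary: z)
      case (Suc k)
      have "(H ^^ Suc k) ((finv H ^^ Suc k) z) = H ((H ^^ k) ((finv H ^^ k) (finv H z)))"
        by (simp add: funpow_swap1)
      thus ?case using Suc that by simp
    qed simp
    have GG: "(G ^^ k) ((finv G ^^ k) z) = z" for k z using itinv G by blast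
    have fF: "(?f ^^ k) ((F ^^ k) z) = z" for k z using itinv[OF f(1), of k z] by (simp only: inc_homeo_inv_inv[OF F(1)])
    have "(F ^^ n) u < p" using u sp inc_homeo_less[OF fit(2), of n u p] F
      by (metis fF fit(1) inc_homeo_less itp(1) order.strict_trans1)
    hence "e' ((F ^^ n) u) = (G ^^ n) (e u)" using e'_val[of "(F ^^ n) u" n] u fF by simp
    also have "\<dots> = y" using e GG by (simp add: u_def)
    finally show ?thesis by blast
  next
    case False
    hence "p \<le> finv e y" using e by (simp add: inc_homeo_le_inv)
    thus ?thesis using e by (intro exI[of _ "finv e y"]) (simp add: e'_def)
  qed
  show ?thesis
  proof (intro exI[of _ e'] conjI allI impI)
    show "inc_homeo e'" using mono surj unfolding inc_homeo_def strict_mono_def surj_def by metis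
    show "e' x = e x" if "x \<le> s \<or> p \<le> x" for x
      using that e'_val[of x 0] sp by (auto simp: e'_def)
    show "e' (F x) = G (e' x)" for x
    proof (cases "x < p")
      case True
      have Fx: "F x < p" using True inc_homeo_less[OF F(1), of x p] F(2) by simp
      have "(?f ^^ Suc (N x)) (F x) \<le> s" using N[OF True] F by (simp add: funpow_swap1)
      from e'_val[OF Fx this] have "e' (F x) = (G ^^ Suc (N x)) (e ((?f ^^ N x) x))"
        using F by (simp add: funpow_swap1)
      thus ?thesis using True by (simp add: e'_def)
    next
      case False
      hence "p \<le> F x" using inc_homeo_le[OF F(1), of p x] F(2) by simp
      thus ?thesis using False high[of x] by (simp add: e'_def)
    qed
  qed
qed

section \<open>Realising a prescribed commutator\<close>

lemma inc_homeo_inv_fix: "inc_homeo f \<Longrightarrow> f p = p \<Longrightarrow> finv f p = p"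
  by (simp add: inc_homeo_inv_eq)

definition commutator :: "(real \<Rightarrow> real) \<Rightarrow> (real \<Rightarrow> real) \<Rightarrow> real \<Rightarrow> real" where
  "commutator f g = f \<circ> g \<circ> finv f \<circ> finv g"

lemma inc_homeo_commutator [simp]: "inc_homeo f \<Longrightarrow> inc_homeo g \<Longrightarrow> inc_homeo (commutator f g)"
  by (simp add: commutator_def)

lemma finv_commutator: "inc_homeo f \<Longrightarrow> inc_homeo g \<Longrightarrow> finv (commutator f g) = commutator g f"
  by (simp add: commutator_def inc_homeo_inv_o o_assoc)

text \<open>To the right of \<open>u\<close> the map follows \<open>p - k * (p - m x)\<close>, a copy of the graph of \<open>m\<close> scaled towards the
fixed point \<open>p\<close>, with \<open>k\<close> chosen so that the pieces match at \<open>u\<close>. It lies above \<open>m\<close> if \<open>k < 1\<close> and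
below \<open>m\<close> if \<open>k > 1\<close>, that is, on the side on which it starts.\<close>

lemma extend_past_graph:
  assumes f: "inc_homeo f" "f p = p" and m: "inc_homeo m" "m p = p" and "u < p"
  obtains f' where "inc_homeo f'" "\<And>x. x \<le> u \<or> p \<le> x \<Longrightarrow> f' x = f x"
    "\<And>x. m u < f u \<Longrightarrow> u \<le> x \<Longrightarrow> x < p \<Longrightarrow> m x < f' x"
    "\<And>x. f u < m u \<Longrightarrow> u \<le> x \<Longrightarrow> x < p \<Longrightarrow> f' x < m x"
proof -
  have lt: "f u < p" "m u < p"
    using inc_homeo_less[OF f(1), of u p] inc_homeo_less[OF m(1), of u p] assms by auto
  define k where "k = (p - f u) / (p - m u)"
  have k: "k > 0" "k * (p - m u) = p - f u" using lt by (auto simp: k_def)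
  define l where "l = (\<lambda>x. (p - k * p) + k * x) \<circ> m"
  have l: "inc_homeo l" unfolding l_def using k(1) m(1) by (intro inc_homeo_comp inc_homeo_affine)
  have l': "l x = p - k * (p - m x)" for x by (simp add: l_def algebra_simps)
  define h where "h = (\<lambda>x. if x \<le> u then f x else l x)"
  have h: "inc_homeo h" unfolding h_def by (rule inc_homeo_join[OF f(1) l]) (simp add: l' k)
  define f' where "f' = (\<lambda>x. if x \<le> p then h x else f x)"
  have f': "inc_homeo f'" unfolding f'_def
    by (rule inc_homeo_join[OF h f(1)]) (use assms in \<open>simp add: h_def l'\<close>)
  have mp: "m x < p" if "x < p" for x using inc_homeo_less[OF m(1), of x p] that m by simp
  have val: "f' x = p - k * (p - m x)" if "u \<le> x" "x < p" for x
    using that k by (cases "x = u") (auto simp: f'_def h_def l')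
  show ?thesis
  proof (rule that[OF f'])
    show "f' x = f x" if "x \<le> u \<or> p \<le> x" for x
      using that assms by (auto simp: f'_def h_def l')
    show "m x < f' x" if "m u < f u" "u \<le> x" "x < p" for x
    proof -
      have "k < 1" using that(1) lt by (simp add: k_def)
      hence "k * (p - m x) < 1 * (p - m x)" using mp[OF that(3)] by (intro mult_strict_right_mono) auto
      thus ?thesis using val[OF that(2,3)] by simp
    qed
    show "f' x < m x" if "f u < m u" "u \<le> x" "x < p" for x
    proof -
      have "1 < k" using that(1) lt by (simp add: k_def)
      hence "1 * (p - m x) < k * (p - m x)" using mp[OF that(3)] by (intro mult_strict_right_mono) auto
      thus ?thesis using val[OF that(2,3)] by simp
    qed
  qed
qed

text \<open>The equation \<open>commutator e' f' = z\<close> says that \<open>e'\<close> conjugates \<open>f'\<close> to \<open>z \<circ> f'\<close>. If both of these maps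
move every point of the interval from \<open>s\<close> to \<open>p\<close> in the same direction, then the old \<open>e\<close> can be continued
to such a conjugacy. So only \<open>f'\<close> has to be found: it keeps the values of \<open>f\<close> up to a point \<open>u\<close>, and from
there on it is chosen to move all points past the identity and past the inverse of \<open>z\<close>. The hypothesis
that \<open>f\<close> moves \<open>s\<close> at least as far as \<open>e\<close> does guarantees that \<open>f\<close> and \<open>z \<circ> f\<close> move in the same direction
on the part on which \<open>f\<close> is kept.\<close>

lemma commutator_flexible_near_mover:
  assumes f: "inc_homeo f" "f p = p" and e: "inc_homeo e" "e p = p" and sp: "s < p"
    and fs: "f s \<noteq> s" and es: "e s \<le> max (f s) (finv f s)" "finv e s \<le> max (f s) (finv f s)"
  shows "\<exists>N<p. \<forall>z. inc_homeo z \<longrightarrow> (\<forall>x. x \<le> N \<or> p \<le> x \<longrightarrow> z x = commutator e f x) \<longrightarrow>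
      (\<exists>e' f'. inc_homeo e' \<and> inc_homeo f' \<and> (\<forall>x. x \<le> s \<or> p \<le> x \<longrightarrow> e' x = e x \<and> f' x = f x) \<and>
        commutator e' f' = z \<and> (\<forall>x. s \<le> x \<longrightarrow> x < p \<longrightarrow> f' x \<noteq> x))"
proof -
  \<comment> \<open>The relation is needed at \<open>e x\<close> for \<open>x \<le> s\<close>, so \<open>f\<close> must be kept up to \<open>e s\<close> as well; the commutator
of the old maps then governs \<open>z\<close> up to \<open>f u\<close>.\<close>
  define u where "u = max s (e s)"
  define y0 where "y0 = max (f s) (finv f s)"
  have up: "u < p" using sp inc_homeo_less[OF e(1), of s p] e by (simp add: u_def)
  have su: "s \<le> u" "e s \<le> u" by (auto simp: u_def)
  have Np: "f u < p" using up inc_homeo_less[OF f(1), of u p] f by simp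
  have "s < f s \<or> s < finv f s" using fs f by (auto simp: inc_homeo_less_inv)
  hence y0: "s < y0" "e s \<le> y0" "finv e s \<le> y0"
    using es by (auto simp: y0_def less_max_iff_disj)
  have uy0: "u \<le> y0" using y0 by (simp add: u_def)
  have pull: "s \<le> finv e y \<and> finv e y \<le> y0" if "e s \<le> y" "y \<le> u" for y
  proof -
    have "finv e y \<le> y0"
    proof (cases "y \<le> s")
      case True
      hence "finv e y \<le> finv e s" using e by (simp add: inc_homeo_le)
      thus ?thesis using y0 by simp
    next
      case False
      hence "y \<le> e s" using that by (auto simp: u_def max_def split: if_splits)
      hence "finv e y \<le> s" using e by (simp add: inc_homeo_inv_le)
      thus ?thesis using y0 by simp
    qed
    thus ?thesis using that e by (simp add: inc_homeo_le_inv)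
  qed
  have main: "\<exists>e' f'. inc_homeo e' \<and> inc_homeo f' \<and> (\<forall>x. x \<le> s \<or> p \<le> x \<longrightarrow> e' x = e x \<and> f' x = f x) \<and>
        commutator e' f' = z \<and> (\<forall>x. s \<le> x \<longrightarrow> x < p \<longrightarrow> f' x \<noteq> x)"
    if z: "inc_homeo z" and zc: "\<And>x. x \<le> f u \<or> p \<le> x \<Longrightarrow> z x = commutator e f x" for z
  proof -
    have fp: "p \<le> f x \<longleftrightarrow> p \<le> x" for x using inc_homeo_le[OF f(1), of p x] f by simp
    have ep: "p \<le> e x \<longleftrightarrow> p \<le> x" for x using inc_homeo_le[OF e(1), of p x] e by simp
    have zf: "z (f y) = e (f (finv e y))" if "y \<le> u \<or> p \<le> y" for y
    proof -
      have "f y \<le> f u \<or> p \<le> f y" using that f fp by (auto simp: inc_homeo_le)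
      thus ?thesis using zc f by (simp add: commutator_def)
    qed
    have zp: "z p = p" using zf[of p] f e by (simp add: inc_homeo_inv_fix)
    have finish: ?thesis if f': "inc_homeo f'" "\<And>x. x \<le> u \<or> p \<le> x \<Longrightarrow> f' x = f x"
      and e': "inc_homeo e'" "\<And>x. x \<le> s \<or> p \<le> x \<Longrightarrow> e' x = e x" and conj: "\<And>x. e' (f' x) = z (f' (e' x))"
      and nofix: "\<And>x. s \<le> x \<Longrightarrow> x < p \<Longrightarrow> f' x \<noteq> x" for e' f'
    proof -
      have "commutator e' f' = z" using conj f' e' by (simp add: commutator_def fun_eq_iff)
      thus ?thesis using that su by (intro exI[of _ e'] exI[of _ f']) auto
    qed
    show ?thesis
    proof (cases "f s > s")
      case True
      have y0s: "y0 = f s" using True f inc_homeo_inv_less[OF f(1), of s s] by (simp add: y0_def)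
      have pos: "x < f x" if "s \<le> x" "x \<le> y0" for x
        using that True y0s inc_homeo_less[OF f(1), of s x] by (cases "x = s") auto
      have pos': "y < z (f y)" if "e s \<le> y" "y \<le> u" for y
      proof -
        have "e (finv e y) < e (f (finv e y))" unfolding inc_homeo_less[OF e(1)] using pos pull[OF that] by blast
        thus ?thesis using zf that e by simp
      qed
      define m where "m = (\<lambda>x. max (id x) (finv z x))"
      have m: "inc_homeo m" "m p = p" unfolding m_def using z zp
        by (auto intro!: inc_homeo_max simp del: id_apply) (simp add: inc_homeo_inv_fix)
      have mu: "m u < f u" using pos[of u] pos'[of u] su uy0 z by (simp add: m_def inc_homeo_inv_less)
      obtain f' where f': "inc_homeo f'" "\<And>x. x \<le> u \<or> p \<le> x \<Longrightarrow> f' x = f x"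
        "\<And>x. u \<le> x \<Longrightarrow> x < p \<Longrightarrow> m x < f' x"
        using extend_past_graph[OF f m up] mu by metis
      have Fpos: "x < f' x" if "s \<le> x" "x < p" for x
      proof (cases "x \<le> u")
        case True thus ?thesis using that f'(2) pos uy0 by auto
      next
        case False thus ?thesis using that f'(3)[of x] by (simp add: m_def)
      qed
      have Gpos: "x < (z \<circ> f') x" if "e s \<le> x" "x < p" for x
      proof (cases "x \<le> u")
        case True thus ?thesis using that f'(2) pos' by auto
      next
        case False thus ?thesis using that f'(3)[of x] z by (simp add: m_def inc_homeo_inv_less)
      qed
      have f'p: "f' p = p" and G: "inc_homeo (z \<circ> f')" "(z \<circ> f') p = p"
        using f' f z zp by simp_all
      have "\<exists>e'. inc_homeo e' \<and> (\<forall>x. x \<le> s \<or> p \<le> x \<longrightarrow> e' x = e x) \<and> (\<forall>x. e' (f' x) = (z \<circ> f') (e' x))"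
      proof (rule extend_conjugacy[of f' p "z \<circ> f'" e s])
        show "e (f' y) = (z \<circ> f') (e y)" if "f' y \<le> s" for y
        proof -
          have "y \<le> s"
          proof (rule ccontr)
            assume "\<not> y \<le> s"
            thus False using that Fpos[of y] f'(2)[of y] fp[of y] sp by (cases "y < p") auto
          qed
          moreover from this have "e y \<le> u" using su inc_homeo_le[OF e(1), of y s] by linarith
          ultimately show ?thesis using f'(2)[of y] f'(2)[of "e y"] zf[of "e y"] su e by simp
        qed
        show "e (f' y) = (z \<circ> f') (e y)" if "p \<le> y" for y
          using that f'(2)[of y] f'(2)[of "e y"] zf[of "e y"] e ep by simp
      qed fact+
      then obtain e' where e': "inc_homeo e'" "\<And>x. x \<le> s \<or> p \<le> x \<Longrightarrow> e' x = e x"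
        "\<And>x. e' (f' x) = (z \<circ> f') (e' x)" by blast
      have A: "e' (f' x) = z (f' (e' x))" for x using e'(3)[of x] by simp
      have B: "f' x \<noteq> x" if "s \<le> x" "x < p" for x using Fpos[OF that] by simp
      show ?thesis by (rule finish[OF f'(1,2) e'(1,2) A B])
    next
      case False
      hence fneg: "f s < s" using fs by simp
      have y0s: "f y0 = s" using fneg f inc_homeo_less_inv[OF f(1), of s s] by (simp add: y0_def max_def)
      have neg: "f x < x" if "s \<le> x" "x \<le> y0" for x
        using that fneg y0s inc_homeo_le[OF f(1), of x y0] by (cases "x = s") auto
      have neg': "z (f y) < y" if "e s \<le> y" "y \<le> u" for y
      proof -
        have "e (f (finv e y)) < e (finv e y)" unfolding inc_homeo_less[OF e(1)] using neg pull[OF that] by blast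
        thus ?thesis using zf that e by simp
      qed
      define m where "m = (\<lambda>x. min (id x) (finv z x))"
      have m: "inc_homeo m" "m p = p" unfolding m_def using z zp
        by (auto intro!: inc_homeo_min simp del: id_apply) (simp add: inc_homeo_inv_fix)
      have mu: "f u < m u" using neg[of u] neg'[of u] su uy0 z by (simp add: m_def inc_homeo_less_inv)
      obtain f' where f': "inc_homeo f'" "\<And>x. x \<le> u \<or> p \<le> x \<Longrightarrow> f' x = f x"
        "\<And>x. u \<le> x \<Longrightarrow> x < p \<Longrightarrow> f' x < m x"
        using extend_past_graph[OF f m up] mu by metis
      have Fneg: "f' x < x" if "s \<le> x" "x < p" for x
      proof (cases "x \<le> u")
        case True thus ?thesis using that f'(2) neg uy0 by auto
      next
        case False thus ?thesis using that f'(3)[of x] by (simp add: m_def)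
      qed
      have Gneg: "(z \<circ> f') x < x" if "e s \<le> x" "x < p" for x
      proof (cases "x \<le> u")
        case True thus ?thesis using that f'(2) neg' by auto
      next
        case False thus ?thesis using that f'(3)[of x] z by (simp add: m_def inc_homeo_less_inv)
      qed
      have conj: "e (f' x) = (z \<circ> f') (e x)" if "x \<le> s \<or> p \<le> x" for x
      proof -
        have "e x \<le> u \<or> p \<le> e x"
          using that inc_homeo_le[OF e(1), of x s] inc_homeo_le[OF e(1), of p x] su(2) e(2) by linarith
        thus ?thesis using that f'(2)[of x] f'(2)[of "e x"] zf[of "e x"] su e by auto
      qed
      have conj': "e (finv f' y) = finv (z \<circ> f') (e y)" if "finv f' y \<le> s \<or> p \<le> finv f' y" for y
      proof -
        have "e y = (z \<circ> f') (e (finv f' y))" using conj[OF that] f' by simp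
        from arg_cong[OF this, of "finv (z \<circ> f')"] show ?thesis
          by (simp only: inc_homeo_inv_left[OF inc_homeo_comp[OF z f'(1)]])
      qed
      have "\<exists>e'. inc_homeo e' \<and> (\<forall>x. x \<le> s \<or> p \<le> x \<longrightarrow> e' x = e x) \<and>
        (\<forall>x. e' (finv f' x) = finv (z \<circ> f') (e' x))"
      proof (rule extend_conjugacy[of "finv f'" p "finv (z \<circ> f')" e s])
        show "finv f' p = p" "finv (z \<circ> f') p = p" using f' f zp z by (simp_all add: inc_homeo_inv_fix)
        show "inc_homeo (finv f')" "inc_homeo (finv (z \<circ> f'))" using f' z by simp_all
        show "x < finv f' x" if "s \<le> x" "x < p" for x
          using Fneg[OF that] f' by (simp add: inc_homeo_less_inv)
        show "x < finv (z \<circ> f') x" if "e s \<le> x" "x < p" for x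
          using Gneg[OF that] inc_homeo_less_inv[OF inc_homeo_comp[OF z f'(1)]] by blast
        show "e (finv f' y) = finv (z \<circ> f') (e y)" if "finv f' y \<le> s" for y
          by (rule conj') (use that in blast)
        show "e (finv f' y) = finv (z \<circ> f') (e y)" if "p \<le> y" for y
        proof (rule conj')
          have "f' p \<le> y" using that f' f by simp
          thus "finv f' y \<le> s \<or> p \<le> finv f' y" using f' by (simp add: inc_homeo_le_inv)
        qed
      qed fact+
      then obtain e' where e': "inc_homeo e'" "\<And>x. x \<le> s \<or> p \<le> x \<Longrightarrow> e' x = e x"
        "\<And>x. e' (finv f' x) = finv (z \<circ> f') (e' x)" by blast
      have A: "e' (f' x) = z (f' (e' x))" for x
      proof -
        have "e' x = finv (z \<circ> f') (e' (f' x))" using e'(3)[of "f' x"] inc_homeo_inv_left[OF f'(1)] by metis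
        hence "(z \<circ> f') (e' x) = e' (f' x)"
          using inc_homeo_inv_right[OF inc_homeo_comp[OF z f'(1)], of "e' (f' x)"] by metis
        thus ?thesis by simp
      qed
      have B: "f' x \<noteq> x" if "s \<le> x" "x < p" for x using Fneg[OF that] by simp
      show ?thesis by (rule finish[OF f'(1,2) e'(1,2) A B])
    qed
  qed
  show ?thesis
  proof (intro exI[of _ "f u"] conjI allI impI Np)
    fix z assume z: "inc_homeo z" and zc: "\<forall>x. x \<le> f u \<or> p \<le> x \<longrightarrow> z x = commutator e f x"
    show "\<exists>e' f'. inc_homeo e' \<and> inc_homeo f' \<and> (\<forall>x. x \<le> s \<or> p \<le> x \<longrightarrow> e' x = e x \<and> f' x = f x) \<and>
        commutator e' f' = z \<and> (\<forall>x. s \<le> x \<longrightarrow> x < p \<longrightarrow> f' x \<noteq> x)"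
      by (rule main[OF z]) (rule zc[rule_format])
  qed
qed

text \<open>The letter with the larger displacement at \<open>s\<close> takes the part of the mover. When this is \<open>a\<close>, the two
letters exchange roles and the commutator is replaced by its inverse.\<close>

lemma commutator_flexible:
  assumes a: "inc_homeo a" "a p = p" and b: "inc_homeo b" "b p = p" and sp: "s < p"
    and mv: "a s \<noteq> s \<or> b s \<noteq> s"
  shows "\<exists>N<p. \<forall>z. inc_homeo z \<longrightarrow> (\<forall>x. x \<le> N \<or> p \<le> x \<longrightarrow> z x = commutator a b x) \<longrightarrow>
      (\<exists>a' b'. inc_homeo a' \<and> inc_homeo b' \<and> (\<forall>x. x \<le> s \<or> p \<le> x \<longrightarrow> a' x = a x \<and> b' x = b x) \<and>
        commutator a' b' = z \<and> (\<forall>x. s \<le> x \<longrightarrow> x < p \<longrightarrow> a' x \<noteq> x \<or> b' x \<noteq> x))"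
proof -
  let ?da = "max (a s) (finv a s)" and ?db = "max (b s) (finv b s)"
  have disp: "s < max (h s) (finv h s) \<longleftrightarrow> h s \<noteq> s" "s \<le> max (h s) (finv h s)" if "inc_homeo h" for h
    using inc_homeo_less_inv[OF that, of s s] inc_homeo_le_inv[OF that, of s s] by linarith+
  note d = disp[OF a(1)] disp[OF b(1)]
  show ?thesis
  proof (cases "?da \<le> ?db")
    case True
    hence mb: "b s \<noteq> s" and le: "a s \<le> ?db" "finv a s \<le> ?db" using mv d by auto
    show ?thesis by (rule ex_forward[OF commutator_flexible_near_mover[OF b a sp mb le]]) blast
  next
    case False
    hence ma: "a s \<noteq> s" and le: "b s \<le> ?da" "finv b s \<le> ?da" using d by auto
    let ?c = "commutator b a"
    have c: "inc_homeo ?c" "finv ?c = commutator a b" using a b by (simp_all add: finv_commutator)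
    have cp: "?c p = p" using a b by (simp add: commutator_def inc_homeo_inv_fix)
    from commutator_flexible_near_mover[OF a b sp ma le] obtain N where N: "N < p" and
      flex: "\<And>z. inc_homeo z \<Longrightarrow> \<forall>x. x \<le> N \<or> p \<le> x \<longrightarrow> z x = commutator b a x \<Longrightarrow>
      \<exists>e' f'. inc_homeo e' \<and> inc_homeo f' \<and> (\<forall>x. x \<le> s \<or> p \<le> x \<longrightarrow> e' x = b x \<and> f' x = a x) \<and>
        commutator e' f' = z \<and> (\<forall>x. s \<le> x \<longrightarrow> x < p \<longrightarrow> f' x \<noteq> x)" by (elim exE conjE) (erule meta_mp[rotated], blast)
    have main: "\<exists>a' b'. inc_homeo a' \<and> inc_homeo b' \<and> (\<forall>x. x \<le> s \<or> p \<le> x \<longrightarrow> a' x = a x \<and> b' x = b x) \<and>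
        commutator a' b' = z \<and> (\<forall>x. s \<le> x \<longrightarrow> x < p \<longrightarrow> a' x \<noteq> x \<or> b' x \<noteq> x)"
      if z: "inc_homeo z" "\<forall>x. x \<le> ?c N \<or> p \<le> x \<longrightarrow> z x = commutator a b x" for z
    proof -
      have "finv z x = ?c x" if "x \<le> N \<or> p \<le> x" for x
      proof -
        have "?c x \<le> ?c N \<or> p \<le> ?c x"
          using that inc_homeo_le[OF c(1), of x N] inc_homeo_le[OF c(1), of p x] cp by auto
        hence "z (?c x) = finv ?c (?c x)" using z(2) by (simp only: c(2))
        hence "z (?c x) = x" using c(1) by simp
        thus ?thesis using z(1) by (simp add: inc_homeo_inv_eq)
      qed
      with flex[of "finv z"] z(1) obtain e' f' where *: "inc_homeo e'" "inc_homeo f'"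
        "\<forall>x. x \<le> s \<or> p \<le> x \<longrightarrow> e' x = b x \<and> f' x = a x" "commutator e' f' = finv z"
        "\<forall>x. s \<le> x \<longrightarrow> x < p \<longrightarrow> f' x \<noteq> x" by auto
      have "commutator f' e' = z" using finv_commutator[OF *(1,2)] *(4) z(1) by simp
      thus ?thesis using * by blast
    qed
    have "?c N < p" using inc_homeo_less[OF c(1), of N p] cp N by simp
    thus ?thesis using main by blast
  qed
qed

section \<open>A standard germ on one side of a common fixed point\<close>

definition comp_list :: "(nat \<Rightarrow> real \<Rightarrow> real) \<Rightarrow> nat list \<Rightarrow> real \<Rightarrow> real" where
  "comp_list c xs = foldr (\<lambda>i F. c i \<circ> F) xs id"

lemma comp_list_simps [simp]:
  "comp_list c [] = id" "comp_list c (i # xs) = c i \<circ> comp_list c xs"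
  by (simp_all add: comp_list_def)

lemma comp_list_append: "comp_list c (xs @ ys) = comp_list c xs \<circ> comp_list c ys"
  by (induction xs) (simp_all add: o_assoc)

lemma comp_list_cong: "(\<And>i. i \<in> set xs \<Longrightarrow> c i = d i) \<Longrightarrow> comp_list c xs = comp_list d xs"
  by (induction xs) simp_all

lemma inc_homeo_comp_list: "(\<And>i. i \<in> set xs \<Longrightarrow> inc_homeo (c i)) \<Longrightarrow> inc_homeo (comp_list c xs)"
  by (induction xs) simp_all

lemma comp_list_fix: "(\<And>i. i \<in> set xs \<Longrightarrow> c i p = p) \<Longrightarrow> comp_list c xs p = p"
  by (induction xs) simp_all

definition commutator_product :: "nat \<Rightarrow> (nat \<Rightarrow> real \<Rightarrow> real) \<Rightarrow> (nat \<Rightarrow> real \<Rightarrow> real) \<Rightarrow> real \<Rightarrow> real" where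
  "commutator_product g a b = comp_list (\<lambda>i. commutator (a i) (b i)) [0..<g]"

text \<open>Evaluating a composition at a point left of \<open>N\<close> only uses the values of its factors up to some \<open>N' < p\<close>,
since the factors fix \<open>p\<close>.\<close>

lemma comp_list_agree:
  assumes "\<And>i. i \<in> set xs \<Longrightarrow> inc_homeo (c i) \<and> c i p = p" and "N < p"
  shows "\<exists>N'<p. \<forall>c'. (\<forall>i\<in>set xs. \<forall>x. x \<le> N' \<or> p \<le> x \<longrightarrow> c' i x = c i x) \<longrightarrow>
    (\<forall>x. x \<le> N \<or> p \<le> x \<longrightarrow> comp_list c' xs x = comp_list c xs x)"
  using assms(1)
proof (induction xs)
  case Nil
  thus ?case using assms(2) by auto
next
  case (Cons i ys)
  have "\<exists>N'<p. \<forall>c'. (\<forall>i\<in>set ys. \<forall>x. x \<le> N' \<or> p \<le> x \<longrightarrow> c' i x = c i x) \<longrightarrow>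
    (\<forall>x. x \<le> N \<or> p \<le> x \<longrightarrow> comp_list c' ys x = comp_list c ys x)"
    by (rule Cons.IH) (use Cons.prems in simp)
  then obtain N1 where N1: "N1 < p" and N1': "\<forall>c'. (\<forall>i\<in>set ys. \<forall>x. x \<le> N1 \<or> p \<le> x \<longrightarrow> c' i x = c i x) \<longrightarrow>
    (\<forall>x. x \<le> N \<or> p \<le> x \<longrightarrow> comp_list c' ys x = comp_list c ys x)" by blast
  let ?F = "comp_list c ys"
  have F: "inc_homeo ?F" "?F p = p"
    using Cons.prems by (auto intro!: inc_homeo_comp_list comp_list_fix)
  have "?F N < p" using inc_homeo_less[OF F(1), of N p] F(2) assms(2) by simp
  moreover have "comp_list c' (i # ys) x = comp_list c (i # ys) x"
    if c': "\<forall>i\<in>set (i # ys). \<forall>x. x \<le> max N1 (?F N) \<or> p \<le> x \<longrightarrow> c' i x = c i x"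
      and x: "x \<le> N \<or> p \<le> x" for c' x
  proof -
    have 1: "comp_list c' ys x = ?F x" by (rule N1'[rule_format, OF _ x]) (use c' in auto)
    have "?F x \<le> ?F N \<or> p \<le> ?F x"
      using x inc_homeo_le[OF F(1), of x N] inc_homeo_le[OF F(1), of p x] F(2) by simp
    hence "c' i (?F x) = c i (?F x)" using c' by auto
    thus ?thesis by (simp add: 1)
  qed
  ultimately show ?case using N1 by (intro exI[of _ "max N1 (?F N)"]) simp
qed

text \<open>Close to \<open>p\<close> the first letter becomes the contraction \<open>x \<mapsto> (x + p) / 2\<close> and the second the identity, so
that they commute there although the first moves every point. The change takes place so close to \<open>p\<close> that
the commutator is not affected left of \<open>N\<close>.\<close>

lemma commutator_trivial_tail:
  assumes a: "inc_homeo a" "a p = p" and b: "inc_homeo b" "b p = p" and N: "N < p"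
  shows "\<exists>a' b' m. inc_homeo a' \<and> inc_homeo b' \<and> m < p \<and>
    (\<forall>x. x \<le> N \<or> p \<le> x \<longrightarrow> a' x = a x \<and> b' x = b x \<and> commutator a' b' x = commutator a b x) \<and>
    (\<forall>x. m \<le> x \<longrightarrow> x < p \<longrightarrow> commutator a' b' x = x \<and> a' x \<noteq> x)"
proof -
  have lt: "f y < p \<longleftrightarrow> y < p" "finv f y < p \<longleftrightarrow> y < p" "p \<le> f y \<longleftrightarrow> p \<le> y" "p \<le> finv f y \<longleftrightarrow> p \<le> y"
    if "inc_homeo f" "f p = p" for f y
    using that inc_homeo_less[OF that(1), of y p] inc_homeo_le[OF that(1), of p y]
    by (simp_all add: inc_homeo_inv_less inc_homeo_le_inv)
  define y2 where "y2 = finv a (finv b N)"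
  \<comment> \<open>These are the points at which the four factors of the commutator are evaluated when it is applied to \<open>N\<close>.\<close>
  define M where "M = max (max N (finv b N)) (max y2 (b y2))"
  have M: "M < p" using N lt[OF a] lt[OF b] by (simp add: M_def y2_def)
  have Mb: "N \<le> M" "finv b N \<le> M" "y2 \<le> M" "b y2 \<le> M" by (auto simp: M_def)
  have psi: "inc_homeo (\<lambda>x. p / 2 + (1 / 2) * x)" by (rule inc_homeo_affine) simp
  obtain a' ma where a': "inc_homeo a'" "M < ma" "ma < p" "\<And>x. x \<le> M \<or> p \<le> x \<Longrightarrow> a' x = a x"
    "\<And>x. ma \<le> x \<Longrightarrow> x < p \<Longrightarrow> a' x = p / 2 + (1 / 2) * x"
    by (rule inc_homeo_change_germ_left[OF a psi _ M]) auto
  obtain b' mb where b': "inc_homeo b'" "M < mb" "mb < p" "\<And>x. x \<le> M \<or> p \<le> x \<Longrightarrow> b' x = b x"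
    "\<And>x. mb \<le> x \<Longrightarrow> x < p \<Longrightarrow> b' x = x"
    by (rule inc_homeo_change_germ_left[OF b inc_homeo_id(2) _ M]) auto
  have a'p: "a' p = p" and b'p: "b' p = p" using a' b' a b by auto
  define m where "m = max (max ma mb) (a' mb)"
  have m: "m < p" using a' b' lt(1)[OF a'(1) a'p, of mb] by (simp add: m_def)
  have comm: "commutator a' b' x = commutator a b x" if "x \<le> N \<or> p \<le> x" for x
  proof -
    have 1: "finv b x \<le> finv b N \<or> p \<le> finv b x"
      using that lt[OF b] inc_homeo_le[OF inc_homeo_inv[OF b(1)], of x N] by auto
    hence "b' (finv b x) = x" using b'(4)[of "finv b x"] Mb(2) b by auto
    hence e1: "finv b' x = finv b x" using b'(1) by (simp add: inc_homeo_inv_eq)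
    have 2: "finv a (finv b x) \<le> y2 \<or> p \<le> finv a (finv b x)"
      using 1 lt[OF a] inc_homeo_le[OF inc_homeo_inv[OF a(1)], of "finv b x" "finv b N"] by (auto simp: y2_def)
    hence "a' (finv a (finv b x)) = finv b x" using a'(4)[of "finv a (finv b x)"] Mb(3) a by auto
    hence e2: "finv a' (finv b x) = finv a (finv b x)" using a'(1) by (simp add: inc_homeo_inv_eq)
    have e3: "b' (finv a (finv b x)) = b (finv a (finv b x))" using 2 Mb(3) b'(4) by auto
    have "b (finv a (finv b x)) \<le> b y2 \<or> p \<le> b (finv a (finv b x))"
      using 2 lt(3)[OF b] inc_homeo_le[OF b(1), of "finv a (finv b x)" y2] by auto
    hence "a' (b (finv a (finv b x))) = a (b (finv a (finv b x)))" using Mb(4) a'(4) by auto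
    thus ?thesis by (simp add: commutator_def e1 e2 e3)
  qed
  have near: "commutator a' b' x = x \<and> a' x \<noteq> x" if x: "m \<le> x" "x < p" for x
  proof -
    have xs: "ma \<le> x" "mb \<le> x" "a' mb \<le> x" using x by (auto simp: m_def)
    have e1: "finv b' x = x" using b'(5)[OF xs(2) x(2)] b'(1) by (simp add: inc_homeo_inv_eq)
    have "mb \<le> finv a' x" "finv a' x < p"
      using xs(3) x(2) a'(1) lt(2)[OF a'(1) a'p] by (simp_all add: inc_homeo_le_inv)
    hence "b' (finv a' x) = finv a' x" by (rule b'(5))
    hence "commutator a' b' x = x" using a'(1) by (simp add: commutator_def e1)
    moreover have "a' x \<noteq> x" using a'(5)[OF xs(1) x(2)] x(2) by simp
    ultimately show ?thesis by blast
  qed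
  show ?thesis
    by (rule exI[of _ a'], rule exI[of _ b'], rule exI[of _ m])
      (use a'(1,4) b'(1,4) m comm near Mb(1) in auto)
qed

text \<open>All handles but the \<open>k\<close>-th are made to have a trivial commutator close to \<open>p\<close>. This changes the product of
the commutators, but only near \<open>p\<close>, and the \<open>k\<close>-th handle, which moves \<open>s\<close>, is flexible enough to absorb
the change: its commutator can be prescribed near \<open>p\<close>. Afterwards every commutator is the identity near
\<open>p\<close>, while every handle moves every point near \<open>p\<close>, and the \<open>k\<close>-th handle leaves no common fixed point
between \<open>s\<close> and \<open>p\<close>.\<close>

lemma standardize_left_end:
  fixes a b :: "nat \<Rightarrow> real \<Rightarrow> real"
  assumes a_all: "\<forall>i<g. inc_homeo (a i) \<and> a i p = p" and b_all: "\<forall>i<g. inc_homeo (b i) \<and> b i p = p"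
    and rel: "commutator_product g a b = id" and sp: "s < p" and k: "k < g" "a k s \<noteq> s \<or> b k s \<noteq> s"
  shows "\<exists>a' b' m. (\<forall>i<g. inc_homeo (a' i) \<and> inc_homeo (b' i) \<and>
        (\<forall>x. x \<le> s \<or> p \<le> x \<longrightarrow> a' i x = a i x \<and> b' i x = b i x)) \<and>
      commutator_product g a' b' = id \<and> s \<le> m \<and> m < p \<and>
      (\<forall>x. m \<le> x \<longrightarrow> x < p \<longrightarrow> (\<forall>i<g. commutator (a' i) (b' i) x = x \<and> (a' i x \<noteq> x \<or> b' i x \<noteq> x))) \<and>
      (\<forall>x. s \<le> x \<longrightarrow> x < p \<longrightarrow> (\<exists>i<g. a' i x \<noteq> x \<or> b' i x \<noteq> x))"
proof -
  note a = a_all[rule_format] and b = b_all[rule_format]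
  define c where "c = (\<lambda>i. commutator (a i) (b i))"
  have c: "inc_homeo (c i) \<and> c i p = p" if "i < g" for i
    using a[OF that] b[OF that] by (simp add: c_def commutator_def inc_homeo_inv_fix)
  let ?xs = "[0..<k]" and ?ys = "[Suc k..<g]"
  have split: "[0..<g] = ?xs @ k # ?ys" using k(1) upt_add_eq_append[of 0 k "g - k"] upt_conv_Cons[of k g] by simp
  let ?pre = "comp_list c ?xs" and ?post = "comp_list c ?ys"
  have pre: "inc_homeo ?pre" "?pre p = p" and post: "inc_homeo ?post" "?post p = p"
    using c k(1) by (auto intro!: inc_homeo_comp_list comp_list_fix)
  have rel': "?pre (c k (?post x)) = x" for x
    using rel by (simp add: commutator_product_def split comp_list_append c_def[symmetric] fun_eq_iff)
  have ck: "c k y = finv ?pre (finv ?post y)" for y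
    using rel'[of "finv ?post y"] inc_homeo_inv_left[OF pre(1), of "c k y"] post(1) by simp
  obtain N0 where N0: "N0 < p" and flex: "\<And>z. inc_homeo z \<Longrightarrow> \<forall>x. x \<le> N0 \<or> p \<le> x \<longrightarrow> z x = commutator (a k) (b k) x \<Longrightarrow>
      \<exists>a' b'. inc_homeo a' \<and> inc_homeo b' \<and> (\<forall>x. x \<le> s \<or> p \<le> x \<longrightarrow> a' x = a k x \<and> b' x = b k x) \<and>
        commutator a' b' = z \<and> (\<forall>x. s \<le> x \<longrightarrow> x < p \<longrightarrow> a' x \<noteq> x \<or> b' x \<noteq> x)"
    using commutator_flexible[of "a k" p "b k" s] a[OF k(1)] b[OF k(1)] sp k(2) by auto
  define N2 where "N2 = finv ?post N0"
  define N3 where "N3 = finv ?pre N2"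
  have "N2 < p" using N0 post inc_homeo_inv_less[OF post(1), of N0 p] by (simp add: N2_def)
  moreover from this have "N3 < p" using pre inc_homeo_inv_less[OF pre(1), of N2 p] by (simp add: N3_def)
  ultimately have N23: "N2 < p" "N3 < p" by simp_all
  have "\<exists>M<p. \<forall>c'. (\<forall>i\<in>set ?xs. \<forall>x. x \<le> M \<or> p \<le> x \<longrightarrow> c' i x = c i x) \<longrightarrow>
    (\<forall>x. x \<le> N3 \<or> p \<le> x \<longrightarrow> comp_list c' ?xs x = ?pre x)"
    by (rule comp_list_agree[OF _ N23(2)]) (use c k(1) in simp)
  then obtain M1 where M1: "M1 < p" and M1': "\<forall>c'. (\<forall>i\<in>set ?xs. \<forall>x. x \<le> M1 \<or> p \<le> x \<longrightarrow> c' i x = c i x) \<longrightarrow>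
    (\<forall>x. x \<le> N3 \<or> p \<le> x \<longrightarrow> comp_list c' ?xs x = ?pre x)" by blast
  have "\<exists>M<p. \<forall>c'. (\<forall>i\<in>set ?ys. \<forall>x. x \<le> M \<or> p \<le> x \<longrightarrow> c' i x = c i x) \<longrightarrow>
    (\<forall>x. x \<le> N2 \<or> p \<le> x \<longrightarrow> comp_list c' ?ys x = ?post x)"
    by (rule comp_list_agree[OF _ N23(1)]) (use c k(1) in simp)
  then obtain M2 where M2: "M2 < p" and M2': "\<forall>c'. (\<forall>i\<in>set ?ys. \<forall>x. x \<le> M2 \<or> p \<le> x \<longrightarrow> c' i x = c i x) \<longrightarrow>
    (\<forall>x. x \<le> N2 \<or> p \<le> x \<longrightarrow> comp_list c' ?ys x = ?post x)" by blast
  define N where "N = max s (max M1 M2)"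
  have Np: "N < p" using sp M1 M2 by (simp add: N_def)
  define P where "P = (\<lambda>i a' b' m. inc_homeo a' \<and> inc_homeo b' \<and> m < p \<and>
    (\<forall>x. x \<le> N \<or> p \<le> x \<longrightarrow> a' x = a i x \<and> b' x = b i x \<and> commutator a' b' x = commutator (a i) (b i) x) \<and>
    (\<forall>x. m \<le> x \<longrightarrow> x < p \<longrightarrow> commutator a' b' x = x \<and> a' x \<noteq> x))"
  have "\<exists>a' b' m. P i a' b' m" if "i < g" for i
    unfolding P_def by (rule commutator_trivial_tail[OF _ _ _ _ Np]) (use a[OF that] b[OF that] in auto)
  then obtain A B m where "\<And>i. i < g \<Longrightarrow> P i (A i) (B i) (m i)" by metis
  hence AB: "\<And>i. i < g \<Longrightarrow> inc_homeo (A i) \<and> inc_homeo (B i) \<and> m i < p"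
    "\<And>i x. i < g \<Longrightarrow> x \<le> N \<or> p \<le> x \<Longrightarrow> A i x = a i x \<and> B i x = b i x \<and> commutator (A i) (B i) x = c i x"
    "\<And>i x. i < g \<Longrightarrow> m i \<le> x \<Longrightarrow> x < p \<Longrightarrow> commutator (A i) (B i) x = x \<and> A i x \<noteq> x"
    unfolding P_def c_def by blast+
  define d where "d = (\<lambda>i. commutator (A i) (B i))"
  have d: "inc_homeo (d i)" if "i < g" for i using AB(1)[OF that] by (simp add: d_def)
  have dc: "d i x = c i x" if "i < g" "x \<le> N \<or> p \<le> x" for i x using AB(2)[OF that] by (simp add: d_def)
  let ?Pre = "comp_list d ?xs" and ?Post = "comp_list d ?ys"
  have Pre: "inc_homeo ?Pre" and Post: "inc_homeo ?Post"
    using d k(1) by (auto intro!: inc_homeo_comp_list)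
  have Pre_eq: "?Pre x = ?pre x" if "x \<le> N3 \<or> p \<le> x" for x
    by (rule M1'[rule_format, OF _ that]) (rule dc, use k(1) in \<open>auto simp: N_def\<close>)
  have Post_eq: "?Post x = ?post x" if "x \<le> N2 \<or> p \<le> x" for x
    by (rule M2'[rule_format, OF _ that]) (rule dc, auto simp: N_def)
  \<comment> \<open>The commutator that the \<open>k\<close>-th handle must have for the product to be the identity again.\<close>
  define z where "z = finv ?Pre \<circ> finv ?Post"
  have z: "inc_homeo z" using Pre Post by (simp add: z_def)
  have zc: "z x = commutator (a k) (b k) x" if "x \<le> N0 \<or> p \<le> x" for x
  proof -
    let ?y = "finv ?post x" and ?w = "finv ?pre (finv ?post x)"
    have y: "?y \<le> N2 \<or> p \<le> ?y"
      using that inc_homeo_le[OF inc_homeo_inv[OF post(1)], of x N0] inc_homeo_le_inv[OF post(1), of p x] post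
      by (auto simp: N2_def)
    have w: "?w \<le> N3 \<or> p \<le> ?w"
      using y inc_homeo_le[OF inc_homeo_inv[OF pre(1)], of ?y N2] inc_homeo_le_inv[OF pre(1), of p ?y] pre
      by (auto simp: N3_def)
    have "?Post ?y = x" using Post_eq[OF y] post by simp
    hence 1: "finv ?Post x = ?y" using Post by (simp add: inc_homeo_inv_eq)
    have "?Pre ?w = ?y" using Pre_eq[OF w] pre by simp
    hence "finv ?Pre ?y = ?w" using Pre by (simp add: inc_homeo_inv_eq)
    hence "z x = c k x" by (simp add: z_def 1 ck)
    thus ?thesis by (simp add: c_def)
  qed
  obtain ak bk where kk: "inc_homeo ak" "inc_homeo bk" "\<And>x. x \<le> s \<or> p \<le> x \<Longrightarrow> ak x = a k x \<and> bk x = b k x"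
    "commutator ak bk = z" "\<And>x. s \<le> x \<Longrightarrow> x < p \<Longrightarrow> ak x \<noteq> x \<or> bk x \<noteq> x"
    using flex[OF z] zc by auto
  define m' where "m' = Max (insert s (m ` {..<g}))"
  have m': "s \<le> m'" "m' < p" "\<And>i. i < g \<Longrightarrow> m i \<le> m'" using AB(1) sp by (auto simp: m'_def)
  let ?a = "A(k := ak)" and ?b = "B(k := bk)"
  have comm: "commutator (?a i) (?b i) = (if i = k then z else d i)" for i
    using kk(4) by (simp add: d_def)
  have lists: "comp_list (\<lambda>i. if i = k then z else d i) ?xs = ?Pre" "comp_list (\<lambda>i. if i = k then z else d i) ?ys = ?Post"
    by (auto intro!: comp_list_cong)
  have rel_new: "commutator_product g ?a ?b = id"
    unfolding commutator_product_def split comp_list_append comp_list_simps comm lists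
    using Pre Post by (simp add: fun_eq_iff z_def)
  have did: "d i x = x" if "i < g" "m' \<le> x" "x < p" for i x
    using AB(3)[OF that(1) _ that(3)] m'(3)[OF that(1)] that(2) by (simp add: d_def)
  have idl: "comp_list d zs x = x" if "set zs \<subseteq> {..<g}" "m' \<le> x" "x < p" for zs x
    using that(1) by (induction zs) (use did that in auto)
  have zid: "z x = x" if "m' \<le> x" "x < p" for x
  proof -
    have "?Post x = x" by (rule idl[OF _ that]) auto
    moreover have "?Pre x = x" by (rule idl[OF _ that]) (use k(1) in auto)
    ultimately have "finv ?Post x = x" "finv ?Pre x = x" using Pre Post by (auto simp: inc_homeo_inv_eq)
    thus ?thesis by (simp add: z_def)
  qed
  show ?thesis
  proof (rule exI[of _ ?a], rule exI[of _ ?b], rule exI[of _ m'], intro conjI allI impI)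
    fix i assume i: "i < g"
    show "inc_homeo (?a i)" "inc_homeo (?b i)" using kk AB(1)[OF i] by auto
    fix x assume "x \<le> s \<or> p \<le> x"
    moreover from this have "x \<le> N \<or> p \<le> x" by (auto simp: N_def)
    ultimately show "?a i x = a i x" "?b i x = b i x" using kk(3)[of x] AB(2)[OF i, of x] by auto
  next
    fix x i assume x: "m' \<le> x" "x < p" and i: "i < g"
    show "commutator (?a i) (?b i) x = x" using zid[OF x] did[OF i x] by (simp only: comm) simp
    show "?a i x \<noteq> x \<or> ?b i x \<noteq> x"
      using kk(5)[of x] AB(3)[OF i _ x(2)] m'(3)[OF i] m'(1) x by (cases "i = k") auto
  next
    fix x assume x: "s \<le> x" "x < p"
    show "\<exists>i<g. ?a i x \<noteq> x \<or> ?b i x \<noteq> x" using kk(5)[OF x] k(1) by (intro exI[of _ k]) simp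
  qed (use rel_new m' in auto)
qed

section \<open>Homeomorphisms commuting with a translation\<close>

text \<open>For \<open>L = 2 * pi\<close> these are the lifts of orientation preserving homeomorphisms of the circle; for \<open>L = 0\<close>
the condition is void and they are all increasing homeomorphisms of the line. Both cases of the theorem
are treated at once in this way.\<close>

definition translation_homeo :: "real \<Rightarrow> (real \<Rightarrow> real) \<Rightarrow> bool" where
  "translation_homeo L f \<longleftrightarrow> inc_homeo f \<and> (\<forall>x. f (x + L) = f x + L)"

lemma translation_homeoD: "translation_homeo L f \<Longrightarrow> inc_homeo f"
  by (simp add: translation_homeo_def)

lemma translation_homeo_id [simp]: "translation_homeo L id"
  by (simp add: translation_homeo_def)

lemma translation_homeo_comp [simp]:
  "translation_homeo L f \<Longrightarrow> translation_homeo L g \<Longrightarrow> translation_homeo L (f \<circ> g)"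
  by (simp add: translation_homeo_def)

lemma translation_homeo_inv [simp]: "translation_homeo L f \<Longrightarrow> translation_homeo L (finv f)"
  by (auto simp: translation_homeo_def inc_homeo_inv_eq)

lemma translation_homeo_commutator [simp]:
  "translation_homeo L f \<Longrightarrow> translation_homeo L g \<Longrightarrow> translation_homeo L (commutator f g)"
  by (simp add: commutator_def)

lemma translation_homeo_int:
  assumes "translation_homeo L f" shows "f (x + of_int k * L) = f x + of_int k * L"
proof -
  have nat: "f (x + real n * L) = f x + real n * L" for n x
  proof (induction n)
    case (Suc n)
    have "f (x + real (Suc n) * L) = f ((x + real n * L) + L)" by (simp add: algebra_simps)
    also have "\<dots> = f (x + real n * L) + L" using assms by (simp only: translation_homeo_def)
    finally show ?case using Suc by (simp add: algebra_simps)
  qed simp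
  show ?thesis
  proof (cases "k \<ge> 0")
    case True thus ?thesis using nat[of x "nat k"] by simp
  next
    case False thus ?thesis using nat[of "x + of_int k * L" "nat (- k)"] by simp
  qed
qed

lemma translation_homeo_int_diff:
  "translation_homeo L f \<Longrightarrow> f (x - of_int k * L) = f x - of_int k * L"
  using translation_homeo_int[of L f x "- k"] by simp

text \<open>The multiple of \<open>L\<close> that moves the point \<open>x\<close> into the cell of the points \<open>y\<close> with \<open>p - L < y \<le> p\<close>. For
\<open>L = 0\<close> it is \<open>0\<close>, so that the whole line is one cell and nothing is made periodic.\<close>

definition cell_shift :: "real \<Rightarrow> real \<Rightarrow> real \<Rightarrow> real" where
  "cell_shift L p x = of_int \<lceil>(x - p) / L\<rceil> * L"

definition periodize :: "real \<Rightarrow> real \<Rightarrow> (real \<Rightarrow> real) \<Rightarrow> real \<Rightarrow> real" where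
  "periodize L p f x = f (x - cell_shift L p x) + cell_shift L p x"

text \<open>The maps that can be repeated periodically because they fix both ends of the cell.\<close>

definition fixes_cell :: "real \<Rightarrow> real \<Rightarrow> (real \<Rightarrow> real) \<Rightarrow> bool" where
  "fixes_cell L p f \<longleftrightarrow> inc_homeo f \<and> f p = p \<and> (L > 0 \<longrightarrow> f (p - L) = p - L)"

definition in_cell :: "real \<Rightarrow> real \<Rightarrow> real \<Rightarrow> bool" where
  "in_cell L p x \<longleftrightarrow> (L > 0 \<longrightarrow> p - L < x \<and> x \<le> p)"

lemma cell_shift_add: "L \<ge> 0 \<Longrightarrow> cell_shift L p (x + of_int k * L) = cell_shift L p x + of_int k * L"
proof (cases "L = 0")
  case False
  hence "(x + of_int k * L - p) / L = (x - p) / L + of_int k" by (simp add: field_simps)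
  thus ?thesis by (simp only: cell_shift_def ceiling_add_of_int of_int_add distrib_right)
qed (simp add: cell_shift_def)

lemma cell_shift_in_cell: assumes "L \<ge> 0" "in_cell L p x" shows "cell_shift L p x = 0"
proof (cases "L = 0")
  case False
  hence "\<lceil>(x - p) / L\<rceil> = 0" using assms by (intro ceiling_unique) (auto simp: in_cell_def field_simps)
  thus ?thesis by (simp add: cell_shift_def)
qed (simp add: cell_shift_def)

lemma in_cell_shift: assumes "L \<ge> 0" shows "in_cell L p (x - cell_shift L p x)"
proof (cases "L = 0")
  case False
  hence L: "L > 0" using assms by simp
  have "(x - p) / L \<le> of_int \<lceil>(x - p) / L\<rceil>" "of_int \<lceil>(x - p) / L\<rceil> < (x - p) / L + 1"
    by linarith+
  from mult_right_mono[OF this(1), of L] mult_strict_right_mono[OF this(2), of L]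
  have "x - p \<le> of_int \<lceil>(x - p) / L\<rceil> * L" "of_int \<lceil>(x - p) / L\<rceil> * L < (x - p) + L"
    using L by (simp_all add: distrib_right)
  thus ?thesis by (auto simp: in_cell_def cell_shift_def)
qed (simp add: in_cell_def)

lemma cell_shift_int: "\<exists>k. cell_shift L p x = of_int k * L"
  by (auto simp: cell_shift_def)

lemma in_cell_image: assumes "fixes_cell L p f" shows "in_cell L p (f x) \<longleftrightarrow> in_cell L p x"
  using assms inc_homeo_less[of f "p - L" x] inc_homeo_le[of f x p] by (auto simp: in_cell_def fixes_cell_def)

lemma fixes_cell_closed [simp]:
  "fixes_cell L p id" "fixes_cell L p f \<Longrightarrow> fixes_cell L p f' \<Longrightarrow> fixes_cell L p (f \<circ> f')"
  "fixes_cell L p f \<Longrightarrow> fixes_cell L p (finv f)"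
  by (auto simp: fixes_cell_def inc_homeo_inv_fix)

lemma fixes_cell_commutator [simp]:
  "fixes_cell L p f \<Longrightarrow> fixes_cell L p f' \<Longrightarrow> fixes_cell L p (commutator f f')"
  by (simp add: commutator_def)

lemma cell_shift_periodize:
  assumes "L \<ge> 0" "fixes_cell L p f" shows "cell_shift L p (periodize L p f x) = cell_shift L p x"
proof -
  obtain k where k: "cell_shift L p x = of_int k * L" using cell_shift_int by blast
  have "in_cell L p (f (x - cell_shift L p x))" using in_cell_image[OF assms(2)] in_cell_shift[OF assms(1)] by blast
  from cell_shift_in_cell[OF assms(1) this] show ?thesis
    using cell_shift_add[OF assms(1), of p "f (x - cell_shift L p x)" k] k by (simp add: periodize_def)
qed

lemma periodize_comp:
  assumes "L \<ge> 0" "fixes_cell L p f'" shows "periodize L p (f \<circ> f') = periodize L p f \<circ> periodize L p f'"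
proof
  fix x
  show "periodize L p (f \<circ> f') x = (periodize L p f \<circ> periodize L p f') x"
    using cell_shift_periodize[OF assms, of x]
    by (simp add: periodize_def[of L p f] periodize_def[of L p "f \<circ> f'"]) (simp add: periodize_def)
qed

lemma periodize_id [simp]: "periodize L p id = id"
  by (auto simp: periodize_def)

lemma periodize_eq: assumes "L \<ge> 0" "in_cell L p x" shows "periodize L p f x = f x"
  using cell_shift_in_cell[OF assms] by (simp add: periodize_def)

lemma translation_homeo_periodize:
  assumes L: "L \<ge> 0" and f: "fixes_cell L p f" shows "translation_homeo L (periodize L p f)"
proof -
  let ?P = "periodize L p f" and ?c = "cell_shift L p"
  have eqv: "?P (x + L) = ?P x + L" for x
    using cell_shift_add[OF L, of p x 1] by (simp add: periodize_def)
  have "?P x < ?P y" if "x < y" for x y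
  proof (cases "?c x = ?c y")
    case True
    thus ?thesis using that f by (simp add: periodize_def fixes_cell_def inc_homeo_less)
  next
    case False
    hence Lp: "L > 0" using L by (cases "L = 0") (auto simp: cell_shift_def)
    have "(x - p) / L \<le> (y - p) / L" using that Lp by (simp add: divide_right_mono)
    hence "\<lceil>(x - p) / L\<rceil> \<le> \<lceil>(y - p) / L\<rceil>" by (rule ceiling_mono)
    hence "\<lceil>(x - p) / L\<rceil> + 1 \<le> \<lceil>(y - p) / L\<rceil>" using False by (auto simp: cell_shift_def order.order_iff_strict)
    hence "of_int (\<lceil>(x - p) / L\<rceil> + 1) * L \<le> of_int \<lceil>(y - p) / L\<rceil> * L"
      using Lp by (intro mult_right_mono) (auto simp del: of_int_add)
    hence c: "?c x + L \<le> ?c y" by (simp add: cell_shift_def algebra_simps)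
    have "in_cell L p (f (x - ?c x))" "in_cell L p (f (y - ?c y))"
      using in_cell_image[OF f] in_cell_shift[OF L] by blast+
    thus ?thesis using c Lp by (simp add: in_cell_def periodize_def)
  qed
  moreover have "periodize L p (f \<circ> finv f) x = (?P \<circ> periodize L p (finv f)) x" for x
    by (subst periodize_comp[OF L]) (use f in simp_all)
  hence "?P (periodize L p (finv f) x) = x" for x
    using f by (simp add: fixes_cell_def)
  hence "surj ?P" by (metis surjI)
  ultimately show ?thesis using eqv by (auto simp: translation_homeo_def inc_homeo_def strict_mono_def)
qed

lemma periodize_inv:
  assumes "L \<ge> 0" "fixes_cell L p f" shows "periodize L p (finv f) = finv (periodize L p f)"
proof
  fix x
  have "periodize L p (f \<circ> finv f) x = periodize L p f (periodize L p (finv f) x)"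
    using periodize_comp[OF assms(1) fixes_cell_closed(3)[OF assms(2)], of f] by simp
  moreover have "f \<circ> finv f = id" using assms(2) by (simp add: fixes_cell_def)
  ultimately have "periodize L p f (periodize L p (finv f) x) = x" by simp
  thus "periodize L p (finv f) x = finv (periodize L p f) x"
    using translation_homeoD[OF translation_homeo_periodize[OF assms]] by (metis inc_homeo_inv_left)
qed

lemma periodize_commutator:
  assumes "L \<ge> 0" "fixes_cell L p f" "fixes_cell L p f'"
  shows "periodize L p (commutator f f') = commutator (periodize L p f) (periodize L p f')"
  using assms by (simp add: commutator_def periodize_comp periodize_inv)

lemma periodize_comp_list:
  assumes "L \<ge> 0" "\<And>i. i \<in> set xs \<Longrightarrow> fixes_cell L p (c i)"
  shows "periodize L p (comp_list c xs) = comp_list (\<lambda>i. periodize L p (c i)) xs"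
proof -
  have "fixes_cell L p (comp_list c xs)" if "\<forall>i\<in>set xs. fixes_cell L p (c i)" for xs
    using that by (induction xs) auto
  thus ?thesis using assms by (induction xs) (simp_all add: periodize_comp)
qed

definition tuple_relation :: "real \<Rightarrow> nat \<Rightarrow> (nat \<Rightarrow> real \<Rightarrow> real) \<Rightarrow> (nat \<Rightarrow> real \<Rightarrow> real) \<Rightarrow> bool" where
  "tuple_relation L g a b \<longleftrightarrow> (\<forall>i<g. translation_homeo L (a i) \<and> translation_homeo L (b i)) \<and>
     commutator_product g a b = id"

lemma tuple_relation_inc: "tuple_relation L g a b \<Longrightarrow> i < g \<Longrightarrow> inc_homeo (a i) \<and> inc_homeo (b i)"
  by (simp add: tuple_relation_def translation_homeo_def)

definition common_fixed :: "nat \<Rightarrow> (nat \<Rightarrow> real \<Rightarrow> real) \<Rightarrow> (nat \<Rightarrow> real \<Rightarrow> real) \<Rightarrow> real set" where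
  "common_fixed g a b = {x. \<forall>i<g. a i x = x \<and> b i x = x}"

text \<open>The change is confined to the interval from \<open>s\<close> to \<open>p\<close>, which lies in one cell, so it can be repeated in
all cells: periodic continuation respects composition, and so it preserves the relation.\<close>

lemma standardize_left_end_periodic:
  assumes L: "L \<ge> 0" and ab: "tuple_relation L g a b" and p: "p \<in> common_fixed g a b"
    and s: "s < p" "L > 0 \<longrightarrow> p - L < s" and k: "s \<notin> common_fixed g a b"
  shows "\<exists>a' b' m. tuple_relation L g a' b' \<and>
      (\<forall>i<g. \<forall>x. (\<forall>k::int. \<not> (s < x - k * L \<and> x - k * L < p)) \<longrightarrow> a' i x = a i x \<and> b' i x = b i x) \<and>
      s \<le> m \<and> m < p \<and>
      (\<forall>x. m \<le> x \<longrightarrow> x < p \<longrightarrow> (\<forall>i<g. commutator (a' i) (b' i) x = x \<and> (a' i x \<noteq> x \<or> b' i x \<noteq> x))) \<and>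
      (\<forall>x. s \<le> x \<longrightarrow> x < p \<longrightarrow> x \<notin> common_fixed g a' b')"
proof -
  have tr: "translation_homeo L (a i)" "translation_homeo L (b i)" if "i < g" for i
    using ab that by (auto simp: tuple_relation_def)
  have ap: "a i p = p" "b i p = p" if "i < g" for i using p that by (auto simp: common_fixed_def)
  obtain j where j: "j < g" "a j s \<noteq> s \<or> b j s \<noteq> s" using k by (auto simp: common_fixed_def)
  have "\<forall>i<g. inc_homeo (a i) \<and> a i p = p" "\<forall>i<g. inc_homeo (b i) \<and> b i p = p" "commutator_product g a b = id"
    using tuple_relation_inc[OF ab] ap ab by (simp_all add: tuple_relation_def)
  from standardize_left_end[OF this s(1) j] obtain a1 b1 m where
    0: "\<forall>i<g. inc_homeo (a1 i) \<and> inc_homeo (b1 i) \<and> (\<forall>x. x \<le> s \<or> p \<le> x \<longrightarrow> a1 i x = a i x \<and> b1 i x = b i x)"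
      "commutator_product g a1 b1 = id" "s \<le> m" "m < p"
      "\<forall>x. m \<le> x \<longrightarrow> x < p \<longrightarrow> (\<forall>i<g. commutator (a1 i) (b1 i) x = x \<and> (a1 i x \<noteq> x \<or> b1 i x \<noteq> x))"
      "\<forall>x. s \<le> x \<longrightarrow> x < p \<longrightarrow> (\<exists>i<g. a1 i x \<noteq> x \<or> b1 i x \<noteq> x)"
    by (elim exE conjE) (rule that; assumption)
  note 1 = 0(1)[rule_format, THEN conjunct1] 0(1)[rule_format, THEN conjunct2, THEN conjunct2, rule_format]
    0(2-4) 0(5)[rule_format] 0(6)[rule_format]
  have cell: "fixes_cell L p (a1 i) \<and> fixes_cell L p (b1 i)" if i: "i < g" for i
  proof -
    have "a i (p - L) = p - L" "b i (p - L) = p - L"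
      using translation_homeo_int_diff[OF tr(1)[OF i], of p 1] translation_homeo_int_diff[OF tr(2)[OF i], of p 1]
        ap[OF i] by auto
    thus ?thesis using 0(1) i 1(2)[OF i, of p] 1(2)[OF i, of "p - L"] ap[OF i] s
      by (auto simp: fixes_cell_def)
  qed
  define a' where "a' = (\<lambda>i. periodize L p (a1 i))"
  define b' where "b' = (\<lambda>i. periodize L p (b1 i))"
  have eq: "a' i x = a1 i x" "b' i x = b1 i x" if "s \<le> x" "x < p" for x i
  proof -
    have "in_cell L p x" using that s by (auto simp: in_cell_def)
    thus "a' i x = a1 i x" "b' i x = b1 i x" using periodize_eq[OF L] by (auto simp: a'_def b'_def)
  qed
  have comm: "commutator (a' i) (b' i) = periodize L p (commutator (a1 i) (b1 i))" if "i < g" for i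
    using cell[OF that] periodize_commutator[OF L] by (simp add: a'_def b'_def)
  have "commutator_product g a' b' = comp_list (\<lambda>i. periodize L p (commutator (a1 i) (b1 i))) [0..<g]"
    unfolding commutator_product_def by (rule comp_list_cong) (use comm in simp)
  also have "\<dots> = periodize L p (commutator_product g a1 b1)"
    unfolding commutator_product_def by (rule periodize_comp_list[symmetric, OF L]) (use cell in simp)
  finally have rel: "tuple_relation L g a' b'"
    using 1(3) cell translation_homeo_periodize[OF L] by (auto simp: tuple_relation_def a'_def b'_def)
  have agree: "a' i x = a i x \<and> b' i x = b i x"
    if i: "i < g" and x: "\<forall>k::int. \<not> (s < x - k * L \<and> x - k * L < p)" for i x
  proof -
    obtain k where k: "cell_shift L p x = of_int k * L" using cell_shift_int by blast
    have "x - k * L \<le> s \<or> p \<le> x - k * L" using x by (meson not_le)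
    thus ?thesis using 1(2)[OF i, of "x - k * L"] translation_homeo_int_diff[OF tr(1)[OF i], of x k]
      translation_homeo_int_diff[OF tr(2)[OF i], of x k] by (simp add: a'_def b'_def periodize_def k)
  qed
  have near: "commutator (a' i) (b' i) x = x \<and> (a' i x \<noteq> x \<or> b' i x \<noteq> x)" if "m \<le> x" "x < p" "i < g" for x i
  proof -
    have "s \<le> x" using that 1(4) by simp
    moreover have "in_cell L p x" using that s \<open>s \<le> x\<close> by (auto simp: in_cell_def)
    ultimately show ?thesis using 1(6)[OF that] comm[OF that(3)] periodize_eq[OF L] eq that(2) by simp
  qed
  have nofix: "x \<notin> common_fixed g a' b'" if "s \<le> x" "x < p" for x
    using 1(7)[OF that] eq[OF that] by (auto simp: common_fixed_def)
  show ?thesis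
  proof (rule exI[of _ a'], rule exI[of _ b'], rule exI[of _ m], intro conjI)
    show "\<forall>i<g. \<forall>x. (\<forall>k::int. \<not> (s < x - k * L \<and> x - k * L < p)) \<longrightarrow> a' i x = a i x \<and> b' i x = b i x"
      using agree by blast
    show "\<forall>x. m \<le> x \<longrightarrow> x < p \<longrightarrow> (\<forall>i<g. commutator (a' i) (b' i) x = x \<and> (a' i x \<noteq> x \<or> b' i x \<noteq> x))"
      by (intro allI impI near)
    show "\<forall>x. s \<le> x \<longrightarrow> x < p \<longrightarrow> x \<notin> common_fixed g a' b'" by (intro allI impI nofix)
  qed (fact rel 1(4) 1(5))+
qed

text \<open>Conjugation with \<open>x \<mapsto> - x\<close> exchanges the two sides of a fixed point.\<close>

definition reflect :: "(real \<Rightarrow> real) \<Rightarrow> real \<Rightarrow> real" where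
  "reflect f x = - f (- x)"

lemma reflect_reflect [simp]: "reflect (reflect f) = f"
  by (auto simp: reflect_def)

lemma inc_homeo_reflect [simp]: "inc_homeo f \<Longrightarrow> inc_homeo (reflect f)"
  unfolding inc_homeo_def strict_mono_def surj_def reflect_def
  by (metis minus_minus neg_less_iff_less)

lemma translation_homeo_reflect [simp]: assumes "translation_homeo L f" shows "translation_homeo L (reflect f)"
  using assms translation_homeo_int_diff[OF assms, of _ 1]
  by (auto simp: translation_homeo_def) (simp add: reflect_def)

lemma reflect_comp: "reflect (f \<circ> f') = reflect f \<circ> reflect f'"
  by (auto simp: reflect_def)

lemma reflect_inv: "inc_homeo f \<Longrightarrow> reflect (finv f) = finv (reflect f)"
proof
  fix x assume f: "inc_homeo f"
  have "reflect f (reflect (finv f) x) = x" using f by (simp add: reflect_def)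
  thus "reflect (finv f) x = finv (reflect f) x" using f by (metis inc_homeo_reflect inc_homeo_inv_left)
qed

lemma reflect_commutator:
  "inc_homeo f \<Longrightarrow> inc_homeo f' \<Longrightarrow> commutator (reflect f) (reflect f') = reflect (commutator f f')"
  by (simp add: commutator_def reflect_comp reflect_inv)

lemma reflect_commutator_product:
  assumes "\<And>i. i < g \<Longrightarrow> inc_homeo (a i) \<and> inc_homeo (b i)"
  shows "commutator_product g (\<lambda>i. reflect (a i)) (\<lambda>i. reflect (b i)) = reflect (commutator_product g a b)"
proof -
  have "comp_list (\<lambda>i. reflect (c i)) xs = reflect (comp_list c xs)" for c xs
    by (induction xs) (auto simp: reflect_def fun_eq_iff)
  moreover have "commutator_product g (\<lambda>i. reflect (a i)) (\<lambda>i. reflect (b i)) =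
      comp_list (\<lambda>i. reflect (commutator (a i) (b i))) [0..<g]"
    unfolding commutator_product_def by (rule comp_list_cong) (use assms in \<open>simp add: reflect_commutator\<close>)
  ultimately show ?thesis by (simp add: commutator_product_def)
qed

lemma tuple_relation_reflect:
  assumes "tuple_relation L g a b"
  shows "tuple_relation L g (\<lambda>i. reflect (a i)) (\<lambda>i. reflect (b i))"
proof -
  have "inc_homeo (a i) \<and> inc_homeo (b i)" if "i < g" for i
    using assms that by (rule tuple_relation_inc)
  hence "commutator_product g (\<lambda>i. reflect (a i)) (\<lambda>i. reflect (b i)) = reflect (commutator_product g a b)"
    by (rule reflect_commutator_product)
  moreover have "reflect id = id" by (auto simp: reflect_def)
  ultimately show ?thesis using assms by (simp add: tuple_relation_def)
qed

lemma common_fixed_reflect: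
  "x \<in> common_fixed g (\<lambda>i. reflect (a i)) (\<lambda>i. reflect (b i)) \<longleftrightarrow> - x \<in> common_fixed g a b"
  by (auto simp: common_fixed_def reflect_def)

lemma standardize_right_end_periodic:
  assumes L: "L \<ge> 0" and ab: "tuple_relation L g a b" and p: "p \<in> common_fixed g a b"
    and t: "p < t" "L > 0 \<longrightarrow> t < p + L" and k: "t \<notin> common_fixed g a b"
  shows "\<exists>a' b' m. tuple_relation L g a' b' \<and>
      (\<forall>i<g. \<forall>x. (\<forall>k::int. \<not> (p < x - k * L \<and> x - k * L < t)) \<longrightarrow> a' i x = a i x \<and> b' i x = b i x) \<and>
      p < m \<and> m \<le> t \<and>
      (\<forall>x. p < x \<longrightarrow> x \<le> m \<longrightarrow> (\<forall>i<g. commutator (a' i) (b' i) x = x \<and> (a' i x \<noteq> x \<or> b' i x \<noteq> x))) \<and>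
      (\<forall>x. p < x \<longrightarrow> x \<le> t \<longrightarrow> x \<notin> common_fixed g a' b')"
proof -
  let ?a = "\<lambda>i. reflect (a i)" and ?b = "\<lambda>i. reflect (b i)"
  have p': "- p \<in> common_fixed g ?a ?b" and t': "- t < - p" "L > 0 \<longrightarrow> - p - L < - t" and k': "- t \<notin> common_fixed g ?a ?b"
    using p t k by (auto simp: common_fixed_reflect)
  from standardize_left_end_periodic[OF L tuple_relation_reflect[OF ab] p' t' k'] obtain a' b' m where *: "tuple_relation L g a' b'"
      "\<And>i x. i < g \<Longrightarrow> \<forall>k::int. \<not> (- t < x - k * L \<and> x - k * L < - p) \<Longrightarrow> a' i x = ?a i x \<and> b' i x = ?b i x"
      "- t \<le> m" "m < - p"
      "\<And>x i. m \<le> x \<Longrightarrow> x < - p \<Longrightarrow> i < g \<Longrightarrow> commutator (a' i) (b' i) x = x \<and> (a' i x \<noteq> x \<or> b' i x \<noteq> x)"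
      "\<And>x. - t \<le> x \<Longrightarrow> x < - p \<Longrightarrow> x \<notin> common_fixed g a' b'"
    by (elim exE conjE) (rule that, (assumption | blast)+)
  have inc: "inc_homeo (a' i)" "inc_homeo (b' i)" if "i < g" for i
    using tuple_relation_inc[OF *(1) that] by auto
  show ?thesis
  proof (rule exI[of _ "\<lambda>i. reflect (a' i)"], rule exI[of _ "\<lambda>i. reflect (b' i)"], rule exI[of _ "- m"],
      intro conjI allI impI)
    show "tuple_relation L g (\<lambda>i. reflect (a' i)) (\<lambda>i. reflect (b' i))" by (rule tuple_relation_reflect[OF *(1)])
    show "p < - m" "- m \<le> t" using *(3,4) by auto
  next
    fix i x assume i: "i < g" and x: "\<forall>k::int. \<not> (p < x - k * L \<and> x - k * L < t)"
    have "\<not> (- t < - x - k * L \<and> - x - k * L < - p)" for k :: int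
      using x[rule_format, of "- k"] by auto
    hence "a' i (- x) = ?a i (- x) \<and> b' i (- x) = ?b i (- x)" using *(2)[OF i] by blast
    thus "reflect (a' i) x = a i x" "reflect (b' i) x = b i x" by (auto simp: reflect_def)
  next
    fix x i assume x: "p < x" "x \<le> - m" and i: "i < g"
    have 5: "commutator (a' i) (b' i) (- x) = - x \<and> (a' i (- x) \<noteq> - x \<or> b' i (- x) \<noteq> - x)"
      by (rule *(5)) (use x i in auto)
    show "commutator (reflect (a' i)) (reflect (b' i)) x = x"
      unfolding reflect_commutator[OF inc[OF i]] by (simp add: reflect_def 5)
    show "reflect (a' i) x \<noteq> x \<or> reflect (b' i) x \<noteq> x"
      unfolding reflect_def using 5[THEN conjunct2] by (metis minus_minus)
  next
    fix x assume x: "p < x" "x \<le> t"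
    show "x \<notin> common_fixed g (\<lambda>i. reflect (a' i)) (\<lambda>i. reflect (b' i))"
      unfolding common_fixed_reflect by (rule *(6)) (use x in auto)
  qed
qed

section \<open>Moving an isolated common fixed point\<close>

text \<open>Half of the distance is added because the distance to \<open>C\<close> has Lipschitz constant \<open>1\<close>; thus the map is
increasing, and its fixed points are the points of \<open>C\<close>.\<close>

definition bump :: "real set \<Rightarrow> real \<Rightarrow> real" where
  "bump C x = x + infdist x C / 2"

lemma bump_fixed: assumes "closed C" "C \<noteq> {}" shows "bump C x = x \<longleftrightarrow> x \<in> C"
  using in_closed_iff_infdist_zero[OF assms] by (simp add: bump_def)

lemma inc_homeo_bump: assumes "closed C" "C \<noteq> {}" shows "inc_homeo (bump C)"
proof -
  obtain c where c: "c \<in> C" using assms by blast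
  have "bump C x < bump C y" if "x < y" for x y
  proof -
    have "infdist x C \<le> infdist y C + dist x y" by (rule infdist_triangle)
    thus ?thesis using that by (simp add: bump_def dist_real_def)
  qed
  moreover have "\<exists>x. bump C x = y" for y
  proof -
    define x0 where "x0 = (if c \<le> y then c else 2 * y - c)"
    have "infdist x0 C \<le> dist x0 c" by (rule infdist_le[OF c])
    hence "bump C x0 \<le> y" using bump_fixed[OF assms, of c] c
      by (cases "c \<le> y") (auto simp: x0_def bump_def dist_real_def)
    moreover have "y \<le> bump C y" using infdist_nonneg[of y C] by (simp add: bump_def)
    moreover have "x0 \<le> y" by (simp add: x0_def)
    moreover have "continuous_on {x0..y} (bump C)" unfolding bump_def[abs_def] by (intro continuous_intros) auto
    ultimately show ?thesis using IVT'[of "bump C" x0 y y] by blast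
  qed
  ultimately show ?thesis unfolding inc_homeo_def strict_mono_def surj_def by metis
qed

lemma translation_homeo_bump:
  assumes "closed C" "C \<noteq> {}" "\<And>x. x + L \<in> C \<longleftrightarrow> x \<in> C" shows "translation_homeo L (bump C)"
proof -
  have "(\<lambda>c. c + L) ` C = C"
  proof (intro equalityI subsetI)
    fix x assume "x \<in> C"
    hence "x - L \<in> C" using assms(3)[of "x - L"] by simp
    thus "x \<in> (\<lambda>c. c + L) ` C" by (rule rev_image_eqI) simp
  qed (use assms(3) in auto)
  hence "infdist (x + L) C = infdist (x + L) ((\<lambda>c. c + L) ` C)" for x by simp
  also have "infdist (x + L) ((\<lambda>c. c + L) ` C) = infdist x C" for x
    by (simp add: infdist_def image_image dist_real_def)
  finally have "bump C (x + L) = bump C x + L" for x by (simp add: bump_def)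
  thus ?thesis using inc_homeo_bump[OF assms(1,2)] by (simp add: translation_homeo_def)
qed

lemma commutator_germ_left:
  assumes f: "inc_homeo f" "f p = p" "inc_homeo f'" and h: "inc_homeo h" "h p = p" "inc_homeo h'" and "q < p"
    and eq: "\<And>x. q < x \<Longrightarrow> x < p \<Longrightarrow> f' x = f x \<and> h' x = h x"
  shows "\<exists>q'<p. \<forall>x. q' < x \<longrightarrow> x < p \<longrightarrow> commutator f' h' x = commutator f h x"
proof -
  have lt: "k y < p \<longleftrightarrow> y < p" "finv k y < p \<longleftrightarrow> y < p" if "inc_homeo k" "k p = p" for k y
    using that inc_homeo_less[OF that(1), of y p] by (simp_all add: inc_homeo_inv_less)
  note ltf = lt[OF f(1,2)] and lth = lt[OF h(1,2)]
  define q' where "q' = max (h q) (max (h (f q)) (h (f (finv h q))))"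
  have "q' < p" using \<open>q < p\<close> ltf lth by (simp add: q'_def)
  moreover have "commutator f' h' x = commutator f h x" if x: "q' < x" "x < p" for x
  proof -
    have g: "h q < x" "h (f q) < x" "h (f (finv h q)) < x" using x(1) by (auto simp: q'_def)
    have 1: "q < finv h x" "finv h x < p" using g x h by (simp_all add: inc_homeo_less_inv lth)
    hence "h' (finv h x) = x" using eq h by simp
    hence e1: "finv h' x = finv h x" using h(3) by (simp add: inc_homeo_inv_eq)
    have 2: "q < finv f (finv h x)" "finv f (finv h x) < p"
      using g x f h by (simp_all add: inc_homeo_less_inv lth ltf)
    hence "f' (finv f (finv h x)) = finv h x" using eq f by simp
    hence e2: "finv f' (finv h x) = finv f (finv h x)" using f(3) by (simp add: inc_homeo_inv_eq)
    have e3: "h' (finv f (finv h x)) = h (finv f (finv h x))" using eq 2 by simp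
    have "finv h q < finv f (finv h x)" using g(3) f h by (simp add: inc_homeo_less_inv)
    hence 3: "q < h (finv f (finv h x))" using h by (simp add: inc_homeo_inv_less)
    have "h (finv f (finv h x)) < p" using 2 lth by simp
    hence "f' (h (finv f (finv h x))) = f (h (finv f (finv h x)))" using eq 3 by simp
    thus ?thesis by (simp add: commutator_def e1 e2 e3)
  qed
  ultimately show ?thesis by blast
qed

lemma ends_not_in_shift:
  fixes k :: int and L l r :: real
  assumes "L \<ge> 0" "L > 0 \<longrightarrow> r - l \<le> L"
  shows "\<not> (l < l - k * L \<and> l - k * L < r)" "\<not> (l < r - k * L \<and> r - k * L < r)"
proof -
  have "of_int k * L \<ge> L" if "k \<ge> 1" using mult_right_mono[of 1 "of_int k" L] that assms(1) by simp
  moreover have "of_int k * L \<le> - L" if "k \<le> -1" using mult_right_mono[of "of_int k" "-1" L] that assms(1) by simp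
  moreover have "k \<ge> 1 \<or> k \<le> -1 \<or> k = 0" by linarith
  ultimately have "L > 0 \<Longrightarrow> of_int k * L \<ge> L \<or> of_int k * L \<le> - L \<or> of_int k * L = 0" by auto
  hence "of_int k * L = 0 \<or> L > 0 \<and> (of_int k * L \<ge> L \<or> of_int k * L \<le> - L)"
    using assms(1) by (cases "L = 0") auto
  thus "\<not> (l < l - k * L \<and> l - k * L < r)" "\<not> (l < r - k * L \<and> r - k * L < r)"
    using assms(2) by auto
qed

text \<open>On a short interval two increasing maps with the same values at the ends are as close as the oscillation
of either.\<close>

lemma close_if_agree_off_interval:
  assumes L: "L \<ge> 0" "L > 0 \<longrightarrow> r - l \<le> L" and f: "translation_homeo L f" and f': "translation_homeo L f'"
    and eq: "\<And>x. \<forall>k::int. \<not> (l < x - k * L \<and> x - k * L < r) \<Longrightarrow> f' x = f x" and e: "f r - f l \<le> e" "0 \<le> e"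
  shows "\<bar>f' x - f x\<bar> \<le> e"
proof (cases "\<exists>k::int. l < x - k * L \<and> x - k * L < r")
  case True
  then obtain k :: int where k: "l < x - k * L" "x - k * L < r" by blast
  let ?y = "x - k * L"
  have "f' l = f l" "f' r = f r" using ends_not_in_shift[OF L] by (auto intro!: eq)
  moreover have "f l < f ?y" "f ?y < f r" "f' l < f' ?y" "f' ?y < f' r"
    using k f f' by (simp_all add: inc_homeo_less translation_homeoD)
  moreover have "f ?y = f x - k * L" "f' ?y = f' x - k * L"
    using translation_homeo_int_diff[OF f] translation_homeo_int_diff[OF f'] by auto
  ultimately show ?thesis using e by linarith
next
  case False
  thus ?thesis using eq[of x] e by auto
qed

lemma common_fixed_shift:
  assumes "tuple_relation L g a b" shows "x - of_int k * L \<in> common_fixed g a b \<longleftrightarrow> x \<in> common_fixed g a b"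
proof -
  have "a i (x - of_int k * L) = a i x - of_int k * L" "b i (x - of_int k * L) = b i x - of_int k * L" if "i < g" for i
    using assms that translation_homeo_int_diff by (auto simp: tuple_relation_def)
  thus ?thesis by (auto simp: common_fixed_def)
qed

lemma commutator_conj:
  assumes "inc_homeo h" "inc_homeo f" "inc_homeo f'"
  shows "commutator (h \<circ> f \<circ> finv h) (h \<circ> f' \<circ> finv h) = h \<circ> commutator f f' \<circ> finv h"
  using assms by (simp add: commutator_def inc_homeo_inv_o fun_eq_iff)

lemma common_fixed_same_if_agree_off:
  assumes ab: "tuple_relation L g a b" "tuple_relation L g a' b'"
    and eq: "\<And>i x. i < g \<Longrightarrow> \<forall>k::int. \<not> (l < x - k * L \<and> x - k * L < r) \<Longrightarrow> a' i x = a i x \<and> b' i x = b i x"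
    and none: "\<And>x. l < x \<Longrightarrow> x < r \<Longrightarrow> x \<notin> common_fixed g a b \<and> x \<notin> common_fixed g a' b'"
  shows "common_fixed g a' b' = common_fixed g a b"
proof -
  have "x \<in> common_fixed g a' b' \<longleftrightarrow> x \<in> common_fixed g a b" for x
  proof (cases "\<exists>k::int. l < x - k * L \<and> x - k * L < r")
    case True
    thus ?thesis using none common_fixed_shift[OF ab(1)] common_fixed_shift[OF ab(2)] by blast
  next
    case False
    thus ?thesis using eq[of _ x] by (auto simp: common_fixed_def)
  qed
  thus ?thesis by blast
qed

lemma small_near_fixed_point:
  assumes f: "\<And>i. i < g \<Longrightarrow> inc_homeo (a i) \<and> inc_homeo (b i)" and p: "p \<in> common_fixed g a b" and e: "0 < e"
  shows "\<exists>d>0. \<forall>i<g. \<forall>x. \<bar>x - p\<bar> < d \<longrightarrow> \<bar>a i x - p\<bar> < e \<and> \<bar>b i x - p\<bar> < e"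
proof -
  have "eventually (\<lambda>x. \<bar>a i x - p\<bar> < e \<and> \<bar>b i x - p\<bar> < e) (nhds p)" if "i \<in> {..<g}" for i
  proof -
    have i: "i < g" using that by simp
    have "(a i \<longlongrightarrow> p) (nhds p)" "(b i \<longlongrightarrow> p) (nhds p)"
      using inc_homeo_isCont[of "a i" p] inc_homeo_isCont[of "b i" p] f[OF i] p i
      by (simp_all add: isCont_def tendsto_at_iff_tendsto_nhds common_fixed_def)
    from tendstoD[OF this(1) e] tendstoD[OF this(2) e] show ?thesis by eventually_elim (simp add: dist_real_def)
  qed
  hence "eventually (\<lambda>x. \<forall>i\<in>{..<g}. \<bar>a i x - p\<bar> < e \<and> \<bar>b i x - p\<bar> < e) (nhds p)"
    by (intro eventually_ball_finite) auto
  thus ?thesis by (auto simp: eventually_nhds_metric dist_real_def)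
qed

text \<open>The left side and then the right side of \<open>p\<close> are changed as in the previous section. By continuity the
letters are close to \<open>p\<close> on a small neighbourhood of \<open>p\<close>, so that changes within it are small.\<close>

lemma standardize_both_sides:
  assumes L: "L \<ge> 0" and ab: "tuple_relation L g a b" and p: "p \<in> common_fixed g a b"
    and win: "s0 < p" "p < t0" "L > 0 \<longrightarrow> t0 - s0 < L"
    and alone: "\<forall>x. s0 < x \<longrightarrow> x < t0 \<longrightarrow> x \<noteq> p \<longrightarrow> x \<notin> common_fixed g a b" and e: "0 < e"
  shows "\<exists>a' b' m m'. tuple_relation L g a' b' \<and> common_fixed g a' b' = common_fixed g a b \<and>
    (\<forall>i<g. \<forall>x. \<bar>a' i x - a i x\<bar> \<le> 2 * e \<and> \<bar>b' i x - b i x\<bar> \<le> 2 * e) \<and> s0 < m \<and> m < p \<and> p < m' \<and> m' < t0 \<and>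
    (\<forall>i<g. \<forall>x. m < x \<and> x < m' \<and> x \<noteq> p \<longrightarrow> commutator (a' i) (b' i) x = x \<and> (a' i x \<noteq> x \<or> b' i x \<noteq> x))"
proof -
  note iso = win alone[rule_format]
  obtain d where d: "d > 0" "\<And>i x. i < g \<Longrightarrow> \<bar>x - p\<bar> < d \<Longrightarrow> \<bar>a i x - p\<bar> < e \<and> \<bar>b i x - p\<bar> < e"
    using small_near_fixed_point[OF tuple_relation_inc[OF ab] p e] by blast
  define s where "s = max ((s0 + p) / 2) (p - d / 2)"
  define t where "t = min ((p + t0) / 2) (p + d / 2)"
  have st: "s0 < s" "s < p" "p < t" "t < t0" "\<bar>s - p\<bar> < d" "\<bar>t - p\<bar> < d"
    using iso(1,2) d(1) by (auto simp: s_def t_def less_max_iff_disj min_less_iff_disj abs_if)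
  have Lst: "L > 0 \<longrightarrow> t - s < L" using st iso(3) by linarith
  have ap: "a i p = p" "b i p = p" if "i < g" for i using p that by (auto simp: common_fixed_def)
  have tr: "translation_homeo L (a i)" "translation_homeo L (b i)" if "i < g" for i
    using ab that by (auto simp: tuple_relation_def)
  have sF: "s \<notin> common_fixed g a b" and tF: "t \<notin> common_fixed g a b" using iso(4) st by auto
  have Ls: "L > 0 \<longrightarrow> p - L < s" and Lt: "L > 0 \<longrightarrow> t < p + L" using Lst st by linarith+
  obtain a1 b1 m1 where 1: "tuple_relation L g a1 b1"
      "\<forall>i<g. \<forall>x. (\<forall>k::int. \<not> (s < x - k * L \<and> x - k * L < p)) \<longrightarrow> a1 i x = a i x \<and> b1 i x = b i x"
      "s \<le> m1" "m1 < p"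
      "\<forall>x. m1 \<le> x \<longrightarrow> x < p \<longrightarrow> (\<forall>i<g. commutator (a1 i) (b1 i) x = x \<and> (a1 i x \<noteq> x \<or> b1 i x \<noteq> x))"
      "\<forall>x. s \<le> x \<longrightarrow> x < p \<longrightarrow> x \<notin> common_fixed g a1 b1"
    using standardize_left_end_periodic[OF L ab p st(2) Ls sF] by (elim exE conjE) (rule that; assumption)
  note eq1 = 1(2)[rule_format]
  have tr1: "translation_homeo L (a1 i)" "translation_homeo L (b1 i)" if "i < g" for i
    using 1(1) that by (auto simp: tuple_relation_def)
  have Lsp: "L > 0 \<longrightarrow> p - s \<le> L" and Lpt: "L > 0 \<longrightarrow> t - p \<le> L" using Lst st by linarith+
  have F1: "common_fixed g a1 b1 = common_fixed g a b"
  proof (rule common_fixed_same_if_agree_off[OF ab 1(1)])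
    show "a1 i x = a i x \<and> b1 i x = b i x" if "i < g" "\<forall>k::int. \<not> (s < x - k * L \<and> x - k * L < p)" for i x
      using 1(2) that by blast
    show "x \<notin> common_fixed g a b \<and> x \<notin> common_fixed g a1 b1" if "s < x" "x < p" for x
      using 1(6) iso(4)[of x] that st by auto
  qed
  have c1: "\<bar>a1 i x - a i x\<bar> \<le> e" "\<bar>b1 i x - b i x\<bar> \<le> e" if i: "i < g" for i x
  proof -
    have "a i p - a i s \<le> e" "b i p - b i s \<le> e" using d(2)[OF i st(5)] ap[OF i] by linarith+
    thus "\<bar>a1 i x - a i x\<bar> \<le> e" "\<bar>b1 i x - b i x\<bar> \<le> e"
      using close_if_agree_off_interval[OF L Lsp tr(1)[OF i] tr1(1)[OF i], of e x]
        close_if_agree_off_interval[OF L Lsp tr(2)[OF i] tr1(2)[OF i], of e x] eq1[OF i] e by auto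
  qed
  have t_off: "\<not> (s < t - k * L \<and> t - k * L < p)" for k :: int
    using ends_not_in_shift(2)[OF L, of t s k] Lst st by auto
  have p1: "p \<in> common_fixed g a1 b1" and t1: "t \<notin> common_fixed g a1 b1" using F1 p tF by auto
  obtain a2 b2 m2 where 2: "tuple_relation L g a2 b2"
      "\<forall>i<g. \<forall>x. (\<forall>k::int. \<not> (p < x - k * L \<and> x - k * L < t)) \<longrightarrow> a2 i x = a1 i x \<and> b2 i x = b1 i x"
      "p < m2" "m2 \<le> t"
      "\<forall>x. p < x \<longrightarrow> x \<le> m2 \<longrightarrow> (\<forall>i<g. commutator (a2 i) (b2 i) x = x \<and> (a2 i x \<noteq> x \<or> b2 i x \<noteq> x))"
      "\<forall>x. p < x \<longrightarrow> x \<le> t \<longrightarrow> x \<notin> common_fixed g a2 b2"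
    using standardize_right_end_periodic[OF L 1(1) p1 st(3) Lt t1] by (elim exE conjE) (rule that; assumption)
  note eq2 = 2(2)[rule_format]
  have tr2: "translation_homeo L (a2 i)" "translation_homeo L (b2 i)" if "i < g" for i
    using 2(1) that by (auto simp: tuple_relation_def)
  have F2: "common_fixed g a2 b2 = common_fixed g a1 b1"
  proof (rule common_fixed_same_if_agree_off[OF 1(1) 2(1)])
    show "a2 i x = a1 i x \<and> b2 i x = b1 i x" if "i < g" "\<forall>k::int. \<not> (p < x - k * L \<and> x - k * L < t)" for i x
      using 2(2) that by blast
    show "x \<notin> common_fixed g a1 b1 \<and> x \<notin> common_fixed g a2 b2" if "p < x" "x < t" for x
      using 2(6) iso(4)[of x] that st F1 by auto
  qed
  have c2: "\<bar>a2 i x - a1 i x\<bar> \<le> e" "\<bar>b2 i x - b1 i x\<bar> \<le> e" if i: "i < g" for i x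
  proof -
    have "a1 i t = a i t" "b1 i t = b i t" using eq1[OF i, of t] t_off by auto
    moreover have "a1 i p = p" "b1 i p = p" using p1 i by (auto simp: common_fixed_def)
    ultimately have "a1 i t - a1 i p \<le> e" "b1 i t - b1 i p \<le> e" using d(2)[OF i st(6)] by linarith+
    thus "\<bar>a2 i x - a1 i x\<bar> \<le> e" "\<bar>b2 i x - b1 i x\<bar> \<le> e"
      using close_if_agree_off_interval[OF L Lpt tr1(1)[OF i] tr2(1)[OF i], of e x]
        close_if_agree_off_interval[OF L Lpt tr1(2)[OF i] tr2(2)[OF i], of e x] eq2[OF i] e by auto
  qed
  have left_eq: "a2 i x = a1 i x \<and> b2 i x = b1 i x" if i: "i < g" and x: "s < x" "x < p" for i x
  proof (rule eq2[OF i])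
    fix k :: int
    show "\<not> (p < x - k * L \<and> x - k * L < t)"
    proof (cases "k \<le> -1 \<and> L > 0")
      case True
      have "of_int k * L \<le> - L" using mult_right_mono[of "of_int k" "-1" L] True L by simp
      thus ?thesis using x Lst True by linarith
    next
      case False
      hence "of_int k * L \<ge> 0" using L by (cases "L = 0") auto
      thus ?thesis using x by linarith
    qed
  qed
  have "\<exists>q<p. \<forall>x. q < x \<longrightarrow> x < p \<longrightarrow> commutator (a2 i) (b2 i) x = commutator (a1 i) (b1 i) x" if i: "i < g" for i
    by (rule commutator_germ_left[OF _ _ _ _ _ _ st(2)])
      (use tuple_relation_inc[OF 1(1) i] tuple_relation_inc[OF 2(1) i] p1 i left_eq[OF i] in \<open>auto simp: common_fixed_def\<close>)
  then obtain q where q: "\<And>i. i < g \<Longrightarrow> q i < p"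
    "\<And>i x. i < g \<Longrightarrow> q i < x \<Longrightarrow> x < p \<Longrightarrow> commutator (a2 i) (b2 i) x = commutator (a1 i) (b1 i) x" by metis
  define m where "m = Max (insert m1 (q ` {..<g}))"
  have m: "m1 \<le> m" "m < p" "\<And>i. i < g \<Longrightarrow> q i \<le> m" using q(1) 1(4) by (auto simp: m_def)
  have near: "commutator (a2 i) (b2 i) x = x \<and> (a2 i x \<noteq> x \<or> b2 i x \<noteq> x)" if i: "i < g" and x: "m < x" "x < m2" "x \<noteq> p" for i x
  proof (cases "x < p")
    case True
    have "q i < x" using m(3)[OF i] x by simp
    hence "commutator (a2 i) (b2 i) x = commutator (a1 i) (b1 i) x" using q(2)[OF i _ True] by simp
    moreover have "a2 i x = a1 i x \<and> b2 i x = b1 i x" using left_eq[OF i, of x] m(1) 1(3) x True by auto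
    ultimately show ?thesis using 1(5) m(1) x True i by auto
  next
    case False
    thus ?thesis using 2(5) x i by auto
  qed
  show ?thesis
  proof (rule exI[of _ a2], rule exI[of _ b2], rule exI[of _ m], rule exI[of _ m2], intro conjI)
    show "\<forall>i<g. \<forall>x. \<bar>a2 i x - a i x\<bar> \<le> 2 * e \<and> \<bar>b2 i x - b i x\<bar> \<le> 2 * e"
    proof (intro allI impI)
      fix i x assume i: "i < g"
      show "\<bar>a2 i x - a i x\<bar> \<le> 2 * e \<and> \<bar>b2 i x - b i x\<bar> \<le> 2 * e"
        using c1[OF i, of x] c2[OF i, of x] by linarith
    qed
    show "\<forall>i<g. \<forall>x. m < x \<and> x < m2 \<and> x \<noteq> p \<longrightarrow> commutator (a2 i) (b2 i) x = x \<and> (a2 i x \<noteq> x \<or> b2 i x \<noteq> x)"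
      using near by blast
    show "common_fixed g a2 b2 = common_fixed g a b" using F1 F2 by simp
    show "s0 < m" "m2 < t0" using m(1) 1(3) 2(4) st by linarith+
  qed (fact 2(1) m(2) 2(3))+
qed

definition orbit :: "real \<Rightarrow> real \<Rightarrow> real set" where
  "orbit L p = {x. \<exists>k::int. x = p + k * L}"

text \<open>Once the situation around \<open>p\<close> is standard, the commutator of handle \<open>0\<close> is the identity near the orbit of
\<open>p\<close>. So conjugating handle \<open>0\<close> by a homeomorphism \<open>h\<close> supported near that orbit does not change its
commutator, and the relation persists. But the conjugated handle now has \<open>h p\<close> instead of \<open>p\<close> as its
only common fixed point near \<open>p\<close>, whereas handle \<open>1\<close>, which exists because the genus is at least two,
still has only \<open>p\<close>. Hence no common fixed point remains there.\<close>

lemma remove_common_fixed_orbit: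
  assumes L: "L \<ge> 0" and g: "2 \<le> g" and ab: "tuple_relation L g a b" and p: "p \<in> common_fixed g a b"
    and iso: "s0 < p" "p < t0" "L > 0 \<longrightarrow> t0 - s0 < L"
      "\<forall>x. s0 < x \<longrightarrow> x < t0 \<longrightarrow> x \<noteq> p \<longrightarrow> x \<notin> common_fixed g a b" and e: "0 < e"
  shows "\<exists>a' b'. tuple_relation L g a' b' \<and> common_fixed g a' b' = common_fixed g a b - orbit L p \<and>
    (\<forall>i<g. \<forall>x. \<bar>a' i x - a i x\<bar> \<le> e \<and> \<bar>b' i x - b i x\<bar> \<le> e) \<and>
    (\<forall>i<g. (\<exists>y. a' i y = y) \<and> (\<exists>y. b' i y = y))"
proof -
  have e8: "0 < e / 8" using e by simp
  obtain a2 b2 m m' where 2: "tuple_relation L g a2 b2" "common_fixed g a2 b2 = common_fixed g a b"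
    "\<forall>i<g. \<forall>x. \<bar>a2 i x - a i x\<bar> \<le> 2 * (e / 8) \<and> \<bar>b2 i x - b i x\<bar> \<le> 2 * (e / 8)"
    "s0 < m" "m < p" "p < m'" "m' < t0"
    "\<forall>i<g. \<forall>x. m < x \<and> x < m' \<and> x \<noteq> p \<longrightarrow> commutator (a2 i) (b2 i) x = x \<and> (a2 i x \<noteq> x \<or> b2 i x \<noteq> x)"
    using standardize_both_sides[OF L ab p iso e8] by (elim exE conjE) (rule that; assumption)
  have g0: "0 < g" "1 < g" using g by auto
  have p2: "a2 i p = p" "b2 i p = p" if "i < g" for i using 2(2) p that by (auto simp: common_fixed_def)
  have tr: "translation_homeo L (a2 i)" "translation_homeo L (b2 i)" if "i < g" for i
    using 2(1) that by (auto simp: tuple_relation_def)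
  have inc: "inc_homeo (a2 i)" "inc_homeo (b2 i)" if "i < g" for i using tuple_relation_inc[OF 2(1) that] by auto
  have p2': "p \<in> common_fixed g a2 b2" using 2(2) p by simp
  obtain d where d: "d > 0" "\<And>i x. i < g \<Longrightarrow> \<bar>x - p\<bar> < d \<Longrightarrow> \<bar>a2 i x - p\<bar> < e / 8 \<and> \<bar>b2 i x - p\<bar> < e / 8"
    using small_near_fixed_point[OF tuple_relation_inc[OF 2(1)] p2' e8] by blast
  define w where "w = min (min (p - m) (m' - p)) (min (d / 2) (e / 8))"
  have w: "0 < w" "w \<le> p - m" "w \<le> m' - p" "w < d" "w \<le> e / 8"
    using 2(5,6) d(1) e by (auto simp: w_def min_def)
  define n1 where "n1 = p - w"
  define n2 where "n2 = p + w"
  have n: "m \<le> n1" "n1 < p" "p < n2" "n2 \<le> m'" "n2 - n1 \<le> e / 4" using w by (auto simp: n1_def n2_def)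
  have osc: "a2 i n2 - a2 i n1 \<le> e / 4" "b2 i n2 - b2 i n1 \<le> e / 4" if "i < g" for i
  proof -
    have "\<bar>n1 - p\<bar> < d" "\<bar>n2 - p\<bar> < d" using w by (auto simp: n1_def n2_def)
    from d(2)[OF that this(1)] d(2)[OF that this(2)] show "a2 i n2 - a2 i n1 \<le> e / 4" "b2 i n2 - b2 i n1 \<le> e / 4"
      by linarith+
  qed
  have Ln: "L > 0 \<longrightarrow> n2 - n1 < L" using n 2(4,7) iso(3) by linarith
  define N where "N = (\<lambda>x. \<exists>k::int. n1 < x - k * L \<and> x - k * L < n2)"
  define C where "C = {x. \<not> N x}"
  \<comment> \<open>A small push that moves exactly the points of the neighbourhoods \<open>n1 + k * L < x < n2 + k * L\<close>.\<close>
  define h where "h = bump C"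
  have "C = - (\<Union>k::int. {n1 + k * L<..<n2 + k * L})"
    by (auto simp: C_def N_def algebra_simps)
  moreover have "open (\<Union>k::int. {n1 + k * L<..<n2 + k * L})"
    by (intro open_UN ballI open_greaterThanLessThan)
  ultimately have closed: "closed C" by (simp only: closed_Compl)
  have endC: "n1 + k * L \<in> C" "n2 + k * L \<in> C" for k :: int
  proof -
    have "\<not> (n1 < n1 + k * L - j * L \<and> n1 + k * L - j * L < n2)"
      "\<not> (n1 < n2 + k * L - j * L \<and> n2 + k * L - j * L < n2)" for j :: int
      using ends_not_in_shift[of L n2 n1 "j - k"] L Ln by (auto simp: algebra_simps)
    thus "n1 + k * L \<in> C" "n2 + k * L \<in> C" by (auto simp: C_def N_def)
  qed
  hence ne: "C \<noteq> {}" by blast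
  have shift: "N (x + L) \<longleftrightarrow> N x" for x
  proof -
    have "N (x + L)" if "N x" for x
    proof -
      from that obtain k :: int where k: "n1 < x - k * L \<and> x - k * L < n2" unfolding N_def by blast
      have "x + L - (k + 1 :: int) * L = x - k * L" by (simp add: algebra_simps)
      thus ?thesis using k unfolding N_def by metis
    qed
    moreover have "N x" if "N (x + L)" for x
    proof -
      from that obtain k :: int where k: "n1 < x + L - k * L \<and> x + L - k * L < n2" unfolding N_def by blast
      have "x - (k - 1 :: int) * L = x + L - k * L" by (simp add: algebra_simps)
      thus ?thesis using k unfolding N_def by metis
    qed
    ultimately show ?thesis by blast
  qed
  have h: "translation_homeo L h" unfolding h_def
    by (rule translation_homeo_bump[OF closed ne]) (simp add: C_def shift)
  have hi: "inc_homeo h" by (rule translation_homeoD[OF h])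
  have hfix: "h x = x \<longleftrightarrow> \<not> N x" for x using bump_fixed[OF closed ne] by (simp add: h_def C_def)
  have hbox: "n1 + k * L < h x \<and> h x < n2 + k * L" if "n1 + k * L < x" "x < n2 + k * L" for x and k :: int
  proof -
    have "h (n1 + k * L) = n1 + k * L" "h (n2 + k * L) = n2 + k * L" using hfix endC by (auto simp: C_def)
    thus ?thesis using that inc_homeo_less[OF hi] by metis
  qed
  have hinvbox: "n1 + k * L < finv h x \<and> finv h x < n2 + k * L" if "n1 + k * L < x" "x < n2 + k * L" for x and k :: int
  proof -
    have "h (n1 + k * L) = n1 + k * L" "h (n2 + k * L) = n2 + k * L" using hfix endC by (auto simp: C_def)
    thus ?thesis using that hi by (simp add: inc_homeo_less_inv inc_homeo_inv_less)
  qed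
  have box: "\<exists>k::int. n1 + k * L < x \<and> x < n2 + k * L" if "N x" for x
    using that by (auto simp: N_def algebra_simps)
  have boxN: "N x" if "n1 + k * L < x" "x < n2 + k * L" for x and k :: int
    unfolding N_def by (rule exI[of _ k]) (use that in linarith)
  have hinvN: "N (finv h x)" if "N x" for x
    using box[OF that] hinvbox boxN by blast
  have hinv_id: "finv h x = x" if "\<not> N x" for x using that hfix[of x] hi by (simp add: inc_homeo_inv_eq)
  let ?c = "commutator (a2 0) (b2 0)"
  have ci: "inc_homeo ?c" using inc[OF g0(1)] by simp
  have ctr: "translation_homeo L ?c" using tr[OF g0(1)] by simp
  have cN: "?c x = x" if "N x" for x
  proof -
    from that obtain k :: int where k: "n1 < x - k * L" "x - k * L < n2" unfolding N_def by blast
    have "?c (x - k * L) = x - k * L"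
    proof (cases "x - k * L = p")
      case True
      have "?c p = p" using inc[OF g0(1)] p2[OF g0(1)] by (simp add: commutator_def inc_homeo_inv_fix)
      thus ?thesis by (simp only: True)
    next
      case False
      have "m < x - k * L \<and> x - k * L < m'" using k n by linarith
      thus ?thesis using 2(8)[rule_format, OF g0(1)] False by blast
    qed
    thus ?thesis using translation_homeo_int_diff[OF ctr, of x k] by simp
  qed
  \<comment> \<open>The supports of \<open>h\<close> and of the commutator \<open>?c\<close> are disjoint.\<close>
  have commute: "h \<circ> ?c \<circ> finv h = ?c"
  proof
    fix x
    show "(h \<circ> ?c \<circ> finv h) x = ?c x"
    proof (cases "N x")
      case True
      thus ?thesis using cN[OF hinvN[OF True]] cN[OF True] hi by simp
    next
      case False
      have "\<not> N (?c x)"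
      proof
        assume "N (?c x)"
        hence "?c (?c x) = ?c x" by (rule cN)
        hence "?c x = x" using inc_homeo_eq[OF ci] by blast
        thus False using \<open>N (?c x)\<close> False by simp
      qed
      hence "h (?c x) = ?c x" using hfix by blast
      thus ?thesis using hinv_id[OF False] by simp
    qed
  qed
  define a3 where "a3 = a2(0 := h \<circ> a2 0 \<circ> finv h)"
  define b3 where "b3 = b2(0 := h \<circ> b2 0 \<circ> finv h)"
  have comm: "commutator (a3 i) (b3 i) = commutator (a2 i) (b2 i)" for i
    using commutator_conj[OF hi inc[OF g0(1)]] commute by (cases "i = 0") (simp_all add: a3_def b3_def)
  have rel3: "tuple_relation L g a3 b3"
  proof -
    have "commutator_product g a3 b3 = commutator_product g a2 b2"
      unfolding commutator_product_def comm ..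
    moreover have "translation_homeo L (a3 i) \<and> translation_homeo L (b3 i)" if "i < g" for i
      using tr[OF that] h by (cases "i = 0") (auto simp: a3_def b3_def)
    ultimately show ?thesis using 2(1) by (simp add: tuple_relation_def)
  qed
  have handle_fix: "x = p + k * L"
    if "i < g" "n1 + k * L < x" "x < n2 + k * L" "a2 i x = x" "b2 i x = x" for i x and k :: int
  proof (rule ccontr)
    assume "x \<noteq> p + k * L"
    hence "m < x - k * L \<and> x - k * L < m' \<and> x - k * L \<noteq> p" using that n by auto
    hence "a2 i (x - k * L) \<noteq> x - k * L \<or> b2 i (x - k * L) \<noteq> x - k * L" using 2(8) that(1) by blast
    thus False using translation_homeo_int_diff[OF tr(1)[OF that(1)], of x k]
      translation_homeo_int_diff[OF tr(2)[OF that(1)], of x k] that(4,5) by simp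
  qed
  have F3: "common_fixed g a3 b3 = common_fixed g a b - orbit L p"
  proof (intro equalityI subsetI)
    fix x assume x: "x \<in> common_fixed g a3 b3"
    have x1: "a2 i x = x" "b2 i x = x" if "i < g" "i \<noteq> 0" for i
      using x that by (auto simp: common_fixed_def a3_def b3_def)
    have "h (a2 0 (finv h x)) = x" "h (b2 0 (finv h x)) = x"
      using x g0 by (auto simp: common_fixed_def a3_def b3_def)
    hence x0: "a2 0 (finv h x) = finv h x" "b2 0 (finv h x) = finv h x"
      using hi by (metis inc_homeo_inv_left)+
    have nN: "\<not> N x"
    proof
      assume "N x"
      then obtain k :: int where k: "n1 + k * L < x" "x < n2 + k * L" using box by blast
      have "x = p + k * L" by (rule handle_fix[OF g0(2) k]) (use x1[OF g0(2)] in auto)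
      moreover have "finv h x = p + k * L" by (rule handle_fix[OF g0(1) _ _ x0]) (use hinvbox[OF k] in auto)
      ultimately have "h x = x" using hi by (metis inc_homeo_inv_right)
      thus False using hfix \<open>N x\<close> by blast
    qed
    have "a2 i x = x \<and> b2 i x = x" if "i < g" for i
      using x1[OF that] x0 hinv_id[OF nN] by (cases "i = 0") auto
    hence "x \<in> common_fixed g a2 b2" by (auto simp: common_fixed_def)
    moreover have "x \<notin> orbit L p"
    proof
      assume "x \<in> orbit L p"
      then obtain k :: int where "x = p + k * L" by (auto simp: orbit_def)
      thus False using nN boxN[of k x] n by auto
    qed
    ultimately show "x \<in> common_fixed g a b - orbit L p" using 2(2) by blast
  next
    fix x assume x: "x \<in> common_fixed g a b - orbit L p"
    have nN: "\<not> N x"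
    proof
      assume "N x"
      then obtain k :: int where k: "n1 + k * L < x" "x < n2 + k * L" using box by blast
      have "a2 0 x = x" "b2 0 x = x" using x 2(2) g0 by (auto simp: common_fixed_def)
      from handle_fix[OF g0(1) k this] have "x \<in> orbit L p" by (auto simp: orbit_def)
      thus False using x by blast
    qed
    hence "h x = x" "finv h x = x" using hfix hinv_id by auto
    moreover have "a2 i x = x \<and> b2 i x = x" if "i < g" for i using x 2(2) that by (auto simp: common_fixed_def)
    ultimately show "x \<in> common_fixed g a3 b3" using g0 by (auto simp: common_fixed_def a3_def b3_def)
  qed
  have conj_close: "\<bar>(h \<circ> f \<circ> finv h) x - f x\<bar> \<le> e / 2"
    if f: "translation_homeo L f" and fo: "f n2 - f n1 \<le> e / 4" for f x
  proof -
    have hc: "\<bar>h z - z\<bar> \<le> e / 4" for z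
    proof (cases "N z")
      case True
      then obtain k :: int where "n1 + k * L < z" "z < n2 + k * L" using box by blast
      from this hbox[OF this] show ?thesis using n by linarith
    next
      case False
      hence "h z = z" using hfix by blast
      thus ?thesis using e by simp
    qed
    have "\<bar>f (finv h x) - f x\<bar> \<le> e / 4"
    proof (cases "N x")
      case True
      then obtain k :: int where k: "n1 + k * L < x" "x < n2 + k * L" using box by blast
      note k' = hinvbox[OF k]
      have "f (n1 + k * L) < f x" "f x < f (n2 + k * L)" "f (n1 + k * L) < f (finv h x)" "f (finv h x) < f (n2 + k * L)"
        using k k' by (simp_all add: inc_homeo_less[OF translation_homeoD[OF f]])
      thus ?thesis using fo unfolding translation_homeo_int[OF f] by linarith
    next
      case False
      thus ?thesis using hinv_id e by simp
    qed
    moreover have "\<bar>h (f (finv h x)) - f (finv h x)\<bar> \<le> e / 4" by (rule hc)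
    ultimately show ?thesis unfolding o_apply by linarith
  qed
  have close: "\<bar>a3 i x - a i x\<bar> \<le> e \<and> \<bar>b3 i x - b i x\<bar> \<le> e" if i: "i < g" for i x
  proof -
    have "\<bar>a3 i x - a2 i x\<bar> \<le> e / 2" "\<bar>b3 i x - b2 i x\<bar> \<le> e / 2"
      using conj_close[OF tr(1)[OF i] osc(1)[OF i], of x] conj_close[OF tr(2)[OF i] osc(2)[OF i], of x] e
      by (cases "i = 0"; simp add: a3_def b3_def)+
    moreover have "\<bar>a2 i x - a i x\<bar> \<le> 2 * (e / 8)" "\<bar>b2 i x - b i x\<bar> \<le> 2 * (e / 8)" using 2(3) i by blast+
    ultimately show ?thesis using e by linarith
  qed
  have letters: "(\<exists>y. a3 i y = y) \<and> (\<exists>y. b3 i y = y)" if i: "i < g" for i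
  proof (cases "i = 0")
    case True
    have "a3 0 (h p) = h p" "b3 0 (h p) = h p" using hi p2[OF g0(1)] by (simp_all add: a3_def b3_def)
    thus ?thesis using True by blast
  next
    case False
    thus ?thesis using p2[OF i] by (auto simp: a3_def b3_def)
  qed
  show ?thesis
    by (rule exI[of _ a3], rule exI[of _ b3], intro conjI rel3 F3 allI impI close[THEN conjunct1]
      close[THEN conjunct2] letters[THEN conjunct1] letters[THEN conjunct2]; assumption)
qed

lemma orbits_isolated:
  assumes L: "L \<ge> 0" and E: "finite E" and p: "p \<in> E"
  shows "\<exists>d>0. (L > 0 \<longrightarrow> 2 * d < L) \<and> (\<forall>x. \<bar>x - p\<bar> < d \<longrightarrow> x \<noteq> p \<longrightarrow> x \<notin> (\<Union>y\<in>E. orbit L y))"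
proof -
  let ?A = "((\<Union>y\<in>E. orbit L y) \<inter> {p - 1..p + 1}) - {p}"
  have "finite (orbit L y \<inter> {p - 1..p + 1})" for y
  proof (cases "L = 0")
    case True
    hence "orbit L y \<subseteq> {y}" by (auto simp: orbit_def)
    thus ?thesis by (meson finite_Int finite.emptyI finite_insert finite_subset)
  next
    case False
    hence L': "L > 0" using L by simp
    have "orbit L y \<inter> {p - 1..p + 1} \<subseteq> (\<lambda>k::int. y + k * L) ` {\<lfloor>(p - 1 - y) / L\<rfloor>..\<lceil>(p + 1 - y) / L\<rceil>}"
    proof
      fix x assume "x \<in> orbit L y \<inter> {p - 1..p + 1}"
      then obtain k :: int where k: "x = y + k * L" "p - 1 \<le> x" "x \<le> p + 1" by (auto simp: orbit_def)
      hence "(p - 1 - y) / L \<le> k" "k \<le> (p + 1 - y) / L" using L' by (simp_all add: field_simps)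
      hence "k \<in> {\<lfloor>(p - 1 - y) / L\<rfloor>..\<lceil>(p + 1 - y) / L\<rceil>}" by (auto; linarith)
      thus "x \<in> (\<lambda>k::int. y + k * L) ` {\<lfloor>(p - 1 - y) / L\<rfloor>..\<lceil>(p + 1 - y) / L\<rceil>}" using k(1) by blast
    qed
    thus ?thesis by (rule finite_subset) simp
  qed
  hence "finite (\<Union>y\<in>E. orbit L y \<inter> {p - 1..p + 1})" using E by blast
  moreover have "?A \<subseteq> (\<Union>y\<in>E. orbit L y \<inter> {p - 1..p + 1})" by blast
  ultimately have fA: "finite ?A" by (rule rev_finite_subset)
  define d0 where "d0 = Min (insert 1 ((\<lambda>x. \<bar>x - p\<bar>) ` ?A))"
  have d0: "d0 > 0" "d0 \<le> 1" "\<And>x. x \<in> ?A \<Longrightarrow> d0 \<le> \<bar>x - p\<bar>" using fA by (auto simp: d0_def)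
  define d where "d = (if L > 0 then min d0 (L / 3) else d0)"
  have d: "d > 0" "L > 0 \<longrightarrow> 2 * d < L" "d \<le> d0" using d0(1) by (auto simp: d_def)
  have "x \<notin> (\<Union>y\<in>E. orbit L y)" if "\<bar>x - p\<bar> < d" "x \<noteq> p" for x
  proof
    assume "x \<in> (\<Union>y\<in>E. orbit L y)"
    hence "x \<in> ?A" using that d d0 by auto
    thus False using d0(3)[of x] that(1) d(3) by simp
  qed
  thus ?thesis using d by blast
qed

text \<open>The orbits are removed one after the other, with the admissible error halved each time.\<close>

lemma remove_all_common_fixed:
  assumes L: "L \<ge> 0" and g: "2 \<le> g"
  shows "finite E \<Longrightarrow> E \<noteq> {} \<Longrightarrow> tuple_relation L g a b \<Longrightarrow> common_fixed g a b = (\<Union>y\<in>E. orbit L y) \<Longrightarrow> 0 < e \<Longrightarrow>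
   \<exists>a' b'. tuple_relation L g a' b' \<and> common_fixed g a' b' = {} \<and>
    (\<forall>i<g. \<forall>x. \<bar>a' i x - a i x\<bar> \<le> e \<and> \<bar>b' i x - b i x\<bar> \<le> e) \<and>
    (\<forall>i<g. (\<exists>y. a' i y = y) \<and> (\<exists>y. b' i y = y))"
proof (induction "card E" arbitrary: E a b e rule: less_induct)
  case less
  note ab = less.prems(3) and F = less.prems(4) and e = less.prems(5)
  obtain p where p: "p \<in> E" using less.prems by blast
  have self: "y \<in> orbit L y" for y by (auto simp: orbit_def intro: exI[of _ 0])
  have pF: "p \<in> common_fixed g a b" using F p self by blast
  obtain d where d: "d > 0" "L > 0 \<longrightarrow> 2 * d < L" "\<forall>x. \<bar>x - p\<bar> < d \<longrightarrow> x \<noteq> p \<longrightarrow> x \<notin> (\<Union>y\<in>E. orbit L y)"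
    using orbits_isolated[OF L less.prems(1) p] by blast
  have iso: "p - d < p" "p < p + d" "L > 0 \<longrightarrow> (p + d) - (p - d) < L" using d by auto
  have iso': "\<forall>x. p - d < x \<longrightarrow> x < p + d \<longrightarrow> x \<noteq> p \<longrightarrow> x \<notin> common_fixed g a b"
    unfolding F using d(3) by (simp add: abs_less_iff)
  have e2: "0 < e / 2" using e by simp
  obtain a1 b1 where 1: "tuple_relation L g a1 b1" "common_fixed g a1 b1 = common_fixed g a b - orbit L p"
    "\<forall>i<g. \<forall>x. \<bar>a1 i x - a i x\<bar> \<le> e / 2 \<and> \<bar>b1 i x - b i x\<bar> \<le> e / 2"
    "\<forall>i<g. (\<exists>y. a1 i y = y) \<and> (\<exists>y. b1 i y = y)"
    using remove_common_fixed_orbit[OF L g ab pF iso iso' e2] by (elim exE conjE) (rule that; assumption)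
  define E' where "E' = E - orbit L p"
  have E': "finite E'" "card E' < card E"
    using less.prems(1) p self by (auto simp: E'_def intro!: psubset_card_mono)
  have orb: "y \<in> orbit L p" if "x \<in> orbit L y" "x \<in> orbit L p" for x y
  proof -
    from that obtain k l :: int where "x = y + k * L" "x = p + l * L" unfolding orbit_def by blast
    hence "y = p + (l - k :: int) * L" by (simp add: algebra_simps)
    thus ?thesis unfolding orbit_def by blast
  qed
  have orb': "x \<in> orbit L p" if "x \<in> orbit L y" "y \<in> orbit L p" for x y
  proof -
    from that obtain k l :: int where "x = y + k * L" "y = p + l * L" by (auto simp: orbit_def)
    hence "x = p + (l + k :: int) * L" by (simp add: algebra_simps)
    thus ?thesis unfolding orbit_def by blast
  qed
  have F1: "common_fixed g a1 b1 = (\<Union>y\<in>E'. orbit L y)"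
    unfolding 1(2) F E'_def using orb orb' by blast
  show ?case
  proof (cases "E' = {}")
    case True
    have "\<bar>a1 i x - a i x\<bar> \<le> e \<and> \<bar>b1 i x - b i x\<bar> \<le> e" if "i < g" for i x
      using 1(3)[rule_format, OF that, of x] e by linarith
    thus ?thesis using 1(1,4) F1 True by (intro exI[of _ a1] exI[of _ b1]) simp
  next
    case False
    obtain a' b' where 2: "tuple_relation L g a' b'" "common_fixed g a' b' = {}"
      "\<forall>i<g. \<forall>x. \<bar>a' i x - a1 i x\<bar> \<le> e / 2 \<and> \<bar>b' i x - b1 i x\<bar> \<le> e / 2"
      "\<forall>i<g. (\<exists>y. a' i y = y) \<and> (\<exists>y. b' i y = y)"
      using less.hyps[OF E'(2) E'(1) False 1(1) F1 e2] by (elim exE conjE) (rule that; assumption)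
    have "\<bar>a' i x - a i x\<bar> \<le> e \<and> \<bar>b' i x - b i x\<bar> \<le> e" if "i < g" for i x
      using 1(3)[rule_format, OF that, of x] 2(3)[rule_format, OF that, of x] e by linarith
    thus ?thesis using 2(1,2,4) by (intro exI[of _ a'] exI[of _ b']) simp
  qed
qed

section \<open>Reduction to finitely many common fixed points\<close>

definition splice :: "real set \<Rightarrow> (real \<Rightarrow> real) \<Rightarrow> (real \<Rightarrow> real) \<Rightarrow> real \<Rightarrow> real" where
  "splice D h f x = (if x \<in> D then h x else f x)"

text \<open>A point of \<open>D\<close> and a point outside \<open>D\<close> always have a point of \<open>F - D\<close> between them (or at the outer point),
so \<open>D\<close> is a union of gaps that are bounded by points of \<open>F\<close>.\<close>

definition separated_by :: "real set \<Rightarrow> real set \<Rightarrow> bool" where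
  "separated_by F D \<longleftrightarrow> (\<forall>x\<in>D. \<forall>w. w \<notin> D \<longrightarrow> (x < w \<longrightarrow> (\<exists>z\<in>F. z \<notin> D \<and> x < z \<and> z \<le> w)) \<and>
     (w < x \<longrightarrow> (\<exists>z\<in>F. z \<notin> D \<and> w \<le> z \<and> z < x)))"

text \<open>It suffices to find points of \<open>F\<close>, possibly inside \<open>D\<close>: applied to the first point outside \<open>D\<close>, the
hypothesis yields points of \<open>F\<close> that accumulate there, and \<open>F\<close> is closed.\<close>

lemma separated_byI:
  assumes F: "closed F" and D: "open D"
    and right: "\<And>x w. x \<in> D \<Longrightarrow> w \<notin> D \<Longrightarrow> x < w \<Longrightarrow> \<exists>z\<in>F. x < z \<and> z \<le> w"
    and left: "\<And>x w. x \<in> D \<Longrightarrow> w \<notin> D \<Longrightarrow> w < x \<Longrightarrow> \<exists>z\<in>F. w \<le> z \<and> z < x"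
  shows "separated_by F D"
proof -
  have cl: "closed (- D)" using D by (rule closed_Compl)
  have r: "\<exists>z\<in>F. z \<notin> D \<and> x < z \<and> z \<le> w" if x: "x \<in> D" and w: "w \<notin> D" "x < w" for x w
  proof -
    define A where "A = - D \<inter> {x..w}"
    have A: "closed A" "A \<noteq> {}" "bdd_below A" using cl w by (auto simp: A_def)
    define z where "z = Inf A"
    have zA: "z \<in> A" unfolding z_def by (rule closed_contains_Inf[OF A(2,3,1)])
    hence z: "z \<notin> D" "x \<le> z" "z \<le> w" by (auto simp: A_def)
    hence xz: "x < z" using x by (cases "x = z") auto
    have inD: "u \<in> D" if "x \<le> u" "u < z" for u
    proof (rule ccontr)
      assume "u \<notin> D"
      hence "u \<in> A" using that z by (auto simp: A_def)
      hence "z \<le> u" unfolding z_def using A(3) by (rule cInf_lower)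
      thus False using that by simp
    qed
    have "\<exists>y\<in>F. dist y z < d" if d: "d > 0" for d
    proof -
      define u where "u = max x (z - d / 2)"
      have u: "x \<le> u" "u < z" "z - d < u" using xz d by (auto simp: u_def)
      from right[OF inD[OF u(1,2)] z(1) u(2)] u show ?thesis by (auto simp: dist_real_def intro!: bexI)
    qed
    hence "z \<in> closure F" by (simp add: closure_approachable)
    thus ?thesis using F z xz by auto
  qed
  have l: "\<exists>z\<in>F. z \<notin> D \<and> w \<le> z \<and> z < x" if x: "x \<in> D" and w: "w \<notin> D" "w < x" for x w
  proof -
    define A where "A = - D \<inter> {w..x}"
    have A: "closed A" "A \<noteq> {}" "bdd_above A" using cl w by (auto simp: A_def)
    define z where "z = Sup A"
    have zA: "z \<in> A" unfolding z_def by (rule closed_contains_Sup[OF A(2,3,1)])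
    hence z: "z \<notin> D" "w \<le> z" "z \<le> x" by (auto simp: A_def)
    hence xz: "z < x" using x by (cases "x = z") auto
    have inD: "u \<in> D" if "z < u" "u \<le> x" for u
    proof (rule ccontr)
      assume "u \<notin> D"
      hence "u \<in> A" using that z by (auto simp: A_def)
      hence "u \<le> z" unfolding z_def using A(3) by (rule cSup_upper)
      thus False using that by simp
    qed
    have "\<exists>y\<in>F. dist y z < d" if d: "d > 0" for d
    proof -
      define u where "u = min x (z + d / 2)"
      have u: "z < u" "u \<le> x" "u < z + d" using xz d by (auto simp: u_def)
      from left[OF inD[OF u(1,2)] z(1) u(1)] u show ?thesis by (auto simp: dist_real_def intro!: bexI)
    qed
    hence "z \<in> closure F" by (simp add: closure_approachable)
    thus ?thesis using F z xz by auto
  qed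
  show ?thesis unfolding separated_by_def using r l by blast
qed

lemma separated_by_right: "separated_by F D \<Longrightarrow> x \<in> D \<Longrightarrow> w \<notin> D \<Longrightarrow> x < w \<Longrightarrow> \<exists>z\<in>F. z \<notin> D \<and> x < z \<and> z \<le> w"
  and separated_by_left: "separated_by F D \<Longrightarrow> x \<in> D \<Longrightarrow> w \<notin> D \<Longrightarrow> w < x \<Longrightarrow> \<exists>z\<in>F. z \<notin> D \<and> w \<le> z \<and> z < x"
  unfolding separated_by_def by blast+

definition fixes_pointwise :: "real set \<Rightarrow> (real \<Rightarrow> real) \<Rightarrow> bool" where
  "fixes_pointwise F f \<longleftrightarrow> inc_homeo f \<and> (\<forall>x\<in>F. f x = x)"

lemma fixes_pointwise_closed [simp]:
  "fixes_pointwise F id" "fixes_pointwise F f \<Longrightarrow> fixes_pointwise F f' \<Longrightarrow> fixes_pointwise F (f \<circ> f')"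
  "fixes_pointwise F f \<Longrightarrow> fixes_pointwise F (finv f)"
  by (auto simp: fixes_pointwise_def inc_homeo_inv_fix)

text \<open>Leaving \<open>D\<close> would mean passing a point of \<open>F\<close>, which is fixed.\<close>

lemma fixes_pointwise_preserves:
  assumes sep: "separated_by F D" and f: "fixes_pointwise F f" shows "f x \<in> D \<longleftrightarrow> x \<in> D"
proof -
  have *: "k u \<in> D" if k: "fixes_pointwise F k" and u: "u \<in> D" for k u
  proof (rule ccontr)
    assume n: "k u \<notin> D"
    hence "k u \<noteq> u" using u by auto
    hence "u < k u \<or> k u < u" by linarith
    thus False
    proof
      assume "u < k u"
      from separated_by_right[OF sep u n this] obtain z where "z \<in> F" "u < z" "z \<le> k u" by blast
      moreover from this have "k u < z" using k inc_homeo_less[of k u z] by (auto simp: fixes_pointwise_def)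
      ultimately show False by simp
    next
      assume "k u < u"
      from separated_by_left[OF sep u n this] obtain z where "z \<in> F" "z < u" "k u \<le> z" by blast
      moreover from this have "z < k u" using k inc_homeo_less[of k z u] by (auto simp: fixes_pointwise_def)
      ultimately show False by simp
    qed
  qed
  have "finv f (f x) = x" using f by (simp add: fixes_pointwise_def)
  thus ?thesis using *[OF f, of x] *[OF fixes_pointwise_closed(3)[OF f], of "f x"] by auto
qed

lemma fixes_complement_preserves:
  assumes "fixes_pointwise (- D) h" shows "h x \<in> D \<longleftrightarrow> x \<in> D"
proof -
  have "h (h x) = h x" if "h x \<notin> D" using assms that by (simp add: fixes_pointwise_def)
  hence "h x = x" if "h x \<notin> D" using assms that inc_homeo_eq[of h "h x" x] by (simp add: fixes_pointwise_def)
  moreover have "h x = x" if "x \<notin> D" using assms that by (simp add: fixes_pointwise_def)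
  ultimately show ?thesis by (cases "x \<in> D"; cases "h x \<in> D") auto
qed

text \<open>Both maps preserve \<open>D\<close> and its complement, so splicing is a homomorphism in the two arguments.\<close>

lemma splice_comp:
  assumes "separated_by F D" "fixes_pointwise (- D) h'" "fixes_pointwise F f'"
  shows "splice D h f \<circ> splice D h' f' = splice D (h \<circ> h') (f \<circ> f')"
  using fixes_pointwise_preserves[OF assms(1,3)] fixes_complement_preserves[OF assms(2)]
  by (auto simp: splice_def)

lemma splice_id [simp]: "splice D id id = id"
  by (auto simp: splice_def)

lemma inc_homeo_splice:
  assumes sep: "separated_by F D" and h: "fixes_pointwise (- D) h" and f: "fixes_pointwise F f"
  shows "inc_homeo (splice D h f)"
proof -
  let ?s = "splice D h f"
  have hi: "inc_homeo h" "\<And>z. z \<notin> D \<Longrightarrow> h z = z" and fi: "inc_homeo f" "\<And>z. z \<in> F \<Longrightarrow> f z = z"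
    using h f by (auto simp: fixes_pointwise_def)
  have "?s x < ?s y" if xy: "x < y" for x y
  proof -
    consider "x \<in> D \<and> y \<in> D" | "x \<notin> D \<and> y \<notin> D" | "x \<in> D" "y \<notin> D" | "x \<notin> D" "y \<in> D" by blast
    thus ?thesis
    proof cases
      case 3
      from separated_by_right[OF sep 3 xy] obtain z where z: "z \<in> F" "z \<notin> D" "x < z" "z \<le> y" by blast
      have "h x < h z" "f z \<le> f y" using inc_homeo_less[OF hi(1)] inc_homeo_le[OF fi(1)] z by blast+
      thus ?thesis using 3 z hi fi by (simp add: splice_def)
    next
      case 4
      from separated_by_left[OF sep 4(2,1) xy] obtain z where z: "z \<in> F" "z \<notin> D" "x \<le> z" "z < y" by blast
      have "h z < h y" "f x \<le> f z" using inc_homeo_less[OF hi(1)] inc_homeo_le[OF fi(1)] z by blast+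
      thus ?thesis using 4 z hi fi by (simp add: splice_def)
    qed (use xy hi fi in \<open>auto simp: splice_def inc_homeo_less\<close>)
  qed
  moreover have "?s (splice D (finv h) (finv f) x) = x" for x
  proof -
    have "?s \<circ> splice D (finv h) (finv f) = splice D (h \<circ> finv h) (f \<circ> finv f)"
      by (rule splice_comp[OF sep]) (use h f in simp_all)
    also have "\<dots> = id" using hi fi by simp
    finally show ?thesis by (metis comp_apply id_apply)
  qed
  hence "surj ?s" by (metis surjI)
  ultimately show ?thesis by (auto simp: inc_homeo_def strict_mono_def)
qed

lemma finv_splice:
  assumes sep: "separated_by F D" and h: "fixes_pointwise (- D) h" and f: "fixes_pointwise F f"
  shows "finv (splice D h f) = splice D (finv h) (finv f)"
proof
  fix x
  have "splice D h f \<circ> splice D (finv h) (finv f) = splice D (h \<circ> finv h) (f \<circ> finv f)"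
    by (rule splice_comp[OF sep]) (use h f in simp_all)
  also have "\<dots> = id" using h f by (simp add: fixes_pointwise_def)
  finally have "splice D h f (splice D (finv h) (finv f) x) = x" by (metis comp_apply id_apply)
  thus "finv (splice D h f) x = splice D (finv h) (finv f) x"
    using inc_homeo_splice[OF assms] by (simp add: inc_homeo_inv_eq)
qed

lemma commutator_splice:
  assumes sep: "separated_by F D" and h: "fixes_pointwise (- D) h" "fixes_pointwise (- D) h'"
    and f: "fixes_pointwise F f" "fixes_pointwise F f'"
  shows "commutator (splice D h f) (splice D h' f') = splice D (commutator h h') (commutator f f')"
  unfolding commutator_def using h f by (simp add: finv_splice[OF sep] splice_comp[OF sep])

text \<open>On \<open>D\<close> all letters are replaced by the identity, except that the first one becomes a map that moves every
point of \<open>D\<close>. All commutators become trivial on \<open>D\<close> and stay what they were outside, so the relation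
persists, and exactly the common fixed points inside \<open>D\<close> disappear.\<close>

lemma replace_on_open_set:
  assumes g: "0 < g" and ab: "tuple_relation L g a b" and F: "F = common_fixed g a b"
    and D: "open D" "D \<noteq> UNIV" "\<And>x. x + L \<in> D \<longleftrightarrow> x \<in> D" and sep: "separated_by F D"
  shows "\<exists>a' b'. tuple_relation L g a' b' \<and> common_fixed g a' b' = F - D \<and>
    (\<forall>i<g. \<forall>x. x \<notin> D \<longrightarrow> a' i x = a i x \<and> b' i x = b i x)"
proof -
  define h where "h = bump (- D)"
  have cl: "closed (- D)" "- D \<noteq> {}" using D by auto
  have h: "fixes_pointwise (- D) h" "translation_homeo L h" "h x = x \<longleftrightarrow> x \<notin> D" for x
    using bump_fixed[OF cl] inc_homeo_bump[OF cl] translation_homeo_bump[OF cl, of L] D(3)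
    by (auto simp: h_def fixes_pointwise_def)
  define a' where "a' = (\<lambda>i. splice D (if i = 0 then h else id) (a i))"
  define b' where "b' = (\<lambda>i. splice D id (b i))"
  have fp: "fixes_pointwise F (a i)" "fixes_pointwise F (b i)" if "i < g" for i
    using tuple_relation_inc[OF ab that] that by (auto simp: fixes_pointwise_def F common_fixed_def)
  have hh: "fixes_pointwise (- D) (if i = (0::nat) then h else id)" for i using h(1) by simp
  have comm: "commutator (a' i) (b' i) = splice D id (commutator (a i) (b i))" if "i < g" for i
    using commutator_splice[OF sep hh fixes_pointwise_closed(1) fp[OF that], of i] h(1)
    by (auto simp: a'_def b'_def commutator_def fixes_pointwise_def)
  have "comp_list (\<lambda>i. splice D id (c i)) xs = splice D id (comp_list c xs) \<and> fixes_pointwise F (comp_list c xs)"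
    if "\<forall>i\<in>set xs. fixes_pointwise F (c i)" for c xs
    using that by (induction xs) (auto simp: splice_comp[OF sep])
  from this[of "[0..<g]" "\<lambda>i. commutator (a i) (b i)"] fp
  have "comp_list (\<lambda>i. splice D id (commutator (a i) (b i))) [0..<g] = splice D id (commutator_product g a b)"
    by (simp add: commutator_product_def commutator_def)
  moreover have "commutator_product g a' b' = comp_list (\<lambda>i. splice D id (commutator (a i) (b i))) [0..<g]"
    unfolding commutator_product_def by (rule comp_list_cong) (use comm in simp)
  ultimately have prod: "commutator_product g a' b' = id" using ab by (simp add: tuple_relation_def)
  have tr: "translation_homeo L (splice D k f)" if "fixes_pointwise (- D) k" "translation_homeo L k"
    "fixes_pointwise F f" "translation_homeo L f" for k f
    using that inc_homeo_splice[OF sep that(1,3)] D(3) by (simp add: translation_homeo_def splice_def)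
  have rel: "tuple_relation L g a' b'"
    using ab prod tr fp h hh by (auto simp: tuple_relation_def a'_def b'_def)
  have "common_fixed g a' b' = F - D"
  proof (intro equalityI subsetI)
    fix x assume x: "x \<in> common_fixed g a' b'"
    hence "a' 0 x = x" using g by (auto simp: common_fixed_def)
    hence "x \<notin> D" using h(3)[of x] by (auto simp: a'_def splice_def split: if_splits)
    thus "x \<in> F - D" using x by (auto simp: F common_fixed_def a'_def b'_def splice_def)
  next
    fix x assume "x \<in> F - D"
    thus "x \<in> common_fixed g a' b'" by (auto simp: F common_fixed_def a'_def b'_def splice_def)
  qed
  thus ?thesis using rel by (intro exI[of _ a'] exI[of _ b']) (simp add: a'_def b'_def splice_def)
qed

lemma finite_if_no_three:
  fixes A :: "real set"
  assumes "\<And>x y z. x \<in> A \<Longrightarrow> y \<in> A \<Longrightarrow> z \<in> A \<Longrightarrow> x < y \<Longrightarrow> y < z \<Longrightarrow> False"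
  shows "finite A"
proof (rule ccontr)
  assume "infinite A"
  then obtain B where B: "finite B" "card B = 3" "B \<subseteq> A" using infinite_arbitrarily_large by blast
  hence ne: "B \<noteq> {}" by auto
  have "card (B - {Min B, Max B}) > 0"
    using B diff_card_le_card_Diff[of "{Min B, Max B}" B] card_insert_le_m1[of 2 "{Max B}" "Min B"] by simp
  hence "B - {Min B, Max B} \<noteq> {}" using card_gt_0_iff by blast
  then obtain y where y: "y \<in> B" "y \<noteq> Min B" "y \<noteq> Max B" by blast
  have "Min B < y" "y < Max B" using y B(1) by (simp_all add: order.strict_iff_order)
  thus False using assms[of "Min B" y "Max B"] y B ne Min_in Max_in by blast
qed

lemma closed_common_fixed: assumes "tuple_relation L g a b" shows "closed (common_fixed g a b)"
proof -
  have "closed {x. a i x = x \<and> b i x = x}" if "i \<in> {..<g}" for i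
  proof -
    have c: "continuous_on UNIV (a i)" "continuous_on UNIV (b i)"
      using tuple_relation_inc[OF assms] that inc_homeo_continuous by auto
    have "closed ({x. a i x = x} \<inter> {x. b i x = x})"
      by (intro closed_Int closed_Collect_eq c continuous_on_id)
    thus ?thesis by (simp add: Collect_conj_eq)
  qed
  hence "closed (\<Inter>i\<in>{..<g}. {x. a i x = x \<and> b i x = x})" by blast
  moreover have "(\<Inter>i\<in>{..<g}. {x. a i x = x \<and> b i x = x}) = common_fixed g a b" by (auto simp: common_fixed_def)
  ultimately show ?thesis by simp
qed

text \<open>The line is divided into cells of length at most \<open>e\<close>. In each cell the letters are replaced on the part
between the first and the last common fixed point; this changes them by at most \<open>e\<close>, as all maps involved
fix the ends of that part, and it leaves at most two common fixed points in the cell. For \<open>L = 0\<close> there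
are infinitely many cells modulo \<open>L\<close>. There the letters are also replaced to the right of the first common fixed
point above \<open>R + e\<close> and to the left of the last one below \<open>- (R + e)\<close>, with no bound on the change, so that
only finitely many common fixed points remain; points of absolute value at most \<open>R\<close> are not affected by this.\<close>

lemma reduce_to_finitely_many_orbits:
  assumes L: "L \<ge> 0" and g: "0 < g" and ab: "tuple_relation L g a b" and c: "c \<in> common_fixed g a b"
    and e: "0 < e" and R: "0 < R"
  shows "\<exists>a' b' E. tuple_relation L g a' b' \<and> finite E \<and> E \<noteq> {} \<and> common_fixed g a' b' = (\<Union>y\<in>E. orbit L y) \<and>
    (\<forall>i<g. \<forall>x. L > 0 \<or> \<bar>x\<bar> \<le> R \<longrightarrow> \<bar>a' i x - a i x\<bar> \<le> e \<and> \<bar>b' i x - b i x\<bar> \<le> e)"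
proof -
  define F where "F = common_fixed g a b"
  have Fsh: "x - of_int k * L \<in> F \<longleftrightarrow> x \<in> F" for x k
    unfolding F_def by (rule common_fixed_shift[OF ab])
  obtain n :: nat and w where w: "0 < w" "w \<le> e" "L > 0 \<longrightarrow> real n * w = L" "L = 0 \<longrightarrow> w = e"
  proof (cases "L > 0")
    case True
    define n where "n = nat \<lceil>L / e\<rceil>"
    have "L / e > 0" using True e by simp
    hence n: "n > 0" "L / e \<le> real n" unfolding n_def by linarith+
    hence "L / real n \<le> e" using e by (simp add: field_simps)
    thus ?thesis using that[of "L / real n" n] True n by auto
  qed (use that[of e 0] e L in auto)
  define o' where "o' = (if L > 0 then c else 0)"
  define R' where "R' = R + e"
  \<comment> \<open>\<open>D1\<close> is the part inside the cells; \<open>D2\<close> and \<open>D3\<close> are the two unbounded parts, used only if \<open>L = 0\<close>.\<close>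
  define D1 where "D1 = {x. \<exists>k::int. \<exists>y\<in>F. \<exists>z\<in>F. o' + k * w \<le> y \<and> y < x \<and> x < z \<and> z \<le> o' + (of_int k + 1) * w}"
  define D2 where "D2 = {x. L = 0 \<and> (\<exists>y\<in>F. R' \<le> y \<and> y < x)}"
  define D3 where "D3 = {x. L = 0 \<and> (\<exists>z\<in>F. x < z \<and> z \<le> - R')}"
  define D where "D = D1 \<union> D2 \<union> D3"
  have D1I: "x \<in> D1" if "y \<in> F" "z \<in> F" "o' + k * w \<le> y" "y < x" "x < z" "z \<le> o' + (of_int k + 1) * w"
    for x y z and k :: int
    unfolding D1_def using that by blast
  have D1E: thesis if "x \<in> D1"
    "\<And>(k::int) y z. y \<in> F \<Longrightarrow> z \<in> F \<Longrightarrow> o' + k * w \<le> y \<Longrightarrow> y < x \<Longrightarrow> x < z \<Longrightarrow> z \<le> o' + (of_int k + 1) * w \<Longrightarrow> thesis"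
    for x thesis
    using that(1) unfolding D1_def by (elim CollectE exE bexE conjE) (rule that(2))
  have "open D1"
  proof (subst open_subopen, intro ballI)
    fix x assume "x \<in> D1"
    then obtain k :: int and y z where *: "y \<in> F" "z \<in> F" "o' + k * w \<le> y" "y < x" "x < z" "z \<le> o' + (of_int k + 1) * w"
      by (rule D1E)
    have "{y<..<z} \<subseteq> D1" by (rule subsetI, rule D1I[OF *(1,2,3) _ _ *(6)]) auto
    thus "\<exists>T. open T \<and> x \<in> T \<and> T \<subseteq> D1" using * by (intro exI[of _ "{y<..<z}"]) auto
  qed
  moreover have "open D2"
  proof (subst open_subopen, intro ballI)
    fix x assume "x \<in> D2"
    then obtain y where *: "L = 0" "y \<in> F" "R' \<le> y" "y < x" unfolding D2_def by blast
    have "{y<..} \<subseteq> D2" unfolding D2_def using * by auto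
    thus "\<exists>T. open T \<and> x \<in> T \<and> T \<subseteq> D2" using * by (intro exI[of _ "{y<..}"]) auto
  qed
  moreover have "open D3"
  proof (subst open_subopen, intro ballI)
    fix x assume "x \<in> D3"
    then obtain z where *: "L = 0" "z \<in> F" "x < z" "z \<le> - R'" unfolding D3_def by blast
    have "{..<z} \<subseteq> D3" unfolding D3_def using * by auto
    thus "\<exists>T. open T \<and> x \<in> T \<and> T \<subseteq> D3" using * by (intro exI[of _ "{..<z}"]) auto
  qed
  ultimately have D_open: "open D" unfolding D_def by blast
  have end1: "o' + j * w \<notin> D1" for j :: int
  proof
    assume "o' + j * w \<in> D1"
    then obtain k :: int and y z where "y \<in> F" "z \<in> F" "o' + k * w \<le> y" "y < o' + j * w" "o' + j * w < z" "z \<le> o' + (of_int k + 1) * w"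
      by (rule D1E)
    hence "of_int k * w < of_int j * w" "of_int j * w < of_int (k + 1) * w" by auto
    hence "k < j" "j < k + 1" using w(1) by (simp_all add: mult_less_cancel_right)
    thus False by simp
  qed
  have R'pos: "R' > 0" using R e by (simp add: R'_def)
  have end_out: "o' + j * w \<notin> D" if "L > 0 \<or> \<bar>o' + j * w\<bar> \<le> R'" for j :: int
    using end1[of j] that by (auto simp: D_def D2_def D3_def)
  have oD: "o' \<notin> D" using end_out[of 0] R'pos by (auto simp: o'_def)
  have inv: "x + L \<in> D \<longleftrightarrow> x \<in> D" for x
  proof (cases "L > 0")
    case True
    have Fp: "y + L \<in> F \<longleftrightarrow> y \<in> F" for y using Fsh[of "y + L" 1] by simp
    have nw: "real n * w = L" using w(3) True by simp
    have 1: "x + L \<in> D1" if "x \<in> D1" for x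
    proof -
      from that obtain k :: int and y z where *: "y \<in> F" "z \<in> F" "o' + k * w \<le> y" "y < x" "x < z" "z \<le> o' + (of_int k + 1) * w"
        by (rule D1E)
      have "o' + of_int (k + int n) * w \<le> y + L" "z + L \<le> o' + (of_int (k + int n) + 1) * w"
        using *(3,6) nw by (simp_all add: algebra_simps)
      from D1I[OF _ _ this(1) _ _ this(2)] show ?thesis using * Fp by auto
    qed
    have 2: "x \<in> D1" if "x + L \<in> D1" for x
    proof -
      from that obtain k :: int and y z where *: "y \<in> F" "z \<in> F" "o' + k * w \<le> y" "y < x + L" "x + L < z" "z \<le> o' + (of_int k + 1) * w"
        by (rule D1E)
      have "o' + of_int (k - int n) * w \<le> y - L" "z - L \<le> o' + (of_int (k - int n) + 1) * w"
        using *(3,6) nw by (simp_all add: algebra_simps)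
      from D1I[OF _ _ this(1) _ _ this(2)] show ?thesis using * Fsh[of y 1] Fsh[of z 1] by auto
    qed
    show ?thesis using 1[of x] 2[of x] True by (auto simp: D_def D2_def D3_def)
  qed (use L in auto)
  have Fcl: "closed F" unfolding F_def by (rule closed_common_fixed[OF ab])
  have sep: "separated_by F D"
  proof (rule separated_byI[OF Fcl D_open])
    fix x v assume x: "x \<in> D" and v: "v \<notin> D"
    show "\<exists>z\<in>F. x < z \<and> z \<le> v" if xv: "x < v"
    proof -
      consider "x \<in> D1" | "x \<in> D2" | "x \<in> D3" using x by (auto simp: D_def)
      thus ?thesis
      proof cases
        case 1
        then obtain k :: int and y z where *: "y \<in> F" "z \<in> F" "o' + k * w \<le> y" "y < x" "x < z" "z \<le> o' + (of_int k + 1) * w"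
          by (rule D1E)
        have "z \<le> v"
        proof (rule ccontr)
          assume "\<not> z \<le> v"
          hence "v \<in> D1" using * xv by (intro D1I[OF *(1,2,3) _ _ *(6)]) auto
          thus False using v by (simp add: D_def)
        qed
        thus ?thesis using * by blast
      next
        case 2
        hence "v \<in> D2" using xv by (force simp: D2_def)
        thus ?thesis using v by (simp add: D_def)
      next
        case 3
        then obtain z where *: "L = 0" "z \<in> F" "x < z" "z \<le> - R'" unfolding D3_def by blast
        have "\<not> v < z" using v * by (auto simp: D_def D3_def)
        thus ?thesis using * by (intro bexI[of _ z]) auto
      qed
    qed
    show "\<exists>z\<in>F. v \<le> z \<and> z < x" if xv: "v < x"
    proof -
      consider "x \<in> D1" | "x \<in> D2" | "x \<in> D3" using x by (auto simp: D_def)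
      thus ?thesis
      proof cases
        case 1
        then obtain k :: int and y z where *: "y \<in> F" "z \<in> F" "o' + k * w \<le> y" "y < x" "x < z" "z \<le> o' + (of_int k + 1) * w"
          by (rule D1E)
        have "v \<le> y"
        proof (rule ccontr)
          assume "\<not> v \<le> y"
          hence "v \<in> D1" using * xv by (intro D1I[OF *(1,2,3) _ _ *(6)]) auto
          thus False using v by (simp add: D_def)
        qed
        thus ?thesis using * by blast
      next
        case 2
        then obtain y where *: "L = 0" "y \<in> F" "R' \<le> y" "y < x" unfolding D2_def by blast
        have "\<not> y < v" using v * by (auto simp: D_def D2_def)
        thus ?thesis using * by (intro bexI[of _ y]) auto
      next
        case 3
        then obtain z where *: "L = 0" "z \<in> F" "x < z" "z \<le> - R'" unfolding D3_def by blast
        hence "v \<in> D3" using xv unfolding D3_def by (intro CollectI conjI bexI[of _ z]) auto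
        thus ?thesis using v by (simp add: D_def)
      qed
    qed
  qed
  have Dne: "D \<noteq> UNIV" using oD by blast
  obtain a' b' where 1: "tuple_relation L g a' b'" "common_fixed g a' b' = F - D"
    "\<forall>i<g. \<forall>x. x \<notin> D \<longrightarrow> a' i x = a i x \<and> b' i x = b i x"
    using replace_on_open_set[OF g ab F_def D_open Dne inv sep] by (elim exE conjE) (rule that; assumption)
  have close: "\<bar>a' i x - a i x\<bar> \<le> e \<and> \<bar>b' i x - b i x\<bar> \<le> e" if i: "i < g" and x: "L > 0 \<or> \<bar>x\<bar> \<le> R" for i x
  proof (cases "x \<in> D")
    case True
    define k where "k = \<lfloor>(x - o') / w\<rfloor>"
    have "of_int k \<le> (x - o') / w" "(x - o') / w < of_int k + 1" unfolding k_def by linarith+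
    hence k: "o' + k * w \<le> x" "x < o' + (of_int k + 1) * w" using w(1) by (simp_all add: field_simps)
    have kw: "o' + (of_int k + 1) * w - (o' + k * w) = w" by (simp add: algebra_simps)
    have "L > 0 \<or> \<bar>o' + k * w\<bar> \<le> R'" "L > 0 \<or> \<bar>o' + (of_int k + 1) * w\<bar> \<le> R'"
      using x k kw w(2) unfolding R'_def by linarith+
    hence out: "o' + k * w \<notin> D" "o' + (of_int k + 1) * w \<notin> D" using end_out[of k] end_out[of "k + 1"] by simp_all
    have "o' + k * w < x" using out(1) k(1) True by (cases "o' + k * w = x") auto
    from separated_by_left[OF sep True out(1) this] obtain y where y: "y \<in> F" "y \<notin> D" "o' + k * w \<le> y" "y < x" by blast
    from separated_by_right[OF sep True out(2) k(2)] obtain z where z: "z \<in> F" "z \<notin> D" "x < z" "z \<le> o' + (of_int k + 1) * w" by blast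
    have zy: "z - y \<le> e" using y z kw w(2) by linarith
    have fy: "a i y = y" "b i y = y" "a' i y = y" "b' i y = y" using y 1(3) i by (auto simp: F_def common_fixed_def)
    have fz: "a i z = z" "b i z = z" "a' i z = z" "b' i z = z" using z 1(3) i by (auto simp: F_def common_fixed_def)
    have btw: "y < f x \<and> f x < z" if "inc_homeo f" "f y = y" "f z = z" for f
      using inc_homeo_less[OF that(1), of y x] inc_homeo_less[OF that(1), of x z] that(2,3) y(4) z(3) by simp
    note inc = tuple_relation_inc[OF ab i] tuple_relation_inc[OF 1(1) i]
    show ?thesis
      using btw[of "a i"] btw[of "b i"] btw[of "a' i"] btw[of "b' i"] inc fy fz zy by linarith
  next
    case False
    thus ?thesis using 1(3) i e by simp
  qed
  have fin: "finite ((F - D) \<inter> {l..r})" for l r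
  proof -
    have cell: "finite ((F - D) \<inter> {o' + k * w..o' + (of_int k + 1) * w})" for k :: int
    proof (rule finite_if_no_three)
      fix x y z assume *: "x \<in> (F - D) \<inter> {o' + k * w..o' + (of_int k + 1) * w}" "y \<in> (F - D) \<inter> {o' + k * w..o' + (of_int k + 1) * w}"
        "z \<in> (F - D) \<inter> {o' + k * w..o' + (of_int k + 1) * w}" "x < y" "y < z"
      hence "y \<in> D1" by (intro D1I[of x z k]) auto
      thus False using * by (simp add: D_def)
    qed
    have "(F - D) \<inter> {l..r} \<subseteq> (\<Union>k\<in>{\<lfloor>(l - o') / w\<rfloor>..\<lfloor>(r - o') / w\<rfloor>}. (F - D) \<inter> {o' + k * w..o' + (of_int k + 1) * w})"
    proof
      fix x assume x: "x \<in> (F - D) \<inter> {l..r}"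
      define k where "k = \<lfloor>(x - o') / w\<rfloor>"
      have "of_int k \<le> (x - o') / w" "(x - o') / w < of_int k + 1" unfolding k_def by linarith+
      hence k: "o' + k * w \<le> x" "x < o' + (of_int k + 1) * w" using w(1) by (simp_all add: field_simps)
      have "\<lfloor>(l - o') / w\<rfloor> \<le> k" "k \<le> \<lfloor>(r - o') / w\<rfloor>"
        unfolding k_def using x w(1) by (auto intro!: floor_mono divide_right_mono)
      thus "x \<in> (\<Union>k\<in>{\<lfloor>(l - o') / w\<rfloor>..\<lfloor>(r - o') / w\<rfloor>}. (F - D) \<inter> {o' + k * w..o' + (of_int k + 1) * w})"
        using x k by (intro UN_I[of k]) auto
    qed
    thus ?thesis by (rule finite_subset) (use cell in blast)
  qed
  \<comment> \<open>The point \<open>o'\<close> is not in \<open>D\<close>, so if \<open>c\<close> is in \<open>D\<close> then a point of \<open>F - D\<close> separates them.\<close>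
  have nonempty: "F - D \<noteq> {}"
  proof (cases "c \<in> D")
    case True
    hence "c \<noteq> o'" using oD by auto
    hence "c < o' \<or> o' < c" by linarith
    thus ?thesis using separated_by_right[OF sep True oD] separated_by_left[OF sep True oD] by blast
  qed (use c in \<open>auto simp: F_def\<close>)
  have orb: "x \<in> F - D" if "x \<in> orbit L y" "y \<in> F - D" for x y
  proof -
    from that obtain k :: int where k: "x = y + k * L" by (auto simp: orbit_def)
    have "x - of_int k * L \<in> common_fixed g a' b'" using that(2) k 1(2) by simp
    thus ?thesis using common_fixed_shift[OF 1(1)] 1(2) by blast
  qed
  have self: "y \<in> orbit L y" for y by (auto simp: orbit_def intro: exI[of _ 0])
  have "\<exists>E. finite E \<and> E \<noteq> {} \<and> F - D = (\<Union>y\<in>E. orbit L y)"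
  proof (cases "L > 0")
    case True
    define E where "E = (F - D) \<inter> {0..L}"
    have "F - D \<subseteq> (\<Union>y\<in>E. orbit L y)"
    proof
      fix x assume x: "x \<in> F - D"
      define k where "k = \<lfloor>x / L\<rfloor>"
      have "of_int k \<le> x / L" "x / L < of_int k + 1" unfolding k_def by linarith+
      hence k: "0 \<le> x - k * L" "x - k * L \<le> L" using True by (simp_all add: field_simps)
      have "x - k * L \<in> orbit L x" unfolding orbit_def by (intro CollectI exI[of _ "- k"]) simp
      hence "x - k * L \<in> E" using orb x k by (auto simp: E_def)
      moreover have "x \<in> orbit L (x - k * L)" unfolding orbit_def by (intro CollectI exI[of _ k]) simp
      ultimately show "x \<in> (\<Union>y\<in>E. orbit L y)" by blast
    qed
    moreover have "(\<Union>y\<in>E. orbit L y) \<subseteq> F - D" using orb by (auto simp: E_def)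
    ultimately have eq: "F - D = (\<Union>y\<in>E. orbit L y)" by blast
    moreover from this have "E \<noteq> {}" using nonempty by auto
    moreover have "finite E" unfolding E_def by (rule fin)
    ultimately show ?thesis by blast
  next
    case False
    hence L0: "L = 0" using L by simp
    have f2: "finite ((F - D) \<inter> {R'..})"
    proof (rule finite_if_no_three)
      fix x y z assume *: "x \<in> (F - D) \<inter> {R'..}" "y \<in> (F - D) \<inter> {R'..}" "x < y"
      hence "y \<in> D2" using L0 by (auto simp: D2_def)
      thus False using * by (simp add: D_def)
    qed
    have f3: "finite ((F - D) \<inter> {..-R'})"
    proof (rule finite_if_no_three)
      fix x y z assume *: "x \<in> (F - D) \<inter> {..-R'}" "y \<in> (F - D) \<inter> {..-R'}" "x < y"
      hence "x \<in> D3" using L0 by (auto simp: D3_def)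
      thus False using * by (simp add: D_def)
    qed
    have "F - D \<subseteq> (F - D) \<inter> {-R'..R'} \<union> (F - D) \<inter> {R'..} \<union> (F - D) \<inter> {..-R'}" by force
    hence "finite (F - D)" by (rule finite_subset) (use fin f2 f3 in blast)
    moreover have "F - D = (\<Union>y\<in>F - D. orbit L y)" using L0 by (auto simp: orbit_def)
    ultimately show ?thesis using nonempty by blast
  qed
  then obtain E where "finite E" "E \<noteq> {}" "F - D = (\<Union>y\<in>E. orbit L y)" by blast
  thus ?thesis using 1(1,2) close by (intro exI[of _ a'] exI[of _ b'] exI[of _ E]) simp
qed

text \<open>The tuples satisfying the relation are the representations of the surface group, and a common fixed point of
the letters is a fixed point of the whole group. That each letter still has a fixed point of its own
matters on the circle: it rules out that a lift without fixed points covers a map with fixed points.\<close>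

theorem perturb_without_common_fixed_point:
  assumes L: "L \<ge> 0" and g: "2 \<le> g" and ab: "tuple_relation L g a b" and ne: "common_fixed g a b \<noteq> {}"
    and e: "0 < e" and R: "0 < R"
  shows "\<exists>a' b'. tuple_relation L g a' b' \<and> common_fixed g a' b' = {} \<and>
    (\<forall>i<g. \<forall>x. L > 0 \<or> \<bar>x\<bar> \<le> R \<longrightarrow> \<bar>a' i x - a i x\<bar> \<le> e \<and> \<bar>b' i x - b i x\<bar> \<le> e) \<and>
    (\<forall>i<g. (\<exists>y. a' i y = y) \<and> (\<exists>y. b' i y = y))"
proof -
  obtain c where c: "c \<in> common_fixed g a b" using ne by blast
  have g0: "0 < g" and e2: "0 < e / 2" using g e by auto
  obtain a1 b1 E where 1: "tuple_relation L g a1 b1" "finite E" "E \<noteq> {}" "common_fixed g a1 b1 = (\<Union>y\<in>E. orbit L y)"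
    "\<forall>i<g. \<forall>x. L > 0 \<or> \<bar>x\<bar> \<le> R \<longrightarrow> \<bar>a1 i x - a i x\<bar> \<le> e / 2 \<and> \<bar>b1 i x - b i x\<bar> \<le> e / 2"
    using reduce_to_finitely_many_orbits[OF L g0 ab c e2 R] by (elim exE conjE) (rule that; assumption)
  obtain a' b' where 2: "tuple_relation L g a' b'" "common_fixed g a' b' = {}"
    "\<forall>i<g. \<forall>x. \<bar>a' i x - a1 i x\<bar> \<le> e / 2 \<and> \<bar>b' i x - b1 i x\<bar> \<le> e / 2"
    "\<forall>i<g. (\<exists>y. a' i y = y) \<and> (\<exists>y. b' i y = y)"
    using remove_all_common_fixed[OF L g 1(2,3,1,4) e2] by (elim exE conjE) (rule that; assumption)
  have "\<bar>a' i x - a i x\<bar> \<le> e \<and> \<bar>b' i x - b i x\<bar> \<le> e" if "i < g" "L > 0 \<or> \<bar>x\<bar> \<le> R" for i x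
    using 1(5)[rule_format, OF that] 2(3)[rule_format, OF that(1), of x] by linarith
  thus ?thesis using 2(1,2,4) by (intro exI[of _ a'] exI[of _ b']) simp
qed

section \<open>The fundamental group\<close>

lemma loops_atI: "path p \<Longrightarrow> path_image p \<subseteq> S \<Longrightarrow> pathstart p = x \<Longrightarrow> pathfinish p = x \<Longrightarrow> p \<in> loops_at S x"
  by (simp add: loops_at_def)

lemma loops_at_join: "p \<in> loops_at S x \<Longrightarrow> q \<in> loops_at S x \<Longrightarrow> p +++ q \<in> loops_at S x"
  by (auto simp: loops_at_def subset_path_image_join)

lemma loops_at_reverse: "p \<in> loops_at S x \<Longrightarrow> reversepath p \<in> loops_at S x"
  by (auto simp: loops_at_def)

lemma loops_at_const: "x \<in> S \<Longrightarrow> (\<lambda>_. x) \<in> loops_at S x"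
  by (auto simp: loops_at_def path_def path_image_def pathstart_def pathfinish_def)

lemma homotopic_paths_convex_image:
  fixes C :: "'b::real_normed_vector set"
  assumes "convex C" "continuous_on C k" "k ` C \<subseteq> S" and c: "path c" "path_image c \<subseteq> C" and c': "path c'" "path_image c' \<subseteq> C"
    and "pathstart c = pathstart c'" "pathfinish c = pathfinish c'"
  shows "homotopic_paths S (k \<circ> c) (k \<circ> c')"
proof (rule homotopic_paths_continuous_image)
  have "closed_segment (c t) (c' t) \<subseteq> C" if "t \<in> {0..1}" for t
    using that c c' assms(1) by (simp add: closed_segment_subset path_image_def image_subset_iff)
  thus "homotopic_paths C c c'" using assms by (intro homotopic_paths_linear) auto
  show "k \<in> C \<rightarrow> S" using assms(3) by blast
qed (fact assms)

text \<open>The straight homotopy between two reparametrisations. The paths live in a topological space without linear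
structure, so the group laws for path classes are derived from this lemma.\<close>

lemma homotopic_paths_rescale:
  fixes c c' :: "real \<Rightarrow> real"
  assumes p: "path p" "path_image p \<subseteq> S" and c: "path c" "path_image c \<subseteq> {0..1}" "path c'" "path_image c' \<subseteq> {0..1}"
    "pathstart c = pathstart c'" "pathfinish c = pathfinish c'"
  shows "homotopic_paths S (p \<circ> c) (p \<circ> c')"
  by (rule homotopic_paths_convex_image[of "{0..1}"]) (use p c in \<open>auto simp: path_def path_image_def\<close>)

lemma homotopic_const_join:
  assumes p: "path p" "path_image p \<subseteq> S"
  shows "homotopic_paths S ((\<lambda>_. pathstart p) +++ p) p"
proof -
  have "homotopic_paths S (p \<circ> (linepath 0 0 +++ linepath 0 1)) (p \<circ> linepath 0 1)"
    by (rule homotopic_paths_rescale[OF p]) (auto simp: path_image_join closed_segment_eq_real_ivl)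
  moreover have "p \<circ> (linepath 0 0 +++ linepath 0 1) = (\<lambda>_. pathstart p) +++ p" "p \<circ> linepath 0 1 = p"
    by (auto simp: joinpaths_def linepath_def fun_eq_iff pathstart_def)
  ultimately show ?thesis by simp
qed

lemma homotopic_reverse_join:
  assumes p: "path p" "path_image p \<subseteq> S"
  shows "homotopic_paths S (reversepath p +++ p) (\<lambda>_. pathfinish p)"
proof -
  have "homotopic_paths S (p \<circ> (linepath 1 0 +++ linepath 0 1)) (p \<circ> linepath 1 1)"
    by (rule homotopic_paths_rescale[OF p]) (auto simp: path_image_join closed_segment_eq_real_ivl)
  moreover have "p \<circ> (linepath 1 0 +++ linepath 0 1) = reversepath p +++ p" "p \<circ> linepath 1 1 = (\<lambda>_. pathfinish p)"
    by (auto simp: joinpaths_def linepath_def fun_eq_iff reversepath_def pathfinish_def)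
  ultimately show ?thesis by simp
qed

lemma loops_at_homotopic: "p \<in> loops_at S x \<Longrightarrow> homotopic_paths S p q \<Longrightarrow> q \<in> loops_at S x"
  unfolding loops_at_def using homotopic_paths_imp_path homotopic_paths_imp_subset
    homotopic_paths_imp_pathstart homotopic_paths_imp_pathfinish by (metis (no_types, lifting) mem_Collect_eq)

lemma loop_class_self: "p \<in> loops_at S x \<Longrightarrow> p \<in> loop_class S x p"
  by (auto simp: loop_class_def loops_at_def)

lemma loop_class_eq:
  assumes "p \<in> loops_at S x" "q \<in> loops_at S x"
  shows "loop_class S x p = loop_class S x q \<longleftrightarrow> homotopic_paths S p q"
proof
  assume "loop_class S x p = loop_class S x q"
  thus "homotopic_paths S p q" using loop_class_self[OF assms(2)] by (auto simp: loop_class_def)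
next
  assume "homotopic_paths S p q"
  thus "loop_class S x p = loop_class S x q" unfolding loop_class_def
    using homotopic_paths_trans homotopic_paths_sym by blast
qed

lemma fundamental_group_carrier: "carrier (fundamental_group S x) = loop_class S x ` loops_at S x"
  by (simp add: fundamental_group_def)

lemma fundamental_group_mult:
  assumes p: "p \<in> loops_at S x" and q: "q \<in> loops_at S x"
  shows "loop_class S x p \<otimes>\<^bsub>fundamental_group S x\<^esub> loop_class S x q = loop_class S x (p +++ q)"
proof -
  have "loop_class S x (p' +++ q') = loop_class S x (p +++ q)"
    if "p' \<in> loop_class S x p" "q' \<in> loop_class S x q" for p' q'
  proof -
    have *: "p' \<in> loops_at S x" "q' \<in> loops_at S x" "homotopic_paths S p p'" "homotopic_paths S q q'"
      using that by (auto simp: loop_class_def)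
    have "homotopic_paths S (p +++ q) (p' +++ q')"
      by (rule homotopic_paths_join[OF *(3,4)]) (use p q in \<open>simp add: loops_at_def\<close>)
    thus ?thesis using loop_class_eq loops_at_join p q * by blast
  qed
  moreover have "p \<in> loop_class S x p" "q \<in> loop_class S x q" using loop_class_self p q by auto
  ultimately have "(\<Union>p'\<in>loop_class S x p. \<Union>q'\<in>loop_class S x q. loop_class S x (p' +++ q')) = loop_class S x (p +++ q)"
    by fast
  thus ?thesis by (simp add: fundamental_group_def)
qed

lemma group_fundamental_group:
  assumes x: "x \<in> S" shows "group (fundamental_group S x)"
proof (rule groupI)
  let ?G = "fundamental_group S x" and ?c = "loop_class S x"
  have one: "\<one>\<^bsub>?G\<^esub> = ?c (\<lambda>_. x)" by (simp add: fundamental_group_def)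
  show "\<one>\<^bsub>?G\<^esub> \<in> carrier ?G" using loops_at_const[OF x] by (auto simp: one fundamental_group_carrier)
  fix A assume "A \<in> carrier ?G"
  then obtain p where p: "p \<in> loops_at S x" "A = ?c p" by (auto simp: fundamental_group_carrier)
  hence p': "path p" "path_image p \<subseteq> S" "pathstart p = x" "pathfinish p = x" by (auto simp: loops_at_def)
  have "homotopic_paths S ((\<lambda>_. x) +++ p) p" using homotopic_const_join[OF p'(1,2)] p'(3) by simp
  thus "\<one>\<^bsub>?G\<^esub> \<otimes>\<^bsub>?G\<^esub> A = A" unfolding one p(2) fundamental_group_mult[OF loops_at_const[OF x] p(1)]
    using loop_class_eq[OF loops_at_join[OF loops_at_const[OF x] p(1)] p(1)] by simp
  have "homotopic_paths S (reversepath p +++ p) (\<lambda>_. x)" using homotopic_reverse_join[OF p'(1,2)] p'(4) by simp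
  hence "?c (reversepath p) \<otimes>\<^bsub>?G\<^esub> A = \<one>\<^bsub>?G\<^esub>"
    unfolding one p(2) fundamental_group_mult[OF loops_at_reverse[OF p(1)] p(1)]
    using loop_class_eq[OF loops_at_join[OF loops_at_reverse[OF p(1)] p(1)] loops_at_const[OF x]] by simp
  thus "\<exists>B\<in>carrier ?G. B \<otimes>\<^bsub>?G\<^esub> A = \<one>\<^bsub>?G\<^esub>"
    using loops_at_reverse[OF p(1)] by (auto simp: fundamental_group_carrier)
  fix B assume "B \<in> carrier ?G"
  then obtain q where q: "q \<in> loops_at S x" "B = ?c q" by (auto simp: fundamental_group_carrier)
  show "A \<otimes>\<^bsub>?G\<^esub> B \<in> carrier ?G" unfolding p(2) q(2) fundamental_group_mult[OF p(1) q(1)]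
    using loops_at_join[OF p(1) q(1)] by (auto simp: fundamental_group_carrier)
  fix C assume "C \<in> carrier ?G"
  then obtain r where r: "r \<in> loops_at S x" "C = ?c r" by (auto simp: fundamental_group_carrier)
  have "homotopic_paths S (p +++ (q +++ r)) ((p +++ q) +++ r)"
    by (rule homotopic_paths_assoc) (use p(1) q(1) r(1) in \<open>auto simp: loops_at_def\<close>)
  thus "A \<otimes>\<^bsub>?G\<^esub> B \<otimes>\<^bsub>?G\<^esub> C = A \<otimes>\<^bsub>?G\<^esub> (B \<otimes>\<^bsub>?G\<^esub> C)"
    unfolding p(2) q(2) r(2)
    using loop_class_eq loops_at_join p(1) q(1) r(1)
    by (metis fundamental_group_mult)
qed

section \<open>Homomorphisms from a flat cocycle\<close>

text \<open>A quotient of a compact convex set by an equivalence relation that is a finite union of compact pieces. For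
the surface these are the diagonal, the graphs of the side identifications and the pairs of corners.\<close>

locale glued_disc =
  fixes D :: "'b::euclidean_space set" and f :: "'b \<Rightarrow> 'a::topological_space" and S :: "'a set"
    and d0 :: 'b and pieces :: "('b \<times> 'b) set set"
  assumes compact_D: "compact D" and convex_D: "convex D" and d0: "d0 \<in> D"
    and quotient: "quotient_map (top_of_set D) (top_of_set S) f"
    and finite_pieces: "finite pieces" and compact_pieces: "\<And>P. P \<in> pieces \<Longrightarrow> compact P"
    and pieces_cover: "\<Union>pieces = {(x, y). x \<in> D \<and> y \<in> D \<and> f x = f y}"
begin

lemma cont_f: "continuous_on D f" and f_image: "f ` D = S"
  using quotient_imp_continuous_map[OF quotient] quotient_imp_surjective_map[OF quotient] by auto

lemma f_in: "d \<in> D \<Longrightarrow> f d \<in> S"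
  using f_image by blast

text \<open>Every point of the convex set is joined to the base point by its spoke. A jump runs out along one spoke
and back along another one that ends at the same point of the quotient; jumps across a side of a polygon
are the standard generators of the fundamental group.\<close>

definition spoke :: "'b \<Rightarrow> real \<Rightarrow> 'a" where
  "spoke d = f \<circ> linepath d0 d"

definition jump :: "'b \<Rightarrow> 'b \<Rightarrow> (real \<Rightarrow> 'a) set" where
  "jump d d' = loop_class S (f d0) (spoke d +++ reversepath (spoke d'))"

lemma path_f: "path c \<Longrightarrow> path_image c \<subseteq> D \<Longrightarrow> path (f \<circ> c) \<and> path_image (f \<circ> c) \<subseteq> S"
  using path_continuous_image[of c f] continuous_on_subset[OF cont_f] f_image
  by (simp add: path_image_compose) blast

lemma spoke_path: assumes "d \<in> D"
  shows "path (spoke d)" "path_image (spoke d) \<subseteq> S" "pathstart (spoke d) = f d0" "pathfinish (spoke d) = f d"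
proof -
  have "path_image (linepath d0 d) \<subseteq> D" using convex_D d0 assms by (simp add: convex_contains_segment)
  thus "path (spoke d)" "path_image (spoke d) \<subseteq> S" using path_f[of "linepath d0 d"] by (auto simp: spoke_def)
qed (auto simp: spoke_def pathstart_compose pathfinish_compose)

lemma jump_loop:
  assumes "d \<in> D" "d' \<in> D" "f d = f d'" shows "spoke d +++ reversepath (spoke d') \<in> loops_at S (f d0)"
proof (rule loops_atI)
  show "path_image (spoke d +++ reversepath (spoke d')) \<subseteq> S"
    by (rule subset_path_image_join) (use spoke_path[OF assms(1)] spoke_path[OF assms(2)] in auto)
qed (use spoke_path[OF assms(1)] spoke_path[OF assms(2)] assms(3) in auto)

text \<open>The map \<open>f\<close> is closed: saturations of closed sets are projections of compact sets, because the
equivalence relation is compact. So fibres have arbitrarily small saturated neighbourhoods.\<close>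

lemma fibre_neighbourhood:
  assumes z: "z \<in> S" and r: "r > 0"
  shows "\<exists>V. openin (top_of_set S) V \<and> z \<in> V \<and> (\<forall>u\<in>D. f u \<in> V \<longrightarrow> (\<exists>d\<in>D. f d = z \<and> dist u d < r))"
proof -
  define K where "K = D - (\<Union>d\<in>{d\<in>D. f d = z}. ball d r)"
  have K: "compact K" "K \<subseteq> D" using compact_D by (auto simp: K_def intro!: compact_diff)
  have "compact (\<Union>pieces)" using finite_pieces compact_pieces by (rule compact_Union)
  moreover have "compact (K \<times> D)" using K compact_D by (intro compact_Times)
  ultimately have "compact (\<Union>pieces \<inter> (K \<times> D))" by (rule compact_Int)
  hence "compact (snd ` (\<Union>pieces \<inter> (K \<times> D)))" by (intro compact_continuous_image continuous_intros)
  moreover have "snd ` (\<Union>pieces \<inter> (K \<times> D)) = {x \<in> D. f x \<in> f ` K}"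
  proof (intro equalityI subsetI)
    fix x assume "x \<in> {x \<in> D. f x \<in> f ` K}"
    then obtain k where "x \<in> D" "k \<in> K" "f k = f x" by auto
    hence "(k, x) \<in> \<Union>pieces \<inter> (K \<times> D)" unfolding pieces_cover using K by auto
    thus "x \<in> snd ` (\<Union>pieces \<inter> (K \<times> D))" by (rule rev_image_eqI) simp
  next
    fix y assume "y \<in> snd ` (\<Union>pieces \<inter> (K \<times> D))"
    then obtain k where "k \<in> K" "y \<in> D" "f y = f k" by (auto simp: pieces_cover)
    thus "y \<in> {x \<in> D. f x \<in> f ` K}" by blast
  qed
  ultimately have "compact {x \<in> D. f x \<in> f ` K}" by simp
  hence "closed {x \<in> D. f x \<in> f ` K}" by (rule compact_imp_closed)
  hence "closedin (top_of_set D) {x \<in> D. f x \<in> f ` K}" by (intro closed_subset) auto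
  moreover have "f ` K \<subseteq> S" using K f_in by blast
  moreover have "\<forall>U. U \<subseteq> S \<longrightarrow> closedin (top_of_set D) {x \<in> D. f x \<in> U} = closedin (top_of_set S) U"
    using quotient by (simp add: quotient_map_closedin)
  ultimately have cl: "closedin (top_of_set S) (f ` K)" by blast
  have "openin (top_of_set S) (S - f ` K)" using cl by (simp add: openin_diff)
  moreover have "z \<notin> f ` K" using r by (auto simp: K_def)
  moreover have "\<exists>d\<in>D. f d = z \<and> dist u d < r" if "u \<in> D" "f u \<notin> f ` K" for u
  proof -
    have "u \<notin> K" using that by blast
    thus ?thesis using that(1) by (auto simp: K_def dist_commute)
  qed
  ultimately show ?thesis using z by (intro exI[of _ "S - f ` K"]) auto
qed

text \<open>The Lebesgue number of the cover of \<open>X\<close> by the preimages of such neighbourhoods.\<close>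

lemma uniform_fibre_neighbourhood:
  fixes X :: "'c::heine_borel set"
  assumes X: "compact X" and K: "continuous_on X K" "K ` X \<subseteq> S" and r: "\<And>z. z \<in> S \<Longrightarrow> openin (top_of_set S) (V z) \<and> z \<in> V z"
  shows "\<exists>\<delta>>0. \<forall>x\<in>X. \<exists>z\<in>S. \<forall>y\<in>X. dist x y < \<delta> \<longrightarrow> K y \<in> V z"
proof -
  have "\<exists>G. open G \<and> X \<inter> G = X \<inter> K -` V z" if "z \<in> S" for z
  proof -
    have "openin (top_of_set X) (X \<inter> K -` V z)"
      by (rule continuous_openin_preimage[OF K(1), of S]) (use K(2) r[OF that] in auto)
    thus ?thesis by (auto simp: openin_open)
  qed
  then obtain G where G: "\<And>z. z \<in> S \<Longrightarrow> open (G z) \<and> X \<inter> G z = X \<inter> K -` V z" by metis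
  have cov: "X \<subseteq> \<Union>(G ` S)" using G r K(2) by fastforce
  obtain \<delta> where "\<delta> > 0" "\<And>x. x \<in> X \<Longrightarrow> \<exists>U\<in>G ` S. ball x \<delta> \<subseteq> U"
    using Heine_Borel_lemma[OF X cov] G by auto
  moreover have "K y \<in> V z" if "x \<in> X" "ball x \<delta> \<subseteq> G z" "z \<in> S" "y \<in> X" "dist x y < \<delta>" for x y z
    using that G[OF that(3)] by (auto simp: subset_iff)
  ultimately show ?thesis by (metis (no_types, lifting) imageE)
qed

end

text \<open>A flat connection on the trivial bundle over the quotient with fibre \<open>H\<close>, given by its transition
functions: identified points \<open>x\<close> and \<open>y\<close> are compared by \<open>inv (\<eta> x) \<otimes> \<eta> y\<close>. Flatness means that this
element is constant on each piece. The parallel transport along loops is a homomorphism into \<open>H\<close>.\<close>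

locale flat_cocycle = glued_disc D f S d0 pieces + group H
  for D :: "'b::euclidean_space set" and f :: "'b \<Rightarrow> 'a::topological_space" and S d0 pieces
    and H :: "('h, 'm) monoid_scheme" (structure) +
  fixes \<eta> :: "'b \<Rightarrow> 'h"
  assumes \<eta>: "\<And>d. d \<in> D \<Longrightarrow> \<eta> d \<in> carrier H"
    and constant_on_pieces: "\<And>P x y x' y'. P \<in> pieces \<Longrightarrow> (x, y) \<in> P \<Longrightarrow> (x', y') \<in> P \<Longrightarrow>
      inv (\<eta> x) \<otimes> \<eta> y = inv (\<eta> x') \<otimes> \<eta> y'"
begin

lemma cancel: "x \<in> carrier H \<Longrightarrow> y \<in> carrier H \<Longrightarrow> x \<otimes> (inv x \<otimes> y) = y"
  "x \<in> carrier H \<Longrightarrow> y \<in> carrier H \<Longrightarrow> inv x \<otimes> (x \<otimes> y) = y"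
  by (simp_all flip: m_assoc)

definition transition :: "'b \<Rightarrow> 'b \<Rightarrow> 'h" where
  "transition x y = inv (\<eta> x) \<otimes> \<eta> y"

lemma transition_closed [simp]: "x \<in> D \<Longrightarrow> y \<in> D \<Longrightarrow> transition x y \<in> carrier H"
  by (simp add: transition_def \<eta>)

lemma transition_mult [simp]:
  "x \<in> D \<Longrightarrow> y \<in> D \<Longrightarrow> z \<in> D \<Longrightarrow> transition x y \<otimes> transition y z = transition x z"
  by (simp add: transition_def m_assoc \<eta> cancel)

lemma transition_self [simp]: "x \<in> D \<Longrightarrow> transition x x = \<one>"
  by (simp add: transition_def \<eta>)

lemma inv_transition [simp]: "x \<in> D \<Longrightarrow> y \<in> D \<Longrightarrow> inv (transition x y) = transition y x"
  by (simp add: transition_def \<eta> inv_mult_group)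

definition related :: "'b \<Rightarrow> 'b \<Rightarrow> bool" where
  "related x y \<longleftrightarrow> x \<in> D \<and> y \<in> D \<and> f x = f y"

text \<open>Disjoint pieces have positive distance, so identified pairs that are close to each other lie in pieces that
intersect, and there the constant values agree.\<close>

lemma transition_locally_constant:
  "\<exists>r>0. \<forall>x y x' y'. related x y \<longrightarrow> related x' y' \<longrightarrow> dist x x' < 3 * r \<longrightarrow> dist y y' < 3 * r \<longrightarrow>
     transition x y = transition x' y'"
proof -
  have "\<exists>\<epsilon>>0. \<forall>u\<in>fst PQ. \<forall>v\<in>snd PQ. dist u v < \<epsilon> \<longrightarrow> fst PQ \<inter> snd PQ \<noteq> {}"
    if PQ: "PQ \<in> pieces \<times> pieces" for PQ
  proof (cases "fst PQ \<inter> snd PQ = {}")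
    case True
    have "compact (fst PQ)" using PQ by (auto intro: compact_pieces)
    moreover have "closed (snd PQ)" using PQ compact_imp_closed[OF compact_pieces, of "snd PQ"] by (simp add: mem_Times_iff)
    ultimately have "compact (fst PQ)" "closed (snd PQ)" by auto
    from separate_compact_closed[OF this True] obtain \<epsilon> where "\<epsilon> > 0" "\<forall>u\<in>fst PQ. \<forall>v\<in>snd PQ. \<epsilon> \<le> dist u v" by blast
    thus ?thesis by (intro exI[of _ \<epsilon>]) force
  qed (auto intro: exI[of _ 1])
  then obtain E where E: "\<And>PQ. PQ \<in> pieces \<times> pieces \<Longrightarrow> E PQ > 0 \<and>
    (\<forall>u\<in>fst PQ. \<forall>v\<in>snd PQ. dist u v < E PQ \<longrightarrow> fst PQ \<inter> snd PQ \<noteq> {})" by metis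
  define \<epsilon> where "\<epsilon> = Min (insert 1 (E ` (pieces \<times> pieces)))"
  have \<epsilon>: "\<epsilon> > 0" "\<And>PQ. PQ \<in> pieces \<times> pieces \<Longrightarrow> \<epsilon> \<le> E PQ" using E finite_pieces by (auto simp: \<epsilon>_def)
  have "transition x y = transition x' y'"
    if rel: "related x y" "related x' y'" and d: "dist x x' < 3 * (\<epsilon> / 6)" "dist y y' < 3 * (\<epsilon> / 6)" for x y x' y'
  proof -
    have "(x, y) \<in> \<Union>pieces" "(x', y') \<in> \<Union>pieces" using rel by (auto simp: pieces_cover related_def)
    then obtain P Q where P: "P \<in> pieces" "(x, y) \<in> P" and Q: "Q \<in> pieces" "(x', y') \<in> Q" by blast
    have "dist (x, y) (x', y') \<le> dist x x' + dist y y'"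
      unfolding dist_Pair_Pair using sqrt_sum_squares_le_sum[of "dist x x'" "dist y y'"] by simp
    hence "dist (x, y) (x', y') < E (P, Q)" using d \<epsilon>(2)[of "(P, Q)"] P(1) Q(1) by auto
    hence "P \<inter> Q \<noteq> {}" using E[of "(P, Q)"] P Q by force
    then obtain u v where uv: "(u, v) \<in> P" "(u, v) \<in> Q" by auto
    show ?thesis using constant_on_pieces[OF P(1,2) uv(1)] constant_on_pieces[OF Q(1,2) uv(2)]
      by (simp add: transition_def)
  qed
  moreover have "\<epsilon> / 6 > 0" using \<epsilon>(1) by simp
  ultimately show ?thesis by blast
qed

definition mesh :: real where
  "mesh = (SOME r. r > 0 \<and> (\<forall>x y x' y'. related x y \<longrightarrow> related x' y' \<longrightarrow> dist x x' < 3 * r \<longrightarrow> dist y y' < 3 * r \<longrightarrow>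
     transition x y = transition x' y'))"

lemma mesh_spec: "mesh > 0 \<and> (\<forall>x y x' y'. related x y \<longrightarrow> related x' y' \<longrightarrow> dist x x' < 3 * mesh \<longrightarrow> dist y y' < 3 * mesh \<longrightarrow>
     transition x y = transition x' y')"
  unfolding mesh_def by (rule someI_ex[OF transition_locally_constant])

lemma mesh_pos: "mesh > 0"
  by (rule mesh_spec[THEN conjunct1])

lemma mesh:
  assumes "related x y" "related x' y'" "dist x x' < 3 * mesh" "dist y y' < 3 * mesh"
  shows "transition x y = transition x' y'"
  by (rule mesh_spec[THEN conjunct2, THEN spec, THEN spec, THEN spec, THEN spec, THEN mp, THEN mp, THEN mp, THEN mp, OF assms])

text \<open>The transition for points that are not identified but close to an identified pair.\<close>

definition near_transition :: "'b \<Rightarrow> 'b \<Rightarrow> 'h" where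
  "near_transition u w = (SOME t. \<exists>d d'. related d d' \<and> dist u d < mesh \<and> dist w d' < mesh \<and> t = transition d d')"

lemma near_transition_eq:
  assumes "related d d'" "dist u d < mesh" "dist w d' < mesh"
  shows "near_transition u w = transition d d'"
proof -
  have "\<exists>t. \<exists>d d'. related d d' \<and> dist u d < mesh \<and> dist w d' < mesh \<and> t = transition d d'" using assms by blast
  from someI_ex[OF this] obtain e e' where e: "related e e'" "dist u e < mesh" "dist w e' < mesh"
    "near_transition u w = transition e e'" unfolding near_transition_def by blast
  have "dist e d < 3 * mesh" "dist e' d' < 3 * mesh"
    using dist_triangle2[of e d u] dist_triangle2[of e' d' w] assms e mesh_pos by (auto simp: dist_commute)
  thus ?thesis using mesh[OF e(1) assms(1)] e(4) by simp
qed

text \<open>A choice of preimages. Over the base point it is \<open>d0\<close>, so that the holonomy of a jump has no correction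
term at its ends.\<close>

definition sheet :: "'a \<Rightarrow> 'b" where
  "sheet z = (if z = f d0 then d0 else SOME d. d \<in> D \<and> f d = z)"

lemma sheet: "z \<in> S \<Longrightarrow> sheet z \<in> D \<and> f (sheet z) = z"
proof -
  assume "z \<in> S"
  hence "\<exists>d. d \<in> D \<and> f d = z" using f_image by blast
  from someI_ex[OF this] show ?thesis using d0 by (auto simp: sheet_def)
qed

definition step :: "'a \<Rightarrow> 'a \<Rightarrow> 'h" where
  "step x y = near_transition (sheet x) (sheet y)"

text \<open>Three points near one fibre satisfy the cocycle rule, as all transitions can then be computed between
points of that fibre.\<close>

definition near_fibre :: "'a \<Rightarrow> 'a \<Rightarrow> bool" where
  "near_fibre z x \<longleftrightarrow> x \<in> S \<and> (\<forall>u\<in>D. f u = x \<longrightarrow> (\<exists>d\<in>D. f d = z \<and> dist u d < mesh))"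

lemma near_fibreE:
  assumes "near_fibre z x" obtains d where "d \<in> D" "f d = z" "dist (sheet x) d < mesh"
  using assms sheet[of x] unfolding near_fibre_def by blast

lemma step_mult:
  assumes "near_fibre z x" "near_fibre z y" "near_fibre z w"
  shows "step x y \<in> carrier H" "step x y \<otimes> step y w = step x w" "step x x = \<one>"
proof -
  obtain a b c where *: "a \<in> D" "f a = z" "dist (sheet x) a < mesh" "b \<in> D" "f b = z" "dist (sheet y) b < mesh"
    "c \<in> D" "f c = z" "dist (sheet w) c < mesh" using assms near_fibreE by metis
  have "step x y = transition a b" "step y w = transition b c" "step x w = transition a c" "step x x = transition a a"
    unfolding step_def by (rule near_transition_eq; use * in \<open>simp add: related_def\<close>)+
  thus "step x y \<in> carrier H" "step x y \<otimes> step y w = step x w" "step x x = \<one>" using * by auto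
qed

definition good_scale :: "('c::metric_space \<Rightarrow> 'a) \<Rightarrow> 'c set \<Rightarrow> real \<Rightarrow> bool" where
  "good_scale K X \<delta> \<longleftrightarrow> \<delta> > 0 \<and> (\<forall>x\<in>X. \<exists>z\<in>S. \<forall>y\<in>X. dist x y < \<delta> \<longrightarrow> near_fibre z (K y))"

lemma good_scale_exists:
  fixes X :: "'c::heine_borel set"
  assumes "compact X" "continuous_on X K" "K ` X \<subseteq> S" shows "\<exists>\<delta>. good_scale K X \<delta>"
proof -
  obtain V where V: "\<And>z. z \<in> S \<Longrightarrow> openin (top_of_set S) (V z) \<and> z \<in> V z \<and>
     (\<forall>u\<in>D. f u \<in> V z \<longrightarrow> (\<exists>d\<in>D. f d = z \<and> dist u d < mesh))"
    using fibre_neighbourhood[OF _ mesh_pos] by metis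
  obtain \<delta> where \<delta>: "\<delta> > 0" "\<forall>x\<in>X. \<exists>z\<in>S. \<forall>y\<in>X. dist x y < \<delta> \<longrightarrow> K y \<in> V z"
    using uniform_fibre_neighbourhood[OF assms, of V] V by auto
  have "near_fibre z (K y)" if "z \<in> S" "y \<in> X" "K y \<in> V z" for z y
    unfolding near_fibre_def using V[OF that(1)] that assms(3) by auto
  thus ?thesis using \<delta> unfolding good_scale_def by (intro exI[of _ \<delta>]) metis
qed

text \<open>A lift of \<open>K\<close> to the covering that belongs to the cocycle, written in the trivialisation over the chosen
sheets: over distances below \<open>\<delta>\<close> it changes by the cocycle.\<close>

definition lift_at :: "real \<Rightarrow> ('c::metric_space \<Rightarrow> 'a) \<Rightarrow> 'c set \<Rightarrow> ('c \<Rightarrow> 'h) \<Rightarrow> bool" where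
  "lift_at \<delta> K X h \<longleftrightarrow> \<delta> > 0 \<and> (\<forall>x\<in>X. h x \<in> carrier H) \<and>
     (\<forall>x\<in>X. \<forall>y\<in>X. dist x y < \<delta> \<longrightarrow> step (K x) (K y) \<in> carrier H \<and> h y = h x \<otimes> step (K x) (K y))"

lemma lift_atI:
  assumes "\<delta> > 0" "\<And>x. x \<in> X \<Longrightarrow> h x \<in> carrier H"
    "\<And>x y. x \<in> X \<Longrightarrow> y \<in> X \<Longrightarrow> dist x y < \<delta> \<Longrightarrow> step (K x) (K y) \<in> carrier H \<and> h y = h x \<otimes> step (K x) (K y)"
  shows "lift_at \<delta> K X h"
  unfolding lift_at_def
proof (intro conjI)
  show "\<forall>x\<in>X. h x \<in> carrier H" using assms(2) by (rule ballI)
  show "\<forall>x\<in>X. \<forall>y\<in>X. dist x y < \<delta> \<longrightarrow> step (K x) (K y) \<in> carrier H \<and> h y = h x \<otimes> step (K x) (K y)"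
    using assms(3) by (intro ballI impI)
qed (fact assms(1))

lemma lift_at_pos: "lift_at \<delta> K X h \<Longrightarrow> \<delta> > 0"
  and lift_at_closed: "lift_at \<delta> K X h \<Longrightarrow> x \<in> X \<Longrightarrow> h x \<in> carrier H"
  unfolding lift_at_def by (elim conjE, assumption) (elim conjE, erule (1) bspec)

lemma lift_at_step:
  assumes "lift_at \<delta> K X h" "x \<in> X" "y \<in> X" "dist x y < \<delta>"
  shows "step (K x) (K y) \<in> carrier H" "h y = h x \<otimes> step (K x) (K y)"
proof -
  have "\<forall>x\<in>X. \<forall>y\<in>X. dist x y < \<delta> \<longrightarrow> step (K x) (K y) \<in> carrier H \<and> h y = h x \<otimes> step (K x) (K y)"
    using assms(1) unfolding lift_at_def by (elim conjE)
  note * = this[THEN bspec, OF assms(2), THEN bspec, OF assms(3), THEN mp, OF assms(4)]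
  show "step (K x) (K y) \<in> carrier H" by (rule *[THEN conjunct1])
  show "h y = h x \<otimes> step (K x) (K y)" by (rule *[THEN conjunct2])
qed

text \<open>Lifting along the segments from a fixed point \<open>a\<close>, each cut into \<open>N\<close> pieces. Neighbouring segments form a
ladder whose small squares commute by the cocycle rule, so the result is a lift in all directions.\<close>

lemma lift_exists:
  fixes X :: "'c::euclidean_space set"
  assumes X: "compact X" "convex X" and K: "continuous_on X K" "K ` X \<subseteq> S"
  shows "\<exists>\<delta> h. lift_at \<delta> K X h"
proof (cases "X = {}")
  case True
  thus ?thesis by (auto simp: lift_at_def intro!: exI[of _ 1])
next
  case False
  then obtain a where a: "a \<in> X" by blast
  obtain \<delta> where \<delta>: "\<delta> > 0" "\<And>x. x \<in> X \<Longrightarrow> \<exists>z\<in>S. \<forall>y\<in>X. dist x y < \<delta> \<longrightarrow> near_fibre z (K y)"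
    using good_scale_exists[OF X(1) K] by (auto simp: good_scale_def)
  have coc: "step (K x) (K y) \<in> carrier H" "step (K x) (K y) \<otimes> step (K y) (K w) = step (K x) (K w)" "step (K x) (K x) = \<one>"
    if xyw: "x \<in> X" "y \<in> X" "w \<in> X" "dist x y < \<delta>" "dist x w < \<delta>" for x y w
  proof -
    obtain z where z: "\<forall>y\<in>X. dist x y < \<delta> \<longrightarrow> near_fibre z (K y)" using \<delta>(2)[OF xyw(1)] by blast
    have "near_fibre z (K x)" "near_fibre z (K y)" "near_fibre z (K w)" using z xyw \<delta>(1) by auto
    from step_mult[OF this] show "step (K x) (K y) \<in> carrier H"
      "step (K x) (K y) \<otimes> step (K y) (K w) = step (K x) (K w)" "step (K x) (K x) = \<one>" by auto
  qed
  obtain B where B: "\<forall>x\<in>X. dist a x \<le> B" using compact_imp_bounded[OF X(1)] bounded_any_center[of X a] by blast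
  define N where "N = nat \<lceil>2 * B / \<delta>\<rceil> + 1"
  have N: "real N > 2 * B / \<delta>" "N > 0" unfolding N_def by linarith+
  define p where "p = (\<lambda>n x. a + (real n / real N) *\<^sub>R (x - a))"
  have pX: "p n x \<in> X" if "n \<le> N" "x \<in> X" for n x
  proof -
    have "p n x = (1 - real n / real N) *\<^sub>R a + (real n / real N) *\<^sub>R x" by (simp add: p_def algebra_simps)
    thus ?thesis using convexD[OF X(2) a that(2), of "1 - real n / real N" "real n / real N"] that(1) N(2) by simp
  qed
  have pstep: "dist (p n x) (p (Suc n) x) < \<delta> / 2" if "x \<in> X" for n x
  proof -
    have "p (Suc n) x - p n x = (1 / real N) *\<^sub>R (x - a)" by (simp add: p_def add_divide_distrib scaleR_left_distrib)
    hence "norm (p (Suc n) x - p n x) = norm (x - a) / real N" by simp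
    hence "dist (p n x) (p (Suc n) x) = dist a x / real N" by (simp only: dist_norm norm_minus_commute)
    also have "\<dots> \<le> B / real N" using B that N(2) by (simp add: divide_right_mono)
    also have "\<dots> < \<delta> / 2" using N \<delta>(1) by (simp add: field_simps)
    finally show ?thesis .
  qed
  have pclose: "dist (p n x) (p n y) \<le> dist x y" if "n \<le> N" for n x y
  proof -
    have "p n x - p n y = (real n / real N) *\<^sub>R (x - y)" by (simp add: p_def algebra_simps)
    hence "dist (p n x) (p n y) = (real n / real N) * dist x y" by (simp add: dist_norm)
    also have "\<dots> \<le> 1 * dist x y" using that N(2) by (intro mult_right_mono) auto
    finally show ?thesis by simp
  qed
  define h where "h = rec_nat (\<lambda>x. \<one>) (\<lambda>n hn x. hn x \<otimes> step (K (p n x)) (K (p (Suc n) x)))"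
  have h0: "h 0 x = \<one>" and hS: "h (Suc n) x = h n x \<otimes> step (K (p n x)) (K (p (Suc n) x))" for n x
    by (simp_all add: h_def)
  have hC: "h n x \<in> carrier H" if "n \<le> N" "x \<in> X" for n x
    using that(1)
  proof (induction n)
    case (Suc n)
    have "step (K (p n x)) (K (p (Suc n) x)) \<in> carrier H"
      using coc(1)[of "p n x" "p (Suc n) x" "p n x"] pX[of n x] pX[of "Suc n" x] Suc.prems that pstep[OF that(2), of n] \<delta>(1)
      by simp
    thus ?case using Suc by (simp add: hS)
  qed (simp add: h0)
  have main: "step (K (p n x)) (K (p n y)) \<in> carrier H \<and> h n y = h n x \<otimes> step (K (p n x)) (K (p n y))"
    if xy: "x \<in> X" "y \<in> X" "dist x y < \<delta> / 2" and "n \<le> N" for n x y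
    using that(4)
  proof (induction n)
    case 0
    have "p 0 x = a" "p 0 y = a" by (simp_all add: p_def)
    thus ?case using coc(3)[OF a a a] \<delta>(1) by (simp add: h0)
  next
    case (Suc n)
    let ?a = "K (p n x)" and ?b = "K (p n y)" and ?c = "K (p (Suc n) x)" and ?d = "K (p (Suc n) y)"
    have inX: "p n x \<in> X" "p n y \<in> X" "p (Suc n) x \<in> X" "p (Suc n) y \<in> X" using pX xy Suc by auto
    have d1: "dist (p n x) (p n y) < \<delta> / 2" "dist (p (Suc n) x) (p (Suc n) y) < \<delta> / 2"
      using pclose[of n x y] pclose[of "Suc n" x y] Suc xy by auto
    have d2: "dist (p n x) (p (Suc n) x) < \<delta> / 2" "dist (p n y) (p (Suc n) y) < \<delta> / 2" using pstep xy by auto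
    have d3: "dist (p n x) (p (Suc n) y) < \<delta>" using dist_triangle[of "p n x" "p (Suc n) y" "p n y"] d1 d2 by simp
    have e1: "step ?a ?b \<otimes> step ?b ?d = step ?a ?d" and c1: "step ?a ?b \<in> carrier H"
      using coc(1,2)[OF inX(1,2,4)] d1 d3 \<delta>(1) by auto
    have e2: "step ?a ?c \<otimes> step ?c ?d = step ?a ?d" and c2: "step ?a ?c \<in> carrier H"
      using coc(1,2)[OF inX(1,3,4)] d2 d3 \<delta>(1) by auto
    have c3: "step ?c ?d \<in> carrier H" using coc(1)[OF inX(3,4,3)] d1 \<delta>(1) by auto
    have c4: "step ?b ?d \<in> carrier H" using coc(1)[OF inX(2,4,2)] d2 \<delta>(1) by auto
    have hx: "h n x \<in> carrier H" using hC Suc xy by simp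
    have "h (Suc n) y = (h n x \<otimes> step ?a ?b) \<otimes> step ?b ?d" using Suc by (simp add: hS)
    also have "\<dots> = h n x \<otimes> step ?a ?d" using hx c1 c4 e1 by (simp add: m_assoc)
    also have "\<dots> = h (Suc n) x \<otimes> step ?c ?d" using hx c2 c3 e2 by (simp add: hS m_assoc)
    finally show ?case using c3 by simp
  qed
  have "p N x = x" for x using N(2) by (simp add: p_def)
  hence main': "step (K x) (K y) \<in> carrier H \<and> h N y = h N x \<otimes> step (K x) (K y)"
    if "x \<in> X" "y \<in> X" "dist x y < \<delta> / 2" for x y using main[OF that order_refl] by simp
  have "lift_at (\<delta> / 2) K X (h N)"
    by (rule lift_atI) (use \<delta>(1) in simp, rule hC[OF order_refl], assumption, rule main')
  thus ?thesis by blast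
qed

text \<open>The quotient of two lifts is locally constant.\<close>

lemma lift_unique:
  assumes X: "connected X" and h: "lift_at \<delta> K X h" and h': "lift_at \<delta>' K X h'" and xy: "x \<in> X" "y \<in> X"
  shows "h' x \<otimes> inv (h x) = h' y \<otimes> inv (h y)"
proof (rule connected_local_const[OF X xy], intro ballI)
  fix a assume a: "a \<in> X"
  have d: "min \<delta> \<delta>' > 0" using lift_at_pos[OF h] lift_at_pos[OF h'] by simp
  have "h' a \<otimes> inv (h a) = h' b \<otimes> inv (h b)" if b: "b \<in> X" "dist b a < min \<delta> \<delta>'" for b
  proof -
    have ab: "dist a b < \<delta>" "dist a b < \<delta>'" using b(2) by (auto simp: dist_commute)
    note c = lift_at_closed[OF h a] lift_at_closed[OF h' a]
    note s = lift_at_step[OF h a b(1) ab(1)] lift_at_step[OF h' a b(1) ab(2)]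
    show ?thesis unfolding s(2,4) using s(1) c by (simp add: inv_mult_group m_assoc cancel)
  qed
  thus "eventually (\<lambda>b. h' a \<otimes> inv (h a) = h' b \<otimes> inv (h b)) (at a within X)"
    unfolding eventually_at using d by blast
qed

definition holonomy :: "(real \<Rightarrow> 'a) \<Rightarrow> 'h" where
  "holonomy p = (SOME t. \<exists>\<delta> h. lift_at \<delta> p {0..1} h \<and> t = inv (h 0) \<otimes> h 1)"

lemma holonomy_eq:
  assumes "lift_at \<delta> p {0..1} h" shows "holonomy p = inv (h 0) \<otimes> h 1"
proof -
  have "\<exists>t. \<exists>\<delta> h. lift_at \<delta> p {0..1} h \<and> t = inv (h 0) \<otimes> h 1" using assms by blast
  from someI_ex[OF this] obtain \<delta>' h' where h': "lift_at \<delta>' p {0..1} h'" "holonomy p = inv (h' 0) \<otimes> h' 1"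
    unfolding holonomy_def by blast
  have c: "h 0 \<in> carrier H" "h 1 \<in> carrier H" "h' 0 \<in> carrier H" "h' 1 \<in> carrier H"
    using lift_at_closed[OF assms] lift_at_closed[OF h'(1)] by auto
  have eq: "h' 0 \<otimes> inv (h 0) = h' 1 \<otimes> inv (h 1)" by (rule lift_unique[OF _ assms h'(1)]) auto
  have "h' 1 = (h' 1 \<otimes> inv (h 1)) \<otimes> h 1" using c by (simp add: m_assoc)
  also have "\<dots> = h' 0 \<otimes> (inv (h 0) \<otimes> h 1)" unfolding eq[symmetric] using c by (simp add: m_assoc)
  finally have "h' 1 = h' 0 \<otimes> (inv (h 0) \<otimes> h 1)" .
  hence "inv (h' 0) \<otimes> h' 1 = inv (h 0) \<otimes> h 1" using c by (simp add: cancel)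
  thus ?thesis using h'(2) by simp
qed

lemma path_lift: assumes "path p" "path_image p \<subseteq> S" shows "\<exists>\<delta> h. lift_at \<delta> p {0..1} h"
  using lift_exists[of "{0..1}" p] assms by (auto simp: path_def path_image_def)

lemma holonomy_closed: assumes "path p" "path_image p \<subseteq> S" shows "holonomy p \<in> carrier H"
proof -
  obtain \<delta> h where "lift_at \<delta> p {0..1} h" using path_lift[OF assms] by blast
  thus ?thesis using holonomy_eq lift_at_closed[of \<delta> p "{0..1}" h] by simp
qed

lemma lift_rescale:
  fixes K :: "real \<Rightarrow> 'a"
  assumes h: "lift_at \<delta> K X h" and m: "m ` Y \<subseteq> X" "\<And>s t. dist (m s) (m t) \<le> dist s t"
    and q: "\<And>t. t \<in> Y \<Longrightarrow> q t = K (m t)"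
  shows "lift_at \<delta> q Y (h \<circ> m)"
proof -
  have mX: "m t \<in> X" if "t \<in> Y" for t using m(1) that by blast
  show ?thesis
  proof (rule lift_atI)
    show "\<delta> > 0" by (rule lift_at_pos[OF h])
    show "(h \<circ> m) x \<in> carrier H" if "x \<in> Y" for x using lift_at_closed[OF h mX[OF that]] by simp
    fix s t assume st: "s \<in> Y" "t \<in> Y" "dist s t < \<delta>"
    have "dist (m s) (m t) < \<delta>" using m(2)[of s t] st(3) by simp
    from lift_at_step[OF h mX[OF st(1)] mX[OF st(2)] this]
    show "step (q s) (q t) \<in> carrier H \<and> (h \<circ> m) t = (h \<circ> m) s \<otimes> step (q s) (q t)"
      unfolding q[OF st(1)] q[OF st(2)] o_apply by blast
  qed
qed

lemma holonomy_join:
  assumes p: "path p" "path_image p \<subseteq> S" and q: "path q" "path_image q \<subseteq> S" and pq: "pathfinish p = pathstart q"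
  shows "holonomy (p +++ q) = holonomy p \<otimes> holonomy q"
proof -
  have "path (p +++ q)" "path_image (p +++ q) \<subseteq> S" using assms by (auto simp: subset_path_image_join)
  then obtain \<delta> h where h: "lift_at \<delta> (p +++ q) {0..1} h" using path_lift by blast
  have "lift_at \<delta> p {0..1} (h \<circ> (\<lambda>t. t / 2))"
    by (rule lift_rescale[OF h]) (auto simp: joinpaths_def dist_real_def)
  moreover have "lift_at \<delta> q {0..1} (h \<circ> (\<lambda>t. (t + 1) / 2))"
  proof (rule lift_rescale[OF h])
    show "dist ((s + 1) / 2) ((t + 1) / 2) \<le> dist s t" for s t :: real
      by (simp add: dist_real_def abs_if field_simps)
    have "2 * ((t + 1) / 2) - 1 = t" for t :: real by (simp add: field_simps)
    thus "q t = (p +++ q) ((t + 1) / 2)" if "t \<in> {0..1}" for t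
      using that pq by (cases "t = 0") (auto simp: joinpaths_def pathfinish_def pathstart_def)
  qed auto
  ultimately have "holonomy p = inv (h 0) \<otimes> h (1/2)" "holonomy q = inv (h (1/2)) \<otimes> h 1"
    using holonomy_eq by fastforce+
  moreover have "holonomy (p +++ q) = inv (h 0) \<otimes> h 1" by (rule holonomy_eq[OF h])
  moreover have "h 0 \<in> carrier H" "h (1/2) \<in> carrier H" "h 1 \<in> carrier H" using lift_at_closed[OF h] by auto
  ultimately show ?thesis by (simp add: m_assoc cancel)
qed

lemma holonomy_reverse:
  assumes p: "path p" "path_image p \<subseteq> S" shows "holonomy (reversepath p) = inv (holonomy p)"
proof -
  obtain \<delta> h where h: "lift_at \<delta> p {0..1} h" using path_lift p by blast
  have "lift_at \<delta> (reversepath p) {0..1} (h \<circ> (\<lambda>t. 1 - t))"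
    by (rule lift_rescale[OF h]) (auto simp: reversepath_def dist_real_def)
  from holonomy_eq[OF this] holonomy_eq[OF h] show ?thesis
    using lift_at_closed[OF h, of 0] lift_at_closed[OF h, of 1] by (simp add: inv_mult_group)
qed

lemma holonomy_homotopic:
  assumes "homotopic_paths S p q" shows "holonomy p = holonomy q"
proof -
  obtain K where K: "continuous_on ({0..1} \<times> {0..1}) K" "K ` ({0..1} \<times> {0..1}) \<subseteq> S"
    "\<forall>x\<in>{0..1}. K (0, x) = p x" "\<forall>x\<in>{0..1}. K (1, x) = q x"
    "\<forall>t\<in>{0..1::real}. K (t, 0) = p 0 \<and> K (t, 1) = p 1"
    using assms unfolding homotopic_paths by (auto simp: pathstart_def pathfinish_def)
  have "compact ({0..1::real} \<times> {0..1::real})" by (intro compact_Times compact_Icc)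
  moreover have "convex ({0..1::real} \<times> {0..1::real})" by (intro convex_Times convex_real_interval)
  ultimately have "\<exists>\<delta> h. lift_at \<delta> K ({0..1} \<times> {0..1}) h" by (rule lift_exists[OF _ _ K(1,2)])
  then obtain \<delta> h where h: "lift_at \<delta> K ({0..1} \<times> {0..1}) h" by blast
  have hor: "lift_at \<delta> r {0..1} (\<lambda>t. h (c, t))" if "c \<in> {0..1}" "\<forall>x\<in>{0..1}. K (c, x) = r x" for c r
  proof (rule lift_atI[OF lift_at_pos[OF h]])
    show "h (c, x) \<in> carrier H" if "x \<in> {0..1}" for x
      by (rule lift_at_closed[OF h]) (use that \<open>c \<in> {0..1}\<close> in simp)
    fix x y :: real assume xy: "x \<in> {0..1}" "y \<in> {0..1}" "dist x y < \<delta>"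
    have "(c, x) \<in> {0..1} \<times> {0..1}" "(c, y) \<in> {0..1} \<times> {0..1}" "dist (c, x) (c, y) < \<delta>"
      using xy that(1) by (simp_all add: dist_Pair_Pair)
    from lift_at_step[OF h this] that(2) xy
    show "step (r x) (r y) \<in> carrier H \<and> h (c, y) = h (c, x) \<otimes> step (r x) (r y)" by auto
  qed
  have "lift_at \<delta> p {0..1} (\<lambda>t. h (0, t))" "lift_at \<delta> q {0..1} (\<lambda>t. h (1, t))"
    using hor[of 0 p] hor[of 1 q] K(3,4) by auto
  hence 1: "holonomy p = inv (h (0, 0)) \<otimes> h (0, 1)" "holonomy q = inv (h (1, 0)) \<otimes> h (1, 1)"
    using holonomy_eq by auto
  have const: "h (0, c) = h (1, c)" if c: "c = 0 \<or> c = 1" for c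
  proof (rule connected_local_const[of "{0..1::real}" 0 1 "\<lambda>s. h (s, c)"])
    have "h (a, c) = h (b, c)" if ab: "a \<in> {0..1}" "b \<in> {0..1}" "dist b a < \<delta>" for a b
    proof -
      have in_sq: "(a, c) \<in> {0..1} \<times> {0..1}" "(b, c) \<in> {0..1} \<times> {0..1}" using ab c by auto
      have d: "dist (a, c) (b, c) < \<delta>" "dist (a, c) (a, c) < \<delta>"
        using ab lift_at_pos[OF h] by (simp_all add: dist_Pair_Pair dist_commute)
      note lift_at_step(2)[OF h in_sq d(1)] lift_at_step(2)[OF h in_sq(1,1) d(2)]
      moreover have "K (a, c) = K (b, c)" using K(5) ab c by auto
      ultimately show ?thesis by simp
    qed
    thus "\<forall>a\<in>{0..1}. eventually (\<lambda>b. h (a, c) = h (b, c)) (at a within {0..1})"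
      unfolding eventually_at using lift_at_pos[OF h] by blast
  qed auto
  show ?thesis using 1 const by simp
qed

text \<open>Along the image of a path \<open>c\<close> in the convex set a lift can be written down: the transition from \<open>c t\<close> to the
chosen sheet.\<close>

lemma holonomy_image:
  assumes c: "path c" "path_image c \<subseteq> D"
  shows "holonomy (f \<circ> c) = inv (transition (pathstart c) (sheet (f (pathstart c)))) \<otimes>
    transition (pathfinish c) (sheet (f (pathfinish c)))"
proof -
  have cD: "c t \<in> D" if "t \<in> {0..1}" for t using c that by (auto simp: path_image_def)
  have cc: "continuous_on {0..1} c" using c by (simp add: path_def)
  have fc: "continuous_on {0..1} (f \<circ> c)" "(f \<circ> c) ` {0..1} \<subseteq> S"
    using path_f[OF c] by (auto simp: path_def path_image_def)
  obtain \<delta>1 where \<delta>1: "\<delta>1 > 0" "\<forall>x\<in>{0..1}. \<exists>z\<in>S. \<forall>y\<in>{0..1}. dist x y < \<delta>1 \<longrightarrow> near_fibre z ((f \<circ> c) y)"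
    using good_scale_exists[OF _ fc] by (auto simp: good_scale_def)
  have "uniformly_continuous_on {0..1} c" using cc by (intro compact_uniformly_continuous) auto
  then obtain \<delta>2 where \<delta>2: "\<delta>2 > 0" "\<forall>x\<in>{0..1}. \<forall>y\<in>{0..1}. dist y x < \<delta>2 \<longrightarrow> dist (c y) (c x) < mesh"
    using mesh_pos unfolding uniformly_continuous_on_def by blast
  define h where "h = (\<lambda>t. transition (c t) (sheet (f (c t))))"
  have sh: "sheet (f (c t)) \<in> D" "f (sheet (f (c t))) = f (c t)" if "t \<in> {0..1}" for t
    using sheet[OF f_in[OF cD[OF that]]] by auto
  have "lift_at (min \<delta>1 \<delta>2) (f \<circ> c) {0..1} h"
    unfolding lift_at_def
  proof (intro conjI ballI impI)
    show "min \<delta>1 \<delta>2 > 0" using \<delta>1 \<delta>2 by simp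
    show "h x \<in> carrier H" if "x \<in> {0..1}" for x using cD sh that by (simp add: h_def)
  next
    fix s t :: real assume st: "s \<in> {0..1}" "t \<in> {0..1}" "dist s t < min \<delta>1 \<delta>2"
    obtain z where z: "\<forall>y\<in>{0..1}. dist s y < \<delta>1 \<longrightarrow> near_fibre z ((f \<circ> c) y)" using \<delta>1 st by blast
    have nf: "near_fibre z (f (c s))" "near_fibre z (f (c t))" using z st \<delta>1 by (auto simp del: mem_box)
    obtain d1 where d1: "d1 \<in> D" "f d1 = z" "dist (sheet (f (c s))) d1 < mesh" using nf(1) by (rule near_fibreE)
    obtain d4 where d4: "d4 \<in> D" "f d4 = z" "dist (sheet (f (c t))) d4 < mesh" using nf(2) by (rule near_fibreE)
    obtain d2 where d2: "d2 \<in> D" "f d2 = z" "dist (c s) d2 < mesh" using nf(1) cD[OF st(1)] unfolding near_fibre_def by blast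
    obtain d3 where d3: "d3 \<in> D" "f d3 = z" "dist (c t) d3 < mesh" using nf(2) cD[OF st(2)] unfolding near_fibre_def by blast
    have cst: "dist (c s) (c t) < mesh" using \<delta>2(2) st by auto
    have "dist d2 d3 < 3 * mesh"
      using dist_triangle[of d2 d3 "c s"] dist_triangle[of "c s" d3 "c t"] d2(3) d3(3) cst by (simp add: dist_commute)
    hence "transition d2 d2 = transition d2 d3"
      by (intro mesh) (use d2 d3 mesh_pos in \<open>auto simp: related_def\<close>)
    hence t23: "transition d2 d3 = \<one>" using d2 by simp
    have hs: "h s = transition d2 d1" unfolding h_def
      by (rule mesh) (use d1 d2 st cD sh mesh_pos in \<open>auto simp: related_def\<close>)
    have ht: "h t = transition d3 d4" unfolding h_def
      by (rule mesh) (use d3 d4 st cD sh mesh_pos in \<open>auto simp: related_def\<close>)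
    have stp: "step ((f \<circ> c) s) ((f \<circ> c) t) = transition d1 d4" unfolding step_def o_apply
      by (rule near_transition_eq) (use d1 d4 in \<open>auto simp: related_def\<close>)
    show "step ((f \<circ> c) s) ((f \<circ> c) t) \<in> carrier H" using stp d1 d4 by simp
    have "transition d3 d4 = transition d2 d3 \<otimes> transition d3 d4" using t23 d3 d4 by simp
    thus "h t = h s \<otimes> step ((f \<circ> c) s) ((f \<circ> c) t)" unfolding hs ht stp using d1 d2 d3 d4 by simp
  qed
  from holonomy_eq[OF this] show ?thesis by (simp add: h_def pathstart_def pathfinish_def)
qed

lemma holonomy_jump:
  assumes d: "d \<in> D" "d' \<in> D" "f d = f d'"
  shows "holonomy (spoke d +++ reversepath (spoke d')) = transition d d'"
proof -
  have seg: "path_image (linepath d0 e) \<subseteq> D" if "e \<in> D" for e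
    using convex_D d0 that by (simp add: convex_contains_segment)
  have s0: "sheet (f d0) = d0" by (simp add: sheet_def)
  have hol: "holonomy (spoke e) = transition e (sheet (f e))" if e: "e \<in> D" for e
    using holonomy_image[OF path_linepath seg[OF e]] s0 d0 sheet[OF f_in[OF e]] e by (simp add: spoke_def)
  have sh: "sheet (f d) \<in> D" using sheet f_in d by blast
  have "holonomy (spoke d +++ reversepath (spoke d')) = holonomy (spoke d) \<otimes> inv (holonomy (spoke d'))"
    using spoke_path[OF d(1)] spoke_path[OF d(2)] d(3) by (simp add: holonomy_join holonomy_reverse)
  also have "\<dots> = transition d d'" using hol d sh by simp
  finally show ?thesis .
qed

theorem holonomy_hom:
  "\<exists>\<phi>\<in>hom (fundamental_group S (f d0)) H. \<forall>d\<in>D. \<forall>d'\<in>D. f d = f d' \<longrightarrow> \<phi> (jump d d') = inv (\<eta> d) \<otimes> \<eta> d'"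
proof -
  define \<phi> where "\<phi> = (\<lambda>A. holonomy (SOME p. p \<in> A))"
  have \<phi>: "\<phi> (loop_class S (f d0) p) = holonomy p" if "p \<in> loops_at S (f d0)" for p
  proof -
    have "(SOME q. q \<in> loop_class S (f d0) p) \<in> loop_class S (f d0) p"
      by (rule someI[of "\<lambda>q. q \<in> loop_class S (f d0) p", OF loop_class_self[OF that]])
    hence "homotopic_paths S p (SOME q. q \<in> loop_class S (f d0) p)" by (simp add: loop_class_def)
    thus ?thesis unfolding \<phi>_def using holonomy_homotopic by metis
  qed
  have lp: "path p \<and> path_image p \<subseteq> S \<and> pathstart p = f d0 \<and> pathfinish p = f d0" if "p \<in> loops_at S (f d0)" for p
    using that by (simp add: loops_at_def)
  have "\<phi> \<in> hom (fundamental_group S (f d0)) H"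
  proof (rule homI)
    fix A assume "A \<in> carrier (fundamental_group S (f d0))"
    then obtain p where p: "p \<in> loops_at S (f d0)" "A = loop_class S (f d0) p" by (auto simp: fundamental_group_carrier)
    show "\<phi> A \<in> carrier H" unfolding p(2) \<phi>[OF p(1)] using lp[OF p(1)] holonomy_closed by blast
    fix B assume "B \<in> carrier (fundamental_group S (f d0))"
    then obtain q where q: "q \<in> loops_at S (f d0)" "B = loop_class S (f d0) q" by (auto simp: fundamental_group_carrier)
    show "\<phi> (A \<otimes>\<^bsub>fundamental_group S (f d0)\<^esub> B) = \<phi> A \<otimes> \<phi> B"
      unfolding p(2) q(2) fundamental_group_mult[OF p(1) q(1)] \<phi>[OF p(1)] \<phi>[OF q(1)] \<phi>[OF loops_at_join[OF p(1) q(1)]]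
      using holonomy_join lp[OF p(1)] lp[OF q(1)] by simp
  qed
  moreover have "\<phi> (jump d d') = inv (\<eta> d) \<otimes> \<eta> d'" if "d \<in> D" "d' \<in> D" "f d = f d'" for d d'
    unfolding jump_def \<phi>[OF jump_loop[OF that]] holonomy_jump[OF that] by (simp add: transition_def)
  ultimately show ?thesis by blast
qed

end

section \<open>Generation by jumps\<close>

lemma homotopic_join_reverse:
  assumes p: "path p" "path_image p \<subseteq> S"
  shows "homotopic_paths S (p +++ reversepath p) (\<lambda>_. pathstart p)"
  using homotopic_reverse_join[of "reversepath p" S] assms by simp

lemma homotopic_join_const:
  assumes p: "path p" "path_image p \<subseteq> S"
  shows "homotopic_paths S (p +++ (\<lambda>_. pathfinish p)) p"
proof -
  have "homotopic_paths S (p \<circ> (linepath 0 1 +++ linepath 1 1)) (p \<circ> linepath 0 1)"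
    by (rule homotopic_paths_rescale[OF p]) (auto simp: path_image_join closed_segment_eq_real_ivl)
  moreover have "p \<circ> (linepath 0 1 +++ linepath 1 1) = p +++ (\<lambda>_. pathfinish p)" "p \<circ> linepath 0 1 = p"
    by (auto simp: joinpaths_def linepath_def fun_eq_iff pathfinish_def)
  ultimately show ?thesis by simp
qed

lemma homotopic_cancel_right:
  assumes a: "path a" "path_image a \<subseteq> S" and k: "path k" "path_image k \<subseteq> S" and ak: "pathfinish a = pathstart k"
  shows "homotopic_paths S ((a +++ k) +++ reversepath k) a"
proof -
  have "homotopic_paths S (a +++ (k +++ reversepath k)) ((a +++ k) +++ reversepath k)"
    by (rule homotopic_paths_assoc) (use assms in auto)
  moreover have "homotopic_paths S (a +++ (k +++ reversepath k)) (a +++ (\<lambda>_. pathstart k))"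
    by (rule homotopic_paths_join[OF _ homotopic_join_reverse[OF k]]) (use assms in auto)
  moreover have "homotopic_paths S (a +++ (\<lambda>_. pathstart k)) a"
    using homotopic_join_const[OF a] ak by simp
  ultimately show ?thesis by (meson homotopic_paths_trans homotopic_paths_sym)
qed

definition discrepancy :: "'a::topological_space set \<Rightarrow> (real \<Rightarrow> 'a) \<Rightarrow> (real \<Rightarrow> 'a) \<Rightarrow> (real \<Rightarrow> 'a) set" where
  "discrepancy S a b = loop_class S (pathstart a) (a +++ reversepath b)"

definition parallel_paths :: "'a::topological_space set \<Rightarrow> (real \<Rightarrow> 'a) \<Rightarrow> (real \<Rightarrow> 'a) \<Rightarrow> bool" where
  "parallel_paths S a b \<longleftrightarrow> path a \<and> path_image a \<subseteq> S \<and> path b \<and> path_image b \<subseteq> S \<and>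
     pathstart a = pathstart b \<and> pathfinish a = pathfinish b"

lemma discrepancy_loop:
  assumes "parallel_paths S a b" shows "a +++ reversepath b \<in> loops_at S (pathstart a)"
proof (rule loops_atI)
  show "path_image (a +++ reversepath b) \<subseteq> S"
    by (rule subset_path_image_join) (use assms in \<open>auto simp: parallel_paths_def\<close>)
qed (use assms in \<open>auto simp: parallel_paths_def\<close>)

lemma discrepancy_homotopic:
  assumes ab: "parallel_paths S a b" and a: "homotopic_paths S a a'" and b: "homotopic_paths S b b'"
  shows "discrepancy S a b = discrepancy S a' b'"
proof -
  have ends: "pathstart a' = pathstart a" "pathfinish a' = pathfinish a" "pathstart b' = pathstart b" "pathfinish b' = pathfinish b"
    using homotopic_paths_imp_pathstart homotopic_paths_imp_pathfinish a b by metis+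
  have h: "homotopic_paths S (a +++ reversepath b) (a' +++ reversepath b')"
    by (rule homotopic_paths_join[OF a]) (use ab b in \<open>simp_all add: homotopic_paths_reversepath parallel_paths_def\<close>)
  have l: "a +++ reversepath b \<in> loops_at S (pathstart a)" by (rule discrepancy_loop[OF ab])
  have l': "a' +++ reversepath b' \<in> loops_at S (pathstart a)" by (rule loops_at_homotopic[OF l h])
  show ?thesis unfolding discrepancy_def ends using h loop_class_eq[OF l l'] by simp
qed

lemma discrepancy_mult:
  assumes ab: "parallel_paths S a b" and bc: "parallel_paths S b c"
  shows "discrepancy S a b \<otimes>\<^bsub>fundamental_group S (pathstart a)\<^esub> discrepancy S b c = discrepancy S a c"
proof -
  have st: "pathstart b = pathstart a" using ab by (simp add: parallel_paths_def)
  have ac: "parallel_paths S a c" using ab bc by (auto simp: parallel_paths_def)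
  note l1 = discrepancy_loop[OF ab] and l2 = discrepancy_loop[OF bc, unfolded st] and l3 = discrepancy_loop[OF ac]
  let ?x = "a +++ reversepath b"
  have x: "path ?x" "path_image ?x \<subseteq> S" using l1 by (auto simp: loops_at_def)
  have "homotopic_paths S (?x +++ (b +++ reversepath c)) ((?x +++ b) +++ reversepath c)"
    by (rule homotopic_paths_assoc) (use ab bc x in \<open>auto simp: parallel_paths_def\<close>)
  moreover have "homotopic_paths S (?x +++ b) a"
    using homotopic_cancel_right[of a S "reversepath b"] ab by (auto simp: parallel_paths_def)
  hence "homotopic_paths S ((?x +++ b) +++ reversepath c) (a +++ reversepath c)"
    by (rule homotopic_paths_join) (use ab bc in \<open>auto simp: parallel_paths_def\<close>)
  ultimately have "homotopic_paths S (?x +++ (b +++ reversepath c)) (a +++ reversepath c)"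
    by (rule homotopic_paths_trans)
  thus ?thesis unfolding discrepancy_def st fundamental_group_mult[OF l1 l2]
    using loop_class_eq[OF loops_at_join[OF l1 l2] l3] by simp
qed

lemma discrepancy_extend:
  assumes ab: "parallel_paths S a b" and k: "path k" "path_image k \<subseteq> S" "pathfinish a = pathstart k"
  shows "discrepancy S (a +++ k) (b +++ k) = discrepancy S a b" "parallel_paths S (a +++ k) (b +++ k)"
proof -
  have ab': "path a" "path_image a \<subseteq> S" "path b" "path_image b \<subseteq> S" "pathstart a = pathstart b" "pathfinish a = pathfinish b"
    using ab by (auto simp: parallel_paths_def)
  show par: "parallel_paths S (a +++ k) (b +++ k)"
    unfolding parallel_paths_def using ab' k by (simp add: path_image_join)
  have rev: "reversepath (b +++ k) = reversepath k +++ reversepath b"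
    by (rule reversepath_joinpaths) (use ab' k in auto)
  have ak: "path (a +++ k)" "path_image (a +++ k) \<subseteq> S" using par by (auto simp: parallel_paths_def)
  have "homotopic_paths S ((a +++ k) +++ (reversepath k +++ reversepath b)) (((a +++ k) +++ reversepath k) +++ reversepath b)"
    by (rule homotopic_paths_assoc) (use ab' k ak in auto)
  moreover have "homotopic_paths S (((a +++ k) +++ reversepath k) +++ reversepath b) (a +++ reversepath b)"
    by (rule homotopic_paths_join[OF homotopic_cancel_right]) (use ab' k in auto)
  ultimately have "homotopic_paths S ((a +++ k) +++ reversepath (b +++ k)) (a +++ reversepath b)"
    unfolding rev by (rule homotopic_paths_trans)
  thus "discrepancy S (a +++ k) (b +++ k) = discrepancy S a b"
    unfolding discrepancy_def using loop_class_eq[OF discrepancy_loop[OF par]] discrepancy_loop[OF ab] by simp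
qed

context glued_disc
begin

lemma f_convex_homotopic:
  assumes "path c" "path_image c \<subseteq> D" "path c'" "path_image c' \<subseteq> D" "pathstart c = pathstart c'" "pathfinish c = pathfinish c'"
  shows "homotopic_paths S (f \<circ> c) (f \<circ> c')"
  by (rule homotopic_paths_convex_image[OF convex_D cont_f]) (use assms f_image in auto)

lemma spoke_join:
  assumes u: "u \<in> D" and c: "path c" "path_image c \<subseteq> D" "pathstart c = u"
  shows "homotopic_paths S (spoke u +++ (f \<circ> c)) (spoke (pathfinish c))"
proof -
  have fin: "pathfinish c \<in> D" using c by (auto simp: path_image_def pathfinish_def)
  have seg: "path_image (linepath d0 e) \<subseteq> D" if "e \<in> D" for e
    using convex_D d0 that by (simp add: convex_contains_segment)
  have "homotopic_paths S (f \<circ> (linepath d0 u +++ c)) (f \<circ> linepath d0 (pathfinish c))"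
    by (rule f_convex_homotopic) (use c seg[OF u] seg[OF fin] in \<open>simp_all add: path_image_join\<close>)
  thus ?thesis by (simp add: spoke_def path_compose_join)
qed

lemma jump_discrepancy: "d \<in> D \<Longrightarrow> jump d d' = discrepancy S (spoke d) (spoke d')"
  using spoke_path by (simp add: jump_def discrepancy_def)

lemma spoke_parallel: "d \<in> D \<Longrightarrow> d' \<in> D \<Longrightarrow> f d = f d' \<Longrightarrow> parallel_paths S (spoke d) (spoke d')"
  using spoke_path by (simp add: parallel_paths_def)

lemma jump_closed: "d \<in> D \<Longrightarrow> d' \<in> D \<Longrightarrow> f d = f d' \<Longrightarrow> jump d d' \<in> carrier (fundamental_group S (f d0))"
  using jump_loop by (simp add: jump_def fundamental_group_carrier)

lemma jump_mult:
  assumes "d \<in> D" "d' \<in> D" "d'' \<in> D" "f d = f d'" "f d' = f d''"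
  shows "jump d d' \<otimes>\<^bsub>fundamental_group S (f d0)\<^esub> jump d' d'' = jump d d''"
  using discrepancy_mult[OF spoke_parallel[OF assms(1,2,4)] spoke_parallel[OF assms(2,3,5)]] assms spoke_path
  by (simp add: jump_discrepancy)

lemma jump_self: assumes "d \<in> D" shows "jump d d = \<one>\<^bsub>fundamental_group S (f d0)\<^esub>"
proof -
  interpret group "fundamental_group S (f d0)" by (rule group_fundamental_group) (use f_in d0 in blast)
  have "jump d d \<otimes>\<^bsub>fundamental_group S (f d0)\<^esub> jump d d = jump d d" using assms by (simp add: jump_mult)
  thus ?thesis using jump_closed[OF assms assms refl] by simp
qed

text \<open>Moving both ends along paths with the same image in the quotient does not change the jump: both spokes are
extended by the same path in the quotient, and in the convex set the extended spokes are homotopic to the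
spokes of the new ends.\<close>

lemma jump_slide:
  assumes c: "path c" "path_image c \<subseteq> D" and c': "path c'" "path_image c' \<subseteq> D"
    and same: "\<And>t. t \<in> {0..1} \<Longrightarrow> f (c t) = f (c' t)"
  shows "jump (pathstart c) (pathstart c') = jump (pathfinish c) (pathfinish c')"
proof -
  have in_D: "c t \<in> D" "c' t \<in> D" if "t \<in> {0..1}" for t using c c' that by (auto simp: path_image_def)
  let ?u = "pathstart c" and ?v = "pathstart c'"
  have uv: "?u \<in> D" "?v \<in> D" "f ?u = f ?v" using in_D same by (auto simp: pathstart_def)
  have wz: "pathfinish c \<in> D" using in_D by (simp add: pathfinish_def)
  note par = spoke_parallel[OF uv]
  have pf: "path (f \<circ> c)" "path_image (f \<circ> c) \<subseteq> S" using path_f[OF c] by auto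
  have k: "pathfinish (spoke ?u) = pathstart (f \<circ> c)" using spoke_path[OF uv(1)] by (simp add: pathstart_compose)
  have h1: "homotopic_paths S (spoke ?u +++ (f \<circ> c)) (spoke (pathfinish c))" by (rule spoke_join[OF uv(1) c refl])
  have "homotopic_paths S (f \<circ> c) (f \<circ> c')" by (rule homotopic_paths_eq[OF pf]) (use same in simp)
  hence "homotopic_paths S (spoke ?v +++ (f \<circ> c)) (spoke ?v +++ (f \<circ> c'))"
    by (intro homotopic_paths_join) (use spoke_path[OF uv(2)] uv(3) in \<open>auto simp: pathstart_compose\<close>)
  hence h2: "homotopic_paths S (spoke ?v +++ (f \<circ> c)) (spoke (pathfinish c'))"
    using spoke_join[OF uv(2) c' refl] by (rule homotopic_paths_trans)
  have "jump ?u ?v = discrepancy S (spoke ?u +++ (f \<circ> c)) (spoke ?v +++ (f \<circ> c))"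
    using discrepancy_extend(1)[OF par pf k] uv by (simp add: jump_discrepancy)
  also have "\<dots> = discrepancy S (spoke (pathfinish c)) (spoke (pathfinish c'))"
    by (rule discrepancy_homotopic[OF discrepancy_extend(2)[OF par pf k] h1 h2])
  finally show ?thesis using wz by (simp add: jump_discrepancy)
qed

text \<open>A contraction of \<open>V\<close> to \<open>z\<close> in the quotient that lifts to paths in the convex set from any given preimage.\<close>

definition contracts_in :: "'a \<Rightarrow> 'a set \<Rightarrow> bool" where
  "contracts_in z V \<longleftrightarrow> openin (top_of_set S) V \<and> z \<in> V \<and>
    (\<exists>C. continuous_on ({0..1} \<times> V) C \<and> C ` ({0..1} \<times> V) \<subseteq> S \<and>
      (\<forall>u\<in>D. f u \<in> V \<longrightarrow> (\<exists>c. path c \<and> path_image c \<subseteq> D \<and> pathstart c = u \<and> f (pathfinish c) = z \<and>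
         (\<forall>s\<in>{0..1}. f (c s) = C (s, f u)))))"

text \<open>The two ways around the square swept out by the path \<open>q\<close> during the contraction; its far side is constant.\<close>

lemma homotopic_to_track:
  assumes q: "path q" "path_image q \<subseteq> V" and C: "continuous_on ({0..1} \<times> V) C" "C ` ({0..1} \<times> V) \<subseteq> S"
    and z: "\<And>x. x \<in> V \<Longrightarrow> C (1, x) = z" and id: "\<And>x. x \<in> V \<Longrightarrow> C (0, x) = x"
  shows "homotopic_paths S (q +++ (\<lambda>s. C (s, pathfinish q))) (\<lambda>s. C (s, pathstart q))"
proof -
  have qV: "q t \<in> V" if "t \<in> {0..1}" for t using q that by (auto simp: path_image_def)
  define K where "K = (\<lambda>x. C (fst x, q (snd x)))"
  let ?Q = "{0..1::real} \<times> {0..1::real}"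
  have cont: "continuous_on ?Q K"
    unfolding K_def
  proof (rule continuous_on_compose2[OF C(1)])
    show "continuous_on ?Q (\<lambda>x. (fst x, q (snd x)))"
      by (intro continuous_on_Pair continuous_on_fst continuous_on_id
          continuous_on_compose2[OF q(1)[unfolded path_def]] continuous_on_snd) auto
  qed (use qV in auto)
  have conv: "convex ?Q" by (intro convex_Times convex_real_interval)
  have img: "K ` ?Q \<subseteq> S"
  proof
    fix y assume "y \<in> K ` ?Q"
    then obtain s t where "s \<in> {0..1}" "t \<in> {0..1}" "y = C (s, q t)" by (auto simp: K_def)
    thus "y \<in> S" using C(2) qV by blast
  qed
  have corner: "(0, 0) \<in> ?Q" "(0, 1) \<in> ?Q" "(1, 0) \<in> ?Q" "(1, 1) \<in> ?Q" by auto
  have seg: "path_image (linepath x y) \<subseteq> ?Q" if "x \<in> ?Q" "y \<in> ?Q" for x y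
    using closed_segment_subset[OF that conv] by simp
  have h: "homotopic_paths S (K \<circ> (linepath (0, 0) (0, 1) +++ linepath (0, 1) (1, 1)))
      (K \<circ> (linepath (0, 0) (1, 0) +++ linepath (1, 0) (1, 1)))"
    by (rule homotopic_paths_convex_image[OF conv cont img])
      (use seg corner in \<open>simp_all add: path_image_join del: path_image_linepath mem_Sigma_iff\<close>)
  have lp: "K \<circ> linepath (0, 0) (0, 1) = (\<lambda>t. C (0, q t))" "K \<circ> linepath (0, 1) (1, 1) = (\<lambda>s. C (s, q 1))"
    "K \<circ> linepath (0, 0) (1, 0) = (\<lambda>s. C (s, q 0))" "K \<circ> linepath (1, 0) (1, 1) = (\<lambda>t. C (1, q t))"
    by (auto simp: fun_eq_iff K_def linepath_def)
  let ?l = "\<lambda>s. C (s, q 0)" and ?r = "\<lambda>s. C (s, q 1)"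
  have pl: "path ?l" "path_image ?l \<subseteq> S" and pr: "path ?r" "path_image ?r \<subseteq> S"
  proof -
    have "path (K \<circ> linepath (0, 0) (1, 0))" "path (K \<circ> linepath (0, 1) (1, 1))"
      by (rule path_continuous_image[OF path_linepath continuous_on_subset[OF cont seg]]; use corner in simp)+
    thus "path ?l" "path ?r" by (simp_all add: lp)
    show "path_image ?l \<subseteq> S" "path_image ?r \<subseteq> S" using C(2) qV by (auto simp: path_image_def image_subset_iff)
  qed
  have qS: "path_image q \<subseteq> S"
  proof
    fix y assume "y \<in> path_image q"
    hence "y \<in> V" using q by blast
    hence "C (0, y) \<in> S" using C(2) by (intro subsetD[OF C(2)] imageI) auto
    thus "y \<in> S" using id[OF \<open>y \<in> V\<close>] by simp
  qed
  have e1: "homotopic_paths S (q +++ ?r) ((\<lambda>t. C (0, q t)) +++ ?r)"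
  proof (rule homotopic_paths_eq)
    show "path (q +++ ?r)" using q(1) pr(1) id[OF qV[of 1]] by (simp add: pathfinish_def pathstart_def)
    show "path_image (q +++ ?r) \<subseteq> S" using qS pr(2) by (rule subset_path_image_join)
    show "(q +++ ?r) t = ((\<lambda>t. C (0, q t)) +++ ?r) t" if "t \<in> {0..1}" for t
      using that qV[of "2 * t"] id by (auto simp: joinpaths_def)
  qed
  have e2: "homotopic_paths S (?l +++ (\<lambda>_. pathfinish ?l)) (?l +++ (\<lambda>t. C (1, q t)))"
  proof (rule homotopic_paths_eq)
    show "path (?l +++ (\<lambda>_. pathfinish ?l))" "path_image (?l +++ (\<lambda>_. pathfinish ?l)) \<subseteq> S"
      using homotopic_join_const[OF pl] homotopic_paths_imp_path homotopic_paths_imp_subset by blast+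
    show "(?l +++ (\<lambda>_. pathfinish ?l)) t = (?l +++ (\<lambda>t. C (1, q t))) t" if "t \<in> {0..1}" for t
      using that qV[of 0] qV[of "2 * t - 1"] z by (auto simp: joinpaths_def pathfinish_def)
  qed
  have "homotopic_paths S ((\<lambda>t. C (0, q t)) +++ ?r) (?l +++ (\<lambda>t. C (1, q t)))"
    using h unfolding path_compose_join lp .
  from homotopic_paths_trans[OF e1 this] homotopic_paths_sym[OF e2]
  have "homotopic_paths S (q +++ ?r) (?l +++ (\<lambda>_. pathfinish ?l))" by (rule homotopic_paths_trans)
  thus ?thesis using homotopic_join_const[OF pl] unfolding pathstart_def pathfinish_def
    by (rule homotopic_paths_trans)
qed

text \<open>Follow a loop \<open>p\<close> and compare its initial portion up to \<open>t\<close> with a spoke to a point over \<open>p t\<close>: let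
\<open>\<Phi> t\<close> say that this difference lies in the subgroup \<open>P\<close>, for every such point. While \<open>p\<close> stays in
a contractible set \<open>V z\<close>, the portion can be pushed along the contraction into the fibre of \<open>z\<close>, where spokes
differ by jumps. So \<open>\<Phi>\<close> is locally constant. It holds at \<open>0\<close>, where the difference is a jump, and at
\<open>1\<close> it says that the class of \<open>p\<close> is in \<open>P\<close>.\<close>

theorem generated_by_jumps:
  assumes contr: "\<And>z. z \<in> S \<Longrightarrow> \<exists>V. contracts_in z V"
    and P: "subgroup P (fundamental_group S (f d0))"
    and jumps: "\<And>d d'. d \<in> D \<Longrightarrow> d' \<in> D \<Longrightarrow> f d = f d' \<Longrightarrow> jump d d' \<in> P"
  shows "carrier (fundamental_group S (f d0)) \<subseteq> P"
proof
  let ?G = "fundamental_group S (f d0)"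
  have x0: "f d0 \<in> S" using f_in d0 by blast
  interpret group ?G by (rule group_fundamental_group[OF x0])
  fix A assume "A \<in> carrier ?G"
  then obtain p where p: "p \<in> loops_at S (f d0)" "A = loop_class S (f d0) p" by (auto simp: fundamental_group_carrier)
  have pp: "path p" "path_image p \<subseteq> S" "p 0 = f d0" "p 1 = f d0" using p by (auto simp: loops_at_def pathstart_def pathfinish_def)
  obtain V where V: "\<And>z. z \<in> S \<Longrightarrow> contracts_in z (V z)" using contr by metis
  obtain \<delta> where \<delta>: "\<delta> > 0" "\<forall>x\<in>{0..1}. \<exists>z\<in>S. \<forall>y\<in>{0..1}. dist x y < \<delta> \<longrightarrow> p y \<in> V z"
  proof -
    have "\<exists>\<delta>>0. \<forall>x\<in>{0..1}. \<exists>z\<in>S. \<forall>y\<in>{0..1}. dist x y < \<delta> \<longrightarrow> p y \<in> V z"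
      by (rule uniform_fibre_neighbourhood) (use pp V in \<open>auto simp: path_def path_image_def contracts_in_def\<close>)
    thus ?thesis using that by blast
  qed
  let ?portion = "\<lambda>s t. p \<circ> linepath s t"
  have sub: "path (?portion s t)" "path_image (?portion s t) \<subseteq> p ` {min s t..max s t}" "path_image (?portion s t) \<subseteq> S"
    "pathstart (?portion s t) = p s" "pathfinish (?portion s t) = p t"
    if "s \<in> {0..1}" "t \<in> {0..1}" for s t
  proof -
    have seg: "closed_segment s t = {min s t..max s t}" by (auto simp: closed_segment_eq_real_ivl)
    have sub01: "closed_segment s t \<subseteq> {0..1}" using that by (auto simp: seg)
    show "path (?portion s t)"
      by (rule path_continuous_image) (use pp(1) sub01 in \<open>auto simp: path_def intro: continuous_on_subset\<close>)
    show im: "path_image (?portion s t) \<subseteq> p ` {min s t..max s t}" by (simp add: path_image_compose seg)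
    have "p ` {min s t..max s t} \<subseteq> S"
      using order_trans[OF image_mono[OF sub01[unfolded seg]] pp(2)[unfolded path_image_def]] .
    with im show "path_image (?portion s t) \<subseteq> S" by (rule order_trans)
  qed (auto simp: pathstart_compose pathfinish_compose)
  define \<Phi> where "\<Phi> = (\<lambda>t. \<forall>u\<in>D. f u = p t \<longrightarrow> discrepancy S (?portion 0 t) (spoke u) \<in> P)"
  have step: "\<Phi> t" if st: "s \<in> {0..1}" "t \<in> {0..1}" and z: "z \<in> S" "p ` {min s t..max s t} \<subseteq> V z" and \<Phi>: "\<Phi> s" for s t z
    unfolding \<Phi>_def
  proof (intro ballI impI)
    fix u assume u: "u \<in> D" "f u = p t"
    obtain C where C: "continuous_on ({0..1} \<times> V z) C" "C ` ({0..1} \<times> V z) \<subseteq> S"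
      "\<forall>u\<in>D. f u \<in> V z \<longrightarrow> (\<exists>c. path c \<and> path_image c \<subseteq> D \<and> pathstart c = u \<and> f (pathfinish c) = z \<and>
         (\<forall>s\<in>{0..1}. f (c s) = C (s, f u)))"
      using V[OF z(1)] unfolding contracts_in_def by (elim exE conjE) (rule that; assumption)
    have VS: "V z \<subseteq> S" using V[OF z(1)] unfolding contracts_in_def by (elim conjE) (rule openin_imp_subset)
    have lift: thesis if "w \<in> D" "f w \<in> V z" and
      *: "\<And>c. path c \<Longrightarrow> path_image c \<subseteq> D \<Longrightarrow> pathstart c = w \<Longrightarrow> f (pathfinish c) = z \<Longrightarrow>
         \<forall>s\<in>{0..1}. f (c s) = C (s, f w) \<Longrightarrow> thesis" for w thesis
      using C(3)[rule_format, OF that(1,2)] by (elim exE conjE) (rule *)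
    have Cends: "C (0, x) = x \<and> C (1, x) = z" if x: "x \<in> V z" for x
    proof -
      have "x \<in> f ` D" unfolding f_image using VS x by (rule subsetD)
      then obtain v where v: "x = f v" "v \<in> D" by (rule imageE)
      show ?thesis
      proof (rule lift[OF v(2)])
        show "f v \<in> V z" using x v by simp
        fix c assume c: "pathstart c = v" "f (pathfinish c) = z" "\<forall>s\<in>{0..1}. f (c s) = C (s, f v)"
        have "f (c 0) = C (0, f v)" "f (c 1) = C (1, f v)" using c(3) by simp_all
        thus ?thesis using v c(1,2) by (simp add: pathstart_def pathfinish_def)
      qed
    qed
    have ps: "p s \<in> V z" "p t \<in> V z" using z(2) by auto
    obtain v where v: "v \<in> D" "f v = p s"
    proof -
      have "p s \<in> f ` D" unfolding f_image using VS ps(1) by (rule subsetD)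
      thus ?thesis using that by (auto elim: imageE)
    qed
    obtain cu where cu: "path cu" "path_image cu \<subseteq> D" "pathstart cu = u" "f (pathfinish cu) = z"
      "\<forall>s\<in>{0..1}. f (cu s) = C (s, p t)"
    proof (rule lift[OF u(1)])
      show "f u \<in> V z" using u ps by simp
    qed (rule that; simp add: u)
    obtain cv where cv: "path cv" "path_image cv \<subseteq> D" "pathstart cv = v" "f (pathfinish cv) = z"
      "\<forall>s'\<in>{0..1}. f (cv s') = C (s', p s)"
    proof (rule lift[OF v(1)])
      show "f v \<in> V z" using v ps by simp
    qed (rule that; simp add: v)
    have zero: "(0::real) \<in> {0..1}" by simp
    let ?a = "?portion 0 s" and ?b = "?portion 0 t" and ?q = "?portion s t"
    note a = sub[OF zero st(1)] and b = sub[OF zero st(2)] and q = sub[OF st]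
    have ku: "path (f \<circ> cu)" "path_image (f \<circ> cu) \<subseteq> S" "pathstart (f \<circ> cu) = p t"
      and kv: "path (f \<circ> cv)" "path_image (f \<circ> cv) \<subseteq> S" "pathstart (f \<circ> cv) = p s"
      using path_f[OF cu(1,2)] path_f[OF cv(1,2)] cu(3) cv(3) u v by (auto simp: pathstart_compose)
    have qV: "path_image ?q \<subseteq> V z" using q(2) z(2) by blast
    have track: "homotopic_paths S (?q +++ (\<lambda>s. C (s, p t))) (\<lambda>s'. C (s', p s))"
      using homotopic_to_track[OF q(1) qV C(1,2)] Cends q(4,5) by simp
    have eu: "homotopic_paths S (f \<circ> cu) (\<lambda>s. C (s, p t))" by (rule homotopic_paths_eq[OF ku(1,2)]) (use cu in simp)
    have ev: "homotopic_paths S (f \<circ> cv) (\<lambda>s'. C (s', p s))" by (rule homotopic_paths_eq[OF kv(1,2)]) (use cv in simp)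
    have "homotopic_paths S (?q +++ (f \<circ> cu)) (?q +++ (\<lambda>s. C (s, p t)))"
      by (rule homotopic_paths_join[OF _ eu]) (use q ku in auto)
    from homotopic_paths_trans[OF homotopic_paths_trans[OF this track] homotopic_paths_sym[OF ev]]
    have quv: "homotopic_paths S (?q +++ (f \<circ> cu)) (f \<circ> cv)" .
    have "homotopic_paths S (p \<circ> (linepath 0 s +++ linepath s t)) (p \<circ> linepath 0 t)"
      by (rule homotopic_paths_rescale[OF pp(1,2)])
        (use st in \<open>auto simp: path_image_join closed_segment_eq_real_ivl split: if_splits\<close>)
    hence "homotopic_paths S ?b (?a +++ ?q)"
      by (simp add: path_compose_join homotopic_paths_sym)
    hence "homotopic_paths S (?b +++ (f \<circ> cu)) ((?a +++ ?q) +++ (f \<circ> cu))"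
      by (rule homotopic_paths_join) (use b ku in auto)
    moreover have "homotopic_paths S (?a +++ (?q +++ (f \<circ> cu))) ((?a +++ ?q) +++ (f \<circ> cu))"
      by (rule homotopic_paths_assoc) (use a q ku in auto)
    moreover have "homotopic_paths S (?a +++ (?q +++ (f \<circ> cu))) (?a +++ (f \<circ> cv))"
      by (rule homotopic_paths_join[OF _ quv]) (use a q ku in auto)
    ultimately have bu: "homotopic_paths S (?b +++ (f \<circ> cu)) (?a +++ (f \<circ> cv))"
      by (meson homotopic_paths_trans homotopic_paths_sym)
    have p0: "pathstart ?a = f d0" "pathstart ?b = f d0" using a b pp by auto
    have parb: "parallel_paths S ?b (spoke u)" using b spoke_path[OF u(1)] u pp by (simp add: parallel_paths_def)
    have para: "parallel_paths S ?a (spoke v)" using a spoke_path[OF v(1)] v pp by (simp add: parallel_paths_def)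
    let ?du = "pathfinish cu" and ?dv = "pathfinish cv"
    have du: "?du \<in> D" "?dv \<in> D" using cu(2) cv(2) by (auto simp: path_image_def pathfinish_def)
    have fin_b: "pathfinish ?b = pathstart (f \<circ> cu)" "pathfinish ?a = pathstart (f \<circ> cv)" using a b ku kv by auto
    have e1: "discrepancy S ?b (spoke u) = discrepancy S (?b +++ (f \<circ> cu)) (spoke u +++ (f \<circ> cu))"
      by (rule discrepancy_extend(1)[OF parb ku(1,2) fin_b(1), symmetric])
    have e2: "\<dots> = discrepancy S (?a +++ (f \<circ> cv)) (spoke ?du)"
      by (rule discrepancy_homotopic[OF discrepancy_extend(2)[OF parb ku(1,2) fin_b(1)] bu spoke_join[OF u(1) cu(1,2,3)]])
    have par3: "parallel_paths S (?a +++ (f \<circ> cv)) (spoke v +++ (f \<circ> cv))"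
      by (rule discrepancy_extend(2)[OF para kv(1,2) fin_b(2)])
    have e3: "discrepancy S ?a (spoke v) = discrepancy S (?a +++ (f \<circ> cv)) (spoke ?dv)"
      using discrepancy_extend(1)[OF para kv(1,2) fin_b(2)]
        discrepancy_homotopic[OF par3 _ spoke_join[OF v(1) cv(1,2,3)]] par3 by (simp add: parallel_paths_def)
    have par4: "parallel_paths S (?a +++ (f \<circ> cv)) (spoke ?dv)"
      using par3 spoke_path[OF du(2)] p0 unfolding parallel_paths_def by (simp add: pathfinish_compose)
    have par5: "parallel_paths S (spoke ?dv) (spoke ?du)" by (rule spoke_parallel) (use du cu cv in auto)
    have "discrepancy S (?a +++ (f \<circ> cv)) (spoke ?du) =
        discrepancy S (?a +++ (f \<circ> cv)) (spoke ?dv) \<otimes>\<^bsub>?G\<^esub> discrepancy S (spoke ?dv) (spoke ?du)"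
      using discrepancy_mult[OF par4 par5] p0 by simp
    also have "\<dots> = discrepancy S ?a (spoke v) \<otimes>\<^bsub>?G\<^esub> jump ?dv ?du" using e3 du by (simp add: jump_discrepancy)
    finally have "discrepancy S ?b (spoke u) = discrepancy S ?a (spoke v) \<otimes>\<^bsub>?G\<^esub> jump ?dv ?du" using e1 e2 by simp
    moreover have "discrepancy S ?a (spoke v) \<in> P" using \<Phi> v by (auto simp: \<Phi>_def)
    moreover have "jump ?dv ?du \<in> P" by (rule jumps) (use du cu cv in auto)
    ultimately show "discrepancy S ?b (spoke u) \<in> P" using subgroup.m_closed[OF P] by simp
  qed
  have "\<Phi> 0 = \<Phi> 1"
  proof (rule connected_local_const[of "{0..1::real}" 0 1])
    have "\<Phi> s = \<Phi> t" if st: "s \<in> {0..1}" "t \<in> {0..1}" "dist t s < \<delta>" for s t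
    proof -
      obtain z where z: "z \<in> S" "\<forall>y\<in>{0..1}. dist s y < \<delta> \<longrightarrow> p y \<in> V z" using \<delta>(2) st(1) by blast
      have "p ` {min s t..max s t} \<subseteq> V z"
      proof
        fix y assume "y \<in> p ` {min s t..max s t}"
        then obtain x where x: "x \<in> {min s t..max s t}" "y = p x" by blast
        hence "x \<in> {0..1}" "dist s x < \<delta>" using st by (auto simp: dist_real_def min_def max_def split: if_splits)
        thus "y \<in> V z" using z(2) x by blast
      qed
      thus ?thesis using step[OF st(1,2) z(1)] step[OF st(2,1) z(1)] by (auto simp: min.commute max.commute)
    qed
    thus "\<forall>a\<in>{0..1}. eventually (\<lambda>b. \<Phi> a = \<Phi> b) (at a within {0..1})"
      unfolding eventually_at using \<delta>(1) by blast
  qed auto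
  moreover have "\<Phi> 0"
    unfolding \<Phi>_def
  proof (intro ballI impI)
    fix u assume u: "u \<in> D" "f u = p 0"
    have "spoke d0 = ?portion 0 0" using pp by (auto simp: spoke_def fun_eq_iff linepath_def simp flip: scaleR_add_left)
    thus "discrepancy S (?portion 0 0) (spoke u) \<in> P"
      using jumps[OF d0 u(1)] u(2) pp(3) d0 by (simp add: jump_discrepancy)
  qed
  ultimately have "discrepancy S (?portion 0 1) (spoke d0) \<in> P" using d0 pp unfolding \<Phi>_def by simp
  moreover have "?portion 0 1 = p" by (simp add: fun_eq_iff linepath_def)
  ultimately have 1: "discrepancy S p (spoke d0) \<in> P" by simp
  have "reversepath (spoke d0) = (\<lambda>_. f d0)"
    by (auto simp: spoke_def fun_eq_iff linepath_def reversepath_def simp flip: scaleR_add_left)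
  hence "discrepancy S p (spoke d0) = loop_class S (f d0) (p +++ (\<lambda>_. f d0))"
    using pp by (simp add: discrepancy_def pathstart_def)
  moreover have "homotopic_paths S (p +++ (\<lambda>_. f d0)) p"
    using homotopic_join_const[OF pp(1,2)] pp(4) by (simp add: pathfinish_def)
  moreover have "p +++ (\<lambda>_. f d0) \<in> loops_at S (f d0)" by (rule loops_at_join[OF p(1) loops_at_const[OF x0]])
  ultimately show "A \<in> P" using 1 p loop_class_eq by metis
qed

end

section \<open>The side identifications of the polygon\<close>

text \<open>The boundary parametrised by the line with period \<open>4 * g\<close>, so that the corners are the integers.\<close>

definition boundary_point :: "nat \<Rightarrow> real \<Rightarrow> complex" where
  "boundary_point g s = cis (2 * pi * s / real (4 * g))"

lemma polygon_side_boundary: "polygon_side g k t = boundary_point g (real k + t)"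
  by (simp add: polygon_side_def boundary_point_def)

lemma norm_boundary_point [simp]: "norm (boundary_point g s) = 1"
  by (simp add: boundary_point_def)

lemma boundary_point_nonzero [simp]: "boundary_point g s \<noteq> 0"
  by (simp add: boundary_point_def)

lemma continuous_boundary_point: "continuous_on A h \<Longrightarrow> continuous_on A (\<lambda>x. boundary_point g (h x))"
  unfolding boundary_point_def by (simp only: divide_inverse) (intro continuous_intros)

lemma boundary_point_eq_iff:
  assumes "g \<ge> 1"
  shows "boundary_point g s = boundary_point g s' \<longleftrightarrow> (\<exists>m::int. s = s' + real (4 * g) * of_int m)"
proof -
  have g: "real (4 * g) > 0" using assms by simp
  have "boundary_point g s = boundary_point g s' \<longleftrightarrow>
      (\<exists>m::int. 2 * pi * s / real (4 * g) = 2 * pi * s' / real (4 * g) + 2 * pi * of_int m)"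
    unfolding boundary_point_def complex_eq_iff cis.sel using sin_cos_eq_iff[of "2 * pi * s / real (4 * g)" "2 * pi * s' / real (4 * g)"]
    by (auto simp: mult.commute)
  moreover have "2 * pi * s / real (4 * g) = 2 * pi * s' / real (4 * g) + 2 * pi * of_int m \<longleftrightarrow> s = s' + real (4 * g) * of_int m" for m
  proof -
    have "2 * pi * s / real (4 * g) = 2 * pi * s' / real (4 * g) + 2 * pi * of_int m \<longleftrightarrow>
      2 * pi / real (4 * g) * s = 2 * pi / real (4 * g) * (s' + real (4 * g) * of_int m)"
      using g by (simp add: field_simps)
    also have "\<dots> \<longleftrightarrow> s = s' + real (4 * g) * of_int m" using g by simp
    finally show ?thesis .
  qed
  ultimately show ?thesis by presburger
qed

lemma boundary_point_inj:
  assumes "g \<ge> 1" "boundary_point g s = boundary_point g s'" "\<bar>s - s'\<bar> < real (4 * g)"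
  shows "s = s'"
proof -
  obtain m :: int where m: "s = s' + real (4 * g) * of_int m" using assms boundary_point_eq_iff by blast
  hence "real (4 * g) * \<bar>of_int m\<bar> < real (4 * g) * 1" using assms(3) by (simp add: abs_mult)
  hence "\<bar>of_int m :: real\<bar> < 1" using mult_less_cancel_left_pos[of "real (4 * g)"] assms(1) by simp
  hence "m = 0" by linarith
  thus ?thesis using m by simp
qed

lemma boundary_point_period: "g \<ge> 1 \<Longrightarrow> boundary_point g (real (4 * g)) = boundary_point g 0"
  using boundary_point_eq_iff[of g "real (4 * g)" 0] by (auto intro!: exI[of _ 1])

definition partner :: "nat \<Rightarrow> nat" where
  "partner k = 4 * (k div 4) + (k mod 4 + 2) mod 4"

lemma partner_cases:
  obtains i where "k = 4 * i" "partner k = 4 * i + 2" | i where "k = 4 * i + 1" "partner k = 4 * i + 3"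
  | i where "k = 4 * i + 2" "partner k = 4 * i" | i where "k = 4 * i + 3" "partner k = 4 * i + 1"
proof -
  have "k mod 4 < 4" "k = 4 * (k div 4) + k mod 4" by auto
  then consider "k = 4 * (k div 4)" "k mod 4 = 0" | "k = 4 * (k div 4) + 1" "k mod 4 = 1"
    | "k = 4 * (k div 4) + 2" "k mod 4 = 2" | "k = 4 * (k div 4) + 3" "k mod 4 = 3" by linarith
  thus thesis using that[of "k div 4"] by cases (auto simp: partner_def)
qed

lemma partner_add: "r < 4 \<Longrightarrow> partner (4 * i + r) = 4 * i + (r + 2) mod 4"
  by (simp add: partner_def)

lemma partner_partner [simp]: "partner (partner k) = k"
proof -
  have "(k mod 4 + 2) mod 4 < 4" by simp
  hence "partner (partner k) = 4 * (k div 4) + ((k mod 4 + 2) mod 4 + 2) mod 4"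
    unfolding partner_def[of k] by (rule partner_add)
  also have "((k mod 4 + 2) mod 4 + 2) mod 4 = k mod 4" by (simp add: mod_simps)
  finally show ?thesis by simp
qed

lemma partner_less: "k < 4 * g \<Longrightarrow> partner k < 4 * g"
proof -
  assume "k < 4 * g"
  hence "k div 4 < g" by auto
  moreover have "(k mod 4 + 2) mod 4 < 4" by simp
  ultimately show ?thesis unfolding partner_def by linarith
qed

text \<open>The symmetric form of the side pairing.\<close>

definition glued :: "nat \<Rightarrow> complex \<Rightarrow> complex \<Rightarrow> bool" where
  "glued g x y \<longleftrightarrow> (\<exists>k<4 * g. \<exists>t\<in>{0..1}. x = boundary_point g (real k + t) \<and>
     y = boundary_point g (real (partner k) + (1 - t)))"

lemma glued_sym: "glued g x y \<Longrightarrow> glued g y x"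
  unfolding glued_def
proof (elim exE bexE conjE)
  fix k t assume "k < 4 * g" "t \<in> {0..1::real}" "x = boundary_point g (real k + t)" "y = boundary_point g (real (partner k) + (1 - t))"
  thus "\<exists>k<4 * g. \<exists>t\<in>{0..1}. y = boundary_point g (real k + t) \<and> x = boundary_point g (real (partner k) + (1 - t))"
    by (intro exI[of _ "partner k"] conjI bexI[of _ "1 - t"] partner_less) auto
qed

lemma glued_iff_side_pairing: "glued g x y \<longleftrightarrow> side_pairing g x y \<or> side_pairing g y x"
proof
  assume "glued g x y"
  then obtain k t where k: "k < 4 * g" "t \<in> {0..1}" "x = boundary_point g (real k + t)"
    "y = boundary_point g (real (partner k) + (1 - t))" unfolding glued_def by blast
  show "side_pairing g x y \<or> side_pairing g y x"
  proof (rule partner_cases[of k])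
    fix i assume i: "k = 4 * i" "partner k = 4 * i + 2"
    have "side_pairing g x y"
      using side_pairing.intros[of i g 0 t] k i by (simp add: polygon_side_boundary)
    thus ?thesis ..
  next
    fix i assume i: "k = 4 * i + 1" "partner k = 4 * i + 3"
    have "side_pairing g x y"
      using side_pairing.intros[of i g 1 t] k i by (simp add: polygon_side_boundary numeral_3_eq_3)
    thus ?thesis ..
  next
    fix i assume i: "k = 4 * i + 2" "partner k = 4 * i"
    have "side_pairing g y x"
      using side_pairing.intros[of i g 0 "1 - t"] k i by (simp add: polygon_side_boundary)
    thus ?thesis ..
  next
    fix i assume i: "k = 4 * i + 3" "partner k = 4 * i + 1"
    have "side_pairing g y x"
      using side_pairing.intros[of i g 1 "1 - t"] k i by (simp add: polygon_side_boundary numeral_3_eq_3)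
    thus ?thesis ..
  qed
next
  have "side_pairing g x y \<Longrightarrow> glued g x y" for x y
  proof (induction rule: side_pairing.induct)
    case (1 i j t)
    hence "partner (4 * i + j) = 4 * i + j + 2" by (auto simp: partner_def)
    moreover have "4 * i + j < 4 * g" using 1 by linarith
    ultimately show ?case unfolding glued_def polygon_side_boundary using 1
      by (intro exI[of _ "4 * i + j"] conjI bexI[of _ t]) simp_all
  qed
  thus "side_pairing g x y \<or> side_pairing g y x \<Longrightarrow> glued g x y" using glued_sym by blast
qed

definition corner :: "nat \<Rightarrow> complex \<Rightarrow> bool" where
  "corner g x \<longleftrightarrow> (\<exists>k<4 * g. x = boundary_point g (real k))"

lemma corner_boundary_point:
  assumes "g \<ge> 1" "k \<le> 4 * g" shows "corner g (boundary_point g (real k))"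
proof (cases "k = 4 * g")
  case True
  thus ?thesis using boundary_point_period[OF assms(1)] assms(1) unfolding corner_def by (intro exI[of _ 0]) auto
next
  case False
  thus ?thesis using assms(2) unfolding corner_def by (intro exI[of _ k]) simp
qed

lemma corner_iff:
  assumes g: "g \<ge> 1" and k: "k < 4 * g" and t: "t \<in> {0..1}"
  shows "corner g (boundary_point g (real k + t)) \<longleftrightarrow> t = 0 \<or> t = 1"
proof
  assume "corner g (boundary_point g (real k + t))"
  then obtain l where l: "l < 4 * g" "boundary_point g (real k + t) = boundary_point g (real l)" by (auto simp: corner_def)
  then obtain m :: int where "real k + t = real l + real (4 * g) * of_int m" using boundary_point_eq_iff[OF g] by blast
  hence "t = of_int (int l + int (4 * g) * m - int k)" by simp
  moreover from this t have "int l + int (4 * g) * m - int k = 0 \<or> int l + int (4 * g) * m - int k = 1"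
    by (smt (verit) atLeastAtMost_iff of_int_0_le_iff of_int_le_1_iff)
  ultimately show "t = 0 \<or> t = 1" by (metis of_int_0 of_int_1)
next
  assume "t = 0 \<or> t = 1"
  thus "corner g (boundary_point g (real k + t))"
    using corner_boundary_point[OF g, of k] corner_boundary_point[OF g, of "Suc k"] k by (auto simp: add.commute)
qed

lemma glued_corner:
  assumes g: "g \<ge> 1" and "glued g x y" shows "corner g x \<longleftrightarrow> corner g y"
proof -
  obtain k t where k: "k < 4 * g" "t \<in> {0..1}" "x = boundary_point g (real k + t)"
    "y = boundary_point g (real (partner k) + (1 - t))" using assms unfolding glued_def by blast
  have t: "1 - t \<in> {0..1}" using k(2) by simp
  show ?thesis unfolding k(3,4) using corner_iff[OF g k(1,2)] corner_iff[OF g partner_less[OF k(1)] t] by auto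
qed

text \<open>A point that is not a corner lies on one side only, and so it has only one partner.\<close>

lemma glued_unique:
  assumes g: "g \<ge> 1" and xy: "glued g x y" and yz: "glued g y z" and y: "\<not> corner g y"
  shows "x = z"
proof -
  obtain k t where k: "k < 4 * g" "t \<in> {0..1}" "x = boundary_point g (real k + t)"
    "y = boundary_point g (real (partner k) + (1 - t))" using xy unfolding glued_def by blast
  obtain l u where l: "l < 4 * g" "u \<in> {0..1}" "y = boundary_point g (real l + u)"
    "z = boundary_point g (real (partner l) + (1 - u))" using yz unfolding glued_def by blast
  have p: "partner k < 4 * g" using k by (simp add: partner_less)
  have t: "1 - t \<in> {0..1}" using k(2) by simp
  have "t \<noteq> 0" "t \<noteq> 1" "u \<noteq> 0" "u \<noteq> 1"
    using y corner_iff[OF g p t] corner_iff[OF g l(1,2)] unfolding k(4)[symmetric] l(3)[symmetric] by auto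
  hence tu: "0 < t" "t < 1" "0 < u" "u < 1" using k(2) l(2) by auto
  have "real (partner k) + (1 - t) = real l + u"
  proof (rule boundary_point_inj[OF g])
    have "real (partner k) + 1 \<le> real (4 * g)" "real l + 1 \<le> real (4 * g)" using p l(1) by linarith+
    thus "\<bar>real (partner k) + (1 - t) - (real l + u)\<bar> < real (4 * g)" using tu by linarith
  qed (use k l in simp)
  moreover from this have "partner k = l" using tu by linarith
  ultimately show "x = z" using k l by (metis add_left_cancel add_diff_cancel_left' diff_add_cancel partner_partner diff_diff_eq2)
qed

text \<open>In block \<open>i\<close> the identifications of the ends of the sides form the chain from corner \<open>4 * i\<close> to
\<open>4 * i + 3\<close>, \<open>4 * i + 2\<close>, \<open>4 * i + 1\<close> and \<open>4 * i + 4\<close>; the blocks are linked at their common corners.\<close>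

lemma corners_identified:
  assumes g: "g \<ge> 1" shows "k \<le> 4 * g \<Longrightarrow> equivclp (side_pairing g) (boundary_point g 0) (boundary_point g (real k))"
proof -
  let ?E = "equivclp (side_pairing g)" and ?c = "\<lambda>k. boundary_point g (real k)"
  have E: "?E x y" if "glued g x y" for x y using that unfolding glued_iff_side_pairing by blast
  have step: "?E (?c k) (?c (partner k + 1))" if "k < 4 * g" for k
    by (rule E) (use that in \<open>auto simp: glued_def add.commute intro!: exI[of _ k] bexI[of _ 0]\<close>)
  have trans: "?E x y \<Longrightarrow> ?E y z \<Longrightarrow> ?E x z" for x y z using transp_equivclp by (rule transpD)
  have block: "?E (?c (4 * i)) (?c (4 * i + 3)) \<and> ?E (?c (4 * i)) (?c (4 * i + 2)) \<and> ?E (?c (4 * i)) (?c (4 * i + 1))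
      \<and> ?E (?c (4 * i)) (?c (4 * i + 4))" if "i < g" for i
  proof -
    have par: "partner (4 * i) + 1 = 4 * i + 3" "partner (4 * i + 3) + 1 = 4 * i + 2" "partner (4 * i + 2) + 1 = 4 * i + 1"
      "partner (4 * i + 1) + 1 = 4 * i + 4" unfolding partner_def by presburger+
    have lt: "4 * i < 4 * g" "4 * i + 3 < 4 * g" "4 * i + 2 < 4 * g" "4 * i + 1 < 4 * g" using that by auto
    note 1 = step[OF lt(1), unfolded par]
    note 2 = trans[OF 1 step[OF lt(2), unfolded par]]
    note 3 = trans[OF 2 step[OF lt(3), unfolded par]]
    note 4 = trans[OF 3 step[OF lt(4), unfolded par]]
    show ?thesis by (intro conjI 1 2 3 4)
  qed
  have base: "?E (?c 0) (?c (4 * i))" if "i \<le> g" for i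
    using that
  proof (induction i)
    case (Suc i)
    have i: "i < g" "i \<le> g" using Suc.prems by auto
    have "?E (?c 0) (?c (4 * i + 4))" by (rule trans[OF Suc.IH[OF i(2)] block[OF i(1), THEN conjunct2, THEN conjunct2, THEN conjunct2]])
    moreover have "4 * i + 4 = 4 * Suc i" by simp
    ultimately show ?case by simp
  qed simp
  assume k: "k \<le> 4 * g"
  show ?thesis
  proof (cases "k = 4 * g")
    case True
    thus ?thesis using base[of g] by simp
  next
    case False
    hence i: "k div 4 < g" using k by auto
    have "k = 4 * (k div 4) \<or> k = 4 * (k div 4) + 1 \<or> k = 4 * (k div 4) + 2 \<or> k = 4 * (k div 4) + 3" by presburger
    hence "?E (?c (4 * (k div 4))) (?c k)"
    proof (elim disjE)
      assume "k = 4 * (k div 4)"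
      hence "?c (4 * (k div 4)) = ?c k" by (rule arg_cong[OF sym])
      thus ?thesis by simp
    qed (use block[OF i] in metis)+
    moreover have "?E (?c 0) (?c (4 * (k div 4)))" by (rule base) (use i in simp)
    ultimately show ?thesis using trans[of "?c 0" "?c (4 * (k div 4))" "?c k"] by simp
  qed
qed

text \<open>The right-hand side is already transitive, since chains of identifications can only continue at corners.\<close>

theorem polygon_identifications:
  assumes g: "g \<ge> 1"
  shows "equivclp (side_pairing g) x y \<longleftrightarrow> x = y \<or> glued g x y \<or> corner g x \<and> corner g y"
proof
  assume "equivclp (side_pairing g) x y"
  thus "x = y \<or> glued g x y \<or> corner g x \<and> corner g y"
  proof (induction rule: equivclp_induct)
    case (step y z)
    hence yz: "glued g y z" by (simp add: glued_iff_side_pairing)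
    from step.IH consider "x = y" | "glued g x y" "\<not> corner g y" | "glued g x y" "corner g y" | "corner g x" "corner g y" by blast
    thus ?case
    proof cases
      case 2
      thus ?thesis using glued_unique[OF g _ yz] by blast
    qed (use yz glued_corner[OF g] in blast)+
  qed simp
next
  have "equivclp (side_pairing g) x y" if c: "corner g x" "corner g y"
  proof -
    obtain k where "k < 4 * g" "x = boundary_point g (real k)" using c(1) unfolding corner_def by auto
    moreover obtain l where "l < 4 * g" "y = boundary_point g (real l)" using c(2) unfolding corner_def by auto
    ultimately show ?thesis using corners_identified[OF g, of k] corners_identified[OF g, of l]
      by (meson equivclp_sym equivclp_trans less_imp_le)
  qed
  moreover have "equivclp (side_pairing g) x y" if "glued g x y" using that unfolding glued_iff_side_pairing by blast
  ultimately show "x = y \<or> glued g x y \<or> corner g x \<and> corner g y \<Longrightarrow> equivclp (side_pairing g) x y" by auto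
qed

definition polygon_pieces :: "nat \<Rightarrow> (complex \<times> complex) set set" where
  "polygon_pieces g = {(\<lambda>x. (x, x)) ` cball 0 1} \<union>
     (\<lambda>k. (\<lambda>t. (boundary_point g (real k + t), boundary_point g (real (partner k) + (1 - t)))) ` {0..1}) ` {..<4 * g} \<union>
     (\<lambda>(k, l). {(boundary_point g (real k), boundary_point g (real l))}) ` ({..<4 * g} \<times> {..<4 * g})"

locale polygon_surface =
  fixes g :: nat and f :: "complex \<Rightarrow> 'a::topological_space" and S :: "'a set" and d0 :: complex
  assumes g: "g \<ge> 1" and d0_disc: "d0 \<in> cball 0 1"
    and quotient_disc: "quotient_map (top_of_set (cball 0 1)) (top_of_set S) f"
    and fibres: "\<And>x y. x \<in> cball 0 1 \<Longrightarrow> y \<in> cball 0 1 \<Longrightarrow> f x = f y \<longleftrightarrow> equivclp (side_pairing g) x y"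
begin

lemma same_image_iff:
  "x \<in> cball 0 1 \<Longrightarrow> y \<in> cball 0 1 \<Longrightarrow> f x = f y \<longleftrightarrow> x = y \<or> glued g x y \<or> corner g x \<and> corner g y"
  using fibres polygon_identifications[OF g] by simp

sublocale glued_disc "cball 0 1" f S d0 "polygon_pieces g"
proof
  show "finite (polygon_pieces g)" by (simp add: polygon_pieces_def)
  show "compact P" if "P \<in> polygon_pieces g" for P
    using that unfolding polygon_pieces_def
    by (auto intro!: compact_continuous_image continuous_intros continuous_boundary_point)
  have gl: "x \<in> cball 0 1 \<and> y \<in> cball 0 1" if "glued g x y" for x y using that by (auto simp: glued_def)
  have co: "x \<in> cball 0 1" if "corner g x" for x using that by (auto simp: corner_def)
  have "\<Union>(polygon_pieces g) = {(x, y). x = y \<and> x \<in> cball 0 1} \<union> {(x, y). glued g x y} \<union> {(x, y). corner g x \<and> corner g y}"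
    unfolding polygon_pieces_def Union_Un_distrib
  proof (intro arg_cong2[where f = "(\<union>)"])
    show "\<Union>((\<lambda>k. (\<lambda>t. (boundary_point g (real k + t), boundary_point g (real (partner k) + (1 - t)))) ` {0..1}) ` {..<4 * g})
        = {(x, y). glued g x y}"
      unfolding glued_def by (auto simp del: atLeastAtMost_iff)
    show "\<Union>((\<lambda>(k, l). {(boundary_point g (real k), boundary_point g (real l))}) ` ({..<4 * g} \<times> {..<4 * g}))
        = {(x, y). corner g x \<and> corner g y}"
      unfolding corner_def by auto
  qed auto+
  moreover have "{(x, y). x = y \<and> x \<in> cball 0 1} \<union> {(x, y). glued g x y} \<union> {(x, y). corner g x \<and> corner g y}
      = {(x, y). x \<in> cball 0 1 \<and> y \<in> cball 0 1 \<and> f x = f y}"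
  proof (rule Set.set_eqI)
    fix p :: "complex \<times> complex"
    obtain x y where p: "p = (x, y)" by (cases p)
    show "p \<in> {(x, y). x = y \<and> x \<in> cball 0 1} \<union> {(x, y). glued g x y} \<union> {(x, y). corner g x \<and> corner g y}
      \<longleftrightarrow> p \<in> {(x, y). x \<in> cball 0 1 \<and> y \<in> cball 0 1 \<and> f x = f y}"
      unfolding p Un_iff mem_Collect_eq prod.case using gl[of x y] co[of x] co[of y] same_image_iff[of x y] by metis
  qed
  ultimately show "\<Union>(polygon_pieces g) = {(x, y). x \<in> cball 0 1 \<and> y \<in> cball 0 1 \<and> f x = f y}" by (rule trans)
qed (use d0_disc quotient_disc in auto)

end

section \<open>Local contractibility of the surface\<close>

context glued_disc
begin

text \<open>Contractions \<open>e d\<close> of the discs around the points \<open>d\<close> of one fibre, compatible with the identifications,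
descend to the quotient. Continuity of the descended homotopy uses that the product of a quotient map with
the identity of the compact interval is a quotient map.\<close>

lemma contracts_inI:
  fixes e :: "'b \<Rightarrow> real \<Rightarrow> 'b \<Rightarrow> 'b"
  assumes z: "z \<in> S" and r: "r > 0"
    and sep: "\<And>d d'. d \<in> D \<Longrightarrow> d' \<in> D \<Longrightarrow> f d = z \<Longrightarrow> f d' = z \<Longrightarrow> d \<noteq> d' \<Longrightarrow> 2 * r \<le> dist d d'"
    and cont: "\<And>d. d \<in> D \<Longrightarrow> f d = z \<Longrightarrow> continuous_on ({0..1} \<times> (D \<inter> ball d r)) (\<lambda>x. e d (fst x) (snd x))"
    and maps: "\<And>d s u. d \<in> D \<Longrightarrow> f d = z \<Longrightarrow> u \<in> D \<Longrightarrow> dist u d < r \<Longrightarrow> s \<in> {0..1} \<Longrightarrow> e d s u \<in> D"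
    and ends: "\<And>d u. d \<in> D \<Longrightarrow> f d = z \<Longrightarrow> u \<in> D \<Longrightarrow> dist u d < r \<Longrightarrow> e d 0 u = u \<and> e d 1 u = d"
    and compat: "\<And>d d' s u u'. d \<in> D \<Longrightarrow> f d = z \<Longrightarrow> d' \<in> D \<Longrightarrow> f d' = z \<Longrightarrow> u \<in> D \<Longrightarrow> u' \<in> D \<Longrightarrow>
      dist u d < r \<Longrightarrow> dist u' d' < r \<Longrightarrow> f u = f u' \<Longrightarrow> s \<in> {0..1} \<Longrightarrow> f (e d s u) = f (e d' s u')"
  shows "\<exists>V. contracts_in z V"
proof -
  obtain V where V: "openin (top_of_set S) V" "z \<in> V" "\<forall>u\<in>D. f u \<in> V \<longrightarrow> (\<exists>d\<in>D. f d = z \<and> dist u d < r)"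
    using fibre_neighbourhood[OF z r] by (elim exE conjE) (rule that; assumption)
  define W where "W = {u \<in> D. f u \<in> V}"
  define centre where "centre = (\<lambda>u. SOME d. d \<in> D \<and> f d = z \<and> dist u d < r)"
  define \<mu> where "\<mu> = (\<lambda>x. e (centre (snd x)) (fst x) (snd x))"
  have WD: "W \<subseteq> D" by (auto simp: W_def)
  have centre: "centre u \<in> D \<and> f (centre u) = z \<and> dist u (centre u) < r" if "u \<in> W" for u
  proof -
    have "\<exists>d. d \<in> D \<and> f d = z \<and> dist u d < r" using V(3) that unfolding W_def by blast
    thus ?thesis unfolding centre_def by (rule someI_ex)
  qed
  have centre_eq: "centre u = d" if "u \<in> W" "d \<in> D" "f d = z" "dist u d < r" for u d
  proof (rule ccontr)
    assume ne: "centre u \<noteq> d"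
    have "2 * r \<le> dist (centre u) d" using sep[OF _ that(2) _ that(3) ne] centre[OF that(1)] by blast
    thus False using centre[OF that(1)] that(4) dist_triangle2[of "centre u" d u] by (simp add: dist_commute)
  qed
  have cont_\<mu>: "continuous_on ({0..1} \<times> W) \<mu>"
    unfolding continuous_on_eq_continuous_within
  proof
    fix a :: "real \<times> 'b" assume a: "a \<in> {0..1} \<times> W"
    define d where "d = centre (snd a)"
    have d: "d \<in> D" "f d = z" "dist (snd a) d < r" using centre[of "snd a"] a by (auto simp: d_def)
    have "continuous_on ({0..1} \<times> (W \<inter> ball d r)) (\<lambda>x. e d (fst x) (snd x))"
      by (rule continuous_on_subset[OF cont[OF d(1,2)]]) (use WD in auto)
    moreover have "e d (fst x) (snd x) = \<mu> x" if "x \<in> {0..1} \<times> (W \<inter> ball d r)" for x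
    proof -
      have "snd x \<in> W" "dist (snd x) d < r" using that by (auto simp: dist_commute)
      thus ?thesis unfolding \<mu>_def using centre_eq[OF _ d(1,2)] by simp
    qed
    ultimately have "continuous_on ({0..1} \<times> (W \<inter> ball d r)) \<mu>" by (rule continuous_on_eq)
    moreover have "a \<in> {0..1} \<times> (W \<inter> ball d r)" using a d by (auto simp: dist_commute)
    ultimately have "continuous (at a within {0..1} \<times> (W \<inter> ball d r)) \<mu>"
      unfolding continuous_on_eq_continuous_within by (rule bspec)
    moreover have "at a within {0..1} \<times> (W \<inter> ball d r) = at a within {0..1} \<times> W"
      by (rule at_within_nhd[of _ "UNIV \<times> ball d r"]) (use a d in \<open>auto simp: dist_commute open_Times\<close>)
    ultimately show "continuous (at a within {0..1} \<times> W) \<mu>" by simp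
  qed
  have \<mu>_in: "\<mu> (s, u) \<in> D" if "s \<in> {0..1}" "u \<in> W" for s u
    unfolding \<mu>_def using maps centre[OF that(2)] that WD by auto
  define C where "C = (\<lambda>x. f (\<mu> (fst x, SOME u. u \<in> D \<and> f u = snd x)))"
  have C: "C (s, f u) = f (\<mu> (s, u))" if s: "s \<in> {0..1}" and u: "u \<in> W" for s u
  proof -
    define v where "v = (SOME v. v \<in> D \<and> f v = f u)"
    have "\<exists>v. v \<in> D \<and> f v = f u" using u WD by blast
    hence v: "v \<in> D \<and> f v = f u" unfolding v_def by (rule someI_ex)
    hence vW: "v \<in> W" using u by (simp add: W_def)
    show ?thesis unfolding C_def \<mu>_def fst_conv snd_conv v_def[symmetric]
      using compat[of "centre v" "centre u" v u s] centre[OF u] centre[OF vW] v u WD s by blast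
  qed
  have quotW: "quotient_map (top_of_set W) (top_of_set V) f"
  proof -
    have VS: "S \<inter> V = V" "D \<inter> W = W" using openin_imp_subset[OF V(1)] WD by auto
    have "quotient_map (subtopology (top_of_set D) W) (subtopology (top_of_set S) V) f"
      by (rule quotient_map_restriction[OF quotient]) (use V(1) in \<open>auto simp: W_def\<close>)
    thus ?thesis by (simp add: subtopology_subtopology VS)
  qed
  have "quotient_map (prod_topology (top_of_set {0..1::real}) (top_of_set W))
      (prod_topology (top_of_set {0..1}) (top_of_set V)) (\<lambda>(x, y). (x, f y))"
    by (rule quotient_map_prod_right[OF _ _ quotW])
      (auto intro!: compact_imp_locally_compact_space disjI1 Hausdorff_space_subtopology simp: compact_space_subtopology)
  hence q: "quotient_map (top_of_set ({0..1::real} \<times> W)) (top_of_set ({0..1} \<times> V)) (\<lambda>(x, y). (x, f y))" by simp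
  have "continuous_on ({0..1} \<times> W) (f \<circ> \<mu>)"
    by (rule continuous_on_compose[OF cont_\<mu>], rule continuous_on_subset[OF cont_f]) (use \<mu>_in in auto)
  hence "continuous_on ({0..1} \<times> W) (C \<circ> (\<lambda>(x, y). (x, f y)))"
    by (rule continuous_on_eq) (use C in auto)
  hence "continuous_map (top_of_set ({0..1} \<times> W)) euclidean (C \<circ> (\<lambda>(x, y). (x, f y)))" by simp
  from continuous_compose_quotient_map[OF q this] have cont_C: "continuous_on ({0..1} \<times> V) C" by simp
  have surj: "\<exists>u\<in>W. f u = y" if "y \<in> V" for y
    using that openin_imp_subset[OF V(1)] f_image unfolding W_def by blast
  show ?thesis
    unfolding contracts_in_def
  proof (intro exI[of _ V] exI[of _ C] conjI ballI impI cont_C V(1,2))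
    show "C ` ({0..1} \<times> V) \<subseteq> S"
    proof
      fix y assume "y \<in> C ` ({0..1} \<times> V)"
      then obtain s w where "s \<in> {0..1}" "w \<in> V" "y = C (s, w)" by auto
      moreover from surj[OF this(2)] obtain u where "u \<in> W" "f u = w" by auto
      ultimately show "y \<in> S" using C[of s u] f_in[OF \<mu>_in[of s u]] by simp
    qed
    fix u assume u: "u \<in> D" "f u \<in> V"
    hence uW: "u \<in> W" by (simp add: W_def)
    have "continuous_on {0..1} (\<lambda>s. \<mu> (s, u))"
      by (rule continuous_on_compose2[OF cont_\<mu>]) (use uW in \<open>auto intro!: continuous_intros\<close>)
    hence "path (\<lambda>s. \<mu> (s, u))" by (simp add: path_def)
    moreover have "path_image (\<lambda>s. \<mu> (s, u)) \<subseteq> D" using \<mu>_in[OF _ uW] by (auto simp: path_image_def)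
    moreover have "pathstart (\<lambda>s. \<mu> (s, u)) = u" "f (pathfinish (\<lambda>s. \<mu> (s, u))) = z"
      using centre[OF uW] ends[of "centre u" u] u(1) by (auto simp: pathstart_def pathfinish_def \<mu>_def)
    moreover have "\<forall>s\<in>{0..1}. f (\<mu> (s, u)) = C (s, f u)" using C[OF _ uW] by simp
    ultimately show "\<exists>c. path c \<and> path_image c \<subseteq> D \<and> pathstart c = u \<and> f (pathfinish c) = z \<and> (\<forall>s\<in>{0..1}. f (c s) = C (s, f u))"
      by (intro exI[of _ "\<lambda>s. \<mu> (s, u)"] conjI)
  qed
qed

end

lemma boundary_point_divide: "boundary_point g s / boundary_point g s0 = boundary_point g (s - s0)"
  by (simp add: boundary_point_def cis_divide diff_divide_distrib right_diff_distrib)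

lemma dist_boundary_point_cong:
  assumes "\<bar>s - s'\<bar> = \<bar>t - t'\<bar>"
  shows "dist (boundary_point g s) (boundary_point g s') = dist (boundary_point g t) (boundary_point g t')"
proof -
  have "dist (boundary_point g a) (boundary_point g b) = norm (boundary_point g (a - b) - 1)" for a b
  proof -
    have "boundary_point g a - boundary_point g b = boundary_point g b * (boundary_point g (a - b) - 1)"
      by (simp add: boundary_point_divide[symmetric] algebra_simps)
    thus ?thesis by (simp add: dist_norm norm_mult)
  qed
  moreover have "norm (boundary_point g (- a) - 1) = norm (boundary_point g a - 1)" for a
  proof -
    have "boundary_point g (- a) - 1 = cnj (boundary_point g a - 1)" by (simp add: boundary_point_def cis_cnj)
    thus ?thesis by (simp only: complex_mod_cnj)
  qed
  moreover have "s - s' = t - t' \<or> s - s' = - (t - t')" using assms by linarith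
  ultimately show ?thesis by metis
qed

text \<open>Powers of \<open>u / d\<close> contract a neighbourhood of the boundary point \<open>d\<close> in the disc. On the boundary they act
linearly in the angle, which makes them compatible with the side identifications, as these are isometries
of the angle.\<close>

lemma angular_contraction:
  assumes g: "g \<ge> 1" and s: "\<bar>s - s0\<bar> \<le> 1"
  shows "boundary_point g s0 * exp (of_real c * Ln (boundary_point g s / boundary_point g s0)) =
    boundary_point g (s0 + c * (s - s0))"
proof -
  define \<theta> where "\<theta> = 2 * pi * (s - s0) / real (4 * g)"
  have "\<bar>\<theta>\<bar> = 2 * pi / real (4 * g) * \<bar>s - s0\<bar>" by (simp add: \<theta>_def abs_mult)
  also have "\<dots> \<le> 2 * pi / real (4 * g) * 1" by (intro mult_left_mono s) simp
  also have "\<dots> \<le> 2 * pi / 4" using g by (simp add: field_simps)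
  finally have \<theta>: "\<bar>\<theta>\<bar> \<le> pi / 2" by simp
  have "boundary_point g s / boundary_point g s0 = cis \<theta>"
    by (simp only: boundary_point_divide) (simp only: boundary_point_def \<theta>_def)
  moreover have "Ln (cis \<theta>) = \<i> * of_real \<theta>"
  proof -
    have "- pi < \<theta>" "\<theta> \<le> pi" using \<theta> pi_gt_zero by linarith+
    thus ?thesis unfolding cis_conv_exp by (intro Ln_exp) auto
  qed
  ultimately have "Ln (boundary_point g s / boundary_point g s0) = \<i> * of_real \<theta>" by simp
  hence "exp (of_real c * Ln (boundary_point g s / boundary_point g s0)) = cis (c * \<theta>)"
    by (simp add: cis_conv_exp mult_ac)
  thus ?thesis unfolding boundary_point_def \<theta>_def by (simp add: cis_mult add_divide_distrib distrib_left mult_ac)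
qed

lemma uniform_radius_finite:
  assumes "finite A" "\<forall>x\<in>A. \<exists>r>0. P x (r::real)" "\<forall>x r r'. P x r \<longrightarrow> 0 < r' \<longrightarrow> r' \<le> r \<longrightarrow> P x r'"
  shows "\<exists>r>0. \<forall>x\<in>A. P x r"
  using assms(1,2)
proof (induction A)
  case (insert a A)
  then obtain r r' where r: "r > 0" "\<forall>x\<in>A. P x r" "r' > 0" "P a r'" by auto
  have "P x (min r r')" if "x \<in> insert a A" for x
  proof (cases "x = a")
    case True
    show ?thesis unfolding True by (rule assms(3)[rule_format, OF r(4)]) (use r in auto)
  next
    case False
    show ?thesis by (rule assms(3)[rule_format, OF r(2)[THEN bspec]]) (use r that False in auto)
  qed
  thus ?case using r by (intro exI[of _ "min r r'"]) auto
qed (auto intro: exI[of _ 1])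

lemma uniformly_separated_finite:
  fixes F :: "'a::metric_space set"
  assumes "finite F" shows "\<exists>r>0. \<forall>x\<in>F. \<forall>y\<in>F. x \<noteq> y \<longrightarrow> 2 * r \<le> dist x y"
proof (rule uniform_radius_finite[OF assms])
  show "\<forall>x\<in>F. \<exists>r>0. \<forall>y\<in>F. x \<noteq> y \<longrightarrow> 2 * r \<le> dist x y"
  proof
    fix x
    obtain d where "d > 0" "\<forall>y\<in>F. y \<noteq> x \<longrightarrow> d \<le> dist x y" using finite_set_avoid[OF assms, of x] by auto
    thus "\<exists>r>0. \<forall>y\<in>F. x \<noteq> y \<longrightarrow> 2 * r \<le> dist x y" by (intro exI[of _ "d / 2"]) auto
  qed
qed force

lemma finite_glued:
  assumes g: "g \<ge> 1" shows "finite {y. glued g x y}"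
proof -
  have "finite {y. \<exists>t\<in>{0..1}. x = boundary_point g (real k + t) \<and> y = boundary_point g (real (partner k) + (1 - t))}" (is "finite ?Y") for k
  proof (cases "?Y = {}")
    case False
    then obtain t where t: "t \<in> {0..1}" "x = boundary_point g (real k + t)" by auto
    have "?Y \<subseteq> {boundary_point g (real (partner k) + (1 - t))}"
    proof
      fix y assume "y \<in> ?Y"
      then obtain u where u: "u \<in> {0..1}" "x = boundary_point g (real k + u)" "y = boundary_point g (real (partner k) + (1 - u))" by auto
      have "real k + u = real k + t"
        by (rule boundary_point_inj[OF g]) (use t u g in \<open>auto simp: abs_less_iff\<close>)
      thus "y \<in> {boundary_point g (real (partner k) + (1 - t))}" using u by simp
    qed
    thus ?thesis by (rule finite_subset) simp
  next
    case True
    show ?thesis unfolding True by simp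
  qed
  moreover have "{y. glued g x y} = (\<Union>k\<in>{..<4 * g}. {y. \<exists>t\<in>{0..1}. x = boundary_point g (real k + t) \<and> y = boundary_point g (real (partner k) + (1 - t))})"
    by (auto simp: glued_def)
  ultimately show ?thesis by simp
qed

lemma norm_glued: "glued g x y \<Longrightarrow> norm x = 1 \<and> norm y = 1"
  by (auto simp: glued_def)

lemma norm_corner: "corner g x \<Longrightarrow> norm x = 1"
  by (auto simp: corner_def)

lemma finite_corners: "finite {x. corner g x}"
proof -
  have "{x. corner g x} = (\<lambda>k. boundary_point g (real k)) ` {..<4 * g}" by (auto simp: corner_def)
  thus ?thesis by simp
qed

context polygon_surface
begin

lemma interior_contracts:
  assumes d: "norm d < 1" shows "\<exists>V. contracts_in (f d) V"
proof (rule contracts_inI[where e = "\<lambda>d s u. (1 - s) *\<^sub>R u + s *\<^sub>R d"])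
  show "f d \<in> S" using f_in[of d] d by simp
  show "1 - norm d > 0" using d by simp
  have only: "x = y" if "x \<in> cball 0 1" "y \<in> cball 0 1" "f x = f y" "norm y < 1" for x y
    using same_image_iff[OF that(1,2)] that norm_glued[of g x y] norm_corner[of g y] by auto
  have fib: "x = d" if "x \<in> cball 0 1" "f x = f d" for x using only[of x d] that d by simp
  show "2 * (1 - norm d) \<le> dist x y" if "x \<in> cball 0 1" "y \<in> cball 0 1" "f x = f d" "f y = f d" "x \<noteq> y" for x y
    using fib that by blast
  show "continuous_on ({0..1} \<times> (cball 0 1 \<inter> ball x (1 - norm d))) (\<lambda>y. (1 - fst y) *\<^sub>R snd y + fst y *\<^sub>R x)" for x :: complex
    by (intro continuous_on_add continuous_on_scaleR continuous_on_diff continuous_on_const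
        continuous_on_fst continuous_on_snd continuous_on_id)
  show "(1 - s) *\<^sub>R u + s *\<^sub>R x \<in> cball 0 1" if "x \<in> cball 0 1" "u \<in> cball 0 1" "s \<in> {0..1}" for x u :: complex and s
    by (rule convexD[OF convex_cball]) (use that in auto)
  show "(1 - 0) *\<^sub>R u + 0 *\<^sub>R x = u \<and> (1 - 1) *\<^sub>R u + 1 *\<^sub>R x = x" for u x :: complex by simp
  show "f ((1 - s) *\<^sub>R u + s *\<^sub>R x) = f ((1 - s) *\<^sub>R u' + s *\<^sub>R x')"
    if "x \<in> cball 0 1" "f x = f d" "x' \<in> cball 0 1" "f x' = f d" "u \<in> cball 0 1" "u' \<in> cball 0 1"
      "dist u x < 1 - norm d" "dist u' x' < 1 - norm d" "f u = f u'" for x x' s u u'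
  proof -
    have "x = d" "x' = d" using fib that by auto
    moreover have "norm u' < 1" using that(8) norm_triangle_sub[of u' d] unfolding \<open>x' = d\<close> by (simp add: dist_norm)
    hence "u = u'" using only that by blast
    ultimately show ?thesis by simp
  qed
qed

text \<open>The radius \<open>r\<close> is so small that the discs of radius \<open>r\<close> around the points of the fibre are disjoint, that
they contain no corners except possibly their centres, and that they meet only those sides on which their
centre lies. Identified points in them then belong to corresponding points of the fibre at the same angular
distance, and this is preserved by the contraction.\<close>

lemma boundary_contracts:
  assumes d: "norm d = 1" shows "\<exists>V. contracts_in (f d) V"
proof -
  have dD: "d \<in> cball 0 1" using d by simp
  define Fib where "Fib = {x \<in> cball 0 1. f x = f d}"
  have norm_Fib: "norm x = 1" if "x \<in> Fib" for x
    using that same_image_iff[OF _ dD, of x] norm_glued[of g x d] norm_corner[of g x] d by (auto simp: Fib_def)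
  have "Fib \<subseteq> {d} \<union> {y. glued g d y} \<union> {y. corner g y}"
  proof
    fix x assume "x \<in> Fib"
    hence "x \<in> cball 0 1" "f d = f x" by (auto simp: Fib_def)
    thus "x \<in> {d} \<union> {y. glued g d y} \<union> {y. corner g y}" using same_image_iff[OF dD, of x] by blast
  qed
  hence finF: "finite (Fib \<union> {y. corner g y})" and fin: "finite Fib"
    using finite_glued[OF g, of d] finite_corners[of g] finite_subset by auto
  obtain r1 where r1: "r1 > 0" "\<forall>x\<in>Fib \<union> {y. corner g y}. \<forall>y\<in>Fib \<union> {y. corner g y}. x \<noteq> y \<longrightarrow> 2 * r1 \<le> dist x y"
    using uniformly_separated_finite[OF finF] by blast
  define side where "side = (\<lambda>k. (\<lambda>t. boundary_point g (real k + t)) ` {0..1})"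
  have "\<exists>r>0. \<forall>x\<in>Fib \<times> {..<4 * g}. fst x \<in> side (snd x) \<or> (\<forall>y\<in>side (snd x). r \<le> dist (fst x) y)"
  proof (rule uniform_radius_finite)
    show "finite (Fib \<times> {..<4 * g})" using fin by simp
    have cl: "closed (side k)" for k unfolding side_def
      by (intro compact_imp_closed compact_continuous_image continuous_boundary_point continuous_intros) simp
    show "\<forall>x\<in>Fib \<times> {..<4 * g}. \<exists>r>0. fst x \<in> side (snd x) \<or> (\<forall>y\<in>side (snd x). r \<le> dist (fst x) y)"
      using separate_point_closed[OF cl] by (metis zero_less_one)
  qed force
  then obtain r2 where r2: "r2 > 0" "\<forall>x\<in>Fib \<times> {..<4 * g}. fst x \<in> side (snd x) \<or> (\<forall>y\<in>side (snd x). r2 \<le> dist (fst x) y)"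
    by blast
  define r where "r = min 1 (min r1 r2)"
  have r: "r > 0" "r \<le> 1" "r \<le> r1" "r \<le> r2" using r1 r2 by (auto simp: r_def)
  have sep: "2 * r \<le> dist x y" if "x \<in> Fib \<or> corner g x" "y \<in> Fib \<or> corner g y" "x \<noteq> y" for x y
  proof -
    have "2 * r1 \<le> dist x y" using r1(2) that by blast
    thus ?thesis using r by linarith
  qed
  have same: "x = y" if "x \<in> Fib \<or> corner g x" "y \<in> Fib \<or> corner g y" "dist u x < r" "dist u y < r" for x y u
  proof (rule ccontr)
    assume "x \<noteq> y"
    hence "2 * r \<le> dist x y" using sep that by blast
    thus False using that dist_triangle2[of x y u] by (simp add: dist_commute)
  qed
  have on_side: "x \<in> side k" if "x \<in> Fib" "k < 4 * g" "y \<in> side k" "dist y x < r" for x y k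
  proof (rule ccontr)
    assume "x \<notin> side k"
    hence "r2 \<le> dist x y" using r2(2)[THEN bspec, of "(x, k)"] that by auto
    thus False using that(4) r by (simp add: dist_commute)
  qed
  have half_plane: "Re (u / x) > 0" if "x \<in> Fib" "dist u x < r" for x u
  proof -
    have "x \<noteq> 0" using norm_Fib[OF that(1)] by auto
    hence "u / x - 1 = (u - x) / x" by (simp add: diff_divide_distrib)
    hence "norm (u / x - 1) = dist u x" using norm_Fib[OF that(1)] by (simp add: dist_norm norm_divide)
    hence "\<bar>Re (u / x - 1)\<bar> < 1" using that r abs_Re_le_cmod[of "u / x - 1"] by linarith
    thus ?thesis by simp
  qed
  define e where "e = (\<lambda>x s u. x * exp (of_real (1 - s) * Ln (u / x)))"
  show ?thesis
  proof (rule contracts_inI[where e = e, OF _ r(1)])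
    show "f d \<in> S" using f_in[OF dD] .
    show "2 * r \<le> dist x y" if "x \<in> cball 0 1" "y \<in> cball 0 1" "f x = f d" "f y = f d" "x \<noteq> y" for x y
      using sep that by (simp add: Fib_def)
    show "continuous_on ({0..1} \<times> (cball 0 1 \<inter> ball x r)) (\<lambda>y. e x (fst y) (snd y))" if "x \<in> cball 0 1" "f x = f d" for x
    proof -
      have x: "x \<in> Fib" using that by (simp add: Fib_def)
      have "snd y / x \<notin> \<real>\<^sub>\<le>\<^sub>0" if "y \<in> {0..1} \<times> (cball 0 1 \<inter> ball x r)" for y
        using half_plane[OF x, of "snd y"] that by (auto simp: dist_commute complex_nonpos_Reals_iff)
      moreover have "x \<noteq> 0" using norm_Fib[OF x] by auto
      ultimately show ?thesis unfolding e_def by (intro continuous_intros) auto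
    qed
    have nz: "x \<noteq> 0 \<and> u \<noteq> 0" if "x \<in> Fib" "dist u x < r" for x u using half_plane[OF that] by auto
    show "e x s u \<in> cball 0 1" if "x \<in> cball 0 1" "f x = f d" "u \<in> cball 0 1" "dist u x < r" "s \<in> {0..1}" for x s u
    proof -
      have x: "x \<in> Fib" using that by (simp add: Fib_def)
      have "norm (e x s u) = exp ((1 - s) * ln (norm u))"
        using nz[OF x that(4)] norm_Fib[OF x] by (simp add: e_def norm_mult norm_divide)
      also have "\<dots> \<le> 1" using nz[OF x that(4)] that by (simp add: mult_nonneg_nonpos)
      finally show ?thesis by simp
    qed
    show "e x 0 u = u \<and> e x 1 u = x" if "x \<in> cball 0 1" "f x = f d" "dist u x < r" for x u
      using nz[of x u] that by (simp add: e_def Fib_def)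
    fix x x' s u u'
    assume xx: "x \<in> cball 0 1" "f x = f d" "x' \<in> cball 0 1" "f x' = f d" and u: "u \<in> cball 0 1" "u' \<in> cball 0 1"
      and near: "dist u x < r" "dist u' x' < r" and fu: "f u = f u'" and s: "s \<in> {0..1::real}"
    have x: "x \<in> Fib" "x' \<in> Fib" using xx by (auto simp: Fib_def)
    have const: "e y s y = y" if "y \<in> Fib" for y using norm_Fib[OF that] by (auto simp: e_def)
    from fu same_image_iff[OF u] consider "u = u'" | "corner g u" "corner g u'" | "glued g u u'" by blast
    thus "f (e x s u) = f (e x' s u')"
    proof cases
      case 1
      thus ?thesis using same[of x x' u] x near by simp
    next
      case 2
      have "u = x" "u' = x'" using same[of u x u] same[of u' x' u'] 2 x near r by auto
      thus ?thesis using const x xx by simp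
    next
      case 3
      then obtain k t where k: "k < 4 * g" "t \<in> {0..1}" "u = boundary_point g (real k + t)"
        "u' = boundary_point g (real (partner k) + (1 - t))" unfolding glued_def by blast
      have "x \<in> side k" by (rule on_side[OF x(1) k(1) _ near(1)]) (use k in \<open>auto simp: side_def\<close>)
      then obtain t0 where t0: "t0 \<in> {0..1}" "x = boundary_point g (real k + t0)" by (auto simp: side_def)
      define x'' where "x'' = boundary_point g (real (partner k) + (1 - t0))"
      have "glued g x x''" unfolding glued_def x''_def using k t0 by blast
      hence "x'' \<in> Fib" using same_image_iff[of x x''] xx by (auto simp: Fib_def norm_glued)
      moreover have "dist u' x'' = dist u x" unfolding k x''_def t0 by (rule dist_boundary_point_cong) simp
      ultimately have x'': "x' = x''" using same[of x' x'' u'] x near by simp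
      define \<tau> where "\<tau> = t0 + (1 - s) * (t - t0)"
      have "\<tau> = s * t0 + (1 - s) * t" by (simp add: \<tau>_def algebra_simps)
      hence \<tau>: "\<tau> \<in> {0..1}" using convexD[OF convex_real_interval(5)[of 0 1] t0(1) k(2), of s "1 - s"] s by simp
      have "e x s u = boundary_point g (real k + \<tau>)"
        unfolding e_def t0 k \<tau>_def using angular_contraction[OF g, of "real k + t" "real k + t0" "1 - s"] t0(1) k(2)
        by (simp add: abs_le_iff add_ac)
      moreover have "e x' s u' = boundary_point g (real (partner k) + (1 - \<tau>))"
        unfolding e_def x'' x''_def k \<tau>_def
        using angular_contraction[OF g, of "real (partner k) + (1 - t)" "real (partner k) + (1 - t0)" "1 - s"] t0(1) k(2)
        by (simp add: abs_le_iff algebra_simps)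
      ultimately have "glued g (e x s u) (e x' s u')" unfolding glued_def using k \<tau> by blast
      thus ?thesis using same_image_iff norm_glued by simp
    qed
  qed
qed

theorem surface_locally_contractible:
  assumes "z \<in> S" shows "\<exists>V. contracts_in z V"
proof -
  obtain d where d: "d \<in> cball 0 1" "z = f d" using assms f_image by blast
  thus ?thesis using interior_contracts[of d] boundary_contracts[of d] by fastforce
qed

end

section \<open>Generators, relation and homomorphisms of the surface group\<close>

primrec commutator_word :: "('h, 'm) monoid_scheme \<Rightarrow> (nat \<Rightarrow> 'h) \<Rightarrow> (nat \<Rightarrow> 'h) \<Rightarrow> nat \<Rightarrow> 'h" where
  "commutator_word H a b 0 = \<one>\<^bsub>H\<^esub>"
| "commutator_word H a b (Suc n) = commutator_word H a b n \<otimes>\<^bsub>H\<^esub>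
     (a n \<otimes>\<^bsub>H\<^esub> (b n \<otimes>\<^bsub>H\<^esub> (inv\<^bsub>H\<^esub> a n \<otimes>\<^bsub>H\<^esub> inv\<^bsub>H\<^esub> b n)))"

text \<open>All corners are one point of the surface. Visiting them in the order \<open>4 * i\<close>, \<open>4 * i + 3\<close>, \<open>4 * i + 2\<close>,
\<open>4 * i + 1\<close>, \<open>4 * i + 4\<close> crosses the sides dual to the letters \<open>a\<close>, \<open>b\<close> and their inverses, so the labels
are the partial products of the boundary word.\<close>

definition corner_label :: "('h, 'm) monoid_scheme \<Rightarrow> (nat \<Rightarrow> 'h) \<Rightarrow> (nat \<Rightarrow> 'h) \<Rightarrow> nat \<Rightarrow> 'h" where
  "corner_label H a b k = (let i = k div 4; h = commutator_word H a b i in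
     if k mod 4 = 0 then h
     else if k mod 4 = 1 then h \<otimes>\<^bsub>H\<^esub> (a i \<otimes>\<^bsub>H\<^esub> (b i \<otimes>\<^bsub>H\<^esub> inv\<^bsub>H\<^esub> a i))
     else if k mod 4 = 2 then h \<otimes>\<^bsub>H\<^esub> (a i \<otimes>\<^bsub>H\<^esub> b i)
     else h \<otimes>\<^bsub>H\<^esub> a i)"

definition side_label :: "('h, 'm) monoid_scheme \<Rightarrow> (nat \<Rightarrow> 'h) \<Rightarrow> (nat \<Rightarrow> 'h) \<Rightarrow> nat \<Rightarrow> 'h" where
  "side_label H a b k = (let i = k div 4 in
     if k mod 4 = 2 then a i else if k mod 4 = 3 then inv\<^bsub>H\<^esub> b i else \<one>\<^bsub>H\<^esub>)"

definition crossing_label :: "('h, 'm) monoid_scheme \<Rightarrow> (nat \<Rightarrow> 'h) \<Rightarrow> (nat \<Rightarrow> 'h) \<Rightarrow> nat \<Rightarrow> 'h" where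
  "crossing_label H a b k = (let i = k div 4 in
     if k mod 4 = 0 then a i else if k mod 4 = 1 then inv\<^bsub>H\<^esub> b i
     else if k mod 4 = 2 then inv\<^bsub>H\<^esub> a i else b i)"

context group
begin

lemma commutator_word_closed:
  "\<forall>i<n. a i \<in> carrier G \<and> b i \<in> carrier G \<Longrightarrow> commutator_word G a b n \<in> carrier G"
  by (induction n) auto

lemma cancel_right:
  "x \<in> carrier G \<Longrightarrow> y \<in> carrier G \<Longrightarrow> x \<otimes> (inv x \<otimes> y) = y"
  "x \<in> carrier G \<Longrightarrow> y \<in> carrier G \<Longrightarrow> inv x \<otimes> (x \<otimes> y) = y"
  by (simp_all flip: m_assoc)

text \<open>The two ends and the interior of side \<open>k\<close> yield the same element for the crossing from side \<open>k\<close> to its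
partner. This makes the labels a flat cocycle.\<close>

lemma label_crossing:
  assumes ab: "\<forall>i<g. a i \<in> carrier G \<and> b i \<in> carrier G" and k: "k < 4 * g"
  shows "corner_label G a b (partner k + 1) = corner_label G a b k \<otimes> crossing_label G a b k"
    and "corner_label G a b (partner k) = corner_label G a b (k + 1) \<otimes> crossing_label G a b k"
    and "side_label G a b (partner k) = side_label G a b k \<otimes> crossing_label G a b k"
    and "crossing_label G a b k \<in> carrier G"
proof -
  define i where "i = k div 4"
  have i: "i < g" using k by (auto simp: i_def)
  define h where "h = commutator_word G a b i"
  have c: "h \<in> carrier G" "a i \<in> carrier G" "b i \<in> carrier G"
    using ab i commutator_word_closed[of i a b] by (auto simp: h_def)
  have dm: "4 * i div 4 = i" "(4 * i + 1) div 4 = i" "(4 * i + 2) div 4 = i" "(4 * i + 3) div 4 = i" "(4 * i + 4) div 4 = Suc i"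
    "4 * i mod 4 = 0" "(4 * i + 1) mod 4 = 1" "(4 * i + 2) mod 4 = 2" "(4 * i + 3) mod 4 = 3" "(4 * i + 4) mod 4 = 0"
    by presburger+
  have corner: "corner_label G a b (4 * i) = h" "corner_label G a b (4 * i + 1) = h \<otimes> (a i \<otimes> (b i \<otimes> inv a i))"
    "corner_label G a b (4 * i + 2) = h \<otimes> (a i \<otimes> b i)" "corner_label G a b (4 * i + 3) = h \<otimes> a i"
    "corner_label G a b (4 * i + 4) = h \<otimes> (a i \<otimes> (b i \<otimes> (inv a i \<otimes> inv b i)))"
    by (simp_all only: corner_label_def Let_def dm) (simp_all add: h_def)
  have side: "side_label G a b (4 * i) = \<one>" "side_label G a b (4 * i + 1) = \<one>" "side_label G a b (4 * i + 2) = a i"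
    "side_label G a b (4 * i + 3) = inv b i"
    by (simp_all only: side_label_def Let_def dm) simp_all
  have crossing: "crossing_label G a b (4 * i) = a i" "crossing_label G a b (4 * i + 1) = inv b i"
    "crossing_label G a b (4 * i + 2) = inv a i" "crossing_label G a b (4 * i + 3) = b i"
    by (simp_all only: crossing_label_def Let_def dm) simp_all
  have p: "partner (4 * i) = 4 * i + 2" "partner (4 * i + 1) = 4 * i + 3" "partner (4 * i + 2) = 4 * i" "partner (4 * i + 3) = 4 * i + 1"
    using partner_add[of 0 i] partner_add[of 1 i] partner_add[of 2 i] partner_add[of 3 i] by simp_all
  have "k = 4 * i \<or> k = 4 * i + 1 \<or> k = 4 * i + 2 \<or> k = 4 * i + 3" unfolding i_def by presburger
  moreover have arith: "4 * i + 2 + 1 = 4 * i + 3" "4 * i + 3 + 1 = 4 * i + 4" "4 * i + 1 + 1 = 4 * i + 2" by simp_all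
  ultimately have "corner_label G a b (partner k + 1) = corner_label G a b k \<otimes> crossing_label G a b k \<and>
    corner_label G a b (partner k) = corner_label G a b (k + 1) \<otimes> crossing_label G a b k \<and>
    side_label G a b (partner k) = side_label G a b k \<otimes> crossing_label G a b k \<and> crossing_label G a b k \<in> carrier G"
    by (elim disjE) (simp_all only: p arith corner side crossing, simp_all add: c m_assoc cancel_right)
  thus "corner_label G a b (partner k + 1) = corner_label G a b k \<otimes> crossing_label G a b k"
    and "corner_label G a b (partner k) = corner_label G a b (k + 1) \<otimes> crossing_label G a b k"
    and "side_label G a b (partner k) = side_label G a b k \<otimes> crossing_label G a b k"
    and "crossing_label G a b k \<in> carrier G" by blast+
qed

lemma label_closed:
  assumes ab: "\<forall>i<g. a i \<in> carrier G \<and> b i \<in> carrier G" and k: "k < 4 * g"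
  shows "corner_label G a b k \<in> carrier G" "side_label G a b k \<in> carrier G"
proof -
  have "k div 4 < g" using k by auto
  hence "commutator_word G a b (k div 4) \<in> carrier G" "a (k div 4) \<in> carrier G" "b (k div 4) \<in> carrier G"
    using ab commutator_word_closed[of "k div 4" a b] by auto
  thus "corner_label G a b k \<in> carrier G" "side_label G a b k \<in> carrier G"
    by (auto simp: corner_label_def side_label_def Let_def)
qed

end

definition boundary_label :: "nat \<Rightarrow> ('h, 'm) monoid_scheme \<Rightarrow> (nat \<Rightarrow> 'h) \<Rightarrow> (nat \<Rightarrow> 'h) \<Rightarrow> complex \<Rightarrow> 'h" where
  "boundary_label g H a b x =
    (if \<exists>k<4 * g. \<exists>t\<in>{0<..<1}. x = boundary_point g (real k + t)
       then side_label H a b (SOME k. k < 4 * g \<and> (\<exists>t\<in>{0<..<1}. x = boundary_point g (real k + t)))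
     else if corner g x then corner_label H a b (SOME k. k < 4 * g \<and> x = boundary_point g (real k))
     else \<one>\<^bsub>H\<^esub>)"

lemma boundary_label_side:
  assumes g: "g \<ge> 1" and k: "k < 4 * g" and t: "0 < t" "t < 1"
  shows "boundary_label g H a b (boundary_point g (real k + t)) = side_label H a b k"
proof -
  let ?P = "\<lambda>l. l < 4 * g \<and> (\<exists>u\<in>{0<..<1}. boundary_point g (real k + t) = boundary_point g (real l + u))"
  have P: "?P k" using k t by auto
  have "l = k" if l: "?P l" for l
  proof -
    obtain u where u: "0 < u" "u < 1" "boundary_point g (real k + t) = boundary_point g (real l + u)" using l by auto
    have "real k + 1 \<le> real (4 * g)" "real l + 1 \<le> real (4 * g)" using k l by linarith+
    hence "real k + t = real l + u" using t u by (intro boundary_point_inj[OF g u(3)]) linarith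
    thus "l = k" using t u by linarith
  qed
  hence "(SOME l. ?P l) = k" using P by (intro some_equality) auto
  thus ?thesis unfolding boundary_label_def using P by auto
qed

text \<open>The relation enters for \<open>k = 4 * g\<close>, which is the same corner as \<open>0\<close>.\<close>

lemma boundary_label_corner:
  assumes g: "g \<ge> 1" and k: "k \<le> 4 * g" and relation: "commutator_word H a b g = \<one>\<^bsub>H\<^esub>"
  shows "boundary_label g H a b (boundary_point g (real k)) = corner_label H a b k"
proof -
  define l where "l = (if k = 4 * g then 0 else k)"
  have l: "l < 4 * g" "boundary_point g (real k) = boundary_point g (real l)" "corner_label H a b k = corner_label H a b l"
    using k g boundary_point_period[OF g] relation by (auto simp: l_def corner_label_def Let_def)
  have cor: "corner g (boundary_point g (real l))" using corner_boundary_point[OF g] l by simp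
  have "\<not> (\<exists>k<4 * g. \<exists>t\<in>{0<..<1}. boundary_point g (real l) = boundary_point g (real k + t))"
  proof
    assume "\<exists>k<4 * g. \<exists>t\<in>{0<..<1}. boundary_point g (real l) = boundary_point g (real k + t)"
    then obtain k t where kt: "k < 4 * g" "t \<in> {0<..<1}" "boundary_point g (real l) = boundary_point g (real k + t)" by blast
    hence "corner g (boundary_point g (real k + t))" using cor by simp
    thus False using corner_iff[OF g kt(1), of t] kt(2) by auto
  qed
  moreover have "(SOME j. j < 4 * g \<and> boundary_point g (real l) = boundary_point g (real j)) = l"
  proof (rule some_equality)
    fix j assume j: "j < 4 * g \<and> boundary_point g (real l) = boundary_point g (real j)"
    have "real l = real j" using j l(1) by (intro boundary_point_inj[OF g]) auto
    thus "j = l" by simp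
  qed (use l in simp)
  ultimately have "boundary_label g H a b (boundary_point g (real l)) = corner_label H a b l"
    unfolding boundary_label_def using cor by (simp only: if_False if_True)
  thus ?thesis using l by simp
qed

context polygon_surface
begin

abbreviation \<pi>\<^sub>1 :: "(real \<Rightarrow> 'a) set monoid" where "\<pi>\<^sub>1 \<equiv> fundamental_group S (f d0)"

sublocale fg: group \<pi>\<^sub>1
  by (rule group_fundamental_group, rule f_in, rule d0)

definition side_class :: "nat \<Rightarrow> (real \<Rightarrow> 'a) set" where
  "side_class k = jump (boundary_point g (real k + 1 / 2)) (boundary_point g (real (partner k) + 1 / 2))"

definition gen_a :: "nat \<Rightarrow> (real \<Rightarrow> 'a) set" where "gen_a i = side_class (4 * i)"
definition gen_b :: "nat \<Rightarrow> (real \<Rightarrow> 'a) set" where "gen_b i = side_class (4 * i + 3)"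

lemma boundary_point_in [simp]: "boundary_point g s \<in> cball 0 1"
  by simp

lemma same_image_side:
  assumes "k < 4 * g" "t \<in> {0..1}"
  shows "f (boundary_point g (real k + t)) = f (boundary_point g (real (partner k) + (1 - t)))"
proof -
  have "glued g (boundary_point g (real k + t)) (boundary_point g (real (partner k) + (1 - t)))"
    unfolding glued_def using assms by blast
  thus ?thesis by (subst same_image_iff[OF boundary_point_in boundary_point_in]) simp
qed

text \<open>The crossing point can be slid along the side.\<close>

lemma jump_across_side:
  assumes k: "k < 4 * g" and t: "t \<in> {0..1}"
  shows "jump (boundary_point g (real k + t)) (boundary_point g (real (partner k) + (1 - t))) = side_class k"
proof -
  let ?c = "\<lambda>x. boundary_point g (real k + linepath t (1 / 2) x)"
  let ?c' = "\<lambda>x. boundary_point g (real (partner k) + (1 - linepath t (1 / 2) x))"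
  have lin: "continuous_on {0..1} (linepath t (1 / 2))" using path_linepath[of t "1 / 2 :: real"] by (simp add: path_def)
  have "jump (pathstart ?c) (pathstart ?c') = jump (pathfinish ?c) (pathfinish ?c')"
  proof (rule jump_slide)
    show "path ?c" "path ?c'" unfolding path_def by (intro continuous_boundary_point continuous_intros lin)+
    show "path_image ?c \<subseteq> cball 0 1" "path_image ?c' \<subseteq> cball 0 1" by (auto simp: path_image_def)
    show "f (?c x) = f (?c' x)" if "x \<in> {0..1}" for x
    proof (rule same_image_side[OF k])
      have "linepath t (1 / 2) x \<in> closed_segment t (1 / 2)" using that by (metis path_image_linepath path_image_def imageI)
      also have "\<dots> \<subseteq> {0..1}" using t by (intro closed_segment_subset) auto
      finally show "linepath t (1 / 2) x \<in> {0..1}" .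
    qed
  qed
  thus ?thesis by (simp add: pathstart_def pathfinish_def linepath_def side_class_def)
qed

lemma side_class_closed [simp]: "k < 4 * g \<Longrightarrow> side_class k \<in> carrier \<pi>\<^sub>1"
  unfolding side_class_def using same_image_side[of k "1 / 2"] by (intro jump_closed) auto

lemma side_class_partner:
  assumes k: "k < 4 * g" shows "side_class (partner k) = inv\<^bsub>\<pi>\<^sub>1\<^esub> (side_class k)"
proof -
  have "side_class (partner k) \<otimes>\<^bsub>\<pi>\<^sub>1\<^esub> side_class k = jump (boundary_point g (real (partner k) + 1 / 2)) (boundary_point g (real (partner k) + 1 / 2))"
    unfolding side_class_def partner_partner
    by (rule jump_mult) (use same_image_side[OF k, of "1 / 2"] in auto)
  also have "\<dots> = \<one>\<^bsub>\<pi>\<^sub>1\<^esub>" by (rule jump_self) simp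
  finally have "inv\<^bsub>\<pi>\<^sub>1\<^esub> (side_class k) = side_class (partner k)"
    by (rule fg.inv_equality) (use k partner_less in simp_all)
  thus ?thesis ..
qed

lemma generators:
  assumes "i < g"
  shows "side_class (4 * i) = gen_a i" "side_class (4 * i + 1) = inv\<^bsub>\<pi>\<^sub>1\<^esub> gen_b i"
    "side_class (4 * i + 2) = inv\<^bsub>\<pi>\<^sub>1\<^esub> gen_a i" "side_class (4 * i + 3) = gen_b i"
    "gen_a i \<in> carrier \<pi>\<^sub>1" "gen_b i \<in> carrier \<pi>\<^sub>1"
proof -
  have lt: "4 * i < 4 * g" "4 * i + 3 < 4 * g" using assms by auto
  show "side_class (4 * i) = gen_a i" "side_class (4 * i + 3) = gen_b i" by (simp_all add: gen_a_def gen_b_def)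
  show "gen_a i \<in> carrier \<pi>\<^sub>1" "gen_b i \<in> carrier \<pi>\<^sub>1" unfolding gen_a_def gen_b_def using lt by simp_all
  have p: "partner (4 * i) = 4 * i + 2" "partner (4 * i + 3) = 4 * i + 1"
    using partner_add[of 0 i] partner_add[of 3 i] by simp_all
  show "side_class (4 * i + 1) = inv\<^bsub>\<pi>\<^sub>1\<^esub> gen_b i" "side_class (4 * i + 2) = inv\<^bsub>\<pi>\<^sub>1\<^esub> gen_a i"
    using side_class_partner[OF lt(1)] side_class_partner[OF lt(2)] unfolding p gen_a_def gen_b_def by simp_all
qed

lemma corners_same_image:
  "k \<le> 4 * g \<Longrightarrow> l \<le> 4 * g \<Longrightarrow> f (boundary_point g (real k)) = f (boundary_point g (real l))"
  by (subst same_image_iff[OF boundary_point_in boundary_point_in]) (simp add: corner_boundary_point[OF g])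

lemma corner_step:
  assumes "k < 4 * g" shows "jump (boundary_point g (real k)) (boundary_point g (real (partner k + 1))) = side_class k"
  using jump_across_side[OF assms, of 0] by (simp add: add.commute)

lemma corner_mult:
  assumes "j \<le> 4 * g" "k \<le> 4 * g" "l \<le> 4 * g"
  shows "jump (boundary_point g (real j)) (boundary_point g (real l)) =
    jump (boundary_point g (real j)) (boundary_point g (real k)) \<otimes>\<^bsub>\<pi>\<^sub>1\<^esub> jump (boundary_point g (real k)) (boundary_point g (real l))"
  by (rule jump_mult[OF boundary_point_in boundary_point_in boundary_point_in
        corners_same_image[OF assms(1,2)] corners_same_image[OF assms(2,3)], symmetric])

lemma corner_closed:
  "k \<le> 4 * g \<Longrightarrow> l \<le> 4 * g \<Longrightarrow> jump (boundary_point g (real k)) (boundary_point g (real l)) \<in> carrier \<pi>\<^sub>1"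
  by (rule jump_closed[OF boundary_point_in boundary_point_in corners_same_image])

text \<open>Sliding the crossing points of the sides into the corners turns jumps between corners into words.\<close>

lemma around_block:
  assumes i: "i < g"
  shows "jump (boundary_point g (real (4 * i))) (boundary_point g (real (4 * i + 3))) = gen_a i" (is "?j 0 3 = _")
    "jump (boundary_point g (real (4 * i))) (boundary_point g (real (4 * i + 2))) = gen_a i \<otimes>\<^bsub>\<pi>\<^sub>1\<^esub> gen_b i"
    "jump (boundary_point g (real (4 * i))) (boundary_point g (real (4 * i + 1))) = gen_a i \<otimes>\<^bsub>\<pi>\<^sub>1\<^esub> (gen_b i \<otimes>\<^bsub>\<pi>\<^sub>1\<^esub> inv\<^bsub>\<pi>\<^sub>1\<^esub> gen_a i)"
    "jump (boundary_point g (real (4 * i))) (boundary_point g (real (4 * i + 4))) =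
      gen_a i \<otimes>\<^bsub>\<pi>\<^sub>1\<^esub> (gen_b i \<otimes>\<^bsub>\<pi>\<^sub>1\<^esub> (inv\<^bsub>\<pi>\<^sub>1\<^esub> gen_a i \<otimes>\<^bsub>\<pi>\<^sub>1\<^esub> inv\<^bsub>\<pi>\<^sub>1\<^esub> gen_b i))"
proof -
  note gens = generators[OF i]
  have p: "partner (4 * i) + 1 = 4 * i + 3" "partner (4 * i + 3) + 1 = 4 * i + 2" "partner (4 * i + 2) + 1 = 4 * i + 1" "partner (4 * i + 1) + 1 = 4 * i + 4"
    using partner_add[of 0 i] partner_add[of 1 i] partner_add[of 2 i] partner_add[of 3 i] by simp_all
  have lt: "4 * i < 4 * g" "4 * i + 1 < 4 * g" "4 * i + 2 < 4 * g" "4 * i + 3 < 4 * g" using i by auto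
  have le: "4 * i \<le> 4 * g" "4 * i + 1 \<le> 4 * g" "4 * i + 2 \<le> 4 * g" "4 * i + 3 \<le> 4 * g" "4 * i + 4 \<le> 4 * g" using i by auto
  show 1: "jump (boundary_point g (real (4 * i))) (boundary_point g (real (4 * i + 3))) = gen_a i"
    using corner_step[OF lt(1)] unfolding p gens(1) .
  show 2: "jump (boundary_point g (real (4 * i))) (boundary_point g (real (4 * i + 2))) = gen_a i \<otimes>\<^bsub>\<pi>\<^sub>1\<^esub> gen_b i"
    unfolding corner_mult[OF le(1) le(4) le(3)] 1 corner_step[OF lt(4), unfolded p gens(4)] ..
  show 3: "jump (boundary_point g (real (4 * i))) (boundary_point g (real (4 * i + 1))) = gen_a i \<otimes>\<^bsub>\<pi>\<^sub>1\<^esub> (gen_b i \<otimes>\<^bsub>\<pi>\<^sub>1\<^esub> inv\<^bsub>\<pi>\<^sub>1\<^esub> gen_a i)"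
    unfolding corner_mult[OF le(1) le(3) le(2)] 2 corner_step[OF lt(3), unfolded p gens(3)]
    using gens(5,6) by (simp add: fg.m_assoc)
  show "jump (boundary_point g (real (4 * i))) (boundary_point g (real (4 * i + 4))) =
      gen_a i \<otimes>\<^bsub>\<pi>\<^sub>1\<^esub> (gen_b i \<otimes>\<^bsub>\<pi>\<^sub>1\<^esub> (inv\<^bsub>\<pi>\<^sub>1\<^esub> gen_a i \<otimes>\<^bsub>\<pi>\<^sub>1\<^esub> inv\<^bsub>\<pi>\<^sub>1\<^esub> gen_b i))"
    unfolding corner_mult[OF le(1) le(2) le(5)] 3 corner_step[OF lt(2), unfolded p gens(2)]
    using gens(5,6) by (simp add: fg.m_assoc)
qed

lemma corner_word: "i \<le> g \<Longrightarrow> jump (boundary_point g (real 0)) (boundary_point g (real (4 * i))) = commutator_word \<pi>\<^sub>1 gen_a gen_b i"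
proof (induction i)
  case 0
  show ?case using jump_self[OF boundary_point_in, of 0] by simp
next
  case (Suc i)
  hence i: "i < g" "i \<le> g" by auto
  have "jump (boundary_point g (real 0)) (boundary_point g (real (4 * i + 4))) =
    jump (boundary_point g (real 0)) (boundary_point g (real (4 * i))) \<otimes>\<^bsub>\<pi>\<^sub>1\<^esub>
    jump (boundary_point g (real (4 * i))) (boundary_point g (real (4 * i + 4)))"
    by (rule corner_mult) (use i in auto)
  also have "\<dots> = commutator_word \<pi>\<^sub>1 gen_a gen_b (Suc i)" unfolding Suc.IH[OF i(2)] around_block(4)[OF i(1)] by simp
  finally show ?case by (simp add: add.commute)
qed

text \<open>Going through all corners yields the boundary word, and it ends at the corner where it began.\<close>

theorem surface_relation: "commutator_word \<pi>\<^sub>1 gen_a gen_b g = \<one>\<^bsub>\<pi>\<^sub>1\<^esub>"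
  using corner_word[of g] boundary_point_period[OF g] jump_self[OF boundary_point_in, of 0] by simp

theorem surface_generators:
  assumes P: "subgroup P \<pi>\<^sub>1" and gens: "\<forall>i<g. gen_a i \<in> P \<and> gen_b i \<in> P"
  shows "carrier \<pi>\<^sub>1 \<subseteq> P"
proof (rule generated_by_jumps[OF surface_locally_contractible P])
  note P_mult = subgroup.m_closed[OF P] and P_inv = subgroup.m_inv_closed[OF P] and P_one = subgroup.one_closed[OF P]
  have side: "side_class k \<in> P" if "k < 4 * g" for k
  proof -
    have i: "k div 4 < g" using that by auto
    have "k = 4 * (k div 4) \<or> k = 4 * (k div 4) + 1 \<or> k = 4 * (k div 4) + 2 \<or> k = 4 * (k div 4) + 3" by presburger
    moreover have "side_class (4 * (k div 4)) \<in> P" "side_class (4 * (k div 4) + 1) \<in> P" "side_class (4 * (k div 4) + 2) \<in> P"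
      "side_class (4 * (k div 4) + 3) \<in> P" unfolding generators[OF i] using gens i P_inv by auto
    ultimately show ?thesis by metis
  qed
  have block: "jump (boundary_point g (real (4 * i))) (boundary_point g (real (4 * i + r))) \<in> P" if i: "i < g" and r: "r < 4" for i r
  proof -
    have r': "r = 0 \<or> r = 1 \<or> r = 2 \<or> r = 3" using r by auto
    have ab: "gen_a i \<in> P" "gen_b i \<in> P" "inv\<^bsub>\<pi>\<^sub>1\<^esub> gen_a i \<in> P" using gens i P_inv by auto
    have "jump (boundary_point g (real (4 * i))) (boundary_point g (real (4 * i + 0))) \<in> P"
      using jump_self[OF boundary_point_in] P_one by simp
    moreover note around_block[OF i]
    ultimately show ?thesis using r' ab P_mult by metis
  qed
  have corner0: "jump (boundary_point g (real 0)) (boundary_point g (real k)) \<in> P" if k: "k < 4 * g" for k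
  proof -
    have i: "k div 4 < g" using k by auto
    have words: "commutator_word \<pi>\<^sub>1 gen_a gen_b i \<in> P" if "i \<le> g" for i
      using that by (induction i) (use gens P_mult P_inv P_one in auto)
    have "jump (boundary_point g (real 0)) (boundary_point g (real (4 * (k div 4)))) \<in> P"
      using corner_word[of "k div 4"] words[of "k div 4"] i by simp
    moreover have "jump (boundary_point g (real (4 * (k div 4)))) (boundary_point g (real k)) \<in> P"
      using block[OF i, of "k mod 4"] by simp
    moreover have "jump (boundary_point g (real 0)) (boundary_point g (real k)) =
      jump (boundary_point g (real 0)) (boundary_point g (real (4 * (k div 4)))) \<otimes>\<^bsub>\<pi>\<^sub>1\<^esub>
      jump (boundary_point g (real (4 * (k div 4)))) (boundary_point g (real k))"
      by (rule corner_mult) (use k in auto)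
    ultimately show ?thesis using P_mult by simp
  qed
  fix d d' assume d: "d \<in> cball 0 1" "d' \<in> cball 0 1" "f d = f d'"
  then consider "d = d'" | "glued g d d'" | "corner g d" "corner g d'" using same_image_iff by blast
  thus "jump d d' \<in> P"
  proof cases
    case 1
    thus ?thesis using jump_self[OF d(1)] P_one by simp
  next
    case 2
    then obtain k t where "k < 4 * g" "t \<in> {0..1}" "d = boundary_point g (real k + t)"
      "d' = boundary_point g (real (partner k) + (1 - t))" unfolding glued_def by blast
    thus ?thesis using jump_across_side side by simp
  next
    case 3
    obtain k where k: "k < 4 * g" "d = boundary_point g (real k)" using 3(1) unfolding corner_def by blast
    obtain l where l: "l < 4 * g" "d' = boundary_point g (real l)" using 3(2) unfolding corner_def by blast
    let ?j = "\<lambda>k l. jump (boundary_point g (real k)) (boundary_point g (real l))"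
    have le: "0 \<le> 4 * g" "k \<le> 4 * g" "l \<le> 4 * g" using k l by auto
    have "?j k 0 \<otimes>\<^bsub>\<pi>\<^sub>1\<^esub> ?j 0 k = \<one>\<^bsub>\<pi>\<^sub>1\<^esub>"
      using corner_mult[OF le(2,1,2)] jump_self[OF boundary_point_in, of "real k"] by simp
    hence "inv\<^bsub>\<pi>\<^sub>1\<^esub> ?j 0 k = ?j k 0" by (rule fg.inv_equality[OF _ corner_closed[OF le(1,2)] corner_closed[OF le(2,1)]])
    hence "?j k 0 \<in> P" using P_inv[OF corner0[OF k(1)]] by simp
    thus ?thesis using P_mult[OF _ corner0[OF l(1)]] corner_mult[OF le(2,1,3)] k l by simp
  qed
qed

text \<open>The defining relation suffices for a homomorphism with prescribed values on the generators: the labels are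
a flat cocycle, and the holonomy of the jump across a side is the element for crossing it.\<close>

theorem surface_group_hom:
  fixes H :: "('h, 'm) monoid_scheme"
  assumes H: "group H" and ab: "\<forall>i<g. a i \<in> carrier H \<and> b i \<in> carrier H"
    and relation: "commutator_word H a b g = \<one>\<^bsub>H\<^esub>"
  shows "\<exists>\<phi>\<in>hom \<pi>\<^sub>1 H. \<forall>i<g. \<phi> (gen_a i) = a i \<and> \<phi> (gen_b i) = b i"
proof -
  interpret H: group H by fact
  let ?\<eta> = "boundary_label g H a b" and ?T = "crossing_label H a b"
  note lab = H.label_crossing[OF ab] and closed = H.label_closed[OF ab]
  have \<eta>: "?\<eta> x \<in> carrier H" for x
  proof -
    consider k t where "k < 4 * g" "0 < t" "t < 1" "x = boundary_point g (real k + t)"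
      | k where "k < 4 * g" "x = boundary_point g (real k)"
      | "\<not> (\<exists>k<4 * g. \<exists>t\<in>{0<..<1}. x = boundary_point g (real k + t))" "\<not> corner g x" unfolding corner_def by fastforce
    thus ?thesis
    proof cases
      case 1
      thus ?thesis using boundary_label_side[OF g 1(1-3), where H = H and a = a and b = b] closed(2)[OF 1(1)] by simp
    next
      case 2
      thus ?thesis using boundary_label_corner[OF g _ relation, of k] closed(1)[OF 2(1)] by simp
    next
      case 3
      thus ?thesis unfolding boundary_label_def by (simp only: if_False) simp
    qed
  qed
  have cancel: "inv\<^bsub>H\<^esub> u \<otimes>\<^bsub>H\<^esub> v = w" if "v = u \<otimes>\<^bsub>H\<^esub> w" "u \<in> carrier H" "w \<in> carrier H" for u v w
    using that H.cancel_right(2) by simp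
  have crossing: "inv\<^bsub>H\<^esub> (?\<eta> (boundary_point g (real k + t))) \<otimes>\<^bsub>H\<^esub> ?\<eta> (boundary_point g (real (partner k) + (1 - t))) = ?T k"
    if k: "k < 4 * g" and t: "t \<in> {0..1}" for k t
  proof (rule cancel[OF _ \<eta> lab(4)[OF k]])
    have p: "partner k < 4 * g" using partner_less[OF k] .
    consider "t = 0" | "t = 1" | "0 < t" "t < 1" using t by fastforce
    thus "?\<eta> (boundary_point g (real (partner k) + (1 - t))) = ?\<eta> (boundary_point g (real k + t)) \<otimes>\<^bsub>H\<^esub> ?T k"
    proof cases
      case 1
      thus ?thesis using boundary_label_corner[OF g _ relation, of k] boundary_label_corner[OF g _ relation, of "partner k + 1"] k p lab(1)[OF k]
        by (simp add: add.commute)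
    next
      case 2
      thus ?thesis using boundary_label_corner[OF g _ relation, of "k + 1"] boundary_label_corner[OF g _ relation, of "partner k"] k p lab(2)[OF k]
        by (simp add: add.commute)
    next
      case 3
      thus ?thesis using boundary_label_side[OF g k 3, where H = H and a = a and b = b]
          boundary_label_side[OF g p, of "1 - t", where H = H and a = a and b = b] lab(3)[OF k] by simp
    qed
  qed
  interpret flat_cocycle "cball 0 1" f S d0 "polygon_pieces g" H ?\<eta>
  proof
    show "?\<eta> d \<in> carrier H" for d by (rule \<eta>)
    fix P x y x' y' assume P: "P \<in> polygon_pieces g" and xy: "(x, y) \<in> P" "(x', y') \<in> P"
    from P consider "P = (\<lambda>x. (x, x)) ` cball 0 1"
      | k where "k < 4 * g" "P = (\<lambda>t. (boundary_point g (real k + t), boundary_point g (real (partner k) + (1 - t)))) ` {0..1}"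
      | k l where "P = {(boundary_point g (real k), boundary_point g (real l))}"
      unfolding polygon_pieces_def by auto
    thus "inv\<^bsub>H\<^esub> ?\<eta> x \<otimes>\<^bsub>H\<^esub> ?\<eta> y = inv\<^bsub>H\<^esub> ?\<eta> x' \<otimes>\<^bsub>H\<^esub> ?\<eta> y'"
    proof cases
      case 1
      hence "x = y" "x' = y'" using xy by auto
      thus ?thesis using \<eta> by simp
    next
      case 2
      obtain t where "t \<in> {0..1}" "x = boundary_point g (real k + t)" "y = boundary_point g (real (partner k) + (1 - t))"
        using xy(1) unfolding 2 by blast
      moreover obtain u where "u \<in> {0..1}" "x' = boundary_point g (real k + u)" "y' = boundary_point g (real (partner k) + (1 - u))"
        using xy(2) unfolding 2 by blast
      ultimately show ?thesis using crossing[OF 2(1)] by simp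
    next
      case 3
      thus ?thesis using xy by simp
    qed
  qed
  obtain \<phi> where \<phi>: "\<phi> \<in> hom \<pi>\<^sub>1 H" "\<forall>d\<in>cball 0 1. \<forall>d'\<in>cball 0 1. f d = f d' \<longrightarrow> \<phi> (jump d d') = inv\<^bsub>H\<^esub> (?\<eta> d) \<otimes>\<^bsub>H\<^esub> ?\<eta> d'"
    using holonomy_hom by blast
  have \<phi>k: "\<phi> (side_class k) = ?T k" if k: "k < 4 * g" for k
    using \<phi>(2)[rule_format, OF boundary_point_in boundary_point_in same_image_side[OF k, of "1 / 2"]] crossing[OF k, of "1 / 2"]
    by (simp add: side_class_def)
  have "\<phi> (gen_a i) = a i \<and> \<phi> (gen_b i) = b i" if "i < g" for i
    unfolding gen_a_def gen_b_def using \<phi>k[of "4 * i"] \<phi>k[of "4 * i + 3"] that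
    by (simp add: crossing_label_def Let_def)
  thus ?thesis using \<phi>(1) by blast
qed

end

section \<open>Convergent sequences of homeomorphisms\<close>

text \<open>Pointwise convergence of increasing maps to a continuous map is locally uniform; only the consequence for
convergent arguments is needed.\<close>

lemma increasing_limit_compose:
  assumes F: "\<forall>n. inc_homeo (F n)" "inc_homeo F0" and lim: "\<forall>x. (\<lambda>n. F n x) \<longlonglongrightarrow> F0 x" and y: "y \<longlonglongrightarrow> l"
  shows "(\<lambda>n. F n (y n)) \<longlonglongrightarrow> F0 l"
proof (rule order_tendstoI)
  fix a assume "a < F0 l"
  then obtain b where b: "a < b" "b < F0 l" using dense by blast
  define x where "x = finv F0 b"
  have x: "x < l" "a < F0 x" using b F(2) by (simp_all add: x_def inc_homeo_inv_less)
  have "eventually (\<lambda>n. a < F n x) sequentially" using order_tendstoD[OF lim[rule_format]] x(2) by blast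
  moreover have "eventually (\<lambda>n. x < y n) sequentially" using y x(1) by (rule order_tendstoD)
  ultimately show "eventually (\<lambda>n. a < F n (y n)) sequentially"
  proof eventually_elim
    case (elim n)
    have "F n x < F n (y n)" using elim(2) inc_homeo_less[OF F(1)[rule_format, of n]] by blast
    thus ?case using elim(1) by linarith
  qed
next
  fix a assume "F0 l < a"
  then obtain b where b: "b < a" "F0 l < b" using dense by blast
  define x where "x = finv F0 b"
  have x: "l < x" "F0 x < a" using b F(2) by (simp_all add: x_def inc_homeo_less_inv)
  have "eventually (\<lambda>n. F n x < a) sequentially" using order_tendstoD[OF lim[rule_format]] x(2) by blast
  moreover have "eventually (\<lambda>n. y n < x) sequentially" using y x(1) by (rule order_tendstoD)
  ultimately show "eventually (\<lambda>n. F n (y n) < a) sequentially"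
  proof eventually_elim
    case (elim n)
    have "F n (y n) < F n x" using elim(2) inc_homeo_less[OF F(1)[rule_format, of n]] by blast
    thus ?case using elim(1) by linarith
  qed
qed

lemma increasing_limit_inverse:
  assumes F: "\<forall>n. inc_homeo (F n)" "inc_homeo F0" and lim: "\<forall>x. (\<lambda>n. F n x) \<longlonglongrightarrow> F0 x"
  shows "(\<lambda>n. finv (F n) x) \<longlonglongrightarrow> finv F0 x"
proof (rule order_tendstoI)
  fix a assume "a < finv F0 x"
  hence "F0 a < x" using F(2) by (simp add: inc_homeo_less_inv)
  hence "eventually (\<lambda>n. F n a < x) sequentially" using order_tendstoD[OF lim[rule_format]] by blast
  thus "eventually (\<lambda>n. a < finv (F n) x) sequentially"
    by eventually_elim (simp add: inc_homeo_less_inv F(1)[rule_format])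
next
  fix a assume "finv F0 x < a"
  hence "x < F0 a" using F(2) by (simp add: inc_homeo_inv_less)
  hence "eventually (\<lambda>n. x < F n a) sequentially" using order_tendstoD[OF lim[rule_format]] by blast
  thus "eventually (\<lambda>n. finv (F n) x < a) sequentially"
    by eventually_elim (simp add: inc_homeo_inv_less F(1)[rule_format])
qed

text \<open>The entry at \<open>0\<close> is the limit of the entries at positive indices. A homomorphism into this group is a sequence
of homomorphisms together with its limit; convergence on the generators gives convergence at
every group element, because the convergent sequences form a group.\<close>

definition convergent_homeos :: "real \<Rightarrow> (nat \<Rightarrow> real \<Rightarrow> real) monoid" where
  "convergent_homeos L =
    \<lparr>carrier = {X. (\<forall>n. translation_homeo L (X n)) \<and> (\<forall>x. (\<lambda>n. X (Suc n) x) \<longlonglongrightarrow> X 0 x)},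
     mult = \<lambda>X Y n. X n \<circ> Y n, one = \<lambda>_. id\<rparr>"

lemma convergent_homeos_inverse:
  assumes X: "X \<in> carrier (convergent_homeos L)" shows "(\<lambda>n. finv (X n)) \<in> carrier (convergent_homeos L)"
proof -
  have tr: "\<forall>n. translation_homeo L (X n)" and lim: "\<forall>x. (\<lambda>n. X (Suc n) x) \<longlonglongrightarrow> X 0 x"
    using X by (simp_all add: convergent_homeos_def)
  have inc: "\<forall>n. inc_homeo (X (Suc n))" "inc_homeo (X 0)" using tr by (auto simp: translation_homeo_def)
  have "(\<lambda>n. finv (X (Suc n)) x) \<longlonglongrightarrow> finv (X 0) x" for x by (rule increasing_limit_inverse[OF inc lim])
  thus ?thesis using tr by (simp add: convergent_homeos_def)
qed

lemma group_convergent_homeos: "group (convergent_homeos L)"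
proof (rule groupI)
  fix X Y assume "X \<in> carrier (convergent_homeos L)" "Y \<in> carrier (convergent_homeos L)"
  hence X: "\<forall>n. translation_homeo L (X n)" "\<forall>x. (\<lambda>n. X (Suc n) x) \<longlonglongrightarrow> X 0 x"
    and Y: "\<forall>n. translation_homeo L (Y n)" "\<forall>x. (\<lambda>n. Y (Suc n) x) \<longlonglongrightarrow> Y 0 x"
    by (simp_all add: convergent_homeos_def)
  have inc: "\<forall>n. inc_homeo (X (Suc n))" "inc_homeo (X 0)" using X by (auto simp: translation_homeo_def)
  have "(\<lambda>n. X (Suc n) (Y (Suc n) x)) \<longlonglongrightarrow> X 0 (Y 0 x)" for x
    by (rule increasing_limit_compose[OF inc X(2)]) (rule Y(2)[rule_format])
  thus "X \<otimes>\<^bsub>convergent_homeos L\<^esub> Y \<in> carrier (convergent_homeos L)"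
    using X Y by (simp add: convergent_homeos_def)
next
  fix X assume X: "X \<in> carrier (convergent_homeos L)"
  hence "\<forall>n. inc_homeo (X n)" by (simp add: convergent_homeos_def translation_homeo_def)
  hence "(\<lambda>n. finv (X n)) \<otimes>\<^bsub>convergent_homeos L\<^esub> X = \<one>\<^bsub>convergent_homeos L\<^esub>"
    by (simp add: convergent_homeos_def)
  thus "\<exists>Y\<in>carrier (convergent_homeos L). Y \<otimes>\<^bsub>convergent_homeos L\<^esub> X = \<one>\<^bsub>convergent_homeos L\<^esub>"
    using convergent_homeos_inverse[OF X] by blast
qed (auto simp: convergent_homeos_def comp_assoc)

lemma convergent_homeos_inv:
  assumes X: "X \<in> carrier (convergent_homeos L)" shows "inv\<^bsub>convergent_homeos L\<^esub> X = (\<lambda>n. finv (X n))"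
proof -
  interpret group "convergent_homeos L" by (rule group_convergent_homeos)
  have "\<forall>n. inc_homeo (X n)" using X by (simp add: convergent_homeos_def translation_homeo_def)
  hence "(\<lambda>n. finv (X n)) \<otimes>\<^bsub>convergent_homeos L\<^esub> X = \<one>\<^bsub>convergent_homeos L\<^esub>"
    by (simp add: convergent_homeos_def)
  thus ?thesis using X convergent_homeos_inverse[OF X] by (rule inv_equality)
qed

lemma commutator_product_Suc: "commutator_product (Suc n) a b = commutator_product n a b \<circ> commutator (a n) (b n)"
  by (simp add: commutator_product_def comp_list_append)

lemma convergent_homeos_word:
  assumes "\<forall>i<n. X i \<in> carrier (convergent_homeos L) \<and> Y i \<in> carrier (convergent_homeos L)"
  shows "commutator_word (convergent_homeos L) X Y n = (\<lambda>m. commutator_product n (\<lambda>i. X i m) (\<lambda>i. Y i m))"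
  using assms
proof (induction n)
  case 0
  show ?case by (simp add: convergent_homeos_def commutator_product_def)
next
  case (Suc n)
  have mult: "A \<otimes>\<^bsub>convergent_homeos L\<^esub> B = (\<lambda>m. A m \<circ> B m)" for A B by (simp add: convergent_homeos_def)
  have IH: "commutator_word (convergent_homeos L) X Y n = (\<lambda>m. commutator_product n (\<lambda>i. X i m) (\<lambda>i. Y i m))"
    using Suc by simp
  have inv: "inv\<^bsub>convergent_homeos L\<^esub> X n = (\<lambda>m. finv (X n m))" "inv\<^bsub>convergent_homeos L\<^esub> Y n = (\<lambda>m. finv (Y n m))"
    using Suc.prems convergent_homeos_inv by auto
  show ?case unfolding commutator_word.simps IH inv mult commutator_product_Suc commutator_def by (simp add: comp_assoc)
qed

lemma hom_commutator_word:
  assumes "group G" "group H" "\<phi> \<in> hom G H" "\<forall>i<n. a i \<in> carrier G \<and> b i \<in> carrier G"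
  shows "\<phi> (commutator_word G a b n) = commutator_word H (\<lambda>i. \<phi> (a i)) (\<lambda>i. \<phi> (b i)) n"
  using assms(4)
proof (induction n)
  interpret group_hom G H \<phi> using assms by (simp add: group_hom_def group_hom_axioms_def)
  case 0
  show ?case by simp
next
  interpret group_hom G H \<phi> using assms by (simp add: group_hom_def group_hom_axioms_def)
  case (Suc n)
  have "commutator_word G a b n \<in> carrier G" using Suc.prems by (intro G.commutator_word_closed) simp
  thus ?case using Suc by simp
qed

section \<open>The compact-open topology\<close>

lemma compact_open_topspace: "topspace (compact_open_topology M H) = H"
proof -
  have "H \<in> {{f \<in> H. f ` K \<subseteq> V} | K V. compact K \<and> K \<subseteq> M \<and> openin (top_of_set M) V}"
    by (intro CollectI exI[of _ "{}"]) auto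
  thus ?thesis unfolding compact_open_topology_def topology_generated_by_topspace by blast
qed

lemma limitin_compact_open:
  assumes f: "f \<in> H" "\<forall>n. h n \<in> H"
    and conv: "\<forall>K V. compact K \<and> K \<subseteq> M \<and> openin (top_of_set M) V \<and> f ` K \<subseteq> V \<longrightarrow> (\<forall>\<^sub>F n in sequentially. h n ` K \<subseteq> V)"
  shows "limitin (compact_open_topology M H) h f sequentially"
  unfolding limitin_def
proof (intro conjI allI impI)
  show "f \<in> topspace (compact_open_topology M H)" using f by (simp add: compact_open_topspace)
  fix W assume W: "openin (compact_open_topology M H) W \<and> f \<in> W"
  hence "generate_topology_on {{f \<in> H. f ` K \<subseteq> V} | K V. compact K \<and> K \<subseteq> M \<and> openin (top_of_set M) V} W"
    unfolding compact_open_topology_def by (simp add: openin_topology_generated_by_iff)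
  moreover have "f \<in> W" using W by simp
  ultimately show "\<forall>\<^sub>F n in sequentially. h n \<in> W"
  proof (induction rule: generate_topology_on.induct)
    case (Int a b)
    thus ?case by (auto intro: eventually_conj)
  next
    case (UN K)
    then obtain k where k: "k \<in> K" "f \<in> k" by blast
    show ?case using UN.IH[OF k] by (rule eventually_mono) (use k in blast)
  next
    case (Basis s)
    then obtain K V where s: "s = {f \<in> H. f ` K \<subseteq> V}" "compact K" "K \<subseteq> M" "openin (top_of_set M) V" by blast
    have "\<forall>\<^sub>F n in sequentially. h n ` K \<subseteq> V" using conv s Basis.prems by blast
    thus ?case by (rule eventually_mono) (use s f(2) in blast)
  qed simp
qed

section \<open>Actions lifted to the line\<close>

text \<open>The common description of the line (\<open>L = 0\<close>, \<open>q\<close> the identity) and of the circle (\<open>L = 2 * pi\<close>, \<open>q = cis\<close>):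
the orientation preserving homeomorphisms are those covered by a homeomorphism of the line commuting with
the deck transformations.\<close>

locale covered_line =
  fixes L :: real and q :: "real \<Rightarrow> 'm::metric_space" and M :: "'m set" and H :: "('m \<Rightarrow> 'm) monoid"
  assumes L: "L \<ge> 0" and cont_q: "continuous_on UNIV q" and range_q: "range q = M"
    and q_eq_iff: "\<And>s t. q s = q t \<longleftrightarrow> (\<exists>k::int. s = t + of_int k * L)"
    and compact_lift: "\<And>K. compact K \<Longrightarrow> K \<subseteq> M \<Longrightarrow> \<exists>I. compact I \<and> K \<subseteq> q ` I"
    and carrier_H: "carrier H = {h \<in> Bij M. \<exists>F. translation_homeo L F \<and> (\<forall>t. h (q t) = q (F t))}"
    and mult_H: "mult H = mult (BijGroup M)"
begin

definition push :: "(real \<Rightarrow> real) \<Rightarrow> 'm \<Rightarrow> 'm" where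
  "push F = (\<lambda>x\<in>M. q (F (SOME t. q t = x)))"

lemma q_in [simp]: "q t \<in> M"
  using range_q by blast

lemma push_q [simp]: assumes F: "translation_homeo L F" shows "push F (q t) = q (F t)"
proof -
  define s where "s = (SOME s. q s = q t)"
  have "q s = q t" unfolding s_def by (rule someI_ex) blast
  then obtain k :: int where "s = t + of_int k * L" using q_eq_iff by blast
  hence "F s = F t + of_int k * L" using translation_homeo_int[OF F] by simp
  hence "q (F s) = q (F t)" using q_eq_iff by blast
  thus ?thesis by (simp add: push_def s_def)
qed

lemma push_eqI:
  assumes F: "translation_homeo L F" and h: "h \<in> extensional M" "\<forall>t. h (q t) = q (F t)" shows "push F = h"
proof (rule extensionalityI[of _ M])
  show "push F \<in> extensional M" by (simp add: push_def)
  show "h \<in> extensional M" by fact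
  fix x assume "x \<in> M"
  then obtain t where "x = q t" using range_q by blast
  thus "push F x = h x" using F h(2) by simp
qed

lemma push_Bij: assumes F: "translation_homeo L F" shows "push F \<in> Bij M"
proof -
  have inv: "push (finv G) (push G x) = x" if "translation_homeo L G" "x \<in> M" for G x
  proof -
    obtain t where "x = q t" using range_q \<open>x \<in> M\<close> by blast
    moreover have "inc_homeo G" using that(1) by (rule translation_homeoD)
    ultimately show ?thesis using that(1) by simp
  qed
  have img: "push G ` M \<subseteq> M" if "translation_homeo L G" for G
  proof
    fix y assume "y \<in> push G ` M"
    then obtain x where "x \<in> M" "y = push G x" by blast
    then obtain t where "y = push G (q t)" using range_q by blast
    thus "y \<in> M" using that by simp
  qed
  have F': "translation_homeo L (finv F)" using F by simp
  have "finv (finv F) = F" using F by (simp add: translation_homeoD[OF F])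
  hence "\<forall>x\<in>M. push F (push (finv F) x) = x" using inv[OF F'] by simp
  hence "bij_betw (push F) M M"
    by (intro bij_betw_byWitness[where f' = "push (finv F)"]) (use inv[OF F] img[OF F] img[OF F'] in auto)
  thus ?thesis by (simp add: Bij_def push_def)
qed

lemma push_carrier: "translation_homeo L F \<Longrightarrow> push F \<in> carrier H"
  unfolding carrier_H using push_Bij by (intro CollectI conjI exI[of _ F]) auto

lemma carrier_Bij: "h \<in> carrier H \<Longrightarrow> h \<in> carrier (BijGroup M)"
  by (simp add: carrier_H BijGroup_def)

lemma push_comp:
  assumes F: "translation_homeo L F" and G: "translation_homeo L G"
  shows "push (F \<circ> G) = push F \<otimes>\<^bsub>BijGroup M\<^esub> push G"
proof (rule push_eqI)
  show "translation_homeo L (F \<circ> G)" using F G by simp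
  show "push F \<otimes>\<^bsub>BijGroup M\<^esub> push G \<in> extensional M" "\<forall>t. (push F \<otimes>\<^bsub>BijGroup M\<^esub> push G) (q t) = q ((F \<circ> G) t)"
    using push_Bij[OF F] push_Bij[OF G] F G by (simp_all add: BijGroup_def compose_def)
qed

lemma push_id: "push id = \<one>\<^bsub>BijGroup M\<^esub>"
  by (rule push_eqI) (auto simp: BijGroup_def)

lemma push_inv: assumes F: "translation_homeo L F" shows "push (finv F) = inv\<^bsub>BijGroup M\<^esub> push F"
proof -
  interpret group "BijGroup M" by (rule group_BijGroup)
  have F': "translation_homeo L (finv F)" using F by simp
  have "push (finv F) \<otimes>\<^bsub>BijGroup M\<^esub> push F = \<one>\<^bsub>BijGroup M\<^esub>"
    unfolding push_comp[OF F' F, symmetric] inc_homeo_inv_comp(1)[OF translation_homeoD[OF F]] by (rule push_id)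
  hence "inv\<^bsub>BijGroup M\<^esub> push F = push (finv F)"
    by (rule inv_equality) (use push_carrier[OF F] push_carrier[OF F'] carrier_Bij in auto)
  thus ?thesis ..
qed

lemma translation_commutator_product:
  assumes "\<forall>i<n. translation_homeo L (a i) \<and> translation_homeo L (b i)"
  shows "translation_homeo L (commutator_product n a b)"
  using assms by (induction n) (simp_all add: commutator_product_Suc, simp add: commutator_product_def)

lemma push_commutator_product:
  assumes "\<forall>i<n. translation_homeo L (a i) \<and> translation_homeo L (b i)"
  shows "push (commutator_product n a b) = commutator_word (BijGroup M) (\<lambda>i. push (a i)) (\<lambda>i. push (b i)) n"
  using assms
proof (induction n)
  case 0
  have "commutator_product 0 a b = id" by (simp add: commutator_product_def fun_eq_iff)
  thus ?case unfolding commutator_word.simps by (simp only: push_id)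
next
  case (Suc n)
  have ab: "translation_homeo L (a n)" "translation_homeo L (b n)" using Suc.prems by auto
  have W: "translation_homeo L (commutator_product n a b)" by (rule translation_commutator_product) (use Suc.prems in auto)
  have IH: "push (commutator_product n a b) = commutator_word (BijGroup M) (\<lambda>i. push (a i)) (\<lambda>i. push (b i)) n"
    using Suc by simp
  show ?case unfolding commutator_word.simps IH[symmetric] push_inv[OF ab(1), symmetric] push_inv[OF ab(2), symmetric]
      commutator_product_Suc commutator_def
    using ab W by (simp only: push_comp[symmetric] comp_assoc translation_homeo_comp translation_homeo_inv)
qed

text \<open>Two maps that agree at \<open>p\<close> agree at its translates, so at any point they differ by less than \<open>L\<close>; being
lifts of the same point there, they are equal.\<close>

lemma same_value:
  assumes F: "translation_homeo L F" and G: "translation_homeo L G" and p: "F p = G p" and y: "q (F y) = q (G y)"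
  shows "F y = G y"
proof (cases "L = 0")
  case True
  thus ?thesis using y q_eq_iff by auto
next
  case False
  hence L': "L > 0" using L by simp
  define j where "j = \<lfloor>(y - p) / L\<rfloor>"
  have "of_int j \<le> (y - p) / L" "(y - p) / L < of_int j + 1" unfolding j_def by linarith+
  hence y': "p + of_int j * L \<le> y" "y < p + of_int (j + 1) * L" using L' by (simp_all add: field_simps)
  have bounds: "E p + of_int j * L \<le> E y \<and> E y < E p + of_int (j + 1) * L" if E: "translation_homeo L E" for E
    using inc_homeo_le[OF translation_homeoD[OF E], of "p + of_int j * L" y]
      inc_homeo_less[OF translation_homeoD[OF E], of y "p + of_int (j + 1) * L"] y'
      translation_homeo_int[OF E, of p j] translation_homeo_int[OF E, of p "j + 1"] by argo
  obtain k :: int where k: "F y = G y + of_int k * L" using y q_eq_iff by blast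
  have "\<bar>of_int k * L\<bar> < L" using bounds[OF F] bounds[OF G] k p unfolding of_int_add of_int_1 distrib_right abs_less_iff by linarith
  hence "\<bar>of_int k :: real\<bar> * L < 1 * L" using L' by (simp add: abs_mult)
  hence "\<bar>of_int k :: real\<bar> < 1" using L' mult_less_cancel_right_pos by blast
  hence "k = 0" by linarith
  thus ?thesis using k by simp
qed

lemma lift_fixing:
  assumes h: "h \<in> carrier H" and p: "h (q p) = q p"
  shows "\<exists>F. translation_homeo L F \<and> push F = h \<and> F p = p"
proof -
  obtain F where F: "translation_homeo L F" "\<forall>t. h (q t) = q (F t)" and hB: "h \<in> Bij M" using h by (auto simp: carrier_H)
  obtain k :: int where k: "F p = p + of_int k * L" using F(2) p q_eq_iff by metis
  define F' where "F' = (\<lambda>t. F t - of_int k * L)"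
  have inc: "inc_homeo F" using F(1) by (rule translation_homeoD)
  have "strict_mono F'" using inc by (simp add: F'_def strict_mono_def inc_homeo_less)
  moreover have "surj F'"
  proof (rule surjI)
    show "F' (finv F (x + of_int k * L)) = x" for x using inc by (simp add: F'_def)
  qed
  ultimately have F': "translation_homeo L F'" using F(1) by (simp add: translation_homeo_def inc_homeo_def F'_def)
  have "q (F' t) = h (q t)" for t
    using F(2) q_eq_iff[of "F' t" "F t"] by (auto simp: F'_def intro!: exI[of _ "- k"])
  hence "push F' = h" using push_eqI[OF F' Bij_imp_extensional[OF hB]] by simp
  thus ?thesis using F' k by (intro exI[of _ F']) (simp add: F'_def)
qed

text \<open>A counterexample would be a sequence of points of \<open>K\<close> that are mapped outside \<open>V\<close>. Lifted to a compact set of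
the line it has a convergent subsequence, whose limit is mapped outside \<open>V\<close> by the limit map.\<close>

lemma push_converges:
  assumes F: "\<forall>n. translation_homeo L (F n)" "translation_homeo L F0" and lim: "\<forall>x. (\<lambda>n. F n x) \<longlonglongrightarrow> F0 x"
    and K: "compact K" "K \<subseteq> M" and V: "openin (top_of_set M) V" and sub: "push F0 ` K \<subseteq> V"
  shows "\<forall>\<^sub>F n in sequentially. push (F n) ` K \<subseteq> V"
proof (rule ccontr)
  assume "\<not> (\<forall>\<^sub>F n in sequentially. push (F n) ` K \<subseteq> V)"
  then obtain r :: "nat \<Rightarrow> nat" where r: "strict_mono r" "\<forall>n. \<not> push (F (r n)) ` K \<subseteq> V"
    using not_eventually_sequentiallyD by blast
  obtain I where I: "compact I" "K \<subseteq> q ` I" using compact_lift[OF K] by blast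
  have "\<forall>n. \<exists>t. t \<in> I \<and> q t \<in> K \<and> push (F (r n)) (q t) \<notin> V" using r(2) I(2) by blast
  then obtain t where t: "\<forall>n. t n \<in> I \<and> q (t n) \<in> K \<and> push (F (r n)) (q (t n)) \<notin> V" by metis
  obtain l s where s: "l \<in> I" "strict_mono (s :: nat \<Rightarrow> nat)" "(t \<circ> s) \<longlonglongrightarrow> l"
    using I(1) t unfolding compact_def by metis
  have qc: "isCont q x" for x using cont_q by (simp add: continuous_on_eq_continuous_at)
  have "(\<lambda>n. q ((t \<circ> s) n)) \<longlonglongrightarrow> q l" by (rule isCont_tendsto_compose[OF qc s(3)])
  hence lK: "q l \<in> K" using compact_imp_closed[OF K(1)] t by (auto intro: closed_sequentially)
  have inc: "\<forall>n. inc_homeo (F (r (s n)))" "inc_homeo F0" using F by (auto simp: translation_homeo_def)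
  have lim': "\<forall>x. (\<lambda>n. F (r (s n)) x) \<longlonglongrightarrow> F0 x"
    using LIMSEQ_subseq_LIMSEQ[OF lim[rule_format] strict_mono_o[OF r(1) s(2)]] by (simp add: o_def)
  have "(\<lambda>n. F (r (s n)) ((t \<circ> s) n)) \<longlonglongrightarrow> F0 l" by (rule increasing_limit_compose[OF inc lim' s(3)])
  hence to: "(\<lambda>n. q (F (r (s n)) ((t \<circ> s) n))) \<longlonglongrightarrow> q (F0 l)" by (rule isCont_tendsto_compose[OF qc])
  obtain O' where O': "open O'" "V = M \<inter> O'" using V by (auto simp: openin_open)
  have "q (F0 l) \<in> V" using sub lK F(2) push_q by (metis image_subset_iff)
  hence "\<forall>\<^sub>F n in sequentially. q (F (r (s n)) ((t \<circ> s) n)) \<in> O'" using to O' by (auto dest: topological_tendstoD)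
  then obtain n where "q (F (r (s n)) (t (s n))) \<in> O'" by (auto dest: eventually_happens'[OF sequentially_bot])
  hence "push (F (r (s n))) (q (t (s n))) \<in> V" using F(1) O'(2) by simp
  thus False using t by blast
qed

end

section \<open>Perturbing a representation\<close>

lemma topspace_Rep: "topspace (Rep G M H) = (\<Pi>\<^sub>E \<gamma>\<in>carrier G. carrier H) \<inter> hom G H"
  by (simp add: Rep_def compact_open_topspace topspace_product_topology)

locale surface_action = polygon_surface g f S d0 + covered_line L q M H
  for g f and S :: "'a::topological_space set" and d0 L q and M :: "'m::metric_space set" and H
begin

lemma hom_BijGroup: assumes "\<rho> \<in> hom \<pi>\<^sub>1 H" shows "\<rho> \<in> hom \<pi>\<^sub>1 (BijGroup M)"
  using assms carrier_Bij mult_H by (auto simp: hom_def)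

text \<open>If a point is fixed by the whole group, then the generators have lifts fixing a point over it, and these lifts
satisfy the relation exactly, since the product of commutators also lifts the identity and fixes that point.
The lifted tuple is perturbed with errors tending to \<open>0\<close> on growing intervals. The sequences of perturbed
letters define a homomorphism into the group of convergent sequences; its entries push down to the
approximating representations, and its limit pushes down to \<open>\<rho>\<close>, because it does so on the generators.\<close>

theorem approximated_without_fixed_point:
  assumes g2: "g \<ge> 2" and \<rho>: "\<rho> \<in> topspace (Rep \<pi>\<^sub>1 M H)" and fixed: "global_fixed_point \<pi>\<^sub>1 M \<rho> x"
  shows "\<exists>\<rho>s. limitin (Rep \<pi>\<^sub>1 M H) \<rho>s \<rho> sequentially \<and> (\<forall>n. \<not> (\<exists>x. global_fixed_point \<pi>\<^sub>1 M (\<rho>s n) x))"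
proof -
  have \<rho>E: "\<rho> \<in> (\<Pi>\<^sub>E \<gamma>\<in>carrier \<pi>\<^sub>1. carrier H)" and \<rho>hom: "\<rho> \<in> hom \<pi>\<^sub>1 H" using \<rho> by (auto simp: topspace_Rep)
  have \<rho>H: "\<rho> \<gamma> \<in> carrier H" if "\<gamma> \<in> carrier \<pi>\<^sub>1" for \<gamma> using \<rho>E that by auto
  note gens = generators(5,6)
  have gens_in: "\<forall>i<g. gen_a i \<in> carrier \<pi>\<^sub>1 \<and> gen_b i \<in> carrier \<pi>\<^sub>1" using gens by blast
  obtain p where p: "x = q p" using fixed range_q unfolding global_fixed_point_def by blast
  have pfix: "\<rho> \<gamma> (q p) = q p" if "\<gamma> \<in> carrier \<pi>\<^sub>1" for \<gamma> using fixed that p by (simp add: global_fixed_point_def)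
  have "\<forall>i. \<exists>F. i < g \<longrightarrow> translation_homeo L F \<and> push F = \<rho> (gen_a i) \<and> F p = p"
    using lift_fixing[OF \<rho>H pfix] gens(1) by blast
  then obtain A where A: "\<forall>i<g. translation_homeo L (A i) \<and> push (A i) = \<rho> (gen_a i) \<and> A i p = p" by metis
  have "\<forall>i. \<exists>F. i < g \<longrightarrow> translation_homeo L F \<and> push F = \<rho> (gen_b i) \<and> F p = p"
    using lift_fixing[OF \<rho>H pfix] gens(2) by blast
  then obtain B where B: "\<forall>i<g. translation_homeo L (B i) \<and> push (B i) = \<rho> (gen_b i) \<and> B i p = p" by metis
  have grB: "group (BijGroup M)" by (rule group_BijGroup)
  have AB: "\<forall>i<g. translation_homeo L (A i) \<and> translation_homeo L (B i)" using A B by blast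
  have word_cong: "commutator_word (BijGroup M) a b n = commutator_word (BijGroup M) a' b' n"
    if "\<forall>i<n. a i = a' i \<and> b i = b' i" for a b a' b' n using that by (induction n) auto
  \<comment> \<open>The relation holds for the lifts: \<open>W\<close> covers the identity and fixes \<open>p\<close>.\<close>
  define W where "W = commutator_product g A B"
  have W: "translation_homeo L W" unfolding W_def by (rule translation_commutator_product[OF AB])
  have "push W = commutator_word (BijGroup M) (\<lambda>i. push (A i)) (\<lambda>i. push (B i)) g"
    unfolding W_def by (rule push_commutator_product[OF AB])
  also have "\<dots> = commutator_word (BijGroup M) (\<lambda>i. \<rho> (gen_a i)) (\<lambda>i. \<rho> (gen_b i)) g"
    by (rule word_cong) (use A B in simp)
  also have "\<dots> = \<rho> (commutator_word \<pi>\<^sub>1 gen_a gen_b g)"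
    by (rule hom_commutator_word[OF fg.is_group grB hom_BijGroup[OF \<rho>hom] gens_in, symmetric])
  also have "\<dots> = \<one>\<^bsub>BijGroup M\<^esub>"
    unfolding surface_relation by (rule hom_one[OF hom_BijGroup[OF \<rho>hom] fg.is_group grB])
  also have "\<dots> = push id" by (rule push_id[symmetric])
  finally have pushW: "push W = push id" .
  have "commutator (A i) (B i) p = p" if "i < g" for i
  proof -
    have inc: "inc_homeo (A i)" "inc_homeo (B i)" using AB that by (auto simp: translation_homeo_def)
    have "finv (A i) p = p" "finv (B i) p = p" using inc A B that by (simp_all add: inc_homeo_inv_eq)
    thus ?thesis using A B that by (simp add: commutator_def)
  qed
  hence Wp: "W p = p" unfolding W_def commutator_product_def by (intro comp_list_fix) simp
  have "W y = y" for y
    using same_value[OF W translation_homeo_id, of p y] Wp push_q[OF W, of y] push_q[OF translation_homeo_id, of y] pushW by simp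
  hence Wid: "W = id" by auto
  have tuple: "tuple_relation L g A B" unfolding tuple_relation_def using AB Wid by (simp add: W_def)
  have "p \<in> common_fixed g A B" using A B by (simp add: common_fixed_def)
  hence ne: "common_fixed g A B \<noteq> {}" by blast
  have "\<forall>n. \<exists>ab. tuple_relation L g (fst ab) (snd ab) \<and> common_fixed g (fst ab) (snd ab) = {} \<and>
      (\<forall>i<g. \<forall>x. L > 0 \<or> \<bar>x\<bar> \<le> real n + 1 \<longrightarrow> \<bar>fst ab i x - A i x\<bar> \<le> 1 / (real n + 1) \<and> \<bar>snd ab i x - B i x\<bar> \<le> 1 / (real n + 1)) \<and>
      (\<forall>i<g. (\<exists>y. fst ab i y = y) \<and> (\<exists>y. snd ab i y = y))"
  proof
    fix n
    have pos: "0 < 1 / (real n + 1)" "0 < real n + 1" by auto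
    show "\<exists>ab. tuple_relation L g (fst ab) (snd ab) \<and> common_fixed g (fst ab) (snd ab) = {} \<and>
      (\<forall>i<g. \<forall>x. L > 0 \<or> \<bar>x\<bar> \<le> real n + 1 \<longrightarrow> \<bar>fst ab i x - A i x\<bar> \<le> 1 / (real n + 1) \<and> \<bar>snd ab i x - B i x\<bar> \<le> 1 / (real n + 1)) \<and>
      (\<forall>i<g. (\<exists>y. fst ab i y = y) \<and> (\<exists>y. snd ab i y = y))"
      using perturb_without_common_fixed_point[OF L g2 tuple ne pos] unfolding split_paired_Ex fst_conv snd_conv .
  qed
  from choice[OF this] obtain ab where ab0: "\<forall>n. tuple_relation L g (fst (ab n)) (snd (ab n)) \<and> common_fixed g (fst (ab n)) (snd (ab n)) = {} \<and>
      (\<forall>i<g. \<forall>x. L > 0 \<or> \<bar>x\<bar> \<le> real n + 1 \<longrightarrow> \<bar>fst (ab n) i x - A i x\<bar> \<le> 1 / (real n + 1) \<and> \<bar>snd (ab n) i x - B i x\<bar> \<le> 1 / (real n + 1)) \<and>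
      (\<forall>i<g. (\<exists>y. fst (ab n) i y = y) \<and> (\<exists>y. snd (ab n) i y = y))" ..
  define a b where "a = (\<lambda>n. fst (ab n))" and "b = (\<lambda>n. snd (ab n))"
  have ab: "tuple_relation L g (a n) (b n)" "common_fixed g (a n) (b n) = {}"
    "\<forall>i<g. \<forall>x. L > 0 \<or> \<bar>x\<bar> \<le> real n + 1 \<longrightarrow> \<bar>a n i x - A i x\<bar> \<le> 1 / (real n + 1) \<and> \<bar>b n i x - B i x\<bar> \<le> 1 / (real n + 1)"
    "\<forall>i<g. (\<exists>y. a n i y = y) \<and> (\<exists>y. b n i y = y)" for n
    using ab0 unfolding a_def b_def by blast+
  \<comment> \<open>Entry \<open>0\<close> is the original letter, entry \<open>n + 1\<close> its \<open>n\<close>-th perturbation.\<close>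
  define X Y where "X = (\<lambda>i. case_nat (A i) (\<lambda>n. a n i))" and "Y = (\<lambda>i. case_nat (B i) (\<lambda>n. b n i))"
  have XY: "\<forall>i<g. X i \<in> carrier (convergent_homeos L) \<and> Y i \<in> carrier (convergent_homeos L)"
  proof (intro allI impI)
    fix i assume i: "i < g"
    have tr: "translation_homeo L (X i n)" "translation_homeo L (Y i n)" for n
      using AB ab(1) i by (cases n; simp add: X_def Y_def tuple_relation_def)+
    have conv: "(\<lambda>n. h n x) \<longlonglongrightarrow> h0 x"
      if h: "\<forall>n x. L > 0 \<or> \<bar>x\<bar> \<le> real n + 1 \<longrightarrow> \<bar>h n x - h0 x\<bar> \<le> 1 / (real n + 1)" for h :: "nat \<Rightarrow> real \<Rightarrow> real" and h0 x
    proof (rule LIM_zero_cancel)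
      have "\<forall>\<^sub>F n in sequentially. \<bar>x\<bar> \<le> real n" by (rule eventually_sequentiallyI[of "nat \<lceil>\<bar>x\<bar>\<rceil>"]) linarith
      hence "\<forall>\<^sub>F n in sequentially. norm (h n x - h0 x) \<le> 1 / (real n + 1)"
      proof eventually_elim
        case (elim n)
        thus ?case using h[rule_format, of x n] by simp
      qed
      thus "(\<lambda>n. h n x - h0 x) \<longlonglongrightarrow> 0"
        by (rule Lim_null_comparison) (use LIMSEQ_inverse_real_of_nat in \<open>simp add: inverse_eq_divide add.commute\<close>)
    qed
    have "(\<lambda>n. a n i x) \<longlonglongrightarrow> A i x" "(\<lambda>n. b n i x) \<longlonglongrightarrow> B i x" for x
    proof -
      have "\<bar>a n i y - A i y\<bar> \<le> 1 / (real n + 1) \<and> \<bar>b n i y - B i y\<bar> \<le> 1 / (real n + 1)"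
        if "L > 0 \<or> \<bar>y\<bar> \<le> real n + 1" for n y
        using ab(3)[of n, THEN spec, of i, THEN mp, OF i, THEN spec, of y, THEN mp, OF that] .
      thus "(\<lambda>n. a n i x) \<longlonglongrightarrow> A i x" "(\<lambda>n. b n i x) \<longlonglongrightarrow> B i x"
        by (intro conv[of "\<lambda>n. a n i" "A i"] conv[of "\<lambda>n. b n i" "B i"] allI impI; simp)+
    qed
    thus "X i \<in> carrier (convergent_homeos L) \<and> Y i \<in> carrier (convergent_homeos L)"
      using tr by (simp add: convergent_homeos_def X_def Y_def)
  qed
  have rel: "commutator_word (convergent_homeos L) X Y g = \<one>\<^bsub>convergent_homeos L\<^esub>"
  proof -
    have "commutator_product g (\<lambda>i. X i m) (\<lambda>i. Y i m) = id" for m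
      using tuple ab(1) by (cases m) (simp_all add: X_def Y_def tuple_relation_def)
    thus ?thesis unfolding convergent_homeos_word[OF XY] by (simp add: convergent_homeos_def)
  qed
  obtain \<phi> where \<phi>: "\<phi> \<in> hom \<pi>\<^sub>1 (convergent_homeos L)" "\<forall>i<g. \<phi> (gen_a i) = X i \<and> \<phi> (gen_b i) = Y i"
    using surface_group_hom[OF group_convergent_homeos XY rel] by blast
  have \<phi>tr: "translation_homeo L (\<phi> \<gamma> n)" if "\<gamma> \<in> carrier \<pi>\<^sub>1" for \<gamma> n
    using hom_in_carrier[OF \<phi>(1) that] by (simp add: convergent_homeos_def)
  have \<phi>lim: "\<forall>x. (\<lambda>n. \<phi> \<gamma> (Suc n) x) \<longlonglongrightarrow> \<phi> \<gamma> 0 x" if "\<gamma> \<in> carrier \<pi>\<^sub>1" for \<gamma>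
    using hom_in_carrier[OF \<phi>(1) that] by (simp add: convergent_homeos_def)
  define \<sigma> where "\<sigma> = (\<lambda>n. \<lambda>\<gamma>\<in>carrier \<pi>\<^sub>1. push (\<phi> \<gamma> n))"
  have \<sigma>H: "\<sigma> n \<gamma> \<in> carrier H" if "\<gamma> \<in> carrier \<pi>\<^sub>1" for n \<gamma>
    using push_carrier[OF \<phi>tr[OF that]] that by (simp add: \<sigma>_def)
  have \<sigma>hom: "\<sigma> n \<in> hom \<pi>\<^sub>1 H" for n
  proof (rule homI)
    fix \<gamma> \<delta> assume \<gamma>: "\<gamma> \<in> carrier \<pi>\<^sub>1" and \<delta>: "\<delta> \<in> carrier \<pi>\<^sub>1"
    have "\<phi> (\<gamma> \<otimes>\<^bsub>\<pi>\<^sub>1\<^esub> \<delta>) n = \<phi> \<gamma> n \<circ> \<phi> \<delta> n" using hom_mult[OF \<phi>(1) \<gamma> \<delta>] by (simp add: convergent_homeos_def)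
    thus "\<sigma> n (\<gamma> \<otimes>\<^bsub>\<pi>\<^sub>1\<^esub> \<delta>) = \<sigma> n \<gamma> \<otimes>\<^bsub>H\<^esub> \<sigma> n \<delta>"
      unfolding mult_H using \<gamma> \<delta> push_comp[OF \<phi>tr[OF \<gamma>] \<phi>tr[OF \<delta>], of n n] by (simp add: \<sigma>_def)
  qed (rule \<sigma>H)
  have \<sigma>0: "\<sigma> 0 = \<rho>"
  proof -
    define P where "P = {\<gamma> \<in> carrier \<pi>\<^sub>1. \<sigma> 0 \<gamma> = \<rho> \<gamma>}"
    interpret h1: group_hom \<pi>\<^sub>1 "BijGroup M" "\<sigma> 0"
      using fg.is_group grB hom_BijGroup[OF \<sigma>hom] by (simp add: group_hom_def group_hom_axioms_def)
    interpret h2: group_hom \<pi>\<^sub>1 "BijGroup M" \<rho>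
      using fg.is_group grB hom_BijGroup[OF \<rho>hom] by (simp add: group_hom_def group_hom_axioms_def)
    have "subgroup P \<pi>\<^sub>1" by unfold_locales (auto simp: P_def)
    moreover have "\<forall>i<g. gen_a i \<in> P \<and> gen_b i \<in> P"
      using gens A B \<phi>(2) by (simp add: P_def \<sigma>_def X_def Y_def)
    ultimately have "carrier \<pi>\<^sub>1 \<subseteq> P" by (rule surface_generators)
    thus ?thesis using \<rho>E by (intro extensionalityI[of _ "carrier \<pi>\<^sub>1"]) (auto simp: P_def \<sigma>_def PiE_def)
  qed
  have "limitin (Rep \<pi>\<^sub>1 M H) (\<lambda>n. \<sigma> (Suc n)) (\<sigma> 0) sequentially"
    unfolding Rep_def limitin_subtopology limitin_componentwise
  proof (intro conjI ballI)
    show "\<sigma> 0 \<in> hom \<pi>\<^sub>1 H" by (rule \<sigma>hom)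
    show "\<forall>\<^sub>F n in sequentially. \<sigma> (Suc n) \<in> hom \<pi>\<^sub>1 H" by (simp add: \<sigma>hom)
    show "\<sigma> 0 \<in> extensional (carrier \<pi>\<^sub>1)" by (simp add: \<sigma>_def)
    show "\<forall>\<^sub>F n in sequentially. \<sigma> (Suc n) \<in> topspace (product_topology (\<lambda>_. compact_open_topology M (carrier H)) (carrier \<pi>\<^sub>1))"
      using \<sigma>H by (simp add: topspace_product_topology compact_open_topspace PiE_iff \<sigma>_def)
    fix \<gamma> assume \<gamma>: "\<gamma> \<in> carrier \<pi>\<^sub>1"
    show "limitin (compact_open_topology M (carrier H)) (\<lambda>n. \<sigma> (Suc n) \<gamma>) (\<sigma> 0 \<gamma>) sequentially"
    proof (rule limitin_compact_open)
      show "\<sigma> 0 \<gamma> \<in> carrier H" "\<forall>n. \<sigma> (Suc n) \<gamma> \<in> carrier H" using \<sigma>H[OF \<gamma>] by simp_all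
      show "\<forall>K V. compact K \<and> K \<subseteq> M \<and> openin (top_of_set M) V \<and> \<sigma> 0 \<gamma> ` K \<subseteq> V \<longrightarrow>
          (\<forall>\<^sub>F n in sequentially. \<sigma> (Suc n) \<gamma> ` K \<subseteq> V)"
      proof (intro allI impI, elim conjE)
        fix K V assume KV: "compact K" "K \<subseteq> M" "openin (top_of_set M) V" "\<sigma> 0 \<gamma> ` K \<subseteq> V"
        have "\<forall>\<^sub>F n in sequentially. push (\<phi> \<gamma> (Suc n)) ` K \<subseteq> V"
          by (rule push_converges[OF _ \<phi>tr[OF \<gamma>] \<phi>lim[OF \<gamma>] KV(1-3)]) (use \<phi>tr[OF \<gamma>] KV(4) \<gamma> in \<open>simp_all add: \<sigma>_def\<close>)
        thus "\<forall>\<^sub>F n in sequentially. \<sigma> (Suc n) \<gamma> ` K \<subseteq> V" using \<gamma> by (simp add: \<sigma>_def)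
      qed
    qed
  qed
  moreover have "\<not> global_fixed_point \<pi>\<^sub>1 M (\<sigma> (Suc n)) z" for n z
  proof
    assume fp: "global_fixed_point \<pi>\<^sub>1 M (\<sigma> (Suc n)) z"
    then obtain y where y: "z = q y" using range_q unfolding global_fixed_point_def by blast
    have fixes_y: "F y = y" if F: "translation_homeo L F" "push F z = z" "\<exists>t. F t = t" for F
    proof -
      obtain t where "F t = t" using F(3) by blast
      thus ?thesis using same_value[OF F(1) translation_homeo_id, of t y] push_q[OF F(1), of y] F(2) y by simp
    qed
    have "a n i y = y \<and> b n i y = y" if i: "i < g" for i
    proof -
      have "push (\<phi> (gen_a i) (Suc n)) z = z" "push (\<phi> (gen_b i) (Suc n)) z = z"
        using fp gens[OF i] unfolding global_fixed_point_def by (simp_all add: \<sigma>_def)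
      hence "push (a n i) z = z" "push (b n i) z = z" using \<phi>(2) i by (simp_all add: X_def Y_def)
      moreover have "translation_homeo L (a n i)" "translation_homeo L (b n i)" using ab(1)[of n] i by (simp_all add: tuple_relation_def)
      ultimately show ?thesis using fixes_y ab(4) i by blast
    qed
    hence "y \<in> common_fixed g (a n) (b n)" by (simp add: common_fixed_def)
    thus False using ab(2) by simp
  qed
  ultimately show ?thesis using \<sigma>0 by (intro exI[of _ "\<lambda>n. \<sigma> (Suc n)"]) simp
qed

theorem dense_without_fixed_point:
  assumes g2: "g \<ge> 2" and \<rho>: "\<rho> \<in> topspace (Rep \<pi>\<^sub>1 M H)" and U: "neighbourhood_in (Rep \<pi>\<^sub>1 M H) \<rho> U"
  shows "\<exists>\<rho>'\<in>U. \<not> (\<exists>x. global_fixed_point \<pi>\<^sub>1 M \<rho>' x)"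
proof -
  obtain V where V: "openin (Rep \<pi>\<^sub>1 M H) V" "\<rho> \<in> V" "V \<subseteq> U" using U unfolding neighbourhood_in_def by blast
  show ?thesis
  proof (cases "\<exists>x. global_fixed_point \<pi>\<^sub>1 M \<rho> x")
    case True
    then obtain \<rho>s where \<rho>s: "limitin (Rep \<pi>\<^sub>1 M H) \<rho>s \<rho> sequentially" "\<forall>n. \<not> (\<exists>x. global_fixed_point \<pi>\<^sub>1 M (\<rho>s n) x)"
      using approximated_without_fixed_point[OF g2 \<rho>] by blast
    have "\<forall>\<^sub>F n in sequentially. \<rho>s n \<in> V" using \<rho>s(1) V unfolding limitin_def by blast
    then obtain n where "\<rho>s n \<in> V" by (auto dest: eventually_happens'[OF sequentially_bot])
    thus ?thesis using V(3) \<rho>s(2) by blast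
  qed (use V in blast)
qed

end

interpretation line: covered_line 0 "\<lambda>t. t" UNIV Homeo_plus_real
proof
  show "\<exists>I. compact I \<and> K \<subseteq> (\<lambda>t. t) ` I" if "compact K" for K :: "real set" using that by auto
  show "carrier Homeo_plus_real = {h \<in> Bij UNIV. \<exists>F. translation_homeo 0 F \<and> (\<forall>t. h t = F t)}"
  proof (rule Set.set_eqI)
    fix h :: "real \<Rightarrow> real"
    have "h \<in> carrier Homeo_plus_real" if h: "h \<in> Bij UNIV" "inc_homeo h"
    proof -
      have "range h = UNIV" "range (finv h) = UNIV" using h(2) inc_homeo_inv[OF h(2)] unfolding inc_homeo_def by blast+
      hence "homeomorphism UNIV UNIV h (finv h)"
        using h(2) by (simp add: homeomorphism_def inc_homeo_continuous)
      thus ?thesis using h by (auto simp: Homeo_plus_real_def Homeo_def inc_homeo_def)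
    qed
    moreover have "h \<in> Bij UNIV \<and> inc_homeo h" if h: "h \<in> carrier Homeo_plus_real"
      using h by (auto simp: Homeo_plus_real_def Homeo_def inc_homeo_def Bij_def bij_betw_def)
    moreover have "(\<exists>F. translation_homeo 0 F \<and> (\<forall>t. h t = F t)) \<longleftrightarrow> inc_homeo h"
      by (auto simp: translation_homeo_def fun_eq_iff[symmetric])
    ultimately show "h \<in> carrier Homeo_plus_real \<longleftrightarrow> h \<in> {h \<in> Bij UNIV. \<exists>F. translation_homeo 0 F \<and> (\<forall>t. h t = F t)}" by blast
  qed
qed (auto simp: Homeo_plus_real_def)

lemma cis_eq_iff: "cis s = cis t \<longleftrightarrow> (\<exists>k::int. s = t + of_int k * (2 * pi))"
  unfolding complex_eq_iff cis.sel using sin_cos_eq_iff[of s t] by (auto simp: mult.commute mult.left_commute)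

lemma continuous_cis: "continuous_on A cis"
  by (rule continuous_on_cis) (rule continuous_on_id)

lemma circle_cis_image: "circle \<subseteq> cis ` {-pi..pi}"
proof
  fix z :: complex assume "z \<in> circle"
  hence "z = cis (Arg z)" using rcis_cmod_Arg[of z] by (simp add: rcis_def)
  moreover have "Arg z \<in> {-pi..pi}" using Arg_bounded[of z] by auto
  ultimately show "z \<in> cis ` {-pi..pi}" by blast
qed

text \<open>A lift advances by a multiple \<open>k\<close> of the period over one period. Monotonicity excludes \<open>k \<le> 0\<close>, and for
\<open>k \<ge> 2\<close> two different points of the circle would have the same image.\<close>

lemma circle_lift_translation:
  assumes F: "continuous_on UNIV F" "strict_mono F" and h: "inj_on h circle" "\<forall>t. h (cis t) = cis (F t)"
  shows "translation_homeo (2 * pi) F"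
proof -
  have inj: "\<exists>k::int. s = t + of_int k * (2 * pi)" if "cis (F s) = cis (F t)" for s t
  proof -
    have "h (cis s) = h (cis t)" using h(2) that by simp
    hence "cis s = cis t" by (rule inj_onD[OF h(1)]) auto
    thus ?thesis using cis_eq_iff by blast
  qed
  have shift: "F (t + 2 * pi) = F t + 2 * pi" for t
  proof -
    have "cis (t + 2 * pi) = cis t" unfolding cis_eq_iff by (rule exI[of _ 1]) simp
    hence "cis (F (t + 2 * pi)) = cis (F t)" using h(2) by metis
    then obtain k :: int where k: "F (t + 2 * pi) = F t + of_int k * (2 * pi)" using cis_eq_iff by blast
    have "F t < F (t + 2 * pi)" using F(2) by (simp add: strict_mono_def)
    hence "of_int k > (0::real)" using k by (simp add: zero_less_mult_iff)
    hence "k \<ge> 1" by simp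
    moreover have "\<not> k \<ge> 2"
    proof
      assume "k \<ge> 2"
      hence "real_of_int k * (2 * pi) \<ge> 2 * (2 * pi)" by (intro mult_right_mono) auto
      hence "F t \<le> F t + 2 * pi" "F t + 2 * pi \<le> F (t + 2 * pi)" using k pi_gt_zero by linarith+
      then obtain s where s: "t \<le> s" "s \<le> t + 2 * pi" "F s = F t + 2 * pi"
        using IVT'[of F t "F t + 2 * pi" "t + 2 * pi"] F(1) continuous_on_subset by force
      have "cis (F s) = cis (F t)" unfolding cis_eq_iff s(3) by (rule exI[of _ 1]) simp
      then obtain m :: int where m: "s = t + of_int m * (2 * pi)" using inj by blast
      have "s \<noteq> t" "s \<noteq> t + 2 * pi" using s(3) k \<open>real_of_int k * (2 * pi) \<ge> 2 * (2 * pi)\<close> pi_gt_zero by auto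
      hence "m \<noteq> 0" "m \<noteq> 1" using m by auto
      have "0 * (2 * pi) \<le> of_int m * (2 * pi)" "of_int m * (2 * pi) \<le> 1 * (2 * pi)" using s m by auto
      hence "0 \<le> real_of_int m" "real_of_int m \<le> 1"
        using mult_le_cancel_right_pos[of "2 * pi" 0 "of_int m"] mult_le_cancel_right_pos[of "2 * pi" "of_int m" 1] pi_gt_zero by argo+
      hence "m = 0 \<or> m = 1" by linarith
      with \<open>m \<noteq> 0\<close> \<open>m \<noteq> 1\<close> have False by blast
      thus False by simp
    qed
    ultimately have "k = 1" by simp
    thus ?thesis using k by simp
  qed
  have multiple: "F (of_int j * (2 * pi)) = F 0 + of_int j * (2 * pi)" for j
  proof -
    have "F (real n * (2 * pi)) = F 0 + real n * (2 * pi) \<and> F (- (real n * (2 * pi))) = F 0 - real n * (2 * pi)" for n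
    proof (induction n)
      case (Suc n)
      show ?case using Suc shift[of "real n * (2 * pi)"] shift[of "- (real (Suc n) * (2 * pi))"] by (simp add: algebra_simps)
    qed simp
    from this[of "nat \<bar>j\<bar>"] show ?thesis by (cases "j \<ge> 0") auto
  qed
  have "surj F"
  proof (rule surjI)
    fix y
    define j where "j = \<lceil>\<bar>y - F 0\<bar> / (2 * pi)\<rceil>"
    have "\<bar>y - F 0\<bar> / (2 * pi) \<le> of_int j" unfolding j_def by linarith
    hence "\<bar>y - F 0\<bar> \<le> of_int j * (2 * pi)" using pi_gt_zero by (simp add: pos_divide_le_eq)
    moreover have "F (- (of_int j * (2 * pi))) = F 0 - of_int j * (2 * pi)" using multiple[of "- j"] by simp
    ultimately have "F (- (of_int j * (2 * pi))) \<le> y" "y \<le> F (of_int j * (2 * pi))" "- (of_int j * (2 * pi)) \<le> of_int j * (2 * pi)"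
      using multiple[of j] by linarith+
    then obtain s where "F s = y" using IVT'[of F _ y] continuous_on_subset[OF F(1)] by blast
    thus "F (SOME s. F s = y) = y" by (rule someI)
  qed
  thus ?thesis using F(2) shift by (simp add: translation_homeo_def inc_homeo_def)
qed

interpretation circle: covered_line "2 * pi" cis circle Homeo_plus_circle
proof
  show "range cis = circle" using circle_cis_image by auto
  show "\<exists>I. compact I \<and> K \<subseteq> cis ` I" if "compact K" "K \<subseteq> circle" for K
    using circle_cis_image that by (intro exI[of _ "{-pi..pi}"]) auto
  show "carrier Homeo_plus_circle = {h \<in> Bij circle. \<exists>F. translation_homeo (2 * pi) F \<and> (\<forall>t. h (cis t) = cis (F t))}"
  proof (rule Set.set_eqI)
    fix h :: "complex \<Rightarrow> complex"
    have "h \<in> carrier Homeo_plus_circle" if h: "h \<in> Bij circle" and F: "translation_homeo (2 * pi) F" "\<forall>t. h (cis t) = cis (F t)" for F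
    proof -
      have inc: "inc_homeo F" using F(1) by (rule translation_homeoD)
      have bij: "bij_betw h circle circle" using h by (simp add: Bij_def)
      \<comment> \<open>Continuity of \<open>h\<close> is inherited from that of its lift, because \<open>cis\<close> is a quotient map on a compact interval.\<close>
      have "quotient_map (top_of_set {-pi..pi}) (top_of_set circle) cis"
        by (rule continuous_imp_quotient_map)
          (use circle_cis_image continuous_cis in \<open>auto simp: compact_space_subtopology Hausdorff_space_subtopology\<close>)
      moreover have "continuous_on {-pi..pi} (\<lambda>t. cis (F t))"
        by (rule continuous_on_compose2[OF continuous_cis inc_homeo_continuous[OF inc]]) auto
      hence "continuous_map (top_of_set {-pi..pi}) euclidean (h \<circ> cis)" using F(2) by (simp add: o_def)
      ultimately have "continuous_map (top_of_set circle) euclidean h" by (rule continuous_compose_quotient_map)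
      hence "continuous_on circle h" by simp
      then obtain h' where "homeomorphism circle circle h h'"
        using homeomorphism_compact[of circle h circle] bij by (auto simp: bij_betw_def)
      thus ?thesis using h F(2) inc inc_homeo_continuous[OF inc]
        by (auto simp: Homeo_plus_circle_def Homeo_def inc_homeo_def)
    qed
    moreover have "h \<in> Bij circle \<and> (\<exists>F. translation_homeo (2 * pi) F \<and> (\<forall>t. h (cis t) = cis (F t)))" if hc: "h \<in> carrier Homeo_plus_circle"
    proof -
      obtain F where F: "continuous_on UNIV F" "strict_mono F" "\<forall>t. h (cis t) = cis (F t)" and h: "h \<in> Bij circle"
        using hc by (auto simp: Homeo_plus_circle_def Homeo_def)
      have "inj_on h circle" using h by (simp add: Bij_def bij_betw_def)
      from circle_lift_translation[OF F(1,2) this F(3)] show ?thesis using F(3) h by blast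
    qed
    ultimately show "h \<in> carrier Homeo_plus_circle \<longleftrightarrow>
        h \<in> {h \<in> Bij circle. \<exists>F. translation_homeo (2 * pi) F \<and> (\<forall>t. h (cis t) = cis (F t))}" by blast
  qed
qed (auto simp: Homeo_plus_circle_def cis_eq_iff intro: continuous_cis)

theorem theorem1p3:
  fixes \<Sigma> :: "'a::topological_space set" and x0 :: 'a and g :: nat
  assumes "closed_orientable_surface g \<Sigma>" and "g \<ge> 2" and "x0 \<in> \<Sigma>"
  shows "(\<forall>\<rho> U. \<rho> \<in> topspace (Rep (fundamental_group \<Sigma> x0) UNIV Homeo_plus_real) \<longrightarrow>
            neighbourhood_in (Rep (fundamental_group \<Sigma> x0) UNIV Homeo_plus_real) \<rho> U \<longrightarrow>
            (\<exists>\<rho>'\<in>U. \<not> (\<exists>x. global_fixed_point (fundamental_group \<Sigma> x0) UNIV \<rho>' x))) \<and>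
         (\<forall>\<rho> U. \<rho> \<in> topspace (Rep (fundamental_group \<Sigma> x0) circle Homeo_plus_circle) \<longrightarrow>
            neighbourhood_in (Rep (fundamental_group \<Sigma> x0) circle Homeo_plus_circle) \<rho> U \<longrightarrow>
            (\<exists>\<rho>'\<in>U. \<not> (\<exists>x. global_fixed_point (fundamental_group \<Sigma> x0) circle \<rho>' x)))"
proof -
  obtain f where f: "quotient_map (top_of_set (cball (0::complex) 1)) (top_of_set \<Sigma>) f"
    "\<forall>x\<in>cball 0 1. \<forall>y\<in>cball 0 1. f x = f y \<longleftrightarrow> equivclp (side_pairing g) x y"
    using assms(1) unfolding closed_orientable_surface_def by blast
  have "f ` cball 0 1 = \<Sigma>" using quotient_imp_surjective_map[OF f(1)] by simp
  then obtain d0 where base: "d0 \<in> cball 0 1" "x0 = f d0" using assms(3) by blast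
  interpret polygon_surface g f \<Sigma> d0 by unfold_locales (use assms f base in auto)
  interpret on_line: surface_action g f \<Sigma> d0 0 "\<lambda>t. t" UNIV Homeo_plus_real ..
  interpret on_circle: surface_action g f \<Sigma> d0 "2 * pi" cis circle Homeo_plus_circle ..
  show ?thesis unfolding base(2)
    using on_line.dense_without_fixed_point[OF assms(2)] on_circle.dense_without_fixed_point[OF assms(2)] by blast
qed

end
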